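(* Let $p\in\mathbb{Z}^+$ and let $n_0=\lceil\log_2(8p)\rceil$. There exists a constant $C>0$, depending only on the degree $p$, such that for all integers $n\ge n_0$ (with $h=2^{-n}$), all $\varphi\in H^{p+1}(\Delta)$, all integers $0\le q\le p+1$ and all $\delta\in\widehat{\mathrm T}_n$ we have $$\left|\varphi-\Pi_{\widehat{\mathcal W}_n}\varphi\right|_{H^q(\delta)}\le C\,h^{p-q+1}\,|\varphi|_{H^{p+1}(\tilde\delta)},$$ where $\widehat{\mathrm T}_n$ is the hierarchical mesh on the triangle $\Delta$, $\Pi_{\widehat{\mathcal W}_n}$ is the projection onto the hierarchical spline space $\widehat{\mathcal W}_n$ and $\tilde\delta$ is the support extension of $\delta$, all defined in the context.
   Context: $|\cdot|_{H^q(D)}$ denotes the Sobolev seminorm of order $q$ on $D$ (for $q=0$ the $L^2(D)$ norm). Fix a degree $p\in\mathbb{Z}^+$. For $n\in\mathbb{Z}_{\ge0}$ put $h=2^{-n}$. B-splines. $b^n_i(s)$, $i=1,\dots,2^n+p$, are the standard degree-$p$ B-splines (normalized to a partition of unity) on $]0,1[$ for the open knot vector with simple interior knots $h,2h,\dots,1-h$ and the end knots $0$ and $1$ repeated $p+1$ times. $B^d_j(t)=\binom{d}{j-1}t^{j-1}(1-t)^{d-j+1}$, $j=1,\dots,d+1$, is the $j$-th Bernstein polynomial of degree $d$. Triangle and singular map. For $\gamma>0$, $\Delta_\gamma=\{(u,v):0<u<\gamma,\ 0<v<u\}$ and $\Delta=\Delta_1$. The map $\mathbf u:\,]0,1[^2\to\Delta$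 is $\mathbf u(s,t)=(s,st)$, with inverse $\mathbf u^{-1}(u,v)=(u,v/u)$. For $c\in\mathbb R$, $c\mathbf I$ denotes the map $(u,v)\mapsto(cu,cv)$. Mesh. $\mathrm T_n$ is the set of open cells $\mathbf u\big(](a-1)h,ah[\times](c-1)h,ch[\big)$, $1\le a,c\le 2^n$. Set $\widehat{\mathrm T}_0=\{\Delta\}$ and, for $n\ge1$, $\widehat{\mathrm T}_n=\{\delta\in\mathrm T_n:\delta\subseteq\Delta\setminus\Delta_{1/2}\}\cup\{\delta/2:\delta\in\widehat{\mathrm T}_{n-1}\}$, where $\delta/2=\{(u/2,v/2):(u,v)\in\delta\}$. Space. The index set and functions $\hat b^n_{i,j}$ on $]0,1[^2$ are: $\hat b^n_{i,j}(s,t)=b^n_i(s)B^{i-1}_j(t)$ for $1\le i\le p+1$, $1\le j\le i$; and, for each $m=1,\dots,n$, $\hat b^n_{i,j}(s,t)=b^n_i(s)b^m_j(t)$ for $p+2^{m-1}+1\le i\le p+2^m$, $1\le j\le p+2^m$. Put $\beta^n_{i,j}=\hat b^n_{i,j}\circ\mathbf u^{-1}$ and $\widehat{\mathcal W}_n=\mathrm{span}\{\beta^n_{i,j}\}$. Dual functionals. $\lambda^n_k:L^2(0,1)\to\mathbb R$, $k=1,\dots,2^n+p$, is the standard ($L^2$-bounded, locally supported) dual basis for univariate B-splines: $\lambda^n_k(b^n_i)=\delta^k_i$ (Kronecker delta) and $|\lambda^n_k(f)|\le C_p|I|^{-1/2}\|f\|_{L^2(I)}$ with $I=\mathrm{supp}\,b^n_k$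 and $C_p$ depending only on $p$. Let $n_0=\lceil\log_2(8p)\rceil$, $h_0=2^{-n_0}$. Let $\mu^{n_0}_{k,l}:L^2(\Delta_{h_0})\to\mathbb R$, $k=1,\dots,p+1$, $l=1,\dots,k$, be bounded linear functionals, fixed once for each $p$, with $\mu^{n_0}_{k,l}(\beta^{n_0}_{i,j}|_{\Delta_{h_0}})=\delta^k_i\delta^l_j$. For $n\ge n_0$ and $\varphi\in L^2(\Delta)$ set $\Lambda^n_{k,l}(\varphi)=\mu^{n_0}_{k,l}(\varphi\circ(2^{n_0-n}\mathbf I))$ for $1\le k\le p+1$, $1\le l\le k$, and $\Lambda^n_{k,l}(\varphi)=(\lambda^n_k\otimes\lambda^{m(k)}_l)(\varphi\circ\mathbf u)$ for $p+2\le k\le 2^n+p$, $1\le l\le 2^{m(k)}+p$, where $m(k)=\lceil\log_2(k-p)\rceil$ ($\lambda^n_k$ acts in $s$, $\lambda^{m(k)}_l$ acts in $t$; the tensor product functional only uses values on the support of $b^n_k(s)b^{m(k)}_l(t)$, which is bounded away from $s=0$). Projection. $\Pi_{\widehat{\mathcal W}_n}(\varphi)=\sum_{k=1}^{2^n+p}\sum_l\Lambda^n_{k,l}(\varphi)\,\beta^n_{k,l}$, with $l$ running over all admissible indices for $k$. Support extension. For $\delta\in\widehat{\mathrm T}_n$, $\tilde\delta$ is the (interior of the) union of the supports of all basis functions $\beta^n_{i,j}$ that do not vanish identically on $\delta$. *)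

theory Defs
  imports "HOL-Analysis.Analysis"
begin

section \<open>Lebesgue and Sobolev spaces\<close>

text \<open>
  Functions are total representatives; only their values on \<open>D\<close> matter, up to null sets.
\<close>

definition L2_on :: "'a::euclidean_space set \<Rightarrow> ('a \<Rightarrow> real) \<Rightarrow> bool" where
  "L2_on D f \<longleftrightarrow> set_borel_measurable lebesgue D f \<and> set_integrable lebesgue D (\<lambda>x. (f x)\<^sup>2)"

definition L2_norm :: "'a::euclidean_space set \<Rightarrow> ('a \<Rightarrow> real) \<Rightarrow> real" where
  "L2_norm D f = sqrt (LINT x:D|lebesgue. (f x)\<^sup>2)"

definition L2_linear :: "'a::euclidean_space set \<Rightarrow> (('a \<Rightarrow> real) \<Rightarrow> real) \<Rightarrow> bool" where
  "L2_linear D L \<longleftrightarrow>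
     (\<forall>f g. \<forall>a b :: real. L2_on D f \<longrightarrow> L2_on D g \<longrightarrow>
        L (\<lambda>x. a * f x + b * g x) = a * L f + b * L g)"

definition L2_bounded_linear :: "'a::euclidean_space set \<Rightarrow> (('a \<Rightarrow> real) \<Rightarrow> real) \<Rightarrow> bool" where
  "L2_bounded_linear D L \<longleftrightarrow>
     L2_linear D L \<and> (\<exists>M. \<forall>f. L2_on D f \<longrightarrow> \<bar>L f\<bar> \<le> M * L2_norm D f)"

definition partial1 :: "(real \<times> real \<Rightarrow> real) \<Rightarrow> real \<times> real \<Rightarrow> real" where
  "partial1 f = (\<lambda>(x, y). deriv (\<lambda>s. f (s, y)) x)"

definition partial2 :: "(real \<times> real \<Rightarrow> real) \<Rightarrow> real \<times> real \<Rightarrow> real" where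
  "partial2 f = (\<lambda>(x, y). deriv (\<lambda>t. f (x, t)) y)"

definition partials :: "nat \<Rightarrow> nat \<Rightarrow> (real \<times> real \<Rightarrow> real) \<Rightarrow> real \<times> real \<Rightarrow> real" where
  "partials i j f = (partial1 ^^ i) ((partial2 ^^ j) f)"

text \<open>
  The largest class of differentiable functions closed under both partial derivatives, i.e. the
  infinitely differentiable functions on the plane.
\<close>

coinductive smooth_plane :: "(real \<times> real \<Rightarrow> real) \<Rightarrow> bool" where
  "f differentiable_on UNIV \<Longrightarrow> smooth_plane (partial1 f) \<Longrightarrow> smooth_plane (partial2 f)
     \<Longrightarrow> smooth_plane f"

definition test_function :: "(real \<times> real) set \<Rightarrow> (real \<times> real \<Rightarrow> real) \<Rightarrow> bool" where
  "test_function D \<psi> \<longleftrightarrow>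
     smooth_plane \<psi> \<and> (\<exists>K. compact K \<and> K \<subseteq> D \<and> (\<forall>x. x \<notin> K \<longrightarrow> \<psi> x = 0))"

definition locally_integrable_on ::
    "(real \<times> real) set \<Rightarrow> (real \<times> real \<Rightarrow> real) \<Rightarrow> bool" where
  "locally_integrable_on D f \<longleftrightarrow> (\<forall>K. compact K \<and> K \<subseteq> D \<longrightarrow> set_integrable lebesgue K f)"

definition weak_partial ::
    "(real \<times> real) set \<Rightarrow> nat \<Rightarrow> nat \<Rightarrow> (real \<times> real \<Rightarrow> real) \<Rightarrow> (real \<times> real \<Rightarrow> real) \<Rightarrow> bool" where
  "weak_partial D i j f g \<longleftrightarrow>
     locally_integrable_on D f \<and> locally_integrable_on D g \<and>
     (\<forall>\<psi>. test_function D \<psi> \<longrightarrow>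
        (LINT x:D|lebesgue. f x * partials i j \<psi> x) =
          (- 1) ^ (i + j) * (LINT x:D|lebesgue. g x * \<psi> x))"

definition sobolev :: "nat \<Rightarrow> (real \<times> real) set \<Rightarrow> (real \<times> real \<Rightarrow> real) \<Rightarrow> bool" where
  "sobolev k D f \<longleftrightarrow>
     L2_on D f \<and> (\<forall>i j. i + j \<le> k \<longrightarrow> (\<exists>g. L2_on D g \<and> weak_partial D i j f g))"

text \<open>
  On an open set a weak derivative is unique up to null sets, so the choice below does not affect
  the seminorm; for \<open>q = 0\<close> the chosen function agrees with \<open>f\<close> almost everywhere on \<open>D\<close>.
  The seminorm is meaningful only for \<open>f\<close> satisfying \<open>sobolev q D f\<close>.
\<close>

definition the_weak_partial ::
    "(real \<times> real) set \<Rightarrow> nat \<Rightarrow> nat \<Rightarrow> (real \<times> real \<Rightarrow> real) \<Rightarrow> real \<times> real \<Rightarrow> real" where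
  "the_weak_partial D i j f = (SOME g. weak_partial D i j f g)"

definition sobolev_seminorm ::
    "nat \<Rightarrow> (real \<times> real) set \<Rightarrow> (real \<times> real \<Rightarrow> real) \<Rightarrow> real" where
  "sobolev_seminorm q D f =
     sqrt (\<Sum>i\<le>q. (L2_norm D (the_weak_partial D i (q - i) f))\<^sup>2)"

section \<open>Univariate B-splines and their dual functionals\<close>

text \<open>
  The Cox--de Boor recursion for a knot sequence \<open>\<xi>\<close>; the usual convention that terms with
  vanishing denominator are dropped is division by zero yielding zero.
\<close>

fun cox_de_boor :: "(nat \<Rightarrow> real) \<Rightarrow> nat \<Rightarrow> nat \<Rightarrow> real \<Rightarrow> real" where
  "cox_de_boor \<xi> 0 i s = (if \<xi> i \<le> s \<and> s < \<xi> (i + 1) then 1 else 0)"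
| "cox_de_boor \<xi> (Suc d) i s =
     (s - \<xi> i) / (\<xi> (i + d + 1) - \<xi> i) * cox_de_boor \<xi> d i s +
     (\<xi> (i + d + 2) - s) / (\<xi> (i + d + 2) - \<xi> (i + 1)) * cox_de_boor \<xi> d (i + 1) s"

text \<open>
  Indexed from 1: the knots \<open>1, \<dots>, p + 1\<close> are 0, the knots \<open>2^n + p + 1, \<dots>, 2^n + 2 * p + 1\<close>
  are 1.
\<close>

definition open_knot :: "nat \<Rightarrow> nat \<Rightarrow> nat \<Rightarrow> real" where
  "open_knot p n i =
     (if i \<le> p + 1 then 0 else if i \<ge> 2 ^ n + p + 1 then 1 else real (i - p - 1) / 2 ^ n)"

definition bspline :: "nat \<Rightarrow> nat \<Rightarrow> nat \<Rightarrow> real \<Rightarrow> real" where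
  "bspline p n i = cox_de_boor (open_knot p n) p i"

definition bspline_supp :: "nat \<Rightarrow> nat \<Rightarrow> nat \<Rightarrow> real set" where
  "bspline_supp p n i = closure {s \<in> {0<..<1}. bspline p n i s \<noteq> 0}"

definition bspline_dual ::
    "nat \<Rightarrow> real \<Rightarrow> (nat \<Rightarrow> nat \<Rightarrow> (real \<Rightarrow> real) \<Rightarrow> real) \<Rightarrow> bool" where
  "bspline_dual p C\<^sub>p lam \<longleftrightarrow>
     (\<forall>n. \<forall>k\<in>{1..2 ^ n + p}.
        L2_linear {0<..<1} (lam n k) \<and>
        (\<forall>i\<in>{1..2 ^ n + p}. lam n k (bspline p n i) = (if i = k then 1 else 0)) \<and>
        (\<forall>f. L2_on {0<..<1} f \<longrightarrow>
           \<bar>lam n k f\<bar> \<le> C\<^sub>p * measure lebesgue (bspline_supp p n k) powr (- 1 / 2) *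
                         L2_norm (bspline_supp p n k) f))"

section \<open>Hierarchical splines on the triangle\<close>

definition open_triangle :: "real \<Rightarrow> (real \<times> real) set" where
  "open_triangle \<gamma> = {(u, v). 0 < u \<and> u < \<gamma> \<and> 0 < v \<and> v < u}"

definition duffy :: "real \<times> real \<Rightarrow> real \<times> real" where
  "duffy = (\<lambda>(s, t). (s, s * t))"

definition duffy_inv :: "real \<times> real \<Rightarrow> real \<times> real" where
  "duffy_inv = (\<lambda>(u, v). (u, v / u))"

definition mesh :: "nat \<Rightarrow> (real \<times> real) set set" where
  "mesh n =
     {duffy ` ({(real a - 1) / 2 ^ n <..< real a / 2 ^ n} \<times>
               {(real c - 1) / 2 ^ n <..< real c / 2 ^ n}) | a c.
        a \<in> {1..2 ^ n} \<and> c \<in> {1..2 ^ n}}"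

fun hier_mesh :: "nat \<Rightarrow> (real \<times> real) set set" where
  "hier_mesh 0 = {open_triangle 1}"
| "hier_mesh (Suc n) =
     {\<delta> \<in> mesh (Suc n). \<delta> \<subseteq> open_triangle 1 - open_triangle (1 / 2)} \<union>
     (\<lambda>\<delta>. (\<lambda>(u, v). (u / 2, v / 2)) ` \<delta>) ` hier_mesh n"

text \<open>
  For \<open>i \<ge> p + 2\<close> this is the unique \<open>m \<ge> 1\<close> with \<open>p + 2 ^ (m - 1) + 1 \<le> i \<le> p + 2 ^ m\<close>.
\<close>

definition row_level :: "nat \<Rightarrow> nat \<Rightarrow> nat" where
  "row_level p i = nat \<lceil>log 2 (real (i - p))\<rceil>"

text \<open>The admissible second indices for first index \<open>i\<close> are \<open>1, \<dots>, row_dim p i\<close>.\<close>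

definition row_dim :: "nat \<Rightarrow> nat \<Rightarrow> nat" where
  "row_dim p i = (if i \<le> p + 1 then i else 2 ^ row_level p i + p)"

text \<open>
  The library's \<open>Bernstein d k\<close> is indexed by \<open>k = 0, \<dots>, d\<close>, hence the shift \<open>j - 1\<close>.
\<close>

definition hier_param :: "nat \<Rightarrow> nat \<Rightarrow> nat \<Rightarrow> nat \<Rightarrow> real \<times> real \<Rightarrow> real" where
  "hier_param p n i j = (\<lambda>(s, t).
     if i \<le> p + 1 then bspline p n i s * Bernstein (i - 1) (j - 1) t
     else bspline p n i s * bspline p (row_level p i) j t)"

definition hier_basis :: "nat \<Rightarrow> nat \<Rightarrow> nat \<Rightarrow> nat \<Rightarrow> real \<times> real \<Rightarrow> real" where
  "hier_basis p n i j = hier_param p n i j \<circ> duffy_inv"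

definition hier_index :: "nat \<Rightarrow> nat \<Rightarrow> (nat \<times> nat) set" where
  "hier_index p n = (SIGMA i:{1..2 ^ n + p}. {1..row_dim p i})"

definition hier_space :: "nat \<Rightarrow> nat \<Rightarrow> (real \<times> real \<Rightarrow> real) set" where
  "hier_space p n =
     {\<lambda>x. \<Sum>(i, j)\<in>hier_index p n. c i j * hier_basis p n i j x | c. True}"

definition base_level :: "nat \<Rightarrow> nat" where
  "base_level p = nat \<lceil>log 2 (8 * real p)\<rceil>"

definition corner_dual ::
    "nat \<Rightarrow> (nat \<Rightarrow> nat \<Rightarrow> (real \<times> real \<Rightarrow> real) \<Rightarrow> real) \<Rightarrow> bool" where
  "corner_dual p mu \<longleftrightarrow>
     (\<forall>k\<in>{1..p + 1}. \<forall>l\<in>{1..k}.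
        L2_bounded_linear (open_triangle (1 / 2 ^ base_level p)) (mu k l) \<and>
        (\<forall>(i, j)\<in>hier_index p (base_level p).
           mu k l (hier_basis p (base_level p) i j) = (if i = k \<and> j = l then 1 else 0)))"

text \<open>
  The functional \<open>\<lambda>\<^sup>n\<^sub>k \<otimes> \<lambda>\<^sup>m\<^sub>l\<close>, applied first in \<open>t\<close>, then in \<open>s\<close>. The argument is cut
  off to the support of the tensor product B-spline, since the pull-back of a square integrable
  function on the triangle need not be square integrable near \<open>s = 0\<close>.
\<close>

definition tensor_functional ::
    "nat \<Rightarrow> (nat \<Rightarrow> nat \<Rightarrow> (real \<Rightarrow> real) \<Rightarrow> real) \<Rightarrow> nat \<Rightarrow> nat \<Rightarrow> nat \<Rightarrow> nat \<Rightarrow>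
     (real \<times> real \<Rightarrow> real) \<Rightarrow> real" where
  "tensor_functional p lam n k m l F =
     lam n k (\<lambda>s. lam m l (\<lambda>t.
       indicator (bspline_supp p n k \<times> bspline_supp p m l) (s, t) * F (s, t)))"

definition hier_dual ::
    "nat \<Rightarrow> (nat \<Rightarrow> nat \<Rightarrow> (real \<Rightarrow> real) \<Rightarrow> real) \<Rightarrow>
     (nat \<Rightarrow> nat \<Rightarrow> (real \<times> real \<Rightarrow> real) \<Rightarrow> real) \<Rightarrow> nat \<Rightarrow> nat \<Rightarrow> nat \<Rightarrow>
     (real \<times> real \<Rightarrow> real) \<Rightarrow> real" where
  "hier_dual p lam mu n k l \<phi> =
     (if k \<le> p + 1 then mu k l (\<lambda>x. \<phi> ((2 powi (int (base_level p) - int n)) *\<^sub>R x))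
      else tensor_functional p lam n k (row_level p k) l (\<phi> \<circ> duffy))"

definition hier_projection ::
    "nat \<Rightarrow> (nat \<Rightarrow> nat \<Rightarrow> (real \<Rightarrow> real) \<Rightarrow> real) \<Rightarrow>
     (nat \<Rightarrow> nat \<Rightarrow> (real \<times> real \<Rightarrow> real) \<Rightarrow> real) \<Rightarrow> nat \<Rightarrow>
     (real \<times> real \<Rightarrow> real) \<Rightarrow> real \<times> real \<Rightarrow> real" where
  "hier_projection p lam mu n \<phi> = (\<lambda>x.
     \<Sum>(k, l)\<in>hier_index p n. hier_dual p lam mu n k l \<phi> * hier_basis p n k l x)"

lemma hier_projection_in_hier_space: "hier_projection p lam mu n \<phi> \<in> hier_space p n"
  unfolding hier_projection_def hier_space_def
  by (intro CollectI exI[of _ "\<lambda>k l. hier_dual p lam mu n k l \<phi>"] conjI refl TrueI)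

definition support_extension :: "nat \<Rightarrow> nat \<Rightarrow> (real \<times> real) set \<Rightarrow> (real \<times> real) set" where
  "support_extension p n \<delta> =
     interior (\<Union>(i, j)\<in>{(i, j)\<in>hier_index p n. \<exists>x\<in>\<delta>. hier_basis p n i j x \<noteq> 0}.
       closure {x \<in> open_triangle 1. hier_basis p n i j x \<noteq> 0})"

end

theory Submission imports Defs begin

text \<open>
  On a cell \<open>\<delta>\<close>, subtract from \<open>\<phi>\<close> the polynomial \<open>P\<close> of degree \<open>p\<close> for which every derivative of
  \<open>r = \<phi> - P\<close> of order at most \<open>p\<close> has mean zero over \<open>\<delta>\<close>. The space contains \<open>P\<close> and the projection
  reproduces it, so on \<open>\<delta>\<close> the error is \<open>r\<close> minus the sum of \<open>\<Lambda>(r) \<beta>\<close> over the at most \<open>(p + 1)\<^sup>2\<close>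
  basis functions \<open>\<beta>\<close> that are active on \<open>\<delta>\<close>. Each of these is positive almost everywhere on a convex
  region \<open>R\<close> of diameter of order \<open>h\<close> that contains \<open>\<delta>\<close> and lies in the support extension, with
  \<open>\<bar>\<Lambda>(r)\<bar> \<le> C / h * \<parallel>r\<parallel>\<close> in terms of the \<open>L\<^sup>2\<close> norm over \<open>R\<close>. A Poincare inequality on convex sets, for
  functions with mean zero over a subset of comparable measure, bounds the derivatives of \<open>r\<close> of order
  \<open>q\<close> over \<open>R\<close> by \<open>h\<^sup>p\<^sup>+\<^sup>1\<^sup>-\<^sup>q\<close> times those of order \<open>p + 1\<close>, which are the ones of \<open>\<phi>\<close>. Finally, the
  derivatives of \<open>\<beta>\<close> of order \<open>q\<close> are at most \<open>C h\<^sup>-\<^sup>q\<close> on \<open>\<delta>\<close>; near the vertex, where the singular map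
  degenerates, this holds because row \<open>i\<close> has the factor \<open>s\<^sup>i\<^sup>-\<^sup>1\<close>, which turns the Bernstein
  polynomials in \<open>v / u\<close> into polynomials in \<open>u\<close> and \<open>v\<close>.
\<close>

section \<open>Smooth functions\<close>

text \<open>Two difficulties shape the proof. The singular map degenerates at the vertex, so cells
  cannot be transported uniformly to a reference cell; a balance of scales replaces this. In a row
  of level m the coordinate u is of order 2^m h and the knots in t = v/u have distance 2^-m, so a
  basis function has extent of order h in both directions. The same balance cancels the powers of
  2^m in the norms of the functionals, the areas of the cells and the derivatives of v/u. Hence one
  polynomial is fixed by moments over \<delta> alone, and each region gets its own Poincare
  inequality. That inequality avoids approximation by smooth functions: differences g(x + z) - g(x)
  are estimated by moving test functions. The final constant depends on p, on the constant of the
  univariate dual basis and on the norms of the finitely many corner functionals, all fixed with p.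
  The level n_0 enters through p + 1 \<le> 2^n_0, which makes the first p + 1 rows of all levels n
  \<ge> n_0 scaled copies of each other.\<close>

definition has_grad :: "(real \<times> real \<Rightarrow> real) \<Rightarrow> real \<Rightarrow> real \<Rightarrow> real \<times> real \<Rightarrow> bool" where
  "has_grad f p q z \<longleftrightarrow> (f has_derivative (\<lambda>h. p * fst h + q * snd h)) (at z)"

lemma has_grad_deriv1:
  assumes "has_grad f p q (x, y)"
  shows "((\<lambda>s. f (s, y)) has_field_derivative p) (at x)"
proof -
  have "((\<lambda>s. (s, y)) has_derivative (\<lambda>h. (h, 0))) (at x)"
    by (auto intro!: derivative_eq_intros)
  from has_derivative_compose[OF this assms[unfolded has_grad_def]] show ?thesis
    by (simp add: has_field_derivative_def)
qed

lemma has_grad_deriv2: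
  assumes "has_grad f p q (x, y)"
  shows "((\<lambda>t. f (x, t)) has_field_derivative q) (at y)"
proof -
  have "((\<lambda>t. (x, t)) has_derivative (\<lambda>h. (0, h))) (at y)"
    by (auto intro!: derivative_eq_intros)
  from has_derivative_compose[OF this assms[unfolded has_grad_def]] show ?thesis
    by (simp add: has_field_derivative_def)
qed

lemma has_grad_partials:
  assumes "has_grad f p q z"
  shows "partial1 f z = p" "partial2 f z = q"
  using has_grad_deriv1[of f p q "fst z" "snd z"] has_grad_deriv2[of f p q "fst z" "snd z"] assms
  by (auto simp: partial1_def partial2_def DERIV_imp_deriv split: prod.split)

lemma has_grad_differentiable: "has_grad f p q z \<Longrightarrow> f differentiable (at z)"
  by (auto simp: has_grad_def differentiable_def)

lemma differentiable_has_grad: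
  assumes "f differentiable (at z)"
  shows "has_grad f (partial1 f z) (partial2 f z) z"
proof -
  obtain D where D: "(f has_derivative D) (at z)"
    using assms by (auto simp: differentiable_def)
  then interpret D: bounded_linear D by (rule has_derivative_bounded_linear)
  have *: "D h = D (1, 0) * fst h + D (0, 1) * snd h" for h
  proof -
    have h: "h = fst h *\<^sub>R (1, 0) + snd h *\<^sub>R (0, 1)" by (cases h) simp
    have "D h = D (fst h *\<^sub>R (1, 0) + snd h *\<^sub>R (0, 1))" by (rule arg_cong[OF h])
    also have "\<dots> = D (fst h *\<^sub>R (1, 0)) + D (snd h *\<^sub>R (0, 1))" by (rule D.add)
    also have "\<dots> = fst h *\<^sub>R D (1, 0) + snd h *\<^sub>R D (0, 1)" by (intro arg_cong2[where f = "(+)"] D.scaleR)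
    finally show ?thesis by simp
  qed
  have "has_grad f (D (1, 0)) (D (0, 1)) z"
    unfolding has_grad_def by (rule has_derivative_eq_rhs[OF D]) (rule ext, rule *)
  with has_grad_partials[OF this] show ?thesis by simp
qed

lemma has_grad_const: "has_grad (\<lambda>_. c) 0 0 z"
  by (simp add: has_grad_def)

lemma has_grad_fst: "has_grad fst 1 0 z"
  by (auto simp: has_grad_def intro!: derivative_eq_intros)

lemma has_grad_snd: "has_grad snd 0 1 z"
  by (auto simp: has_grad_def intro!: derivative_eq_intros)

lemma has_grad_add:
  "has_grad f p q z \<Longrightarrow> has_grad g p' q' z \<Longrightarrow> has_grad (\<lambda>x. f x + g x) (p + p') (q + q') z"
  unfolding has_grad_def
  by (rule has_derivative_eq_rhs, rule has_derivative_add, assumption+) (auto simp: algebra_simps)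

lemma has_grad_mult:
  "has_grad f p q z \<Longrightarrow> has_grad g p' q' z \<Longrightarrow>
    has_grad (\<lambda>x. f x * g x) (p * g z + f z * p') (q * g z + f z * q') z"
  unfolding has_grad_def
  by (rule has_derivative_eq_rhs, rule has_derivative_mult, assumption+) (auto simp: algebra_simps)

lemma has_grad_compose:
  assumes "(g has_field_derivative d) (at (f z))" "has_grad f p q z"
  shows "has_grad (\<lambda>x. g (f x)) (d * p) (d * q) z"
  using has_derivative_compose[OF assms(2)[unfolded has_grad_def] assms(1)[unfolded has_field_derivative_def]]
  by (simp add: has_grad_def algebra_simps)

lemma has_grad_translate:
  assumes "has_grad f p q (z - w)"
  shows "has_grad (\<lambda>x. f (x - w)) p q z"
proof -
  have "((\<lambda>x. x - w) has_derivative (\<lambda>h. h)) (at z)"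
    by (auto intro!: derivative_eq_intros)
  from has_derivative_compose[OF this assms[unfolded has_grad_def]] show ?thesis
    by (simp add: has_grad_def)
qed

lemma has_grad_continuous: "has_grad f p q z \<Longrightarrow> isCont f z"
  unfolding has_grad_def by (rule has_derivative_continuous)

lemma has_grad_transform:
  assumes "has_grad f p q z" "open S" "z \<in> S" "\<And>x. x \<in> S \<Longrightarrow> f x = g x"
  shows "has_grad g p q z"
  using has_derivative_transform_within_open[OF assms(1)[unfolded has_grad_def] assms(2-4)]
  by (simp add: has_grad_def)

text \<open>Finite stages of the coinductive \<open>smooth_plane\<close>. They allow closure under
  sums, products and translations to be proved by plain induction on the order;
  \<open>smooth_plane_iff\<close> transfers the result.\<close>

fun smooth_upto :: "nat \<Rightarrow> (real \<times> real \<Rightarrow> real) \<Rightarrow> bool" where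
  "smooth_upto 0 f \<longleftrightarrow> f differentiable_on UNIV"
| "smooth_upto (Suc n) f \<longleftrightarrow>
     f differentiable_on UNIV \<and> smooth_upto n (partial1 f) \<and> smooth_upto n (partial2 f)"

lemma smooth_plane_iff: "smooth_plane f \<longleftrightarrow> (\<forall>n. smooth_upto n f)"
proof
  assume "smooth_plane f"
  then have "smooth_upto n f" for n
    by (induction n arbitrary: f) (auto elim: smooth_plane.cases)
  then show "\<forall>n. smooth_upto n f" ..
next
  assume "\<forall>n. smooth_upto n f"
  then show "smooth_plane f"
  proof (coinduction arbitrary: f)
    case smooth_plane
    then have "f differentiable_on UNIV" "\<forall>n. smooth_upto n (partial1 f)"
      "\<forall>n. smooth_upto n (partial2 f)"
      by (metis smooth_upto.simps(1), metis smooth_upto.simps(2), metis smooth_upto.simps(2))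
    then show ?case by auto
  qed
qed

lemma smooth_upto_differentiable: "smooth_upto n f \<Longrightarrow> f differentiable (at z)"
  by (cases n) (auto simp: differentiable_on_def simp del: split_paired_All)

lemma smooth_upto_has_grad: "smooth_upto n f \<Longrightarrow> has_grad f (partial1 f z) (partial2 f z) z"
  by (intro differentiable_has_grad smooth_upto_differentiable)

lemma smooth_plane_has_grad: "smooth_plane f \<Longrightarrow> has_grad f (partial1 f z) (partial2 f z) z"
  using smooth_upto_has_grad smooth_plane_iff by blast

lemma smooth_plane_partial:
  assumes "smooth_plane f" shows "smooth_plane (partial1 f)" "smooth_plane (partial2 f)"
  using assms by (auto elim: smooth_plane.cases)

lemma smooth_plane_continuous: "smooth_plane f \<Longrightarrow> continuous_on S f"
  by (meson continuous_at_imp_continuous_on has_grad_continuous smooth_plane_has_grad)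

lemma smooth_upto_SucI:
  assumes "\<And>z. has_grad f (fx z) (fy z) z" "smooth_upto n fx" "smooth_upto n fy"
  shows "smooth_upto (Suc n) f"
proof -
  have "partial1 f = fx" "partial2 f = fy"
    using has_grad_partials[OF assms(1)] by auto
  with assms show ?thesis
    by (auto simp: differentiable_on_def intro: has_grad_differentiable)
qed

lemma smooth_upto_0I: "(\<And>z. has_grad f (fx z) (fy z) z) \<Longrightarrow> smooth_upto 0 f"
  by (auto simp: differentiable_on_def intro: has_grad_differentiable)

lemma smooth_upto_Suc_D: "smooth_upto (Suc n) f \<Longrightarrow> smooth_upto n f"
proof (induction n arbitrary: f)
  case (Suc n)
  then have "f differentiable_on UNIV" "smooth_upto (Suc n) (partial1 f)"
    "smooth_upto (Suc n) (partial2 f)"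
    by (simp_all only: smooth_upto.simps(2)[of "Suc n"])
  with this(2,3)[THEN Suc.IH] show ?case by (simp only: smooth_upto.simps simp_thms)
qed simp

lemma smooth_upto_const: "smooth_upto n (\<lambda>_. c)"
proof (induction n arbitrary: c)
  case (Suc n)
  show ?case by (rule smooth_upto_SucI[OF has_grad_const]) (use Suc in auto)
qed (simp add: differentiable_on_def)

lemma smooth_upto_add: "smooth_upto n f \<Longrightarrow> smooth_upto n g \<Longrightarrow> smooth_upto n (\<lambda>x. f x + g x)"
proof (induction n arbitrary: f g)
  case 0
  then show ?case by (rule smooth_upto_0I[OF has_grad_add[OF smooth_upto_has_grad smooth_upto_has_grad]])
next
  case (Suc n)
  show ?case
    by (rule smooth_upto_SucI[OF has_grad_add[OF Suc.prems[THEN smooth_upto_has_grad]]])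
      (use Suc in auto)
qed

lemma smooth_upto_mult: "smooth_upto n f \<Longrightarrow> smooth_upto n g \<Longrightarrow> smooth_upto n (\<lambda>x. f x * g x)"
proof (induction n arbitrary: f g)
  case 0
  then show ?case by (rule smooth_upto_0I[OF has_grad_mult[OF smooth_upto_has_grad smooth_upto_has_grad]])
next
  case (Suc n)
  note fg = Suc.prems[THEN smooth_upto_Suc_D]
  have d: "smooth_upto n (partial1 f)" "smooth_upto n (partial2 f)"
    "smooth_upto n (partial1 g)" "smooth_upto n (partial2 g)"
    using Suc.prems by simp_all
  show ?case
    by (rule smooth_upto_SucI[OF has_grad_mult[OF Suc.prems[THEN smooth_upto_has_grad]]
        smooth_upto_add[OF Suc.IH[OF d(1) fg(2)] Suc.IH[OF fg(1) d(3)]]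
        smooth_upto_add[OF Suc.IH[OF d(2) fg(2)] Suc.IH[OF fg(1) d(4)]]])
qed

lemma smooth_upto_translate: "smooth_upto n f \<Longrightarrow> smooth_upto n (\<lambda>x. f (x - w))"
proof (induction n arbitrary: f)
  case 0
  then show ?case by (rule smooth_upto_0I[OF has_grad_translate[OF smooth_upto_has_grad]])
next
  case (Suc n)
  show ?case
    by (rule smooth_upto_SucI[OF has_grad_translate[OF Suc.prems[THEN smooth_upto_has_grad]]]) (use Suc in auto)
qed

lemma smooth_plane_const: "smooth_plane (\<lambda>_. c)"
  by (simp add: smooth_plane_iff smooth_upto_const)

lemma smooth_plane_mult: "smooth_plane f \<Longrightarrow> smooth_plane g \<Longrightarrow> smooth_plane (\<lambda>x. f x * g x)"
  by (simp add: smooth_plane_iff smooth_upto_mult)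

lemma smooth_plane_add: "smooth_plane f \<Longrightarrow> smooth_plane g \<Longrightarrow> smooth_plane (\<lambda>x. f x + g x)"
  by (simp add: smooth_plane_iff smooth_upto_add)

lemma smooth_plane_diff:
  assumes "smooth_plane f" "smooth_plane g" shows "smooth_plane (\<lambda>x. f x - g x)"
  using smooth_plane_add[OF assms(1) smooth_plane_mult[OF smooth_plane_const assms(2)], of "-1"]
  by simp

lemma smooth_plane_prod: "(\<And>i. i \<in> I \<Longrightarrow> smooth_plane (f i)) \<Longrightarrow> smooth_plane (\<lambda>x. \<Prod>i\<in>I. f i x)"
  by (induction I rule: infinite_finite_induct)
    (auto intro: smooth_plane_const smooth_plane_mult)

lemma smooth_plane_translate: "smooth_plane f \<Longrightarrow> smooth_plane (\<lambda>x. f (x - w))"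
  by (simp add: smooth_plane_iff smooth_upto_translate)

text \<open>The polynomial factor makes the class closed under differentiation.\<close>

definition exp_bump :: "real poly \<Rightarrow> real \<Rightarrow> real" where
  "exp_bump P x = (if x > 0 then poly P (1 / x) * exp (- 1 / x) else 0)"

text \<open>The power y^k strengthens the induction over the polynomial: the value of
  \<open>pCons a P\<close> is a + y * P(y), so the tail is the hypothesis at
  \<open>Suc k\<close>.\<close>

lemma poly_exp_tendsto_0: "((\<lambda>y. y ^ k * poly P y * exp (- y)) \<longlongrightarrow> (0::real)) at_top"
proof (induction P arbitrary: k)
  case (pCons a P)
  have "((\<lambda>y. a * (y ^ k / exp y) + y ^ Suc k * poly P y * exp (- y)) \<longlongrightarrow> a * 0 + 0) at_top"
    by (intro tendsto_intros pCons.IH tendsto_power_div_exp_0)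
  then show ?case by (simp add: algebra_simps exp_minus divide_inverse)
qed simp

text \<open>This is the difference quotient at 0, so all derivatives at the flat point vanish. With
  y = 1/x it becomes y P(y) exp(-y) from the right; from the left the function is 0.\<close>

lemma exp_bump_quotient_tendsto: "((\<lambda>x. exp_bump P x / x) \<longlongrightarrow> 0) (at 0)"
proof -
  have "((\<lambda>x. inverse x ^ 1 * poly P (inverse x) * exp (- inverse x)) \<longlongrightarrow> 0) (at_right 0)"
    using filterlim_compose[OF poly_exp_tendsto_0 filterlim_inverse_at_top_right] .
  then have "((\<lambda>x. exp_bump P x / x) \<longlongrightarrow> 0) (at_right 0)"
    by (rule Lim_transform_eventually)
      (auto simp: eventually_at_filter exp_bump_def field_simps)
  moreover have "((\<lambda>x. exp_bump P x / x) \<longlongrightarrow> 0) (at_left 0)"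
    by (rule tendsto_eventually) (auto simp: eventually_at_filter exp_bump_def)
  ultimately show ?thesis by (rule filterlim_split_at_real[rotated])
qed

text \<open>With y = 1/x one has dy/dx = -y^2, and the derivative of P(y) exp(-y) in y is (P' -
  P)(y) exp(-y). The new polynomial is therefore y^2 (P - P').\<close>

lemma exp_bump_deriv:
  "(exp_bump P has_field_derivative exp_bump ([:0, 0, 1:] * (P - pderiv P)) x) (at x)"
proof -
  consider "x > 0" | "x < 0" | "x = 0" by linarith
  then show ?thesis
  proof cases
    case 1
    have d: "((\<lambda>x. 1 / x) has_field_derivative - (1 / x * (1 / x))) (at x)"
      using 1 by (auto intro!: derivative_eq_intros)
    have "((\<lambda>x. poly P (1 / x) * exp (- (1 / x))) has_field_derivative
      poly P (1 / x) * (exp (- (1 / x)) * - (- (1 / x * (1 / x)))) +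
      poly (pderiv P) (1 / x) * - (1 / x * (1 / x)) * exp (- (1 / x))) (at x)"
      by (intro DERIV_mult' DERIV_chain2[OF poly_DERIV d] DERIV_fun_exp DERIV_minus d)
    also have "poly P (1 / x) * (exp (- (1 / x)) * - (- (1 / x * (1 / x)))) +
      poly (pderiv P) (1 / x) * - (1 / x * (1 / x)) * exp (- (1 / x)) =
      exp_bump ([:0, 0, 1:] * (P - pderiv P)) x"
      using 1 by (simp add: exp_bump_def algebra_simps)
    finally have "((\<lambda>x. poly P (1 / x) * exp (- 1 / x)) has_field_derivative
      exp_bump ([:0, 0, 1:] * (P - pderiv P)) x) (at x)" by simp
    then show ?thesis
      by (rule has_field_derivative_transform_within_open[where S = "{0<..}"])
        (use 1 in \<open>auto simp: exp_bump_def\<close>)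
  next
    case 2
    have "((\<lambda>x. 0) has_field_derivative exp_bump ([:0, 0, 1:] * (P - pderiv P)) x) (at x)"
      using 2 by (auto simp: exp_bump_def)
    then show ?thesis
      by (rule has_field_derivative_transform_within_open[where S = "{..<0}"])
        (use 2 in \<open>auto simp: exp_bump_def\<close>)
  next
    case 3
    then show ?thesis
      using exp_bump_quotient_tendsto[of P] by (simp add: DERIV_def exp_bump_def)
  qed
qed

lemma has_grad_affine: "has_grad (\<lambda>z. \<alpha> * fst z + \<beta> * snd z + c) \<alpha> \<beta> z"
  unfolding has_grad_def by (auto intro!: derivative_eq_intros)

lemma smooth_upto_exp_bump:
  "smooth_upto n (\<lambda>z. exp_bump P (\<alpha> * fst z + \<beta> * snd z + c))"
proof (induction n arbitrary: P)
  case 0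
  show ?case by (rule smooth_upto_0I[OF has_grad_compose[OF exp_bump_deriv has_grad_affine]])
next
  case (Suc n)
  show ?case
    by (rule smooth_upto_SucI[OF has_grad_compose[OF exp_bump_deriv has_grad_affine]
          smooth_upto_mult[OF Suc smooth_upto_const] smooth_upto_mult[OF Suc smooth_upto_const]])
qed

section \<open>Smooth bumps on boxes and smooth approximation of indicators of open sets\<close>

abbreviation bump1 :: "real \<Rightarrow> real" where "bump1 \<equiv> exp_bump [:1:]"

lemma bump1_bounds: "0 \<le> bump1 x" "bump1 x \<le> 1"
  by (auto simp: exp_bump_def)

lemma bump1_nonpos: "x \<le> 0 \<Longrightarrow> bump1 x = 0"
  by (auto simp: exp_bump_def)

lemma bump1_tendsto:
  assumes "t > 0" shows "(\<lambda>k. bump1 (real k * t - 1)) \<longlonglongrightarrow> 1"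
proof -
  have lim: "filterlim (\<lambda>k. real k * t - 1) at_top sequentially"
    using filterlim_tendsto_add_at_top[OF tendsto_const[of "-1"]
        filterlim_at_top_mult_tendsto_pos[OF tendsto_const assms filterlim_real_sequentially]]
    by (simp add: mult.commute)
  have "((\<lambda>x::real. exp (- 1 / x)) \<longlongrightarrow> 1) at_top"
    using tendsto_exp[OF tendsto_divide_0[OF tendsto_const[of "-1::real"]
        filterlim_at_top_imp_at_infinity[OF filterlim_ident]]] by simp
  from filterlim_compose[OF this lim]
  have "(\<lambda>k. exp (- 1 / (real k * t - 1))) \<longlonglongrightarrow> 1" .
  moreover have "\<forall>\<^sub>F k in sequentially. exp (- 1 / (real k * t - 1)) = bump1 (real k * t - 1)"
    using lim[unfolded filterlim_at_top_dense, rule_format, of 0]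
    by eventually_elim (auto simp: exp_bump_def)
  ultimately show ?thesis by (rule Lim_transform_eventually)
qed

text \<open>A factor is nonzero only where the distance to its side of the box exceeds 1/k. The
  shift by -1 thus gives a compact support inside the open box, while for k tending to infinity all
  four factors tend to 1 in the box.\<close>

definition box_bump :: "nat \<Rightarrow> real \<times> real \<Rightarrow> real \<times> real \<Rightarrow> real \<times> real \<Rightarrow> real" where
  "box_bump k a b z =
     bump1 (real k * (fst z - fst a) - 1) * bump1 (real k * (fst b - fst z) - 1) *
     bump1 (real k * (snd z - snd a) - 1) * bump1 (real k * (snd b - snd z) - 1)"

lemma smooth_box_bump: "smooth_plane (box_bump k a b)"
proof -
  have "smooth_plane (\<lambda>z. bump1 (real k * (fst z - fst a) - 1))"
    using smooth_upto_exp_bump[of _ "[:1:]" "real k" 0 "- real k * fst a - 1"]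
    by (simp add: smooth_plane_iff algebra_simps)
  moreover have "smooth_plane (\<lambda>z. bump1 (real k * (fst b - fst z) - 1))"
    using smooth_upto_exp_bump[of _ "[:1:]" "- real k" 0 "real k * fst b - 1"]
    by (simp add: smooth_plane_iff algebra_simps)
  moreover have "smooth_plane (\<lambda>z. bump1 (real k * (snd z - snd a) - 1))"
    using smooth_upto_exp_bump[of _ "[:1:]" 0 "real k" "- real k * snd a - 1"]
    by (simp add: smooth_plane_iff algebra_simps)
  moreover have "smooth_plane (\<lambda>z. bump1 (real k * (snd b - snd z) - 1))"
    using smooth_upto_exp_bump[of _ "[:1:]" 0 "- real k" "real k * snd b - 1"]
    by (simp add: smooth_plane_iff algebra_simps)
  ultimately show ?thesis
    unfolding box_bump_def by (intro smooth_plane_mult)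
qed

lemma box_bump_bounds: "0 \<le> box_bump k a b z" "box_bump k a b z \<le> 1"
  unfolding box_bump_def by (auto intro!: mult_nonneg_nonneg mult_le_one bump1_bounds)

lemma mem_box_plane:
  fixes a b z :: "real \<times> real"
  shows "z \<in> box a b \<longleftrightarrow> fst a < fst z \<and> fst z < fst b \<and> snd a < snd z \<and> snd z < snd b"
    "z \<in> cbox a b \<longleftrightarrow> fst a \<le> fst z \<and> fst z \<le> fst b \<and> snd a \<le> snd z \<and> snd z \<le> snd b"
  by (cases z; cases a; cases b; auto simp: mem_box Basis_prod_def ball_Un)+

lemma box_bump_tendsto: "(\<lambda>k. box_bump k a b z) \<longlonglongrightarrow> indicator (box a b) z"
proof (cases "z \<in> box a b")
  case True
  have "(\<lambda>k. box_bump k a b z) \<longlonglongrightarrow> 1 * 1 * 1 * 1"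
    unfolding box_bump_def using True
    by (intro tendsto_mult bump1_tendsto) (auto simp: mem_box_plane)
  with True show ?thesis by simp
next
  case False
  have "bump1 (real k * t - 1) = 0" if "t \<le> 0" for k t
    using that mult_nonneg_nonpos[of "real k" t] by (intro bump1_nonpos) auto
  with False have "box_bump k a b z = 0" for k
    unfolding box_bump_def by (auto simp: mem_box_plane not_less)
  with False show ?thesis by simp
qed

lemma box_bump_support:
  "\<exists>K. compact K \<and> K \<subseteq> box a b \<and> (\<forall>z. z \<notin> K \<longrightarrow> box_bump k a b z = 0)"
proof (cases "k = 0")
  case True
  then have "box_bump k a b z = 0" for z by (simp add: box_bump_def bump1_nonpos)
  then show ?thesis by (intro exI[of _ "{}"]) auto
next
  case False
  let ?e = "(1 / real k, 1 / real k)"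
  have e: "real k * t - 1 \<le> 0" if "t \<le> 1 / real k" for t
    using that False by (simp add: field_simps)
  have "box_bump k a b z = 0" if z: "z \<notin> cbox (a + ?e) (b - ?e)" for z
  proof -
    have "fst z - fst a \<le> 1 / real k \<or> fst b - fst z \<le> 1 / real k \<or>
      snd z - snd a \<le> 1 / real k \<or> snd b - snd z \<le> 1 / real k"
      using z by (auto simp: mem_box_plane)
    then show ?thesis unfolding box_bump_def using bump1_nonpos[OF e] by auto
  qed
  moreover have "cbox (a + ?e) (b - ?e) \<subseteq> box a b"
  proof
    fix z assume z: "z \<in> cbox (a + ?e) (b - ?e)"
    define e where "e = 1 / real k"
    have "e > 0" using False by (simp add: e_def)
    moreover have "fst a + e \<le> fst z" "fst z \<le> fst b - e" "snd a + e \<le> snd z"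
      "snd z \<le> snd b - e"
      using z by (simp_all add: mem_box_plane e_def)
    ultimately show "z \<in> box a b" unfolding mem_box_plane by linarith
  qed
  ultimately show ?thesis by (intro exI[of _ "cbox (a + ?e) (b - ?e)"]) auto
qed

text \<open>U is a countable union of open boxes. The function 1 - prod (1 - bump) over the first k
  boxes is a smooth substitute for the union: it stays in [0, 1], dominates each single bump, and
  vanishes off a finite union of compact supports.\<close>

lemma test_function_indicator_approx:
  fixes U :: "(real \<times> real) set"
  assumes "open U"
  obtains \<psi> :: "nat \<Rightarrow> real \<times> real \<Rightarrow> real" where
    "\<And>k. test_function U (\<psi> k)" "\<And>k x. 0 \<le> \<psi> k x" "\<And>k x. \<psi> k x \<le> 1"
    "\<And>x. (\<lambda>k. \<psi> k x) \<longlonglongrightarrow> indicator U x"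
proof -
  obtain \<D> where D: "countable \<D>" "\<And>X. X \<in> \<D> \<Longrightarrow> \<exists>a b. X = box a b" "\<Union>\<D> = U"
    using open_countable_Union_open_box[OF assms] by metis
  \<comment> \<open>Adding the empty box makes the family nonempty, so the natural numbers enumerate
    all of it even if U is empty or finitely many boxes suffice.\<close>
  define B where "B = from_nat_into (insert {} \<D>)"
  have rB: "range B = insert {} \<D>"
    unfolding B_def using D(1) by (intro range_from_nat_into) auto
  have "\<exists>a b. B i = box a b" for i
  proof -
    have "B i \<in> insert {} \<D>" using rB by auto
    then show ?thesis
    proof
      assume "B i = {}"
      then have "B i = box 0 0" by (auto simp: mem_box_plane)
      then show ?thesis by blast
    qed (rule D(2))
  qed
  then have "\<forall>i. \<exists>c. B i = box (fst c) (snd c)" by simp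
  then obtain c where c: "\<And>i. B i = box (fst (c i)) (snd (c i))"
    using choice[of "\<lambda>i c. B i = box (fst c) (snd c)"] by auto
  define a b where "a i = fst (c i)" and "b i = snd (c i)" for i
  have ab: "B i = box (a i) (b i)" for i by (simp add: a_def b_def c)
  have "U = \<Union>(range B)" unfolding rB using D(3) by simp
  then have U: "U = (\<Union>i. box (a i) (b i))" by (simp add: ab)
  define \<psi> where "\<psi> k x = 1 - (\<Prod>i<k. 1 - box_bump k (a i) (b i) x)" for k :: nat and x
  have p0: "0 \<le> (\<Prod>i\<in>I. 1 - box_bump k (a i) (b i) x)" for I k x
    using box_bump_bounds by (intro prod_nonneg) auto
  have p1: "(\<Prod>i\<in>I. 1 - box_bump k (a i) (b i) x) \<le> 1" for I k x
    using box_bump_bounds by (intro prod_le_1) auto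
  have "test_function U (\<psi> k)" for k
    unfolding test_function_def
  proof (intro conjI)
    show "smooth_plane (\<psi> k)" unfolding \<psi>_def
      by (intro smooth_plane_diff smooth_plane_const smooth_plane_prod smooth_box_bump)
    have "\<forall>i. \<exists>K. compact K \<and> K \<subseteq> box (a i) (b i) \<and>
      (\<forall>z. z \<notin> K \<longrightarrow> box_bump k (a i) (b i) z = 0)"
      using box_bump_support by blast
    then obtain K where K: "\<And>i. compact (K i)" "\<And>i. K i \<subseteq> box (a i) (b i)"
      "\<And>i z. z \<notin> K i \<Longrightarrow> box_bump k (a i) (b i) z = 0"
      using choice[of "\<lambda>i K. compact K \<and> K \<subseteq> box (a i) (b i) \<and>
        (\<forall>z. z \<notin> K \<longrightarrow> box_bump k (a i) (b i) z = 0)"] by blast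
    have "\<psi> k x = 0" if "x \<notin> (\<Union>i<k. K i)" for x
      using that by (auto simp: \<psi>_def K(3) intro!: prod.neutral)
    moreover have "(\<Union>i<k. K i) \<subseteq> U" using K(2) by (auto simp: U)
    moreover have "compact (\<Union>i<k. K i)" using K(1) by (intro compact_UN) auto
    ultimately show "\<exists>K. compact K \<and> K \<subseteq> U \<and> (\<forall>x. x \<notin> K \<longrightarrow> \<psi> k x = 0)"
      by blast
  qed
  moreover have "(\<lambda>k. \<psi> k x) \<longlonglongrightarrow> indicator U x" for x
  proof (cases "x \<in> U")
    case True
    then obtain j where j: "x \<in> box (a j) (b j)" using U by auto
    have ev: "\<forall>\<^sub>F k in sequentially. box_bump k (a j) (b j) x \<le> \<psi> k x"
      using eventually_gt_at_top[of j]
    proof eventually_elim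
      case (elim k)
      have "(\<Prod>i<k. 1 - box_bump k (a i) (b i) x) =
        (1 - box_bump k (a j) (b j) x) * (\<Prod>i\<in>{..<k} - {j}. 1 - box_bump k (a i) (b i) x)"
        using elim by (intro prod.remove) auto
      also have "\<dots> \<le> (1 - box_bump k (a j) (b j) x) * 1"
        using box_bump_bounds p1 by (intro mult_left_mono) auto
      finally show ?case by (simp add: \<psi>_def)
    qed
    have "(\<lambda>k. box_bump k (a j) (b j) x) \<longlonglongrightarrow> 1"
      using box_bump_tendsto[of "a j" "b j" x] j by simp
    moreover have "\<forall>\<^sub>F k in sequentially. \<psi> k x \<le> 1"
      using p0 by (intro always_eventually) (auto simp: \<psi>_def)
    ultimately have "(\<lambda>k. \<psi> k x) \<longlonglongrightarrow> 1"
      using tendsto_sandwich[OF ev _ _ tendsto_const] by blast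
    with True show ?thesis by simp
  next
    case False
    have "box_bump k (a i) (b i) x = 0" for i k
      using box_bump_support[of "a i" "b i" k] False U by blast
    with False show ?thesis by (simp add: \<psi>_def)
  qed
  ultimately show ?thesis using that[of \<psi>] p0 p1 by (auto simp: \<psi>_def)
qed

section \<open>Square integrable functions\<close>

lemma integrable_on_iff:
  fixes f :: "'a::euclidean_space \<Rightarrow> real"
  assumes "D \<in> sets lebesgue"
  shows "set_integrable lebesgue D f \<longleftrightarrow> integrable (lebesgue_on D) f"
  using assms by (subst integrable_restrict_space) (auto simp: set_integrable_def)

lemma integral_on_eq:
  fixes f :: "'a::euclidean_space \<Rightarrow> real"
  assumes "D \<in> sets lebesgue"
  shows "(LINT x:D|lebesgue. f x) = integral\<^sup>L (lebesgue_on D) f"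
  using assms by (subst integral_restrict_space) (auto simp: set_lebesgue_integral_def)

lemma L2_on_iff:
  assumes "D \<in> sets lebesgue"
  shows "L2_on D f \<longleftrightarrow>
    f \<in> borel_measurable (lebesgue_on D) \<and> integrable (lebesgue_on D) (\<lambda>x. (f x)\<^sup>2)"
  using assms
  by (subst borel_measurable_restrict_space_iff)
    (auto simp: L2_on_def integrable_on_iff set_borel_measurable_def)

lemma L2_norm_eq:
  assumes "D \<in> sets lebesgue"
  shows "L2_norm D f = sqrt (integral\<^sup>L (lebesgue_on D) (\<lambda>x. (f x)\<^sup>2))"
  using assms by (simp add: L2_norm_def integral_on_eq)

lemma L2_norm_nonneg: "0 \<le> L2_norm D f"
  unfolding L2_norm_def set_lebesgue_integral_def
  by (intro real_sqrt_ge_zero Bochner_Integration.integral_nonneg) auto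

lemma L2_norm_sq: "(L2_norm D f)\<^sup>2 = (LINT x:D|lebesgue. (f x)\<^sup>2)"
  unfolding L2_norm_def set_lebesgue_integral_def
  by (intro real_sqrt_pow2 Bochner_Integration.integral_nonneg) auto

lemma L2_norm_sq_eq:
  "D \<in> sets lebesgue \<Longrightarrow> (L2_norm D f)\<^sup>2 = integral\<^sup>L (lebesgue_on D) (\<lambda>x. (f x)\<^sup>2)"
  by (simp add: L2_norm_sq integral_on_eq)

lemma L2_on_mult_integrable:
  assumes "D \<in> sets lebesgue" "L2_on D f" "L2_on D g"
  shows "integrable (lebesgue_on D) (\<lambda>x. f x * g x)"
proof (rule Bochner_Integration.integrable_bound)
  show "integrable (lebesgue_on D) (\<lambda>x. (f x)\<^sup>2 + (g x)\<^sup>2)"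
    using assms by (auto simp: L2_on_iff)
  show "(\<lambda>x. f x * g x) \<in> borel_measurable (lebesgue_on D)"
    using assms by (auto simp: L2_on_iff intro!: borel_measurable_times)
  have "\<bar>a * b\<bar> \<le> a\<^sup>2 + b\<^sup>2" for a b :: real
  proof -
    have "2 * (\<bar>a\<bar> * \<bar>b\<bar>) \<le> a\<^sup>2 + b\<^sup>2"
      using zero_le_power2[of "\<bar>a\<bar> - \<bar>b\<bar>"] by (simp add: power2_diff)
    moreover have "0 \<le> \<bar>a\<bar> * \<bar>b\<bar>" by simp
    ultimately show ?thesis unfolding abs_mult by linarith
  qed
  then show "AE x in lebesgue_on D. norm (f x * g x) \<le> norm ((f x)\<^sup>2 + (g x)\<^sup>2)"
    by (intro AE_I2) (simp add: order_trans[OF _ abs_ge_self])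
qed

lemma L2_on_linear:
  assumes D: "D \<in> sets lebesgue" and f: "L2_on D f" and g: "L2_on D g"
  shows "L2_on D (\<lambda>x. a * f x + b * g x)"
proof -
  have eq: "(a * f x + b * g x)\<^sup>2 = a\<^sup>2 * (f x)\<^sup>2 + (2 * a * b) * (f x * g x) + b\<^sup>2 * (g x)\<^sup>2" for x
    by (simp add: power2_eq_square algebra_simps)
  have "integrable (lebesgue_on D) (\<lambda>x. (a * f x + b * g x)\<^sup>2)"
    unfolding eq using f g L2_on_mult_integrable[OF D f g]
    by (intro Bochner_Integration.integrable_add integrable_mult_right) (auto simp: L2_on_iff[OF D])
  then show ?thesis using f g by (auto simp: L2_on_iff[OF D] intro!: borel_measurable_add borel_measurable_times)
qed

lemma L2_on_add: "D \<in> sets lebesgue \<Longrightarrow> L2_on D f \<Longrightarrow> L2_on D g \<Longrightarrow> L2_on D (\<lambda>x. f x + g x)"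
  using L2_on_linear[of D f g 1 1] by simp

lemma L2_on_diff: "D \<in> sets lebesgue \<Longrightarrow> L2_on D f \<Longrightarrow> L2_on D g \<Longrightarrow> L2_on D (\<lambda>x. f x - g x)"
  using L2_on_linear[of D f g 1 "-1"] by simp

lemma L2_on_cmult: "D \<in> sets lebesgue \<Longrightarrow> L2_on D f \<Longrightarrow> L2_on D (\<lambda>x. c * f x)"
  using L2_on_linear[of D f f c 0] by simp

lemma L2_on_zero: "D \<in> sets lebesgue \<Longrightarrow> L2_on D (\<lambda>x. 0)"
  by (simp add: L2_on_iff)

lemma L2_on_sum:
  "D \<in> sets lebesgue \<Longrightarrow> (\<And>i. i \<in> I \<Longrightarrow> L2_on D (f i)) \<Longrightarrow> L2_on D (\<lambda>x. \<Sum>i\<in>I. f i x)"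
  by (induction I rule: infinite_finite_induct) (auto intro: L2_on_zero L2_on_add)

lemma L2_norm_cmult:
  "D \<in> sets lebesgue \<Longrightarrow> L2_norm D (\<lambda>x. c * f x) = \<bar>c\<bar> * L2_norm D f"
  by (simp add: L2_norm_eq power_mult_distrib real_sqrt_mult)

lemma L2_norm_zero: "L2_norm D (\<lambda>x. 0) = 0"
  by (simp add: L2_norm_def set_lebesgue_integral_def)

text \<open>The quadratic in t given by the squared norm of f - t g is nonnegative; its value at the
  minimizer I / G gives the claim. If G = 0 the quadratic is affine, and for I \<noteq> 0 the point
  (F + 1) / (2 I) would give the value -1.\<close>

lemma L2_Cauchy_Schwarz:
  assumes D: "D \<in> sets lebesgue" and f: "L2_on D f" and g: "L2_on D g"
  shows "\<bar>integral\<^sup>L (lebesgue_on D) (\<lambda>x. f x * g x)\<bar> \<le> L2_norm D f * L2_norm D g"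
proof -
  let ?I = "integral\<^sup>L (lebesgue_on D)"
  define F G I where "F = ?I (\<lambda>x. (f x)\<^sup>2)" and "G = ?I (\<lambda>x. (g x)\<^sup>2)" and "I = ?I (\<lambda>x. f x * g x)"
  have int: "integrable (lebesgue_on D) (\<lambda>x. (f x)\<^sup>2)" "integrable (lebesgue_on D) (\<lambda>x. (g x)\<^sup>2)"
    "integrable (lebesgue_on D) (\<lambda>x. f x * g x)"
    using f g L2_on_mult_integrable[OF D f g] by (auto simp: L2_on_iff[OF D])
  have q: "0 \<le> F - 2 * t * I + t\<^sup>2 * G" for t
  proof -
    have "0 \<le> ?I (\<lambda>x. (f x - t * g x)\<^sup>2)"
      by (intro Bochner_Integration.integral_nonneg) auto
    also have "(\<lambda>x. (f x - t * g x)\<^sup>2) = (\<lambda>x. (f x)\<^sup>2 - (2 * t) * (f x * g x) + t\<^sup>2 * (g x)\<^sup>2)"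
      by (auto simp: power2_eq_square algebra_simps)
    also have "?I \<dots> = F - 2 * t * I + t\<^sup>2 * G"
      unfolding F_def G_def I_def using int by simp
    finally show ?thesis .
  qed
  have G: "0 \<le> G" unfolding G_def by (intro Bochner_Integration.integral_nonneg) auto
  have F: "0 \<le> F" using q[of 0] by simp
  have "I\<^sup>2 \<le> F * G"
  proof (cases "G = 0")
    case True
    have "I = 0"
    proof (rule ccontr)
      assume "I \<noteq> 0"
      then show False using q[of "(F + 1) / (2 * I)"] True by simp
    qed
    with True show ?thesis by simp
  next
    case False
    then have "0 < G" using G by simp
    moreover have "F - 2 * (I / G) * I + (I / G)\<^sup>2 * G = F - I\<^sup>2 / G"
      using False by (simp add: power2_eq_square field_simps)
    ultimately have "I\<^sup>2 / G \<le> F" using q[of "I / G"] by linarith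
    with \<open>0 < G\<close> show ?thesis by (simp add: pos_divide_le_eq)
  qed
  then have "\<bar>I\<bar> \<le> sqrt (F * G)" by (metis real_sqrt_abs real_sqrt_le_mono)
  then show ?thesis by (simp add: L2_norm_eq[OF D] F_def G_def I_def real_sqrt_mult)
qed

lemma L2_norm_triangle:
  assumes D: "D \<in> sets lebesgue" and f: "L2_on D f" and g: "L2_on D g"
  shows "L2_norm D (\<lambda>x. f x + g x) \<le> L2_norm D f + L2_norm D g"
proof -
  let ?I = "integral\<^sup>L (lebesgue_on D)"
  have int: "integrable (lebesgue_on D) (\<lambda>x. (f x)\<^sup>2)" "integrable (lebesgue_on D) (\<lambda>x. (g x)\<^sup>2)"
    "integrable (lebesgue_on D) (\<lambda>x. f x * g x)"
    using f g L2_on_mult_integrable[OF D f g] by (auto simp: L2_on_iff[OF D])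
  have "(L2_norm D (\<lambda>x. f x + g x))\<^sup>2 = ?I (\<lambda>x. (f x)\<^sup>2 + 2 * (f x * g x) + (g x)\<^sup>2)"
    by (simp add: L2_norm_sq_eq[OF D] power2_sum algebra_simps)
  also have "\<dots> = (L2_norm D f)\<^sup>2 + 2 * ?I (\<lambda>x. f x * g x) + (L2_norm D g)\<^sup>2"
    using int by (simp add: L2_norm_sq_eq[OF D])
  also have "\<dots> \<le> (L2_norm D f)\<^sup>2 + 2 * (L2_norm D f * L2_norm D g) + (L2_norm D g)\<^sup>2"
    using L2_Cauchy_Schwarz[OF D f g] by auto
  also have "\<dots> = (L2_norm D f + L2_norm D g)\<^sup>2" by (simp add: power2_sum algebra_simps)
  finally show ?thesis
    by (rule power2_le_imp_le) (auto intro: add_nonneg_nonneg L2_norm_nonneg)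
qed

lemma L2_norm_diff_le:
  assumes D: "D \<in> sets lebesgue" and f: "L2_on D f" and g: "L2_on D g"
  shows "L2_norm D (\<lambda>x. f x - g x) \<le> L2_norm D f + L2_norm D g"
  using L2_norm_triangle[OF D f L2_on_cmult[OF D g, of "-1"]] L2_norm_cmult[OF D, of "-1" g] by simp

lemma L2_norm_sum_le:
  assumes D: "D \<in> sets lebesgue" and "\<And>i. i \<in> I \<Longrightarrow> L2_on D (f i)"
  shows "L2_norm D (\<lambda>x. \<Sum>i\<in>I. f i x) \<le> (\<Sum>i\<in>I. L2_norm D (f i))"
  using assms(2)
proof (induction I rule: infinite_finite_induct)
  case (insert i I)
  have "L2_norm D (\<lambda>x. f i x + (\<Sum>i\<in>I. f i x)) \<le> L2_norm D (f i) + L2_norm D (\<lambda>x. \<Sum>i\<in>I. f i x)"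
    using insert.prems by (intro L2_norm_triangle[OF D] L2_on_sum[OF D]) auto
  with insert show ?case by force
qed (auto simp: L2_norm_zero)

lemma L2_on_subset:
  assumes "L2_on E f" "D \<subseteq> E" "D \<in> sets lebesgue" "E \<in> sets lebesgue"
  shows "L2_on D f"
  unfolding L2_on_def
proof
  show "set_integrable lebesgue D (\<lambda>x. (f x)\<^sup>2)"
    by (rule set_integrable_subset[OF _ assms(3,2)]) (use assms(1) in \<open>simp add: L2_on_def\<close>)
  have "f \<in> borel_measurable (lebesgue_on E)" using assms(1,4) by (simp add: L2_on_iff)
  from measurable_restrict_mono[OF this assms(2)]
  have "f \<in> borel_measurable (lebesgue_on D)" .
  with assms(3) show "set_borel_measurable lebesgue D f"
    by (subst (asm) borel_measurable_restrict_space_iff) (auto simp: set_borel_measurable_def)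
qed

lemma L2_norm_mono:
  assumes "L2_on E f" "D \<subseteq> E" "D \<in> sets lebesgue" "E \<in> sets lebesgue"
  shows "L2_norm D f \<le> L2_norm E f"
  unfolding L2_norm_def
  unfolding set_lebesgue_integral_def
proof (intro real_sqrt_le_mono Bochner_Integration.integral_mono)
  show "integrable lebesgue (\<lambda>x. indicat_real E x *\<^sub>R (f x)\<^sup>2)"
    using assms by (simp add: L2_on_def set_integrable_def)
  show "integrable lebesgue (\<lambda>x. indicat_real D x *\<^sub>R (f x)\<^sup>2)"
    using L2_on_subset[OF assms] by (simp add: L2_on_def set_integrable_def)
qed (use assms in \<open>auto simp: indicator_def\<close>)

text \<open>The preimages under f and g differ inside a null set, and every subset of a null set is
  measurable because the measure is complete.\<close>

lemma lebesgue_measurable_cong_AE: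
  fixes f g :: "'a::euclidean_space \<Rightarrow> real"
  assumes f: "f \<in> borel_measurable lebesgue" and eq: "AE x in lebesgue. f x = g x"
  shows "g \<in> borel_measurable lebesgue"
proof (rule measurableI)
  fix S :: "real set" assume S: "S \<in> sets borel"
  obtain N where N: "{x \<in> space lebesgue. \<not> f x = g x} \<subseteq> N" "N \<in> null_sets (lebesgue :: 'a measure)"
    using eq by (auto simp: eventually_ae_filter)
  have "f -` S \<in> sets lebesgue" using measurable_sets[OF f S] by simp
  moreover have "g -` S \<inter> N \<in> null_sets lebesgue"
    by (rule completion.complete2[OF Int_lower2 N(2)])
  ultimately have "(f -` S - N) \<union> (g -` S \<inter> N) \<in> sets lebesgue"
    using N(2) by (intro sets.Un sets.Diff) auto
  moreover have "f x = g x" if "x \<notin> N" for x using N(1) that by auto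
  then have "g -` S = (f -` S - N) \<union> (g -` S \<inter> N)" by auto
  ultimately have "g -` S \<in> sets lebesgue" by simp
  then show "g -` S \<inter> space lebesgue \<in> sets lebesgue" by simp
qed simp

lemma AE_lebesgue_on:
  assumes "D \<in> sets lebesgue" "AE x in lebesgue. x \<in> D \<longrightarrow> P x"
  shows "AE x in lebesgue_on D. P x"
  using assms by (subst AE_restrict_space_iff) auto

lemma L2_on_cong_AE:
  assumes D: "D \<in> sets lebesgue" and f: "L2_on D f" and eq: "AE x in lebesgue. x \<in> D \<longrightarrow> f x = g x"
  shows "L2_on D g" "L2_norm D g = L2_norm D f"
proof -
  have "(\<lambda>x. indicator D x *\<^sub>R f x) \<in> borel_measurable lebesgue"
    using f by (simp add: L2_on_def set_borel_measurable_def)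
  then have "(\<lambda>x. indicator D x *\<^sub>R g x) \<in> borel_measurable lebesgue"
    by (rule lebesgue_measurable_cong_AE) (use eq in eventually_elim, auto simp: indicator_def)
  then have m: "g \<in> borel_measurable (lebesgue_on D)"
    using D by (subst borel_measurable_restrict_space_iff) auto
  have eq': "AE x in lebesgue_on D. f x = g x" by (rule AE_lebesgue_on[OF D eq])
  have sq: "AE x in lebesgue_on D. (f x)\<^sup>2 = (g x)\<^sup>2" using eq' by eventually_elim simp
  have sq': "AE x in lebesgue_on D. (g x)\<^sup>2 = (f x)\<^sup>2" using eq' by eventually_elim simp
  have f': "f \<in> borel_measurable (lebesgue_on D)" "integrable (lebesgue_on D) (\<lambda>x. (f x)\<^sup>2)"
    using f by (auto simp: L2_on_iff[OF D])
  have "integrable (lebesgue_on D) (\<lambda>x. (g x)\<^sup>2)"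
    by (rule integrable_cong_AE_imp[OF f'(2)]) (use m sq in auto)
  with m show "L2_on D g" by (simp add: L2_on_iff[OF D])
  show "L2_norm D g = L2_norm D f"
    unfolding L2_norm_eq[OF D]
    by (intro arg_cong[where f = sqrt] integral_cong_AE) (use m f' sq' in auto)
qed

lemma L2_on_bounded:
  assumes D: "D \<in> sets lebesgue" "emeasure lebesgue D < \<infinity>"
    and m: "f \<in> borel_measurable (lebesgue_on D)" and b: "\<And>x. x \<in> D \<Longrightarrow> \<bar>f x\<bar> \<le> M"
  shows "L2_on D f" "L2_norm D f \<le> M * sqrt (measure lebesgue D)"
proof -
  have M: "0 \<le> M \<or> D = {}" using b by fastforce
  have le: "(f x)\<^sup>2 \<le> M\<^sup>2" if "x \<in> D" for x
    using power_mono[OF b[OF that], of 2] by simp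
  have fin: "emeasure (lebesgue_on D) (space (lebesgue_on D)) < \<infinity>"
    using D by (simp add: emeasure_restrict_space)
  have c: "integrable (lebesgue_on D) (\<lambda>x. M\<^sup>2)"
    using fin by (intro finite_measure.integrable_const finite_measureI) auto
  have i: "integrable (lebesgue_on D) (\<lambda>x. (f x)\<^sup>2)"
    by (rule Bochner_Integration.integrable_bound[OF c]) (use m le in \<open>auto intro!: AE_I2\<close>)
  then show "L2_on D f" using m by (simp add: L2_on_iff[OF D(1)])
  have "integral\<^sup>L (lebesgue_on D) (\<lambda>x. (f x)\<^sup>2) \<le> integral\<^sup>L (lebesgue_on D) (\<lambda>x. M\<^sup>2)"
    by (rule integral_mono[OF i c]) (use le in auto)
  also have "\<dots> = M\<^sup>2 * measure lebesgue D"
    using D by (simp add: measure_restrict_space)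
  finally have "L2_norm D f \<le> sqrt (M\<^sup>2 * measure lebesgue D)"
    by (simp add: L2_norm_eq[OF D(1)])
  then show "L2_norm D f \<le> M * sqrt (measure lebesgue D)"
    using M by (auto simp: real_sqrt_mult)
qed

lemma L2_on_integrable:
  assumes D: "D \<in> sets lebesgue" "emeasure lebesgue D < \<infinity>" and f: "L2_on D f"
  shows "integrable (lebesgue_on D) f"
  using L2_on_mult_integrable[OF D(1) f, of "\<lambda>_. 1"] L2_on_bounded(1)[OF D, of "\<lambda>_. 1" 1] by simp

text \<open>Composing a Lebesgue measurable function with a measurable map, or restricting it to a
  line, can destroy measurability. All arguments with translations, scalings, sections and Fubini
  therefore pass to a Borel function that is equal almost everywhere.\<close>

lemma lebesgue_borel_representative:
  fixes f :: "'a::euclidean_space \<Rightarrow> real"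
  assumes "f \<in> borel_measurable lebesgue"
  obtains g where "g \<in> borel_measurable borel" "AE x in lborel. f x = g x"
  using completion_ex_borel_measurable_real[of f lborel] assms by auto

section \<open>Test functions and weak derivatives\<close>

text \<open>Symmetry of second derivatives. Write f(s, t) as f(s, a) plus the integral of its second
  partial derivative from a to t, differentiate in s under the integral sign, and then in t by the
  fundamental theorem of calculus.\<close>

lemma smooth_plane_mixed_partials:
  assumes f: "smooth_plane f"
  shows "partial1 (partial2 f) = partial2 (partial1 f)"
proof
  fix z :: "real \<times> real"
  obtain x y where z: "z = (x, y)" by (cases z)
  define a b where "a = y - 1" and "b = y + 1"
  define f2 f12 where "f2 = partial2 f" and "f12 = partial1 (partial2 f)"
  have sm: "smooth_plane f2" "smooth_plane f12" "smooth_plane (partial1 f)"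
    unfolding f2_def f12_def using f smooth_plane_partial by blast+
  note g = smooth_plane_has_grad[OF f]
  note g2 = smooth_plane_has_grad[OF sm(1)]
  note g1 = smooth_plane_has_grad[OF sm(3)]
  have c2: "continuous_on S (\<lambda>\<tau>. f2 (s, \<tau>))" for s S
    by (rule continuous_on_compose2[OF smooth_plane_continuous[OF sm(1), of UNIV]])
      (auto intro!: continuous_intros)
  have c12: "continuous_on S (\<lambda>\<tau>. f12 (s, \<tau>))" for s S
    by (rule continuous_on_compose2[OF smooth_plane_continuous[OF sm(2), of UNIV]])
      (auto intro!: continuous_intros)
  have F: "f (s, t) = f (s, a) + integral (cbox a t) (\<lambda>\<tau>. f2 (s, \<tau>))" if "a \<le> t" for s t
  proof -
    have "((\<lambda>\<tau>. f2 (s, \<tau>)) has_integral f (s, t) - f (s, a)) {a..t}"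
    proof (rule fundamental_theorem_of_calculus[OF that])
      fix \<tau>
      have "((\<lambda>t. f (s, t)) has_field_derivative f2 (s, \<tau>)) (at \<tau>)"
        unfolding f2_def by (rule has_grad_deriv2[OF g])
      then show "((\<lambda>t. f (s, t)) has_vector_derivative f2 (s, \<tau>)) (at \<tau> within {a..t})"
        by (metis has_field_derivative_at_within has_real_derivative_iff_has_vector_derivative)
    qed
    then show ?thesis by (simp add: integral_unique)
  qed
  have G: "partial1 f (x, t) = partial1 f (x, a) + integral (cbox a t) (\<lambda>\<tau>. f12 (x, \<tau>))"
    if "a \<le> t" for t
  proof -
    have int: "((\<lambda>s. integral (cbox a t) (\<lambda>\<tau>. f2 (s, \<tau>))) has_field_derivative
        integral (cbox a t) (\<lambda>\<tau>. f12 (x, \<tau>))) (at x within UNIV)"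
    proof (rule leibniz_rule_field_derivative)
      show "((\<lambda>s. f2 (s, \<tau>)) has_field_derivative f12 (s, \<tau>)) (at s within UNIV)" for s \<tau>
        using has_grad_deriv1[OF g2] unfolding f12_def f2_def by simp
      show "(\<lambda>\<tau>. f2 (s, \<tau>)) integrable_on cbox a t" for s
        by (rule integrable_continuous[OF c2])
      show "continuous_on (UNIV \<times> cbox a t) (\<lambda>(s, \<tau>). f12 (s, \<tau>))"
        using smooth_plane_continuous[OF sm(2)] by simp
    qed auto
    have eq: "(\<lambda>s. f (s, t)) = (\<lambda>s. f (s, a) + integral (cbox a t) (\<lambda>\<tau>. f2 (s, \<tau>)))"
      by (rule ext) (rule F[OF that])
    have "((\<lambda>s. f (s, t)) has_field_derivative
        partial1 f (x, a) + integral (cbox a t) (\<lambda>\<tau>. f12 (x, \<tau>))) (at x)"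
      by (subst eq) (rule DERIV_add[OF has_grad_deriv1[OF g] int])
    from DERIV_unique[OF has_grad_deriv1[OF g, where x = x and y = t] this] show ?thesis .
  qed
  have "((\<lambda>t. integral {a..t} (\<lambda>\<tau>. f12 (x, \<tau>))) has_vector_derivative f12 (x, y)) (at y within {a..b})"
    by (rule integral_has_vector_derivative[OF c12]) (auto simp: a_def b_def)
  moreover have "at y within {a..b} = at y"
    by (rule at_within_interior) (simp add: a_def b_def)
  ultimately have "((\<lambda>t. integral {a..t} (\<lambda>\<tau>. f12 (x, \<tau>))) has_field_derivative f12 (x, y)) (at y)"
    by (simp add: has_real_derivative_iff_has_vector_derivative)
  from DERIV_add[OF DERIV_const[of "partial1 f (x, a)"] this]
  have "((\<lambda>t. partial1 f (x, a) + integral {a..t} (\<lambda>\<tau>. f12 (x, \<tau>))) has_field_derivative f12 (x, y)) (at y)"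
    by simp
  then have "((\<lambda>t. partial1 f (x, t)) has_field_derivative f12 (x, y)) (at y)"
  proof (rule has_field_derivative_transform_within_open[where S = "{a<..}"])
    show "partial1 f (x, a) + integral {a..t} (\<lambda>\<tau>. f12 (x, \<tau>)) = partial1 f (x, t)"
      if "t \<in> {a<..}" for t using G[of t] that by (subst G) auto
  qed (auto simp: a_def)
  from DERIV_unique[OF this has_grad_deriv2[OF g1]]
  show "partial1 (partial2 f) z = partial2 (partial1 f) z"
    by (simp add: z f12_def)
qed

lemma smooth_plane_partials: "smooth_plane \<psi> \<Longrightarrow> smooth_plane (partials i j \<psi>)"
proof -
  assume \<psi>: "smooth_plane \<psi>"
  have "smooth_plane ((partial2 ^^ j) \<psi>)" by (induction j) (auto intro: \<psi> smooth_plane_partial)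
  then show ?thesis
    unfolding partials_def by (induction i) (auto intro: smooth_plane_partial)
qed

lemma partials_0: "partials 0 0 \<psi> = \<psi>"
  by (simp add: partials_def)

lemma partials_partial2: "partials i j (partial2 \<psi>) = partials i (Suc j) \<psi>"
  by (simp add: partials_def funpow_swap1)

text \<open>\<open>partials\<close> applies \<open>partial2\<close> first, so an inner
  \<open>partial1\<close> has to be moved past all of them. This is where symmetry of mixed
  derivatives enters.\<close>

lemma partials_partial1:
  assumes "smooth_plane \<psi>" shows "partials i j (partial1 \<psi>) = partials (Suc i) j \<psi>"
proof -
  have "(partial2 ^^ j) (partial1 \<psi>) = partial1 ((partial2 ^^ j) \<psi>)"
  proof (induction j)
    case (Suc j)
    have "smooth_plane ((partial2 ^^ j) \<psi>)"
      using smooth_plane_partials[OF assms, of 0 j] by (simp add: partials_def)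
    then show ?case using Suc smooth_plane_mixed_partials by simp
  qed simp
  then show ?thesis by (simp add: partials_def funpow_swap1)
qed

lemma partial_vanish_outside:
  assumes "closed K" "\<And>z. z \<notin> K \<Longrightarrow> has_grad f (fx z) (fy z) z" "\<And>z. z \<notin> K \<Longrightarrow> f z = 0" "z \<notin> K"
  shows "fx z = 0" "fy z = 0"
proof -
  have "has_grad f 0 0 z"
    by (rule has_grad_transform[OF has_grad_const, of "- K" _ 0]) (use assms in auto)
  from has_grad_partials[OF this] has_grad_partials[OF assms(2)[OF assms(4)]]
  show "fx z = 0" "fy z = 0" by auto
qed

lemma partials_vanish_outside:
  assumes \<psi>: "smooth_plane \<psi>" and K: "closed K" and 0: "\<And>z. z \<notin> K \<Longrightarrow> \<psi> z = 0"
  shows "z \<notin> K \<Longrightarrow> partials i j \<psi> z = 0"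
proof (induction i arbitrary: z)
  case 0
  then show ?case
  proof (induction j arbitrary: z)
    case 0
    then show ?case using assms by (simp add: partials_0)
  next
    case (Suc j)
    have "partial2 (partials 0 j \<psi>) z = 0"
      by (rule partial_vanish_outside(2)[OF K smooth_plane_has_grad[OF smooth_plane_partials[OF \<psi>]]])
        (use Suc in auto)
    then show ?case by (simp add: partials_def)
  qed
next
  case (Suc i)
  have "partial1 (partials i j \<psi>) z = 0"
    by (rule partial_vanish_outside(1)[OF K smooth_plane_has_grad[OF smooth_plane_partials[OF \<psi>]]])
      (use Suc in auto)
  then show ?case by (simp add: partials_def)
qed

section \<open>Test functions\<close>

lemma test_function_partials: "test_function D \<psi> \<Longrightarrow> test_function D (partials i j \<psi>)"
  unfolding test_function_def
  by (meson compact_imp_closed partials_vanish_outside smooth_plane_partials)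

lemma test_function_partial1: "test_function D \<psi> \<Longrightarrow> test_function D (partial1 \<psi>)"
  using test_function_partials[of D \<psi> 1 0] by (simp add: partials_def)

lemma test_function_partial2: "test_function D \<psi> \<Longrightarrow> test_function D (partial2 \<psi>)"
  using test_function_partials[of D \<psi> 0 1] by (simp add: partials_def)

lemma test_function_mono: "test_function D \<psi> \<Longrightarrow> D \<subseteq> E \<Longrightarrow> test_function E \<psi>"
  unfolding test_function_def by blast

lemma test_function_outside: "test_function D \<psi> \<Longrightarrow> x \<notin> D \<Longrightarrow> \<psi> x = 0"
  unfolding test_function_def by blast

lemma test_function_continuous: "test_function D \<psi> \<Longrightarrow> continuous_on S \<psi>"
  unfolding test_function_def by (blast intro: smooth_plane_continuous)

lemma test_function_measurable: "test_function D \<psi> \<Longrightarrow> \<psi> \<in> borel_measurable borel"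
  by (rule borel_measurable_continuous_onI[OF test_function_continuous])

lemma test_function_bounded:
  assumes "test_function D \<psi>" obtains M where "\<And>x. \<bar>\<psi> x\<bar> \<le> M"
proof -
  obtain K where K: "compact K" "\<And>x. x \<notin> K \<Longrightarrow> \<psi> x = 0"
    using assms unfolding test_function_def by blast
  have "compact (\<psi> ` K)" by (rule compact_continuous_image[OF test_function_continuous[OF assms] K(1)])
  then obtain M where "\<forall>y\<in>\<psi> ` K. norm y \<le> M"
    using compact_imp_bounded[of "\<psi> ` K"] unfolding bounded_iff by blast
  then have M: "\<bar>\<psi> x\<bar> \<le> M" if "x \<in> K" for x using that by simp
  have "\<bar>\<psi> x\<bar> \<le> max M 0" for x using M[of x] K(2)[of x] by (cases "x \<in> K") auto
  then show thesis by (rule that)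
qed

lemma test_function_zero: "test_function D (\<lambda>x. 0)"
  unfolding test_function_def by (intro conjI smooth_plane_const exI[of _ "{}"]) auto

lemma test_function_add:
  assumes "test_function D f" "test_function D g"
  shows "test_function D (\<lambda>x. f x + g x)"
proof -
  obtain K L where "compact K" "K \<subseteq> D" "\<And>x. x \<notin> K \<Longrightarrow> f x = 0"
    "compact L" "L \<subseteq> D" "\<And>x. x \<notin> L \<Longrightarrow> g x = 0"
    using assms unfolding test_function_def by blast
  then show ?thesis
    using assms unfolding test_function_def
    by (intro conjI smooth_plane_add exI[of _ "K \<union> L"]) auto
qed

lemma test_function_cmult:
  assumes "test_function D f" shows "test_function D (\<lambda>x. c * f x)"
proof -
  obtain K where "compact K" "K \<subseteq> D" "\<And>x. x \<notin> K \<Longrightarrow> f x = 0"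
    using assms unfolding test_function_def by blast
  then show ?thesis
    using assms unfolding test_function_def
    by (intro conjI smooth_plane_mult smooth_plane_const exI[of _ K]) auto
qed

lemma locally_integrable_subset: "locally_integrable_on D f \<Longrightarrow> E \<subseteq> D \<Longrightarrow> locally_integrable_on E f"
  unfolding locally_integrable_on_def by blast

lemma locally_integrable_continuous:
  assumes "continuous_on D f" shows "locally_integrable_on D f"
  unfolding locally_integrable_on_def set_integrable_def
proof (intro allI impI, elim conjE)
  fix K assume K: "compact K" "K \<subseteq> D"
  have i: "integrable lborel (\<lambda>x. indicator K x *\<^sub>R f x)"
    by (rule borel_integrable_compact[OF K(1) continuous_on_subset[OF assms K(2)]])
  then show "integrable lebesgue (\<lambda>x. indicator K x *\<^sub>R f x)"
    using integrable_completion[OF borel_measurable_integrable[OF i]] by simp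
qed

text \<open>On the compact support of the test function f is integrable, and the other factor is
  bounded. Every pairing below is a genuine integral by this lemma.\<close>

lemma locally_integrable_test:
  assumes f: "locally_integrable_on D f" and \<psi>: "test_function D \<psi>"
  shows "set_integrable lebesgue D (\<lambda>x. f x * \<psi> x)"
proof -
  obtain K where K: "compact K" "K \<subseteq> D" "\<And>x. x \<notin> K \<Longrightarrow> \<psi> x = 0"
    using \<psi> unfolding test_function_def by blast
  obtain M where M: "\<And>x. \<bar>\<psi> x\<bar> \<le> M" using test_function_bounded[OF \<psi>] by blast
  have i: "integrable lebesgue (\<lambda>x. indicator K x *\<^sub>R f x)"
    using f K unfolding locally_integrable_on_def set_integrable_def by blast
  have m: "\<psi> \<in> borel_measurable lebesgue"
    using measurable_completion[of \<psi> lborel borel] test_function_measurable[OF \<psi>] by simp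
  have eq: "indicator D x *\<^sub>R (f x * \<psi> x) = (indicator K x *\<^sub>R f x) * \<psi> x" for x
    using K(2,3) by (cases "x \<in> K") (auto simp: indicator_def)
  show ?thesis
    unfolding set_integrable_def eq
  proof (rule Bochner_Integration.integrable_bound)
    show "integrable lebesgue (\<lambda>x. M * (indicator K x *\<^sub>R f x))" using i by (intro integrable_mult_right)
    show "(\<lambda>x. (indicator K x *\<^sub>R f x) * \<psi> x) \<in> borel_measurable lebesgue"
      using borel_measurable_integrable[OF i] m by (rule borel_measurable_times)
    have "\<bar>indicator K x *\<^sub>R f x\<bar> * \<bar>\<psi> x\<bar> \<le> \<bar>indicator K x *\<^sub>R f x\<bar> * \<bar>M\<bar>" for x
      using M[of x] by (intro mult_left_mono) auto
    then show "AE x in lebesgue. norm ((indicator K x *\<^sub>R f x) * \<psi> x) \<le> norm (M * (indicator K x *\<^sub>R f x))"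
      by (intro AE_I2) (simp add: abs_mult mult.commute)
  qed
qed

section \<open>Calculus of weak derivatives\<close>

lemma weak_partialD:
  assumes "weak_partial D i j f g"
  shows "locally_integrable_on D f" "locally_integrable_on D g"
    "test_function D \<psi> \<Longrightarrow> (LINT x:D|lebesgue. f x * partials i j \<psi> x) =
       (- 1) ^ (i + j) * (LINT x:D|lebesgue. g x * \<psi> x)"
  using assms unfolding weak_partial_def by auto

lemma weak_partial_0: "locally_integrable_on D f \<Longrightarrow> weak_partial D 0 0 f f"
  by (simp add: weak_partial_def partials_0)

lemma weak_partial_linear:
  assumes D: "D \<in> sets lebesgue"
    and f: "weak_partial D i j f f'" and g: "weak_partial D i j g g'"
  shows "weak_partial D i j (\<lambda>x. a * f x + b * g x) (\<lambda>x. a * f' x + b * g' x)"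
  unfolding weak_partial_def
proof (intro conjI allI impI)
  have *: "locally_integrable_on D (\<lambda>x. a * u x + b * v x)"
    if "locally_integrable_on D u" "locally_integrable_on D v" for u v
    using that unfolding locally_integrable_on_def by (auto intro!: set_integral_add set_integrable_mult_right)
  show "locally_integrable_on D (\<lambda>x. a * f x + b * g x)" "locally_integrable_on D (\<lambda>x. a * f' x + b * g' x)"
    using * weak_partialD(1,2)[OF f] weak_partialD(1,2)[OF g] by auto
  fix \<psi> assume \<psi>: "test_function D \<psi>"
  have lin: "(LINT x:D|lebesgue. (a * u x + b * v x) * \<eta> x) =
      a * (LINT x:D|lebesgue. u x * \<eta> x) + b * (LINT x:D|lebesgue. v x * \<eta> x)"
    if "locally_integrable_on D u" "locally_integrable_on D v" "test_function D \<eta>" for u v \<eta>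
  proof -
    have 1: "set_integrable lebesgue D (\<lambda>x. a * (u x * \<eta> x))" "set_integrable lebesgue D (\<lambda>x. b * (v x * \<eta> x))"
      using that by (auto intro!: set_integrable_mult_right locally_integrable_test)
    have "(a * u x + b * v x) * \<eta> x = a * (u x * \<eta> x) + b * (v x * \<eta> x)" for x
      by (simp add: algebra_simps)
    then show ?thesis using set_integral_add(2)[OF 1] by simp
  qed
  show "(LINT x:D|lebesgue. (a * f x + b * g x) * partials i j \<psi> x) =
      (- 1) ^ (i + j) * (LINT x:D|lebesgue. (a * f' x + b * g' x) * \<psi> x)"
    using lin[OF weak_partialD(1)[OF f] weak_partialD(1)[OF g] test_function_partials[OF \<psi>, of i j]]
      lin[OF weak_partialD(2)[OF f] weak_partialD(2)[OF g] \<psi>]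
      weak_partialD(3)[OF f \<psi>] weak_partialD(3)[OF g \<psi>]
    by (simp add: algebra_simps)
qed

text \<open>A test function on the smaller set is one on the larger set, and it vanishes on the
  difference, so the integrals agree.\<close>

lemma weak_partial_restrict:
  assumes f: "weak_partial D i j f g" and E: "E \<subseteq> D"
  shows "weak_partial E i j f g"
  unfolding weak_partial_def
proof (intro conjI allI impI)
  show "locally_integrable_on E f" "locally_integrable_on E g"
    using locally_integrable_subset[OF _ E] weak_partialD[OF f] by auto
  fix \<psi> assume \<psi>: "test_function E \<psi>"
  have *: "(LINT x:E|lebesgue. u x * \<eta> x) = (LINT x:D|lebesgue. u x * \<eta> x)"
    if "test_function E \<eta>" for u \<eta>
    unfolding set_lebesgue_integral_def
    using E test_function_outside[OF that] by (intro Bochner_Integration.integral_cong) (auto simp: indicator_def)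
  show "(LINT x:E|lebesgue. f x * partials i j \<psi> x) = (- 1) ^ (i + j) * (LINT x:E|lebesgue. g x * \<psi> x)"
    using *[OF \<psi>] *[OF test_function_partials[OF \<psi>]]
      weak_partialD(3)[OF f test_function_mono[OF \<psi> E]] by simp
qed

lemma weak_partial_trans1:
  assumes f: "weak_partial D i j f g" and g: "weak_partial D 1 0 g g'"
  shows "weak_partial D (Suc i) j f g'"
  unfolding weak_partial_def
proof (intro conjI allI impI)
  fix \<psi> assume \<psi>: "test_function D \<psi>"
  have "partials (Suc i) j \<psi> = partials i j (partial1 \<psi>)"
    using partials_partial1 \<psi> unfolding test_function_def by metis
  then show "(LINT x:D|lebesgue. f x * partials (Suc i) j \<psi> x) =
      (- 1) ^ (Suc i + j) * (LINT x:D|lebesgue. g' x * \<psi> x)"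
    using weak_partialD(3)[OF f test_function_partial1[OF \<psi>]] weak_partialD(3)[OF g \<psi>]
    by (simp add: partials_def)
qed (use weak_partialD[OF f] weak_partialD[OF g] in auto)

lemma weak_partial_trans2:
  assumes f: "weak_partial D i j f g" and g: "weak_partial D 0 1 g g'"
  shows "weak_partial D i (Suc j) f g'"
  unfolding weak_partial_def
proof (intro conjI allI impI)
  fix \<psi> assume \<psi>: "test_function D \<psi>"
  show "(LINT x:D|lebesgue. f x * partials i (Suc j) \<psi> x) =
      (- 1) ^ (i + Suc j) * (LINT x:D|lebesgue. g' x * \<psi> x)"
    using weak_partialD(3)[OF f test_function_partial2[OF \<psi>]] weak_partialD(3)[OF g \<psi>]
      partials_partial2[of i j \<psi>] by (simp add: partials_def)
qed (use weak_partialD[OF f] weak_partialD[OF g] in auto)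

text \<open>Testing the relation of order (i, j) with the first partial derivative of the test
  function produces the same left side as the relation of order (i + 1, j). Thus derivatives of one
  function that are known separately become first-order derivatives of each other, as the Poincare
  inequality requires.\<close>

lemma weak_partial_cancel1:
  assumes f: "weak_partial D i j f g" and g: "weak_partial D (Suc i) j f g'"
  shows "weak_partial D 1 0 g g'"
  unfolding weak_partial_def
proof (intro conjI allI impI)
  fix \<psi> assume \<psi>: "test_function D \<psi>"
  have "partials (Suc i) j \<psi> = partials i j (partial1 \<psi>)"
    using partials_partial1 \<psi> unfolding test_function_def by metis
  then have "(- 1) ^ (i + j) * (LINT x:D|lebesgue. g x * partial1 \<psi> x) =
      (- 1) ^ (i + j) * - (LINT x:D|lebesgue. g' x * \<psi> x)"
    using weak_partialD(3)[OF f test_function_partial1[OF \<psi>]] weak_partialD(3)[OF g \<psi>] by simp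
  then have "(LINT x:D|lebesgue. g x * partial1 \<psi> x) = - (LINT x:D|lebesgue. g' x * \<psi> x)"
    by (subst (asm) mult_cancel_left) simp
  then show "(LINT x:D|lebesgue. g x * partials 1 0 \<psi> x) =
      (- 1) ^ (1 + 0) * (LINT x:D|lebesgue. g' x * \<psi> x)"
    by (simp add: partials_def)
qed (use weak_partialD[OF f] weak_partialD[OF g] in auto)

lemma weak_partial_cancel2:
  assumes f: "weak_partial D i j f g" and g: "weak_partial D i (Suc j) f g'"
  shows "weak_partial D 0 1 g g'"
  unfolding weak_partial_def
proof (intro conjI allI impI)
  fix \<psi> assume \<psi>: "test_function D \<psi>"
  have "(- 1) ^ (i + j) * (LINT x:D|lebesgue. g x * partial2 \<psi> x) =
      (- 1) ^ (i + j) * - (LINT x:D|lebesgue. g' x * \<psi> x)"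
    using weak_partialD(3)[OF f test_function_partial2[OF \<psi>]] weak_partialD(3)[OF g \<psi>]
    by (simp add: partials_partial2)
  then have "(LINT x:D|lebesgue. g x * partial2 \<psi> x) = - (LINT x:D|lebesgue. g' x * \<psi> x)"
    by (subst (asm) mult_cancel_left) simp
  then show "(LINT x:D|lebesgue. g x * partials 0 1 \<psi> x) =
      (- 1) ^ (0 + 1) * (LINT x:D|lebesgue. g' x * \<psi> x)"
    by (simp add: partials_def)
qed (use weak_partialD[OF f] weak_partialD[OF g] in auto)

text \<open>By Fubini it is enough to integrate along lines, where the fundamental theorem of
  calculus gives a difference of two boundary values outside the support.\<close>

lemma integral_partial_compact_support:
  assumes g: "\<And>z. has_grad w (wx z) (wy z) z" and c: "continuous_on UNIV wx" "continuous_on UNIV wy"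
    and K: "compact K" "\<And>z. z \<notin> K \<Longrightarrow> w z = 0"
  shows "integrable lborel wx" "integral\<^sup>L lborel wx = 0"
    "integrable lborel wy" "integral\<^sup>L lborel wy = 0"
proof -
  note out = partial_vanish_outside[OF compact_imp_closed[OF K(1)] g K(2)]
  have ix: "integrable lborel u" if "continuous_on UNIV u" "\<And>z. z \<notin> K \<Longrightarrow> u z = 0" for u :: "real \<times> real \<Rightarrow> real"
  proof -
    have "integrable lborel (\<lambda>x. indicator K x *\<^sub>R u x)"
      by (rule borel_integrable_compact[OF K(1) continuous_on_subset[OF that(1)]]) auto
    also have "(\<lambda>x. indicator K x *\<^sub>R u x) = u"
    proof
      show "indicator K x *\<^sub>R u x = u x" for x using that(2)[of x] by (cases "x \<in> K") auto
    qed
    finally show ?thesis .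
  qed
  show i: "integrable lborel wx" "integrable lborel wy"
    using ix[OF c(1)] ix[OF c(2)] out by auto
  obtain a0 where a0: "K \<subseteq> cbox (- a0) a0"
    using bounded_subset_cbox_symmetric[OF compact_imp_bounded[OF K(1)]] .
  \<comment> \<open>All points of K have coordinates of modulus less than A, so the end points -A
    and A of every line integral lie off the support.\<close>
  define A where "A = max \<bar>fst a0\<bar> \<bar>snd a0\<bar> + 1"
  have A: "(s, t) \<notin> K" if "A \<le> \<bar>s\<bar> \<or> A \<le> \<bar>t\<bar>" for s t
  proof
    assume "(s, t) \<in> K"
    then have "(s, t) \<in> cbox (- a0) a0" using a0 by blast
    with that show False by (auto simp: mem_box_plane A_def)
  qed
  have A0: "- A \<le> A" by (simp add: A_def)
  have line: "(LINT s|lborel. u' s) = 0"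
    if u: "\<And>s. (u has_field_derivative u' s) (at s)" "continuous_on UNIV u'"
      "\<And>s. A \<le> \<bar>s\<bar> \<Longrightarrow> u s = 0" "\<And>s. A \<le> \<bar>s\<bar> \<Longrightarrow> u' s = 0" for u u' :: "real \<Rightarrow> real"
  proof -
    have "(LINT s|lborel. indicator {-A..A} s *\<^sub>R u' s) = u A - u (-A)"
    proof (rule integral_FTC_atLeastAtMost[OF A0])
      show "(u has_vector_derivative u' x) (at x within {-A..A})" for x
        using u(1) has_field_derivative_at_within has_real_derivative_iff_has_vector_derivative by blast
    qed (rule continuous_on_subset[OF u(2)], simp)
    also have "(\<lambda>s. indicator {-A..A} s *\<^sub>R u' s) = u'"
    proof
      show "indicator {-A..A} s *\<^sub>R u' s = u' s" for s
        using u(4)[of s] by (cases "s \<in> {-A..A}") auto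
    qed
    also have "u A - u (-A) = 0" using u(3)[of A] u(3)[of "-A"] by simp
    finally show ?thesis .
  qed
  have cs: "continuous_on UNIV (\<lambda>s. u (s, y))" "continuous_on UNIV (\<lambda>s. u (y, s))"
    if "continuous_on UNIV u" for u :: "real \<times> real \<Rightarrow> real" and y
    by (rule continuous_on_compose2[OF that]; auto intro!: continuous_intros)+
  have "(LINT s|lborel. wx (s, y)) = 0" for y
    by (rule line[OF has_grad_deriv1[OF g] cs(1)[OF c(1)]]) (use A K(2) out(1) in auto)
  then show "integral\<^sup>L lborel wx = 0"
    using lborel_pair.integral_snd[of "\<lambda>s t. wx (s, t)"] i(1) by (simp add: lborel_prod)
  have "(LINT t|lborel. wy (x, t)) = 0" for x
    by (rule line[OF has_grad_deriv2[OF g] cs(2)[OF c(2)]]) (use A K(2) out(2) in auto)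
  then show "integral\<^sup>L lborel wy = 0"
    using lborel_pair.integral_fst[of "\<lambda>s t. wy (s, t)"] i(2) by (simp add: lborel_prod)
qed

text \<open>The product of f with a test function, extended by 0, is continuously differentiable on
  the whole plane; the integrals of its partial derivatives vanish, which is integration by
  parts.\<close>

lemma weak_partial_classical:
  assumes D: "open D" and g: "\<And>z. z \<in> D \<Longrightarrow> has_grad f (fx z) (fy z) z"
    and c: "continuous_on D fx" "continuous_on D fy"
  shows "weak_partial D 1 0 f fx" "weak_partial D 0 1 f fy"
proof -
  have cf: "continuous_on D f"
    using has_grad_continuous[OF g] by (auto intro: continuous_at_imp_continuous_on)
  have key: "(LINT x:D|lebesgue. f x * partial1 \<psi> x) = - (LINT x:D|lebesgue. fx x * \<psi> x) \<and>
      (LINT x:D|lebesgue. f x * partial2 \<psi> x) = - (LINT x:D|lebesgue. fy x * \<psi> x)"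
    if \<psi>: "test_function D \<psi>" for \<psi>
  proof -
    obtain K where K: "compact K" "K \<subseteq> D" "\<And>x. x \<notin> K \<Longrightarrow> \<psi> x = 0" and sm: "smooth_plane \<psi>"
      using \<psi> unfolding test_function_def by blast
    have oK: "open (- K)" using K(1) by (simp add: compact_imp_closed open_Compl)
    \<comment> \<open>The plane is covered by two open sets: on D the product rule applies, on the
      complement of K the extension is 0. Differentiability and continuity are glued from these two
      pieces.\<close>
    have DK: "D \<union> - K = UNIV" using K(2) by auto
    note out = partial_vanish_outside[OF compact_imp_closed[OF K(1)] smooth_plane_has_grad[OF sm] K(3)]
    define w where "w z = indicator D z * (f z * \<psi> z)" for z
    define wx where "wx z = indicator D z * (fx z * \<psi> z + f z * partial1 \<psi> z)" for z
    define wy where "wy z = indicator D z * (fy z * \<psi> z + f z * partial2 \<psi> z)" for z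
    have 0: "w z = 0" "wx z = 0" "wy z = 0" if "z \<notin> K" for z
      using that K(3) out by (auto simp: w_def wx_def wy_def)
    have gr: "has_grad w (wx z) (wy z) z" for z
    proof (cases "z \<in> D")
      case True
      have "has_grad (\<lambda>z. f z * \<psi> z) (fx z * \<psi> z + f z * partial1 \<psi> z) (fy z * \<psi> z + f z * partial2 \<psi> z) z"
        by (rule has_grad_mult[OF g[OF True] smooth_plane_has_grad[OF sm]])
      then have "has_grad w (fx z * \<psi> z + f z * partial1 \<psi> z) (fy z * \<psi> z + f z * partial2 \<psi> z) z"
        by (rule has_grad_transform[OF _ D True]) (simp add: w_def)
      then show ?thesis using True by (simp add: wx_def wy_def)
    next
      case False
      then have z: "z \<in> - K" using K(2) by auto
      have "has_grad w 0 0 z"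
        by (rule has_grad_transform[OF has_grad_const oK z, of 0]) (simp add: 0)
      then show ?thesis using False by (simp add: wx_def wy_def)
    qed
    have cont: "continuous_on UNIV u" if "continuous_on D u" "\<And>z. z \<notin> K \<Longrightarrow> u z = 0" for u :: "real \<times> real \<Rightarrow> real"
    proof -
      have "continuous_on (- K) u"
        using that(2) by (subst continuous_on_cong[OF refl, of _ _ "\<lambda>_. 0"]) auto
      from continuous_on_open_Un[OF D oK that(1) this] show ?thesis by (simp add: DK)
    qed
    have cp: "continuous_on D (partial1 \<psi>)" "continuous_on D (partial2 \<psi>)" "continuous_on D \<psi>"
      using sm smooth_plane_continuous smooth_plane_partial by blast+
    have "continuous_on D wx"
      by (subst continuous_on_cong[OF refl, of _ _ "\<lambda>z. fx z * \<psi> z + f z * partial1 \<psi> z"])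
        (auto simp: wx_def intro!: continuous_intros c cf cp)
    then have cx: "continuous_on UNIV wx" using cont 0 by blast
    have "continuous_on D wy"
      by (subst continuous_on_cong[OF refl, of _ _ "\<lambda>z. fy z * \<psi> z + f z * partial2 \<psi> z"])
        (auto simp: wy_def intro!: continuous_intros c cf cp)
    then have cy: "continuous_on UNIV wy" using cont 0 by blast
    note I = integral_partial_compact_support[OF gr cx cy K(1) 0(1)]
    have si: "set_integrable lebesgue D (\<lambda>x. fx x * \<psi> x)" "set_integrable lebesgue D (\<lambda>x. f x * partial1 \<psi> x)"
      "set_integrable lebesgue D (\<lambda>x. fy x * \<psi> x)" "set_integrable lebesgue D (\<lambda>x. f x * partial2 \<psi> x)"
      using c cf \<psi> by (auto intro!: locally_integrable_test locally_integrable_continuous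
          test_function_partial1 test_function_partial2)
    have "(LINT x:D|lebesgue. fx x * \<psi> x + f x * partial1 \<psi> x) = integral\<^sup>L lborel wx"
      using integral_completion[OF borel_measurable_integrable[OF I(1)]]
      by (simp add: set_lebesgue_integral_def wx_def[abs_def])
    moreover have "(LINT x:D|lebesgue. fy x * \<psi> x + f x * partial2 \<psi> x) = integral\<^sup>L lborel wy"
      using integral_completion[OF borel_measurable_integrable[OF I(3)]]
      by (simp add: set_lebesgue_integral_def wy_def[abs_def])
    ultimately show ?thesis
      using set_integral_add(2)[OF si(1,2)] set_integral_add(2)[OF si(3,4)] I(2,4) by simp
  qed
  show "weak_partial D 1 0 f fx" "weak_partial D 0 1 f fy"
    unfolding weak_partial_def using key cf c
    by (auto simp: partials_def intro: locally_integrable_continuous)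
qed

section \<open>The fundamental lemma and uniqueness of weak derivatives\<close>

lemma sets_borel_eq_sigma_open: "sets (borel :: 'a::topological_space measure) = sigma_sets UNIV {U. open U}"
  by (simp add: borel_def)

text \<open>Dynkin's theorem for the generator of open sets, which is stable under
  intersection.\<close>

lemma borel_Dynkin_open [consumes 1, case_names opn compl un]:
  fixes A :: "'a::topological_space set"
  assumes "A \<in> sets borel" and "\<And>U. open U \<Longrightarrow> P U"
    and "\<And>A. A \<in> sets borel \<Longrightarrow> P A \<Longrightarrow> P (- A)"
    and "\<And>A :: nat \<Rightarrow> 'a set. disjoint_family A \<Longrightarrow> (\<And>i. A i \<in> sets borel) \<Longrightarrow>
      (\<And>i. P (A i)) \<Longrightarrow> P (\<Union>i. A i)"
  shows "P A"
proof -
  have A: "A \<in> sigma_sets UNIV {U. open U}" using assms(1) by (simp add: sets_borel_eq_sigma_open)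
  have "Int_stable {U :: 'a set. open U}" by (auto simp: Int_stable_def)
  from this _ A show ?thesis
  proof (rule sigma_sets_induct_disjoint)
    fix A :: "nat \<Rightarrow> 'a set"
    assume "disjoint_family A" "range A \<subseteq> sigma_sets UNIV {U. open U}" "\<And>i. P (A i)"
    then show "P (\<Union>i. A i)"
      by (intro assms(4)) (auto simp: sets_borel_eq_sigma_open)
  qed (use assms in \<open>auto simp: sets_borel_eq_sigma_open Compl_eq_Diff_UNIV[symmetric]\<close>)
qed

lemma AE_lebesgue_borel: "(AE x in lborel. P x) \<Longrightarrow> AE x in lebesgue. P x"
  by (rule AE_completion)

text \<open>The cut-off to a box whose closure lies in D makes w globally integrable. Its integrals
  over open sets are limits of integrals against test functions by dominated convergence, hence 0;
  by Dynkin the same holds for all Borel sets, and a function with this property vanishes almost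
  everywhere.\<close>

lemma vanishing_on_box:
  assumes w: "locally_integrable_on D w" and ab: "cbox a b \<subseteq> D"
    and 0: "\<And>\<psi>. test_function D \<psi> \<Longrightarrow> (LINT x:D|lebesgue. w x * \<psi> x) = 0"
  shows "AE x in lebesgue. x \<in> box a b \<longrightarrow> w x = 0"
proof -
  define v where "v x = indicator (box a b) x * w x" for x
  have "set_integrable lebesgue (cbox a b) w"
    using w ab compact_cbox unfolding locally_integrable_on_def by blast
  then have "set_integrable lebesgue (box a b) w"
    by (rule set_integrable_subset[OF _ _ box_subset_cbox]) auto
  then have vi: "integrable lebesgue v" by (simp add: set_integrable_def v_def[abs_def])
  obtain g where g: "g \<in> borel_measurable borel" "AE x in lborel. v x = g x"
    using lebesgue_borel_representative[OF borel_measurable_integrable[OF vi]] .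
  have ae: "AE x in lebesgue. v x = g x" by (rule AE_lebesgue_borel[OF g(2)])
  have gl: "g \<in> borel_measurable lebesgue" using measurable_completion[of g lborel borel] g(1) by simp
  have gi': "integrable lebesgue g" by (rule integrable_cong_AE_imp[OF vi gl]) (use ae in auto)
  then have gi: "integrable lborel g" using integrable_completion[of g lborel] g(1) by simp
  have openU: "(LINT x:U|lborel. g x) = 0" if U: "open U" for U
  proof -
    have "open (U \<inter> box a b)" using U by auto
    then obtain \<psi> :: "nat \<Rightarrow> real \<times> real \<Rightarrow> real" where \<psi>: "\<And>k. test_function (U \<inter> box a b) (\<psi> k)"
      "\<And>k x. 0 \<le> \<psi> k x" "\<And>k x. \<psi> k x \<le> 1" "\<And>x. (\<lambda>k. \<psi> k x) \<longlonglongrightarrow> indicator (U \<inter> box a b) x"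
      using test_function_indicator_approx by blast
    have sub: "U \<inter> box a b \<subseteq> D" using ab box_subset_cbox by blast
    have "(\<lambda>k. LINT x|lebesgue. v x * \<psi> k x) \<longlonglongrightarrow> (LINT x|lebesgue. indicator U x * v x)"
    proof (rule integral_dominated_convergence)
      show "integrable lebesgue (\<lambda>x. norm (v x))" using vi by (rule integrable_norm)
      show "(\<lambda>x. indicator U x * v x) \<in> borel_measurable lebesgue"
        using borel_measurable_integrable[OF vi] U by (intro borel_measurable_times borel_measurable_indicator) auto
      show "(\<lambda>x. v x * \<psi> k x) \<in> borel_measurable lebesgue" for k
        using borel_measurable_integrable[OF vi] measurable_completion[of "\<psi> k" lborel borel]
          test_function_measurable[OF \<psi>(1)] by (intro borel_measurable_times) auto
      show "AE x in lebesgue. (\<lambda>k. v x * \<psi> k x) \<longlonglongrightarrow> indicator U x * v x"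
      proof (intro AE_I2)
        fix x
        have "(\<lambda>k. v x * \<psi> k x) \<longlonglongrightarrow> v x * indicator (U \<inter> box a b) x"
          by (intro tendsto_intros \<psi>(4))
        also have "v x * indicator (U \<inter> box a b) x = indicator U x * v x"
          by (auto simp: v_def indicator_def)
        finally show "(\<lambda>k. v x * \<psi> k x) \<longlonglongrightarrow> indicator U x * v x" .
      qed
      have "\<bar>v x\<bar> * \<bar>\<psi> k x\<bar> \<le> \<bar>v x\<bar> * 1" for k x
        using \<psi>(2,3)[of k x] by (intro mult_left_mono) auto
      then show "AE x in lebesgue. norm (v x * \<psi> k x) \<le> norm (v x)" for k
        by (intro AE_I2) (simp add: abs_mult)
    qed
    moreover have "(LINT x|lebesgue. v x * \<psi> k x) = 0" for k
    proof -
      have eq: "v x * \<psi> k x = indicator D x *\<^sub>R (w x * \<psi> k x)" for x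
        using test_function_outside[OF \<psi>(1), of x k] sub by (auto simp: v_def indicator_def)
      show ?thesis
        unfolding eq by (rule 0[OF test_function_mono[OF \<psi>(1)[of k] sub], unfolded set_lebesgue_integral_def])
    qed
    ultimately have "(LINT x|lebesgue. indicator U x * v x) = 0"
      by (simp add: LIMSEQ_const_iff)
    moreover have "(LINT x|lebesgue. indicator U x * v x) = (LINT x|lebesgue. indicator U x * g x)"
      using borel_measurable_integrable[OF vi] U gl
      by (intro integral_cong_AE borel_measurable_times borel_measurable_indicator)
        (use ae in \<open>auto elim: eventually_mono\<close>)
    moreover have "(LINT x|lebesgue. indicator U x * g x) = (LINT x|lborel. indicator U x * g x)"
      using g(1) U by (intro integral_completion) (auto intro!: borel_measurable_times borel_measurable_indicator)
    ultimately show ?thesis by (simp add: set_lebesgue_integral_def)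
  qed
  have si: "set_integrable lborel A g" if "A \<in> sets borel" for A
    unfolding set_integrable_def using gi that by (intro integrable_mult_indicator) auto
  have "(LINT x:A|lborel. g x) = 0" if "A \<in> sets borel" for A
    using that
  proof (induction A rule: borel_Dynkin_open)
    case (opn U)
    then show ?case by (rule openU)
  next
    case (compl A)
    have "(LINT x:A \<union> (- A)|lborel. g x) = (LINT x:A|lborel. g x) + (LINT x:- A|lborel. g x)"
      using compl by (intro set_integral_Un si) auto
    with compl openU[of UNIV] show ?case by (simp add: Compl_partition)
  next
    case (un A)
    have "(LINT x:(\<Union>i. A i)|lborel. g x) = (\<Sum>i. (LINT x:(A i)|lborel. g x))"
      using un(1,2) by (intro lebesgue_integral_countable_add si) (auto simp: disjoint_family_on_def)
    with un(3) show ?case by simp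
  qed
  then have "AE x in lborel. g x = 0" using sigma_finite_measure.density_zero[OF sigma_finite_lborel gi] by simp
  from AE_lebesgue_borel[OF this] ae show ?thesis
    by eventually_elim (auto simp: v_def)
qed

text \<open>D is a countable union of closed boxes, each contained in D; their frontiers are null
  sets, so the result on the open boxes suffices.\<close>

lemma fundamental_lemma:
  assumes D: "open D" and w: "locally_integrable_on D w"
    and 0: "\<And>\<psi>. test_function D \<psi> \<Longrightarrow> (LINT x:D|lebesgue. w x * \<psi> x) = 0"
  shows "AE x in lebesgue. x \<in> D \<longrightarrow> w x = 0"
proof -
  obtain \<D> where \<D>: "countable \<D>" "\<D> \<subseteq> Pow D" "\<And>X. X \<in> \<D> \<Longrightarrow> \<exists>a b. X = cbox a b" "\<Union>\<D> = D"
    using open_countable_Union_open_cbox[OF D] by metis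
  have "AE x in lebesgue. x \<in> X \<longrightarrow> w x = 0" if X: "X \<in> \<D>" for X
  proof -
    obtain a b where ab: "X = cbox a b" using \<D>(3)[OF X] by blast
    have "cbox a b \<subseteq> D" using \<D>(2) X ab by blast
    from vanishing_on_box[OF w this 0]
    have "AE x in lebesgue. x \<in> box a b \<longrightarrow> w x = 0" by simp
    moreover have "AE x in lebesgue. x \<notin> cbox a b - box a b"
      using negligible_frontier_interval[of a b] unfolding negligible_iff_null_sets by (rule AE_not_in)
    ultimately show ?thesis unfolding ab by eventually_elim auto
  qed
  then have "AE x in lebesgue. \<forall>X\<in>\<D>. x \<in> X \<longrightarrow> w x = 0" by (rule AE_ball_countable'[OF _ \<D>(1)])
  then show ?thesis by eventually_elim (use \<D>(4) in auto)
qed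

lemma weak_partial_unique:
  assumes D: "open D" and g: "weak_partial D i j f g" and g': "weak_partial D i j f g'"
  shows "AE x in lebesgue. x \<in> D \<longrightarrow> g x = g' x"
proof -
  note l = weak_partialD(2)[OF g] weak_partialD(2)[OF g']
  have "AE x in lebesgue. x \<in> D \<longrightarrow> g x - g' x = 0"
  proof (rule fundamental_lemma[OF D])
    show "locally_integrable_on D (\<lambda>x. g x - g' x)"
      using l unfolding locally_integrable_on_def by (auto intro: set_integral_diff(1))
    fix \<psi> assume \<psi>: "test_function D \<psi>"
    have "(- 1) ^ (i + j) * (LINT x:D|lebesgue. g x * \<psi> x) = (- 1) ^ (i + j) * (LINT x:D|lebesgue. g' x * \<psi> x)"
      using weak_partialD(3)[OF g \<psi>] weak_partialD(3)[OF g' \<psi>] by simp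
    then have "(LINT x:D|lebesgue. g x * \<psi> x) = (LINT x:D|lebesgue. g' x * \<psi> x)" by simp
    then show "(LINT x:D|lebesgue. (g x - g' x) * \<psi> x) = 0"
      using set_integral_diff(2)[OF locally_integrable_test[OF l(1) \<psi>] locally_integrable_test[OF l(2) \<psi>]]
      by (simp add: left_diff_distrib)
  qed
  then show ?thesis by eventually_elim auto
qed

lemma the_weak_partial_AE:
  assumes D: "open D" and g: "weak_partial D i j f g"
  shows "AE x in lebesgue. x \<in> D \<longrightarrow> g x = the_weak_partial D i j f x"
proof -
  have "weak_partial D i j f (the_weak_partial D i j f)"
    using someI[of "weak_partial D i j f", OF g] by (simp add: the_weak_partial_def)
  from weak_partial_unique[OF D g this] show ?thesis .
qed

lemma L2_norm_the_weak_partial: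
  assumes D: "open D" and g: "weak_partial D i j f g" and L: "L2_on D g"
  shows "L2_norm D (the_weak_partial D i j f) = L2_norm D g"
  using L2_on_cong_AE(2)[OF _ L the_weak_partial_AE[OF D g]] D by auto

section \<open>Density of test functions\<close>

definition test_approximable :: "(real \<times> real) set \<Rightarrow> (real \<times> real \<Rightarrow> real) \<Rightarrow> bool" where
  "test_approximable D f \<longleftrightarrow> L2_on D f \<and> (\<forall>\<epsilon>>0. \<exists>\<psi>. test_function D \<psi> \<and> L2_norm D (\<lambda>x. f x - \<psi> x) < \<epsilon>)"

lemma borel_measurable_lebesgue_on: "f \<in> borel_measurable borel \<Longrightarrow> f \<in> borel_measurable (lebesgue_on D)"
  by (rule measurable_restrict_space1[OF measurable_completion]) simp

lemma test_function_L2: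
  assumes D: "D \<in> sets lebesgue" "emeasure lebesgue D < \<infinity>" and \<psi>: "test_function E \<psi>"
  shows "L2_on D \<psi>"
proof -
  obtain M where M: "\<And>x. \<bar>\<psi> x\<bar> \<le> M" using test_function_bounded[OF \<psi>] by blast
  show ?thesis
    by (rule L2_on_bounded(1)[OF D borel_measurable_lebesgue_on[OF test_function_measurable[OF \<psi>]] M])
qed

lemma L2_norm_tendsto_0:
  assumes D: "D \<in> sets lebesgue" and L: "L2_on D g"
    and m: "\<And>k. f k \<in> borel_measurable (lebesgue_on D)"
    and lim: "\<And>x. x \<in> D \<Longrightarrow> (\<lambda>k. f k x) \<longlonglongrightarrow> 0"
    and b: "\<And>k x. x \<in> D \<Longrightarrow> \<bar>f k x\<bar> \<le> g x"
  shows "(\<lambda>k. L2_norm D (f k)) \<longlonglongrightarrow> 0"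
proof -
  have "(\<lambda>k. integral\<^sup>L (lebesgue_on D) (\<lambda>x. (f k x)\<^sup>2)) \<longlonglongrightarrow> integral\<^sup>L (lebesgue_on D) (\<lambda>x. 0)"
  proof (rule integral_dominated_convergence)
    show "integrable (lebesgue_on D) (\<lambda>x. (g x)\<^sup>2)" using L by (simp add: L2_on_iff[OF D])
    show "(\<lambda>x. (f k x)\<^sup>2) \<in> borel_measurable (lebesgue_on D)" for k using m[of k] by simp
    have "(\<lambda>k. (f k x)\<^sup>2) \<longlonglongrightarrow> 0" if "x \<in> D" for x
      using tendsto_power[OF lim[OF that], of 2] by simp
    then show "AE x in lebesgue_on D. (\<lambda>k. (f k x)\<^sup>2) \<longlonglongrightarrow> 0" by (intro AE_I2) simp
    have "(f k x)\<^sup>2 \<le> (g x)\<^sup>2" if "x \<in> D" for k x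
      using power_mono[OF b[OF that, of k], where n = 2] by simp
    then show "AE x in lebesgue_on D. norm ((f k x)\<^sup>2) \<le> (g x)\<^sup>2" for k by (intro AE_I2) simp
  qed simp
  from tendsto_real_sqrt[OF this] show ?thesis by (simp add: L2_norm_eq[OF D])
qed

context
  fixes D :: "(real \<times> real) set"
  assumes D: "open D" "emeasure lebesgue D < \<infinity>"
begin

lemma sets_D: "D \<in> sets lebesgue" using D(1) by auto

lemma test_approximable_linear:
  assumes f: "test_approximable D f" and g: "test_approximable D g"
  shows "test_approximable D (\<lambda>x. a * f x + b * g x)"
  unfolding test_approximable_def
proof (intro conjI allI impI)
  have L: "L2_on D f" "L2_on D g" using f g by (auto simp: test_approximable_def)
  show "L2_on D (\<lambda>x. a * f x + b * g x)" by (rule L2_on_linear[OF sets_D L])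
  fix \<epsilon> :: real assume e: "\<epsilon> > 0"
  define d where "d = \<epsilon> / (\<bar>a\<bar> + \<bar>b\<bar> + 1)"
  have d: "d > 0" using e by (simp add: d_def add_nonneg_pos)
  obtain \<psi> \<phi> where \<psi>: "test_function D \<psi>" "L2_norm D (\<lambda>x. f x - \<psi> x) < d"
    and \<phi>: "test_function D \<phi>" "L2_norm D (\<lambda>x. g x - \<phi> x) < d"
    using f g d unfolding test_approximable_def by meson
  have T: "test_function D (\<lambda>x. a * \<psi> x + b * \<phi> x)"
    by (intro test_function_add test_function_cmult \<psi> \<phi>)
  have L': "L2_on D (\<lambda>x. f x - \<psi> x)" "L2_on D (\<lambda>x. g x - \<phi> x)"
    using L test_function_L2[OF sets_D D(2)] \<psi>(1) \<phi>(1) by (auto intro: L2_on_diff[OF sets_D])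
  have "(\<lambda>x. (a * f x + b * g x) - (a * \<psi> x + b * \<phi> x)) = (\<lambda>x. a * (f x - \<psi> x) + b * (g x - \<phi> x))"
    by (auto simp: algebra_simps)
  then have "L2_norm D (\<lambda>x. (a * f x + b * g x) - (a * \<psi> x + b * \<phi> x)) \<le>
      \<bar>a\<bar> * L2_norm D (\<lambda>x. f x - \<psi> x) + \<bar>b\<bar> * L2_norm D (\<lambda>x. g x - \<phi> x)"
    using L2_norm_triangle[OF sets_D L2_on_cmult[OF sets_D L'(1), of a] L2_on_cmult[OF sets_D L'(2), of b]]
    by (simp add: L2_norm_cmult[OF sets_D])
  also have "\<dots> \<le> \<bar>a\<bar> * d + \<bar>b\<bar> * d"
    using \<psi>(2) \<phi>(2) by (intro add_mono mult_left_mono) auto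
  also have "\<dots> < (\<bar>a\<bar> + \<bar>b\<bar> + 1) * d" using d by (simp add: algebra_simps)
  also have "\<dots> = \<epsilon>" unfolding d_def by (simp add: add_nonneg_eq_0_iff)
  finally show "\<exists>\<psi>. test_function D \<psi> \<and> L2_norm D (\<lambda>x. a * f x + b * g x - \<psi> x) < \<epsilon>"
    using T by blast
qed

lemma test_approximable_sum:
  assumes "\<And>i. i \<in> I \<Longrightarrow> test_approximable D (f i)"
  shows "test_approximable D (\<lambda>x. \<Sum>i\<in>I. f i x)"
  using assms
proof (induction I rule: infinite_finite_induct)
  case (insert i I)
  then show ?case using test_approximable_linear[of "f i" "\<lambda>x. \<Sum>i\<in>I. f i x" 1 1] by simp
qed (auto simp: test_approximable_def L2_on_zero[OF sets_D] L2_norm_zero intro!: exI[of _ "\<lambda>x. 0"] test_function_zero)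

lemma test_approximable_limit:
  assumes f: "L2_on D f" and g: "\<And>k. test_approximable D (g k)"
    and lim: "(\<lambda>k::nat. L2_norm D (\<lambda>x. f x - g k x)) \<longlonglongrightarrow> 0"
  shows "test_approximable D f"
  unfolding test_approximable_def
proof (intro conjI allI impI f)
  fix \<epsilon> :: real assume e: "\<epsilon> > 0"
  then have "\<forall>\<^sub>F k in sequentially. L2_norm D (\<lambda>x. f x - g k x) < \<epsilon> / 2"
    using order_tendstoD(2)[OF lim, of "\<epsilon> / 2"] by simp
  then obtain k where k: "L2_norm D (\<lambda>x. f x - g k x) < \<epsilon> / 2"
    using eventually_happens sequentially_bot by blast
  have "\<epsilon> / 2 > 0" using e by simp
  then obtain \<psi> where \<psi>: "test_function D \<psi>" "L2_norm D (\<lambda>x. g k x - \<psi> x) < \<epsilon> / 2"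
    using g[of k] unfolding test_approximable_def by meson
  have "L2_norm D (\<lambda>x. (f x - g k x) + (g k x - \<psi> x)) \<le> L2_norm D (\<lambda>x. f x - g k x) + L2_norm D (\<lambda>x. g k x - \<psi> x)"
    using f g[of k] test_function_L2[OF sets_D D(2) \<psi>(1)] unfolding test_approximable_def
    by (intro L2_norm_triangle[OF sets_D] L2_on_diff[OF sets_D]) auto
  with k \<psi> show "\<exists>\<psi>. test_function D \<psi> \<and> L2_norm D (\<lambda>x. f x - \<psi> x) < \<epsilon>" by force
qed

lemma L2_on_indicator: "A \<in> sets borel \<Longrightarrow> L2_on D (indicator A)"
  by (rule L2_on_bounded(1)[OF sets_D D(2), where M = 1])
    (rule borel_measurable_lebesgue_on[OF borel_measurable_indicator], auto simp: indicator_def)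

lemma L2_on_one: "L2_on D (\<lambda>x. c)"
  by (rule L2_on_bounded(1)[OF sets_D D(2), where M = "\<bar>c\<bar>"]) auto

lemma test_approximable_indicator_open:
  assumes open_U: "open U" shows "test_approximable D (indicator U)"
proof -
  have "open (U \<inter> D)" using open_U D(1) by blast
  then obtain \<psi> :: "nat \<Rightarrow> real \<times> real \<Rightarrow> real" where \<psi>: "\<And>k. test_function (U \<inter> D) (\<psi> k)"
    "\<And>k x. 0 \<le> \<psi> k x" "\<And>k x. \<psi> k x \<le> 1" "\<And>x. (\<lambda>k. \<psi> k x) \<longlonglongrightarrow> indicator (U \<inter> D) x"
    using test_function_indicator_approx by blast
  have U: "U \<in> sets borel" using open_U by simp
  have lim: "(\<lambda>k. L2_norm D (\<lambda>x. indicator U x - \<psi> k x)) \<longlonglongrightarrow> 0"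
  proof (rule L2_norm_tendsto_0[OF sets_D L2_on_one[of 1]])
    show "(\<lambda>x. indicator U x - \<psi> k x) \<in> borel_measurable (lebesgue_on D)" for k
      using U test_function_measurable[OF \<psi>(1)]
      by (intro borel_measurable_lebesgue_on borel_measurable_diff borel_measurable_indicator) auto
    show "(\<lambda>k. indicator U x - \<psi> k x) \<longlonglongrightarrow> 0" if "x \<in> D" for x
      using tendsto_diff[OF tendsto_const[of "indicator U x"] \<psi>(4)[of x]] that
      by (auto simp: indicator_def split: if_splits)
    show "\<bar>indicator U x - \<psi> k x\<bar> \<le> 1" for k x
      using \<psi>(2,3)[of k x] by (auto simp: indicator_def)
  qed
  have T: "test_function D (\<psi> k)" for k
    by (rule test_function_mono[OF \<psi>(1)]) auto
  have "\<exists>\<phi>. test_function D \<phi> \<and> L2_norm D (\<lambda>x. indicator U x - \<phi> x) < \<epsilon>" if "\<epsilon> > 0" for \<epsilon>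
    using eventually_happens[OF order_tendstoD(2)[OF lim that]] T by auto
  then show ?thesis using L2_on_indicator[OF U] by (simp add: test_approximable_def)
qed

text \<open>Dynkin induction starting from open sets. The complement step subtracts from the
  constant 1, which is the open case for the whole plane; for disjoint unions the partial sums are
  indicators again and converge in norm by domination.\<close>

lemma test_approximable_indicator:
  assumes "A \<in> sets borel" shows "test_approximable D (indicator A)"
  using assms
proof (induction A rule: borel_Dynkin_open)
  case (opn U)
  then show ?case by (rule test_approximable_indicator_open)
next
  case (compl A)
  have "(\<lambda>x. 1 * indicator UNIV x + (- 1) * indicator A x) = (indicator (- A) :: _ \<Rightarrow> real)"
    by (auto simp: indicator_def)
  with test_approximable_linear[OF test_approximable_indicator_open[OF open_UNIV] compl(2), of 1 "- 1"]
  show ?case by (simp only:)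
next
  case (un A)
  have s: "test_approximable D (\<lambda>x. \<Sum>i<n. indicator (A i) x)" for n
    using un(3) by (intro test_approximable_sum)
  have U: "(\<Union>i. A i) \<in> sets borel" using un(2) by auto
  have eq: "(\<Sum>i<n. indicator (A i) x) = (indicator (\<Union>i<n. A i) x :: real)" for n x
    using un(1) by (subst indicator_UN_disjoint) (auto simp: disjoint_family_on_def)
  show ?case
  proof (rule test_approximable_limit[OF L2_on_indicator[OF U] s])
    show "(\<lambda>k. L2_norm D (\<lambda>x. indicator (\<Union>i. A i) x - (\<Sum>i<k. indicator (A i) x))) \<longlonglongrightarrow> 0"
    proof (rule L2_norm_tendsto_0[OF sets_D L2_on_one[of 1]])
      show "(\<lambda>x. indicator (\<Union>i. A i) x - (\<Sum>i<k. indicator (A i) x) :: real) \<in> borel_measurable (lebesgue_on D)" for k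
        by (intro borel_measurable_lebesgue_on borel_measurable_diff borel_measurable_sum
            borel_measurable_indicator U un(2))
      show "(\<lambda>k. indicator (\<Union>i. A i) x - (\<Sum>i<k. indicator (A i) x) :: real) \<longlonglongrightarrow> 0" for x
        unfolding eq
      proof (rule tendsto_eventually)
        show "\<forall>\<^sub>F k in sequentially. indicator (\<Union>i. A i) x - indicator (\<Union>i<k. A i) x = (0::real)"
        proof (cases "x \<in> (\<Union>i. A i)")
          case True
          then obtain i where "x \<in> A i" by blast
          show ?thesis
            using eventually_gt_at_top[of i]
          proof eventually_elim
            case (elim k)
            then have "x \<in> (\<Union>i<k. A i)" using \<open>x \<in> A i\<close> by blast
            with True show ?case by (simp only: indicator_simps)
          qed
        qed (auto simp: indicator_def)
      qed
      show "\<bar>indicator (\<Union>i. A i) x - (\<Sum>i<k. indicator (A i) x) :: real\<bar> \<le> 1" for k x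
        unfolding eq by (auto simp: indicator_def)
    qed
  qed
qed

text \<open>Passing to a Borel representative, the function is an L2 limit of simple functions, and
  these are combinations of indicators of Borel sets.\<close>

lemma L2_test_approximable:
  assumes f: "L2_on D f" shows "test_approximable D f"
proof -
  have "(\<lambda>x. indicator D x *\<^sub>R f x) \<in> borel_measurable lebesgue"
    using f by (simp add: L2_on_def set_borel_measurable_def)
  then obtain g where g: "g \<in> borel_measurable borel" "AE x in lborel. indicator D x *\<^sub>R f x = g x"
    by (rule lebesgue_borel_representative)
  have ae: "AE x in lebesgue. x \<in> D \<longrightarrow> f x = g x"
    using AE_lebesgue_borel[OF g(2)] by eventually_elim auto
  note gL = L2_on_cong_AE[OF sets_D f ae]
  have gm: "g \<in> borel_measurable lborel" using g(1) by simp
  obtain s where s: "\<And>i. simple_function lborel (s i)" "\<And>x. (\<lambda>i. s i x) \<longlonglongrightarrow> g x"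
    "\<And>i x. dist (s i x) 0 \<le> 2 * dist (g x) 0"
    using borel_measurable_implies_sequence_metric[OF gm, of 0] by auto
  have sm: "s i \<in> borel_measurable borel" for i
    using borel_measurable_simple_function[OF s(1)] by simp
  have "test_approximable D (s i)" for i
  proof -
    have eq: "(\<lambda>x. \<Sum>y\<in>range (s i). y * indicator (s i -` {y}) x) = s i"
    proof
      fix x
      have "(\<Sum>y\<in>range (s i). y * indicator (s i -` {y}) x) =
          (\<Sum>y\<in>s i ` space lborel. indicator (s i -` {y} \<inter> space lborel) x *\<^sub>R y)"
        by (simp only: space_lborel space_borel Int_UNIV_right real_scaleR_def mult.commute)
      also have "\<dots> = s i x"
        by (rule simple_function_indicator_representation_banach[OF s(1), symmetric]) simp
      finally show "(\<Sum>y\<in>range (s i). y * indicator (s i -` {y}) x) = s i x" .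
    qed
    have "test_approximable D (\<lambda>x. \<Sum>y\<in>range (s i). y * indicator (s i -` {y}) x)"
    proof (rule test_approximable_sum)
      fix y
      have "s i -` {y} \<in> sets borel" using measurable_sets[OF sm, of "{y}"] by simp
      from test_approximable_linear[OF test_approximable_indicator[OF this] test_approximable_indicator[OF this], of y 0]
      show "test_approximable D (\<lambda>x. y * indicator (s i -` {y}) x)" by simp
    qed
    then show ?thesis unfolding eq .
  qed
  moreover have "(\<lambda>k. L2_norm D (\<lambda>x. g x - s k x)) \<longlonglongrightarrow> 0"
  proof (rule L2_norm_tendsto_0[OF sets_D])
    show "L2_on D (\<lambda>x. \<bar>3 * g x\<bar>)"
      using L2_on_cmult[OF sets_D gL(1), of 3] by (auto simp: L2_on_iff[OF sets_D])
    show "(\<lambda>x. g x - s k x) \<in> borel_measurable (lebesgue_on D)" for k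
      using g(1) sm by (intro borel_measurable_lebesgue_on borel_measurable_diff) auto
    show "(\<lambda>k. g x - s k x) \<longlonglongrightarrow> 0" for x
      using tendsto_diff[OF tendsto_const[of "g x"] s(2)[of x]] by simp
    \<comment> \<open>The simple functions satisfy |s k| \<le> 2 |g|, hence the majorant 3 |g| of
      the differences.\<close>
    show "\<bar>g x - s k x\<bar> \<le> \<bar>3 * g x\<bar>" for k x
      using s(3)[of k x] by (auto simp: dist_real_def)
  qed
  ultimately have ga: "test_approximable D g" by (rule test_approximable_limit[OF gL(1)])
  have eq: "L2_norm D (\<lambda>x. f x - \<psi> x) = L2_norm D (\<lambda>x. g x - \<psi> x)" if "test_function D \<psi>" for \<psi>
  proof (rule L2_on_cong_AE(2)[OF sets_D])
    show "L2_on D (\<lambda>x. g x - \<psi> x)"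
      by (rule L2_on_diff[OF sets_D gL(1) test_function_L2[OF sets_D D(2) that]])
    show "AE x in lebesgue. x \<in> D \<longrightarrow> g x - \<psi> x = f x - \<psi> x"
      using ae by eventually_elim auto
  qed
  show ?thesis unfolding test_approximable_def
  proof (intro conjI allI impI f)
    fix \<epsilon> :: real assume "\<epsilon> > 0"
    then obtain \<psi> where "test_function D \<psi>" "L2_norm D (\<lambda>x. g x - \<psi> x) < \<epsilon>"
      using ga unfolding test_approximable_def by blast
    then show "\<exists>\<psi>. test_function D \<psi> \<and> L2_norm D (\<lambda>x. f x - \<psi> x) < \<epsilon>"
      by (intro exI[of _ \<psi>] conjI) (simp_all only: eq)
  qed
qed

text \<open>The test function is chosen close to f itself, so the pairing is almost the squared norm
  of f. It turns a bound that is only accessible by testing into a bound of the norm.\<close>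

lemma L2_norm_le_duality:
  assumes f: "L2_on D f" and M: "0 \<le> M"
    and b: "\<And>\<psi>. test_function D \<psi> \<Longrightarrow> \<bar>integral\<^sup>L (lebesgue_on D) (\<lambda>x. f x * \<psi> x)\<bar> \<le> M * L2_norm D \<psi>"
  shows "L2_norm D f \<le> M"
proof (rule ccontr)
  let ?N = "L2_norm D f"
  assume "\<not> ?N \<le> M"
  then have N: "M < ?N" by simp
  have N0: "0 < ?N" using M N by simp
  \<comment> \<open>With this choice the total error (M + N) \<epsilon>, N being the norm of f, is
    half of N (N - M), so N^2 \<le> M N + N (N - M) / 2 contradicts M < N.\<close>
  define \<epsilon> where "\<epsilon> = ?N * (?N - M) / (2 * (M + ?N))"
  have e: "\<epsilon> > 0" using M N N0 by (simp add: \<epsilon>_def)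
  obtain \<psi> where \<psi>: "test_function D \<psi>" "L2_norm D (\<lambda>x. f x - \<psi> x) < \<epsilon>"
    using L2_test_approximable[OF f] e unfolding test_approximable_def by meson
  have L: "L2_on D \<psi>" "L2_on D (\<lambda>x. f x - \<psi> x)"
    using test_function_L2[OF sets_D D(2) \<psi>(1)] f by (auto intro: L2_on_diff[OF sets_D])
  have "(\<lambda>x. (f x)\<^sup>2) = (\<lambda>x. f x * \<psi> x + f x * (f x - \<psi> x))"
    by (auto simp: power2_eq_square algebra_simps)
  then have "?N\<^sup>2 = integral\<^sup>L (lebesgue_on D) (\<lambda>x. f x * \<psi> x + f x * (f x - \<psi> x))"
    by (simp only: L2_norm_sq_eq[OF sets_D])
  also have "\<dots> = integral\<^sup>L (lebesgue_on D) (\<lambda>x. f x * \<psi> x) + integral\<^sup>L (lebesgue_on D) (\<lambda>x. f x * (f x - \<psi> x))"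
    by (intro Bochner_Integration.integral_add L2_on_mult_integrable[OF sets_D] f L)
  also have "\<dots> \<le> M * L2_norm D \<psi> + ?N * L2_norm D (\<lambda>x. f x - \<psi> x)"
    using b[OF \<psi>(1)] L2_Cauchy_Schwarz[OF sets_D f L(2)] by linarith
  also have "L2_norm D \<psi> \<le> ?N + L2_norm D (\<lambda>x. f x - \<psi> x)"
    using L2_norm_diff_le[OF sets_D f L(2)] by simp
  then have "M * L2_norm D \<psi> \<le> M * (?N + L2_norm D (\<lambda>x. f x - \<psi> x))"
    by (rule mult_left_mono[OF _ M])
  finally have "?N\<^sup>2 \<le> M * ?N + (M + ?N) * L2_norm D (\<lambda>x. f x - \<psi> x)"
    by (simp add: algebra_simps)
  also have "\<dots> \<le> M * ?N + (M + ?N) * \<epsilon>"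
    using \<psi>(2) M N0 by (intro add_left_mono mult_left_mono) auto
  also have "(M + ?N) * \<epsilon> = ?N * (?N - M) / 2"
    unfolding \<epsilon>_def using M N0 by (simp add: divide_simps) (simp add: algebra_simps)
  finally have "?N\<^sup>2 \<le> M * ?N + ?N * (?N - M) / 2" .
  moreover have "?N * (?N - M) = ?N\<^sup>2 - M * ?N" by (simp add: power2_eq_square algebra_simps)
  moreover have "0 < ?N * (?N - M)" using N0 N by simp
  ultimately show False by linarith
qed

end

section \<open>A Poincare inequality on convex domains\<close>

lemma lborel_integral_translate:
  fixes f :: "'a::euclidean_space \<Rightarrow> real"
  assumes f: "f \<in> borel_measurable borel"
  shows "(LINT x|lborel. f (x + c)) = integral\<^sup>L lborel f"
    "integrable lborel (\<lambda>x. f (x + c)) \<longleftrightarrow> integrable lborel f"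
proof -
  have d: "distr lborel borel ((+) c) = (lborel :: 'a measure)" by (rule lborel_distr_plus)
  have "integral\<^sup>L (distr lborel borel ((+) c)) f = (LINT x|lborel. f (c + x))"
    by (rule integral_distr) (use f in auto)
  then show "(LINT x|lborel. f (x + c)) = integral\<^sup>L lborel f" unfolding d by (simp add: add.commute)
  have "integrable (distr lborel borel ((+) c)) f \<longleftrightarrow> integrable lborel (\<lambda>x. f (c + x))"
    by (rule integrable_distr_eq) (use f in auto)
  then show "integrable lborel (\<lambda>x. f (x + c)) \<longleftrightarrow> integrable lborel f" unfolding d by (simp add: add.commute)
qed

lemma nn_integral_lborel_translate:
  fixes f :: "'a::euclidean_space \<Rightarrow> ennreal"
  assumes f: "f \<in> borel_measurable borel"
  shows "(\<integral>\<^sup>+x. f (c + x) \<partial>lborel) = (\<integral>\<^sup>+x. f x \<partial>lborel)"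
proof -
  have "integral\<^sup>N (distr lborel borel ((+) c)) f = (\<integral>\<^sup>+x. f (c + x) \<partial>lborel)"
    by (rule nn_integral_distr) (use f in auto)
  then show ?thesis unfolding lborel_distr_plus by simp
qed

lemma integral_lebesgue_on_borel:
  fixes f :: "'a::euclidean_space \<Rightarrow> real"
  assumes D: "D \<in> sets borel" and f: "f \<in> borel_measurable borel"
  shows "integral\<^sup>L (lebesgue_on D) f = (LINT x|lborel. indicator D x * f x)"
    "integrable (lebesgue_on D) f \<longleftrightarrow> integrable lborel (\<lambda>x. indicator D x * f x)"
proof -
  have D': "D \<inter> space lebesgue \<in> sets lebesgue" using D by auto
  have m: "(\<lambda>x. indicator D x * f x) \<in> borel_measurable lborel"
    using D f by (simp add: borel_measurable_times borel_measurable_indicator)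
  show "integral\<^sup>L (lebesgue_on D) f = (LINT x|lborel. indicator D x * f x)"
    using integral_completion[OF m] integral_restrict_space[OF D', of f] by simp
  show "integrable (lebesgue_on D) f \<longleftrightarrow> integrable lborel (\<lambda>x. indicator D x * f x)"
    using integrable_completion[OF m] integrable_restrict_space[OF D', of f] by simp
qed

lemma weak_partial_cong_AE:
  assumes f: "weak_partial D i j f g" and eq: "AE x in lebesgue. x \<in> D \<longrightarrow> f x = f' x"
  shows "weak_partial D i j f' g"
proof -
  have l: "locally_integrable_on D f'"
    unfolding locally_integrable_on_def set_integrable_def
  proof (intro allI impI, elim conjE)
    fix K assume K: "compact K" "K \<subseteq> D"
    have i: "integrable lebesgue (\<lambda>x. indicator K x *\<^sub>R f x)"
      using weak_partialD(1)[OF f] K unfolding locally_integrable_on_def set_integrable_def by blast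
    have ae: "AE x in lebesgue. indicator K x *\<^sub>R f x = indicator K x *\<^sub>R f' x"
      using eq by eventually_elim (use K in \<open>auto simp: indicator_def\<close>)
    show "integrable lebesgue (\<lambda>x. indicator K x *\<^sub>R f' x)"
      by (rule integrable_cong_AE_imp[OF i])
       (use lebesgue_measurable_cong_AE[OF borel_measurable_integrable[OF i] ae] ae in \<open>auto elim: eventually_mono\<close>)
  qed
  have "(LINT x:D|lebesgue. f' x * \<eta> x) = (LINT x:D|lebesgue. f x * \<eta> x)" if "test_function D \<eta>" for \<eta>
    unfolding set_lebesgue_integral_def
  proof (rule integral_cong_AE)
    show "AE x in lebesgue. indicator D x *\<^sub>R (f' x * \<eta> x) = indicator D x *\<^sub>R (f x * \<eta> x)"
      using eq by eventually_elim (auto simp: indicator_def)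
  qed (use locally_integrable_test[OF l that] locally_integrable_test[OF weak_partialD(1)[OF f] that] in
      \<open>simp_all add: set_integrable_def borel_measurable_integrable del: real_scaleR_def\<close>)
  with l f show ?thesis unfolding weak_partial_def by (simp add: test_function_partials)
qed

section \<open>A translation estimate on convex domains\<close>

definition dir_deriv :: "real \<times> real \<Rightarrow> (real \<times> real \<Rightarrow> real) \<Rightarrow> real \<times> real \<Rightarrow> real" where
  "dir_deriv z \<psi> x = fst z * partial1 \<psi> x + snd z * partial2 \<psi> x"

lemma test_function_dir_deriv: "test_function D \<psi> \<Longrightarrow> test_function D (dir_deriv z \<psi>)"
  unfolding dir_deriv_def[abs_def]
  by (intro test_function_add test_function_cmult test_function_partial1 test_function_partial2)

lemma has_field_derivative_line:
  assumes "smooth_plane \<psi>"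
  shows "((\<lambda>t. \<psi> (y - t *\<^sub>R z)) has_field_derivative - dir_deriv z \<psi> (y - t *\<^sub>R z)) (at t)"
proof -
  have "((\<lambda>t. y - t *\<^sub>R z) has_derivative (\<lambda>h. - (h *\<^sub>R z))) (at t)"
    by (auto intro!: derivative_eq_intros)
  from has_derivative_compose[OF this smooth_plane_has_grad[OF assms, unfolded has_grad_def]]
  show ?thesis unfolding has_field_derivative_def
    by (rule has_derivative_eq_rhs) (auto simp: dir_deriv_def algebra_simps)
qed

text \<open>The mean value inequality, applied first to the directional derivative and then to the
  remainder. The bound is uniform in the base point, so it survives integration against g; the
  constant C in place of C/2 is good enough for that.\<close>

lemma taylor_line:
  assumes sm: "smooth_plane \<psi>" "smooth_plane (dir_deriv z \<psi>)"
    and C: "\<And>x. \<bar>dir_deriv z (dir_deriv z \<psi>) x\<bar> \<le> C"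
  shows "\<bar>\<psi> (y - t *\<^sub>R z) - \<psi> y + t * dir_deriv z \<psi> y\<bar> \<le> C * t\<^sup>2"
proof -
  let ?S = "closed_segment 0 t"
  have seg: "\<bar>s\<bar> \<le> \<bar>t\<bar>" if "s \<in> ?S" for s
    using that by (auto simp: closed_segment_eq_real_ivl split: if_splits)
  have C0: "0 \<le> C" using C[of 0] by linarith
  have 1: "\<bar>dir_deriv z \<psi> (y - s *\<^sub>R z) - dir_deriv z \<psi> y\<bar> \<le> C * \<bar>s\<bar>" for s
  proof -
    have "norm (dir_deriv z \<psi> (y - s *\<^sub>R z) - dir_deriv z \<psi> (y - 0 *\<^sub>R z)) \<le> C * norm (s - 0)"
    proof (rule field_differentiable_bound[where S = UNIV])
      show "((\<lambda>t. dir_deriv z \<psi> (y - t *\<^sub>R z)) has_field_derivative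
          - dir_deriv z (dir_deriv z \<psi>) (y - t *\<^sub>R z)) (at t within UNIV)" for t
        by (rule has_field_derivative_line[OF sm(2)])
      show "norm (- dir_deriv z (dir_deriv z \<psi>) (y - t *\<^sub>R z)) \<le> C" for t
        using C by simp
    qed auto
    then show ?thesis by simp
  qed
  define h where "h s = \<psi> (y - s *\<^sub>R z) - \<psi> y + s * dir_deriv z \<psi> y" for s
  have "norm (h t - h 0) \<le> (C * \<bar>t\<bar>) * norm (t - 0)"
  proof (rule field_differentiable_bound[where S = ?S])
    fix s assume s: "s \<in> ?S"
    have "(h has_field_derivative - dir_deriv z \<psi> (y - s *\<^sub>R z) - 0 + 1 * dir_deriv z \<psi> y) (at s)"
      unfolding h_def[abs_def]
      by (intro DERIV_add DERIV_diff has_field_derivative_line[OF sm(1)] DERIV_const DERIV_cmult_right DERIV_ident)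
    then show "(h has_field_derivative - dir_deriv z \<psi> (y - s *\<^sub>R z) - 0 + 1 * dir_deriv z \<psi> y) (at s within ?S)"
      by (rule has_field_derivative_at_within)
    have "C * \<bar>s\<bar> \<le> C * \<bar>t\<bar>" using seg[OF s] C0 by (intro mult_left_mono) auto
    with 1[of s] show "norm (- dir_deriv z \<psi> (y - s *\<^sub>R z) - 0 + 1 * dir_deriv z \<psi> y) \<le> C * \<bar>t\<bar>"
      by (simp add: abs_minus_commute)
  qed auto
  then show ?thesis by (simp add: h_def power2_eq_square)
qed

lemma has_field_derivative_quadratic_remainder:
  fixes G :: "real \<Rightarrow> real"
  assumes "\<And>e. \<bar>G (t + e) - G t - e * A\<bar> \<le> K * e\<^sup>2"
  shows "(G has_field_derivative A) (at t)"
proof -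
  have "((\<lambda>e. (G (t + e) - G t) / e - A) \<longlongrightarrow> 0) (at 0)"
  proof (rule Lim_null_comparison)
    show "\<forall>\<^sub>F e in at 0. norm ((G (t + e) - G t) / e - A) \<le> K * \<bar>e\<bar>"
      unfolding eventually_at_filter
    proof (intro always_eventually allI impI)
      fix e :: real assume e: "e \<noteq> 0"
      have "\<bar>(G (t + e) - G t) / e - A\<bar> = \<bar>G (t + e) - G t - e * A\<bar> / \<bar>e\<bar>"
        using e by (simp add: abs_divide[symmetric] diff_divide_distrib)
      also have "\<dots> \<le> K * e\<^sup>2 / \<bar>e\<bar>" using assms[of e] by (intro divide_right_mono) auto
      also have "\<dots> = K * \<bar>e\<bar>" using e by (simp add: power2_eq_square abs_if)
      finally show "norm ((G (t + e) - G t) / e - A) \<le> K * \<bar>e\<bar>" by simp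
    qed
    have "((\<lambda>e. K * \<bar>e\<bar>) \<longlongrightarrow> K * \<bar>0\<bar>) (at (0::real))" by (intro tendsto_intros)
    then show "((\<lambda>e. K * \<bar>e\<bar>) \<longlongrightarrow> 0) (at (0::real))" by simp
  qed
  then have "((\<lambda>e. (G (t + e) - G t) / e) \<longlongrightarrow> A) (at 0)" by (simp add: LIM_zero_iff)
  then show ?thesis by (simp add: DERIV_def)
qed

text \<open>The domain of the difference g(x + z) - g(x). For convex D the whole segment from x to x
  + z lies in D, so a test function on this set can be moved along z without leaving D.\<close>

definition shift_dom :: "(real \<times> real) set \<Rightarrow> real \<times> real \<Rightarrow> (real \<times> real) set" where
  "shift_dom D z = {x \<in> D. x + z \<in> D}"

context
  fixes D :: "(real \<times> real) set" and g gx gy :: "real \<times> real \<Rightarrow> real"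
  assumes D: "open D" "convex D" "emeasure lebesgue D < \<infinity>"
    and gb: "g \<in> borel_measurable borel"
    and L: "L2_on D g" "L2_on D gx" "L2_on D gy"
    and wx: "weak_partial D 1 0 g gx" and wy: "weak_partial D 0 1 g gy"
begin

lemma sets_D': "D \<in> sets borel" "D \<in> sets lebesgue" using D(1) by auto

lemma open_shift_dom: "open (shift_dom D z)"
proof -
  have "shift_dom D z = D \<inter> (\<lambda>x. x + z) -` D" by (auto simp: shift_dom_def)
  moreover have "open ((\<lambda>x. x + z) -` D)"
    by (rule open_vimage[OF D(1)]) (auto intro!: continuous_intros)
  ultimately show ?thesis using D(1) by auto
qed

text \<open>The difference of g is moved onto the test function: let G(t) be the integral of g times
  the test function moved by t z. Its derivative pairs g with a directional derivative of a test
  function on D, hence is a pairing with the weak derivatives of g and bounded by Cauchy-Schwarz.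
  The mean value theorem on [0, 1] concludes.\<close>

lemma translation_estimate:
  assumes \<psi>: "test_function (shift_dom D z) \<psi>"
  shows "\<bar>LINT x|lborel. indicator (shift_dom D z) x * ((g (x + z) - g x) * \<psi> x)\<bar> \<le>
    (\<bar>fst z\<bar> * L2_norm D gx + \<bar>snd z\<bar> * L2_norm D gy) * L2_norm (shift_dom D z) \<psi>"
proof -
  let ?T = "shift_dom D z"
  let ?I = "integral\<^sup>L (lebesgue_on D)"
  obtain K where K: "compact K" "K \<subseteq> ?T" "\<And>x. x \<notin> K \<Longrightarrow> \<psi> x = 0" and sm: "smooth_plane \<psi>"
    using \<psi> unfolding test_function_def by blast
  define ps where "ps t x = \<psi> (x - t *\<^sub>R z)" for t x
  have \<psi>m: "\<psi> \<in> borel_measurable borel" by (rule test_function_measurable[OF \<psi>])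
  have T: "?T \<in> sets borel" using open_shift_dom by auto
  have shift_m: "(\<lambda>x. f (x - w)) \<in> borel_measurable borel" if "f \<in> borel_measurable borel" for f :: "real \<times> real \<Rightarrow> real" and w
    using that by (rule measurable_compose_rev) simp
  have inD: "k + t *\<^sub>R z \<in> D" if "k \<in> K" "0 \<le> t" "t \<le> 1" for k t
  proof -
    have "k \<in> D" "k + z \<in> D" using K(2) that(1) by (auto simp: shift_dom_def)
    then have "(1 - t) *\<^sub>R k + t *\<^sub>R (k + z) \<in> D" using D(2) that(2,3) by (intro convexD) auto
    then show ?thesis by (simp add: algebra_simps)
  qed
  have tst: "test_function D (ps t)" if "0 \<le> t" "t \<le> 1" for t
    unfolding test_function_def
  proof (intro conjI exI)
    show "smooth_plane (ps t)" unfolding ps_def by (rule smooth_plane_translate[OF sm])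
    show "compact ((\<lambda>k. k + t *\<^sub>R z) ` K)"
      using K(1) by (intro compact_continuous_image continuous_intros)
    show "(\<lambda>k. k + t *\<^sub>R z) ` K \<subseteq> D" using inD that by auto
    show "\<forall>x. x \<notin> (\<lambda>k. k + t *\<^sub>R z) ` K \<longrightarrow> ps t x = 0"
    proof (intro allI impI)
      fix x assume "x \<notin> (\<lambda>k. k + t *\<^sub>R z) ` K"
      then have "x - t *\<^sub>R z \<notin> K" by (metis diff_add_cancel image_eqI)
      then show "ps t x = 0" unfolding ps_def by (rule K(3))
    qed
  qed
  have nrm: "L2_norm D (ps t) = L2_norm ?T \<psi>" if t: "0 \<le> t" "t \<le> 1" for t
  proof -
    have m: "(\<lambda>x. (\<psi> x)\<^sup>2) \<in> borel_measurable borel" using \<psi>m by simp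
    have "(L2_norm D (ps t))\<^sup>2 = (LINT x|lborel. indicator D x * (ps t x)\<^sup>2)"
      unfolding L2_norm_sq_eq[OF sets_D'(2)]
      by (rule integral_lebesgue_on_borel[OF sets_D'(1)]) (use shift_m[OF m] in \<open>simp add: ps_def\<close>)
    also have "\<dots> = (LINT x|lborel. (ps t x)\<^sup>2)"
      by (intro Bochner_Integration.integral_cong)
        (use test_function_outside[OF tst[OF t]] in \<open>auto simp: indicator_def\<close>)
    also have "\<dots> = (LINT x|lborel. (\<psi> x)\<^sup>2)"
      unfolding ps_def using lborel_integral_translate(1)[OF m, of "- (t *\<^sub>R z)"] by simp
    also have "\<dots> = (LINT x|lborel. indicator ?T x * (\<psi> x)\<^sup>2)"
      by (intro Bochner_Integration.integral_cong)
        (use test_function_outside[OF \<psi>] in \<open>auto simp: indicator_def\<close>)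
    also have "\<dots> = (L2_norm ?T \<psi>)\<^sup>2"
      using T integral_lebesgue_on_borel[OF T m] by (subst L2_norm_sq_eq) auto
    finally show ?thesis using L2_norm_nonneg power2_eq_imp_eq by blast
  qed
  let ?e = "dir_deriv z \<psi>"
  have te: "test_function ?T ?e" "test_function ?T (dir_deriv z ?e)"
    using \<psi> by (auto intro: test_function_dir_deriv)
  then have sme: "smooth_plane ?e" by (simp add: test_function_def)
  obtain C where C: "\<And>x. \<bar>dir_deriv z ?e x\<bar> \<le> C" using test_function_bounded[OF te(2)] by blast
  have int: "integrable (lebesgue_on D) (\<lambda>x. g x * \<phi> (x - w))" if \<phi>: "test_function ?T \<phi>" for \<phi> w
  proof (rule L2_on_mult_integrable[OF sets_D'(2) L(1)])
    obtain M where "\<And>x. \<bar>\<phi> x\<bar> \<le> M" using test_function_bounded[OF \<phi>] by blast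
    then show "L2_on D (\<lambda>x. \<phi> (x - w))"
      using shift_m[OF test_function_measurable[OF \<phi>]]
      by (intro L2_on_bounded(1)[OF sets_D'(2) D(3), where M = M] borel_measurable_lebesgue_on) auto
  qed
  have gint: "integrable (lebesgue_on D) g" by (rule L2_on_integrable[OF sets_D'(2) D(3) L(1)])
  \<comment> \<open>G is defined for all real t. Its derivative exists everywhere, but the moved
    function is known to be a test function on D only for t in [0, 1], which is where the bound is
    needed.\<close>
  define G where "G t = ?I (\<lambda>x. g x * ps t x)" for t
  define G' where "G' t = ?I (\<lambda>x. g x * ?e (x - t *\<^sub>R z))" for t
  have dG: "(G has_field_derivative - G' t) (at t)" for t
  proof (rule has_field_derivative_quadratic_remainder)
    fix e
    define r where "r x = ps (t + e) x - ps t x + e * ?e (x - t *\<^sub>R z)" for x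
    have r: "\<bar>r x\<bar> \<le> C * e\<^sup>2" for x
      using taylor_line[OF sm sme C, of "x - t *\<^sub>R z" e]
      by (simp add: r_def ps_def algebra_simps)
    have i: "integrable (lebesgue_on D) (\<lambda>x. g x * ps (t + e) x)" "integrable (lebesgue_on D) (\<lambda>x. g x * ps t x)"
      "integrable (lebesgue_on D) (\<lambda>x. e * (g x * ?e (x - t *\<^sub>R z)))"
      unfolding ps_def using int[OF \<psi>] int[OF te(1)] by (auto intro: integrable_mult_right)
    have eq: "(\<lambda>x. g x * ps (t + e) x - g x * ps t x + e * (g x * ?e (x - t *\<^sub>R z))) = (\<lambda>x. g x * r x)"
      by (auto simp: r_def algebra_simps)
    have ir: "integrable (lebesgue_on D) (\<lambda>x. g x * r x)"
      unfolding eq[symmetric] by (intro Bochner_Integration.integrable_add Bochner_Integration.integrable_diff i)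
    have "G (t + e) - G t - e * - G' t = ?I (\<lambda>x. g x * ps (t + e) x - g x * ps t x + e * (g x * ?e (x - t *\<^sub>R z)))"
      unfolding G_def G'_def using i by simp
    also have "\<dots> = ?I (\<lambda>x. g x * r x)" by (simp only: eq)
    also have "\<bar>\<dots>\<bar> \<le> ?I (\<lambda>x. \<bar>g x * r x\<bar>)"
      using integral_abs_bound by blast
    also have "\<dots> \<le> ?I (\<lambda>x. (C * e\<^sup>2) * \<bar>g x\<bar>)"
    proof (rule integral_mono)
      show "\<bar>g x * r x\<bar> \<le> (C * e\<^sup>2) * \<bar>g x\<bar>" for x
        using mult_left_mono[OF r[of x], of "\<bar>g x\<bar>"] by (simp add: abs_mult mult.commute)
    qed (use ir gint in auto)
    also have "\<dots> = (C * ?I (\<lambda>x. \<bar>g x\<bar>)) * e\<^sup>2" using gint by simp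
    finally show "\<bar>G (t + e) - G t - e * - G' t\<bar> \<le> (C * ?I (\<lambda>x. \<bar>g x\<bar>)) * e\<^sup>2" .
  qed
  have G'_bound: "\<bar>G' t\<bar> \<le> (\<bar>fst z\<bar> * L2_norm D gx + \<bar>snd z\<bar> * L2_norm D gy) * L2_norm ?T \<psi>"
    if t: "0 \<le> t" "t \<le> 1" for t
  proof -
    note tt = tst[OF t]
    have p: "partial1 (ps t) x = partial1 \<psi> (x - t *\<^sub>R z)" "partial2 (ps t) x = partial2 \<psi> (x - t *\<^sub>R z)" for x
      using has_grad_partials[OF has_grad_translate[OF smooth_plane_has_grad[OF sm]]]
      unfolding ps_def by auto
    have Lps: "L2_on D (ps t)" by (rule test_function_L2[OF sets_D'(2) D(3) tt])
    have i: "integrable (lebesgue_on D) (\<lambda>x. g x * partial1 (ps t) x)" "integrable (lebesgue_on D) (\<lambda>x. g x * partial2 (ps t) x)"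
      using L2_on_mult_integrable[OF sets_D'(2) L(1) test_function_L2[OF sets_D'(2) D(3)]]
        test_function_partial1[OF tt] test_function_partial2[OF tt] by blast+
    have "(\<lambda>x. g x * ?e (x - t *\<^sub>R z)) = (\<lambda>x. fst z * (g x * partial1 (ps t) x) + snd z * (g x * partial2 (ps t) x))"
      by (auto simp: p dir_deriv_def algebra_simps)
    then have "G' t = fst z * ?I (\<lambda>x. g x * partial1 (ps t) x) + snd z * ?I (\<lambda>x. g x * partial2 (ps t) x)"
      unfolding G'_def using i by simp
    also have "?I (\<lambda>x. g x * partial1 (ps t) x) = - ?I (\<lambda>x. gx x * ps t x)"
      using weak_partialD(3)[OF wx tt] by (simp add: partials_def integral_on_eq[OF sets_D'(2)])
    also have "?I (\<lambda>x. g x * partial2 (ps t) x) = - ?I (\<lambda>x. gy x * ps t x)"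
      using weak_partialD(3)[OF wy tt] by (simp add: partials_def integral_on_eq[OF sets_D'(2)])
    finally have "\<bar>G' t\<bar> \<le> \<bar>fst z * - ?I (\<lambda>x. gx x * ps t x)\<bar> + \<bar>snd z * - ?I (\<lambda>x. gy x * ps t x)\<bar>"
      by simp
    also have "\<dots> \<le> \<bar>fst z\<bar> * (L2_norm D gx * L2_norm D (ps t)) + \<bar>snd z\<bar> * (L2_norm D gy * L2_norm D (ps t))"
      unfolding abs_mult abs_minus_cancel
      by (intro add_mono mult_left_mono L2_Cauchy_Schwarz[OF sets_D'(2)] L Lps) auto
    also have "\<dots> = (\<bar>fst z\<bar> * L2_norm D gx + \<bar>snd z\<bar> * L2_norm D gy) * L2_norm ?T \<psi>"
      by (simp add: nrm[OF t] algebra_simps)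
    finally show ?thesis .
  qed
  obtain t where t: "0 < t" "t < 1" "G 1 - G 0 = (1 - 0) * - G' t"
    using MVT2[of 0 1 G "\<lambda>t. - G' t"] dG by auto
  have gpm: "(\<lambda>x. g x * ps s x) \<in> borel_measurable borel" for s
    unfolding ps_def by (intro borel_measurable_times gb shift_m[OF \<psi>m])
  have Geq: "G s = (LINT x|lborel. g x * ps s x)" "integrable lborel (\<lambda>x. g x * ps s x)" if "0 \<le> s" "s \<le> 1" for s
  proof -
    have "(\<lambda>x. indicator D x * (g x * ps s x)) = (\<lambda>x. g x * ps s x)"
      using test_function_outside[OF tst[OF that]] by (auto simp: indicator_def fun_eq_iff)
    then show "G s = (LINT x|lborel. g x * ps s x)" "integrable lborel (\<lambda>x. g x * ps s x)"
      using integral_lebesgue_on_borel[OF sets_D'(1) gpm[of s]] int[OF \<psi>, of "s *\<^sub>R z"] unfolding G_def ps_def by simp_all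
  qed
  have gz: "(\<lambda>x. g (x + z) * \<psi> x) \<in> borel_measurable borel"
    using shift_m[OF gb, of "- z"] \<psi>m by simp
  \<comment> \<open>Substituting x + z for x moves the translation from the test function back to
    g.\<close>
  have G1: "G 1 = (LINT x|lborel. g (x + z) * \<psi> x)" "integrable lborel (\<lambda>x. g (x + z) * \<psi> x)"
    using lborel_integral_translate[OF gpm[of 1], of z] Geq[of 1] by (simp_all add: ps_def)
  have G0: "G 0 = (LINT x|lborel. g x * \<psi> x)" "integrable lborel (\<lambda>x. g x * \<psi> x)"
    using Geq[of 0] by (simp_all add: ps_def)
  have "(LINT x|lborel. indicator ?T x * ((g (x + z) - g x) * \<psi> x)) = (LINT x|lborel. g (x + z) * \<psi> x - g x * \<psi> x)"
    by (intro Bochner_Integration.integral_cong)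
      (use test_function_outside[OF \<psi>] in \<open>auto simp: indicator_def algebra_simps\<close>)
  also have "\<dots> = G 1 - G 0" using G1 G0 by simp
  also have "\<bar>\<dots>\<bar> = \<bar>G' t\<bar>" using t(3) by simp
  also have "\<dots> \<le> (\<bar>fst z\<bar> * L2_norm D gx + \<bar>snd z\<bar> * L2_norm D gy) * L2_norm ?T \<psi>"
    using t by (intro G'_bound) auto
  finally show ?thesis .
qed

text \<open>\<open>translation_estimate\<close> bounds the pairing with every test function on the
  open set \<open>shift_dom D z\<close>, so \<open>L2_norm_le_duality\<close> yields the
  norm.\<close>

lemma shift_L2:
  "L2_on (shift_dom D z) (\<lambda>x. g (x + z) - g x)"
  "L2_norm (shift_dom D z) (\<lambda>x. g (x + z) - g x) \<le> \<bar>fst z\<bar> * L2_norm D gx + \<bar>snd z\<bar> * L2_norm D gy"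
proof -
  let ?T = "shift_dom D z"
  have T: "?T \<in> sets borel" "?T \<in> sets lebesgue" using open_shift_dom by auto
  have TD: "?T \<subseteq> D" by (auto simp: shift_dom_def)
  have fin: "emeasure lebesgue ?T < \<infinity>"
    using emeasure_mono[OF TD sets_D'(2)] D(3) by (auto intro: le_less_trans)
  have gz: "(\<lambda>x. g (x + z)) \<in> borel_measurable borel"
    using gb by (rule measurable_compose_rev) simp
  have "integrable lborel (\<lambda>x. indicator D x * (g x)\<^sup>2)"
    using L(1) gb integral_lebesgue_on_borel(2)[OF sets_D'(1), of "\<lambda>x. (g x)\<^sup>2"] by (simp add: L2_on_iff[OF sets_D'(2)])
  then have i: "integrable lborel (\<lambda>x. indicator D (x + z) * (g (x + z))\<^sup>2)"
    using sets_D'(1) gb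
    by (subst lborel_integral_translate(2)[of "\<lambda>x. indicator D x * (g x)\<^sup>2"]) auto
  have "integrable lborel (\<lambda>x. indicator ?T x * (g (x + z))\<^sup>2)"
  proof (rule Bochner_Integration.integrable_bound[OF i])
    show "(\<lambda>x. indicator ?T x * (g (x + z))\<^sup>2) \<in> borel_measurable lborel"
      using T(1) gz by (simp add: borel_measurable_times borel_measurable_indicator borel_measurable_power)
  qed (auto simp: shift_dom_def indicator_def)
  then have "L2_on ?T (\<lambda>x. g (x + z))"
    using integral_lebesgue_on_borel(2)[OF T(1), of "\<lambda>x. (g (x + z))\<^sup>2"] gz
    by (auto simp: L2_on_iff[OF T(2)] intro: borel_measurable_lebesgue_on)
  moreover have "L2_on ?T g" by (rule L2_on_subset[OF L(1) TD T(2) sets_D'(2)])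
  ultimately show Lw: "L2_on ?T (\<lambda>x. g (x + z) - g x)" by (rule L2_on_diff[OF T(2)])
  show "L2_norm ?T (\<lambda>x. g (x + z) - g x) \<le> \<bar>fst z\<bar> * L2_norm D gx + \<bar>snd z\<bar> * L2_norm D gy"
  proof (rule L2_norm_le_duality[OF open_shift_dom fin Lw])
    show "0 \<le> \<bar>fst z\<bar> * L2_norm D gx + \<bar>snd z\<bar> * L2_norm D gy"
      by (intro add_nonneg_nonneg mult_nonneg_nonneg L2_norm_nonneg) auto
    fix \<psi> assume \<psi>: "test_function ?T \<psi>"
    have "(\<lambda>x. (g (x + z) - g x) * \<psi> x) \<in> borel_measurable borel"
      using gz gb test_function_measurable[OF \<psi>] by simp
    from integral_lebesgue_on_borel(1)[OF T(1) this] translation_estimate[OF \<psi>]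
    show "\<bar>integral\<^sup>L (lebesgue_on ?T) (\<lambda>x. (g (x + z) - g x) * \<psi> x)\<bar> \<le>
      (\<bar>fst z\<bar> * L2_norm D gx + \<bar>snd z\<bar> * L2_norm D gy) * L2_norm ?T \<psi>" by simp
  qed
qed

end

text \<open>
  Integrating \<open>(f y - f x)\<^sup>2\<close> over \<open>y \<in> B\<close> bounds \<open>b (f x)\<^sup>2\<close>, as \<open>f\<close> has mean zero over \<open>B\<close>. The integral
  over \<open>x\<close> and the shift \<open>z = y - x\<close> is then estimated with \<open>\<parallel>f(\<cdot> + z) - f\<parallel>\<close> being of order \<open>l\<close>; shifts
  outside a square of side \<open>2 l\<close> do not contribute.
\<close>

lemma convex_poincare:
  assumes D: "open D" "convex D" "D \<subseteq> cbox a (a + (l, l))"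
    and L: "L2_on D g" "L2_on D gx" "L2_on D gy"
    and wx: "weak_partial D 1 0 g gx" and wy: "weak_partial D 0 1 g gy"
    and B: "B \<in> sets borel" "B \<subseteq> D" "0 < measure lebesgue B" "(LINT x:B|lebesgue. g x) = 0"
  shows "measure lebesgue B * (L2_norm D g)\<^sup>2 \<le> 4 * l ^ 4 * (L2_norm D gx + L2_norm D gy)\<^sup>2"
proof -
  have sD: "D \<in> sets borel" "D \<in> sets lebesgue" using D(1) by auto
  have sB: "B \<in> sets lebesgue" using B(1) by auto
  have "emeasure lebesgue D \<le> emeasure lebesgue (cbox a (a + (l, l)))"
    using D(3) by (intro emeasure_mono) auto
  also have "\<dots> < \<infinity>" by (simp add: emeasure_lborel_cbox_eq)
  finally have fin: "emeasure lebesgue D < \<infinity>" .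
  have finB: "emeasure lebesgue B < \<infinity>"
    using emeasure_mono[OF B(2) sD(2)] fin by (auto intro: le_less_trans)
  define S where "S = L2_norm D gx + L2_norm D gy"
  have S: "0 \<le> S" by (simp add: S_def L2_norm_nonneg)
  have "D \<noteq> {}" using B by auto
  then obtain d where d: "d \<in> D" by blast
  then have l: "0 \<le> l" using D(3) by (force simp: mem_box_plane)
  have "(\<lambda>x. indicator D x *\<^sub>R g x) \<in> borel_measurable lebesgue"
    using L(1) by (simp add: L2_on_def set_borel_measurable_def)
  then obtain f where f: "f \<in> borel_measurable borel" "AE x in lborel. indicator D x *\<^sub>R g x = f x"
    by (rule lebesgue_borel_representative)
  have ae: "AE x in lebesgue. x \<in> D \<longrightarrow> g x = f x"
    using AE_lebesgue_borel[OF f(2)] by eventually_elim auto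
  note fL = L2_on_cong_AE[OF sD(2) L(1) ae]
  have w': "weak_partial D 1 0 f gx" "weak_partial D 0 1 f gy"
    using weak_partial_cong_AE[OF wx ae] weak_partial_cong_AE[OF wy ae] by blast+
  note shift = shift_L2[OF D(1,2) fin f(1) fL(1) L(2,3) w']
  have oT: "open (shift_dom D z)" for z
    by (rule open_shift_dom[OF D(1,2) fin f(1) fL(1) L(2,3) w'])
  note [measurable] = sD(1) B(1) f(1)
  define b where "b = measure lebesgue B"
  have LB: "L2_on B f" by (rule L2_on_subset[OF fL(1) B(2) sB sD(2)])
  have "integrable (lebesgue_on B) (\<lambda>x. (f x)\<^sup>2)" using LB by (simp add: L2_on_iff[OF sB])
  with L2_on_integrable[OF sB finB LB]
  have fB: "integrable (lebesgue_on B) f" "integrable (lebesgue_on B) (\<lambda>x. (f x)\<^sup>2)" by blast+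
  have "(LINT x|lebesgue_on B. f x) = (LINT x|lebesgue_on B. g x)"
  proof (rule integral_cong_AE)
    show "g \<in> borel_measurable (lebesgue_on B)"
      using L2_on_subset[OF L(1) B(2) sB sD(2)] by (simp add: L2_on_iff[OF sB])
    show "f \<in> borel_measurable (lebesgue_on B)" using fB(1) by auto
    show "AE x in lebesgue_on B. f x = g x"
      by (rule AE_lebesgue_on[OF sB]) (use ae B(2) in \<open>auto elim: eventually_mono\<close>)
  qed
  then have mean: "(LINT x|lebesgue_on B. f x) = 0" using B(4) by (simp add: integral_on_eq[OF sB])
  have lower: "ennreal (b * (f x)\<^sup>2) \<le> (\<integral>\<^sup>+y. indicator B y * ennreal ((f y - f x)\<^sup>2) \<partial>lborel)" for x
  proof -
    have c: "integrable (lebesgue_on B) (\<lambda>y. (f x)\<^sup>2)"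
      using finB sB by (intro finite_measure.integrable_const finite_measureI) (simp add: emeasure_restrict_space)
    have i: "integrable (lebesgue_on B) (\<lambda>y. (f y)\<^sup>2 - (2 * f x) * f y + (f x)\<^sup>2)"
      by (intro Bochner_Integration.integrable_add Bochner_Integration.integrable_diff fB integrable_mult_right c)
    have eq: "(\<lambda>y. (f y - f x)\<^sup>2) = (\<lambda>y. (f y)\<^sup>2 - (2 * f x) * f y + (f x)\<^sup>2)"
      by (auto simp: power2_eq_square algebra_simps)
    have "(LINT y|lebesgue_on B. (f y - f x)\<^sup>2) =
        (LINT y|lebesgue_on B. (f y)\<^sup>2) - (2 * f x) * (LINT y|lebesgue_on B. f y) + (LINT y|lebesgue_on B. (f x)\<^sup>2)"
      unfolding eq using fB c by simp
    also have "(LINT y|lebesgue_on B. (f x)\<^sup>2) = b * (f x)\<^sup>2"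
      using sB by (simp add: measure_restrict_space b_def)
    finally have "b * (f x)\<^sup>2 \<le> (LINT y|lebesgue_on B. (f y - f x)\<^sup>2)"
      using Bochner_Integration.integral_nonneg[of "lebesgue_on B" "\<lambda>y. (f y)\<^sup>2"] by (simp add: mean)
    also have "\<dots> = (LINT y|lborel. indicator B y * (f y - f x)\<^sup>2)"
      by (rule integral_lebesgue_on_borel[OF B(1)]) simp
    finally have "ennreal (b * (f x)\<^sup>2) \<le> ennreal (LINT y|lborel. indicator B y * (f y - f x)\<^sup>2)"
      by (rule ennreal_leI)
    also have "\<dots> = (\<integral>\<^sup>+y. ennreal (indicator B y * (f y - f x)\<^sup>2) \<partial>lborel)"
      using i integral_lebesgue_on_borel(2)[OF B(1), of "\<lambda>y. (f y - f x)\<^sup>2"]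
      by (intro nn_integral_eq_integral[symmetric]) (auto simp: eq)
    also have "\<dots> = (\<integral>\<^sup>+y. indicator B y * ennreal ((f y - f x)\<^sup>2) \<partial>lborel)"
      by (intro nn_integral_cong) (auto simp: indicator_def)
    finally show ?thesis .
  qed
  \<comment> \<open>The double integral is taken in \<open>ennreal\<close>, so that the order of
    integration can be exchanged without proving integrability first.\<close>
  define h :: "real \<times> real \<Rightarrow> real \<times> real \<Rightarrow> ennreal" where
    "h x z = indicator D x * (indicator D (x + z) * ennreal ((f (x + z) - f x)\<^sup>2))" for x z
  have hm: "case_prod h \<in> borel_measurable (lborel \<Otimes>\<^sub>M lborel)"
    unfolding h_def by measurable
  have sq: "(\<integral>\<^sup>+x. indicator E x * ennreal ((u x)\<^sup>2) \<partial>lborel) = ennreal ((L2_norm E u)\<^sup>2)"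
    if E: "E \<in> sets borel" and u: "u \<in> borel_measurable borel" and Lu: "L2_on E u" for E and u :: "real \<times> real \<Rightarrow> real"
  proof -
    have sE: "E \<in> sets lebesgue" using E by auto
    have m: "(\<lambda>x. (u x)\<^sup>2) \<in> borel_measurable borel" using u by simp
    have "(\<integral>\<^sup>+x. indicator E x * ennreal ((u x)\<^sup>2) \<partial>lborel) = (\<integral>\<^sup>+x. ennreal (indicator E x * (u x)\<^sup>2) \<partial>lborel)"
      by (intro nn_integral_cong) (auto simp: indicator_def)
    also have "\<dots> = ennreal (LINT x|lborel. indicator E x * (u x)\<^sup>2)"
      using Lu integral_lebesgue_on_borel(2)[OF E m] by (intro nn_integral_eq_integral) (auto simp: L2_on_iff[OF sE])
    also have "\<dots> = ennreal ((L2_norm E u)\<^sup>2)"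
      using integral_lebesgue_on_borel(1)[OF E m] by (simp add: L2_norm_sq_eq[OF sE])
    finally show ?thesis .
  qed
  have "ennreal (b * (L2_norm D f)\<^sup>2) = ennreal b * (\<integral>\<^sup>+x. indicator D x * ennreal ((f x)\<^sup>2) \<partial>lborel)"
    unfolding sq[OF sD(1) f(1) fL(1)] by (simp add: ennreal_mult b_def)
  also have "\<dots> = (\<integral>\<^sup>+x. ennreal b * (indicator D x * ennreal ((f x)\<^sup>2)) \<partial>lborel)"
    by (intro nn_integral_cmult[symmetric]) simp
  also have "\<dots> = (\<integral>\<^sup>+x. indicator D x * ennreal (b * (f x)\<^sup>2) \<partial>lborel)"
    by (intro nn_integral_cong) (auto simp: indicator_def ennreal_mult b_def)
  also have "\<dots> \<le> (\<integral>\<^sup>+x. indicator D x * (\<integral>\<^sup>+y. indicator D y * ennreal ((f y - f x)\<^sup>2) \<partial>lborel) \<partial>lborel)"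
  proof (intro nn_integral_mono mult_left_mono)
    fix x
    show "ennreal (b * (f x)\<^sup>2) \<le> (\<integral>\<^sup>+y. indicator D y * ennreal ((f y - f x)\<^sup>2) \<partial>lborel)"
      by (rule order_trans[OF lower]) (use B(2) in \<open>auto intro!: nn_integral_mono mult_right_mono simp: indicator_def\<close>)
  qed simp
  also have "\<dots> = (\<integral>\<^sup>+x. indicator D x * (\<integral>\<^sup>+z. indicator D (x + z) * ennreal ((f (x + z) - f x)\<^sup>2) \<partial>lborel) \<partial>lborel)"
    by (intro nn_integral_cong arg_cong2[where f = "(*)"] refl
        nn_integral_lborel_translate[of "\<lambda>y. indicator D y * ennreal ((f y - f _)\<^sup>2)", symmetric]) simp
  also have "\<dots> = (\<integral>\<^sup>+x. \<integral>\<^sup>+z. h x z \<partial>lborel \<partial>lborel)"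
    unfolding h_def by (intro nn_integral_cong nn_integral_cmult[symmetric]) simp
  also have "\<dots> = (\<integral>\<^sup>+z. \<integral>\<^sup>+x. h x z \<partial>lborel \<partial>lborel)"
    by (rule lborel_pair.Fubini'[OF hm, symmetric])
  also have "\<dots> \<le> (\<integral>\<^sup>+z. ennreal ((l * S)\<^sup>2) * indicator (cbox (- (l, l)) (l, l)) z \<partial>lborel)"
  proof (intro nn_integral_mono)
    fix z :: "real \<times> real"
    have h_eq: "h x z = indicator (shift_dom D z) x * ennreal ((f (x + z) - f x)\<^sup>2)" for x
      by (auto simp: h_def indicator_def shift_dom_def)
    show "(\<integral>\<^sup>+x. h x z \<partial>lborel) \<le> ennreal ((l * S)\<^sup>2) * indicator (cbox (- (l, l)) (l, l)) z"
    proof (cases "z \<in> cbox (- (l, l)) (l, l)")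
      case True
      then have z: "\<bar>fst z\<bar> \<le> l" "\<bar>snd z\<bar> \<le> l" by (auto simp: mem_box_plane)
      have "(\<integral>\<^sup>+x. h x z \<partial>lborel) = ennreal ((L2_norm (shift_dom D z) (\<lambda>x. f (x + z) - f x))\<^sup>2)"
        unfolding h_eq using oT[of z] by (intro sq shift(1)) auto
      also have "\<dots> \<le> ennreal ((l * S)\<^sup>2)"
      proof (intro ennreal_leI power_mono order_trans[OF shift(2)] L2_norm_nonneg)
        show "\<bar>fst z\<bar> * L2_norm D gx + \<bar>snd z\<bar> * L2_norm D gy \<le> l * S"
          unfolding S_def distrib_left using z by (intro add_mono mult_right_mono L2_norm_nonneg)
      qed
      finally show ?thesis using True by simp
    next
      case False
      have "x \<notin> shift_dom D z" for x
      proof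
        assume "x \<in> shift_dom D z"
        then have "x \<in> cbox a (a + (l, l))" "x + z \<in> cbox a (a + (l, l))"
          using D(3) by (auto simp: shift_dom_def)
        with False show False by (auto simp: mem_box_plane)
      qed
      then show ?thesis by (simp add: h_eq)
    qed
  qed
  also have "\<dots> = ennreal ((l * S)\<^sup>2) * emeasure lborel (cbox (- (l, l)) (l, l))"
    by (rule nn_integral_cmult_indicator) simp
  also have "cbox (- (l, l)) (l, l) = {-l..l} \<times> {-l..l}"
    by (simp add: cbox_Pair_eq)
  also have "emeasure lborel ({-l..l} \<times> {-l..l}) = ennreal (2 * l) * ennreal (2 * l)"
    using lborel.emeasure_pair_measure_Times[of "{-l..l}" lborel "{-l..l}"] l by (simp add: lborel_prod)
  \<comment> \<open>One factor l^2 comes from the squared translation estimate, the factor 4 l^2 is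
    the area of the square of admissible shifts.\<close>
  also have "ennreal ((l * S)\<^sup>2) * (ennreal (2 * l) * ennreal (2 * l)) = ennreal (4 * l ^ 4 * S\<^sup>2)"
    using l S by (simp add: ennreal_mult[symmetric] power2_eq_square power4_eq_xxxx algebra_simps)
  finally have "b * (L2_norm D f)\<^sup>2 \<le> 4 * l ^ 4 * S\<^sup>2"
    using l S by (subst (asm) ennreal_le_iff) auto
  then show ?thesis using fL(2) by (simp add: b_def S_def)
qed

section \<open>Polynomial approximation\<close>

text \<open>The partial derivative of order (i, j) of the monomial with exponents (a, b), written
  with formal derivatives so that all orders are available without differentiability
  conditions.\<close>

definition mono_deriv :: "nat \<Rightarrow> nat \<Rightarrow> nat \<Rightarrow> nat \<Rightarrow> real \<times> real \<Rightarrow> real" where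
  "mono_deriv a b i j z =
     poly ((pderiv ^^ i) (monom 1 a)) (fst z) * poly ((pderiv ^^ j) (monom 1 b)) (snd z)"

lemma has_grad_mono_deriv:
  "has_grad (mono_deriv a b i j) (mono_deriv a b (Suc i) j z) (mono_deriv a b i (Suc j) z) z"
proof -
  have "has_grad (\<lambda>z. poly ((pderiv ^^ i) (monom 1 a)) (fst z)) (poly (pderiv ((pderiv ^^ i) (monom 1 a))) (fst z) * 1)
      (poly (pderiv ((pderiv ^^ i) (monom 1 a))) (fst z) * 0) z"
    by (rule has_grad_compose[OF poly_DERIV has_grad_fst])
  moreover have "has_grad (\<lambda>z. poly ((pderiv ^^ j) (monom 1 b)) (snd z)) (poly (pderiv ((pderiv ^^ j) (monom 1 b))) (snd z) * 0)
      (poly (pderiv ((pderiv ^^ j) (monom 1 b))) (snd z) * 1) z"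
    by (rule has_grad_compose[OF poly_DERIV has_grad_snd])
  ultimately have "has_grad (mono_deriv a b i j)
     ((poly (pderiv ((pderiv ^^ i) (monom 1 a))) (fst z) * 1) * poly ((pderiv ^^ j) (monom 1 b)) (snd z) +
        poly ((pderiv ^^ i) (monom 1 a)) (fst z) * (poly (pderiv ((pderiv ^^ j) (monom 1 b))) (snd z) * 0))
     ((poly (pderiv ((pderiv ^^ i) (monom 1 a))) (fst z) * 0) * poly ((pderiv ^^ j) (monom 1 b)) (snd z) +
        poly ((pderiv ^^ i) (monom 1 a)) (fst z) * (poly (pderiv ((pderiv ^^ j) (monom 1 b))) (snd z) * 1)) z"
    unfolding mono_deriv_def[abs_def] by (rule has_grad_mult)
  then show ?thesis by (simp add: mono_deriv_def)
qed

lemma pderiv_funpow_monom: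
  "i > a \<Longrightarrow> (pderiv ^^ i) (monom (c::real) a) = 0"
  "(pderiv ^^ a) (monom (c::real) a) = [:c * fact a:]"
proof -
  show "(pderiv ^^ a) (monom (c::real) a) = [:c * fact a:]" for a c
  proof (induction a arbitrary: c)
    case 0
    then show ?case by (simp add: monom_0)
  next
    case (Suc a)
    then show ?case by (simp add: funpow_Suc_right pderiv_monom algebra_simps del: funpow.simps)
  qed
  note top = this
  assume "i > a"
  then obtain k where k: "i = Suc k + a" by (metis add.commute less_imp_Suc_add add_Suc_right)
  have "(pderiv ^^ i) (monom c a) = (pderiv ^^ Suc k) [:c * fact a:]"
    unfolding k funpow_add o_def top ..
  also have "\<dots> = 0" by (induction k) (auto simp: pderiv_pCons)
  finally show "(pderiv ^^ i) (monom (c::real) a) = 0" .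
qed

lemma mono_deriv_0: "mono_deriv a b 0 0 z = fst z ^ a * snd z ^ b"
  by (simp add: mono_deriv_def poly_monom)

text \<open>On monomials of degree at most i + j the derivative of order (i, j) is diagonal. This
  makes the system for the moments in \<open>poly_moments\<close> triangular.\<close>

lemma mono_deriv_high:
  assumes "a + b \<le> i + j"
  shows "mono_deriv a b i j z = (if (i, j) = (a, b) then fact a * fact b else 0)"
proof -
  consider "i > a" | "j > b" | "(i, j) = (a, b)" using assms by force
  then show ?thesis
    by cases (auto simp: mono_deriv_def pderiv_funpow_monom)
qed

definition poly_deriv :: "nat \<Rightarrow> (nat \<times> nat \<Rightarrow> real) \<Rightarrow> nat \<Rightarrow> nat \<Rightarrow> real \<times> real \<Rightarrow> real" where
  "poly_deriv p c i j z = (\<Sum>(a, b)\<in>{(a, b). a + b \<le> p}. c (a, b) * mono_deriv a b i j z)"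

lemma finite_degree_le: "finite {(a, b). a + b \<le> (p::nat)}"
  by (rule finite_subset[of _ "{..p} \<times> {..p}"]) auto

lemma has_grad_sum:
  assumes "\<And>i. i \<in> I \<Longrightarrow> has_grad (f i) (fx i) (fy i) z"
  shows "has_grad (\<lambda>x. \<Sum>i\<in>I. f i x) (\<Sum>i\<in>I. fx i) (\<Sum>i\<in>I. fy i) z"
  using assms
  by (induction I rule: infinite_finite_induct) (auto intro: has_grad_const has_grad_add)

lemma has_grad_cmult: "has_grad f p q z \<Longrightarrow> has_grad (\<lambda>x. c * f x) (c * p) (c * q) z"
  using has_grad_mult[OF has_grad_const[of c], of f p q z] by simp

lemma has_grad_poly_deriv:
  "has_grad (poly_deriv p c i j) (poly_deriv p c (Suc i) j z) (poly_deriv p c i (Suc j) z) z"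
  unfolding poly_deriv_def[abs_def] case_prod_unfold
  by (intro has_grad_sum has_grad_cmult has_grad_mono_deriv)

lemma poly_deriv_top: "p < i + j \<Longrightarrow> poly_deriv p c i j z = 0"
  unfolding poly_deriv_def by (intro sum.neutral) (auto simp: mono_deriv_high)

lemma poly_deriv_add: "poly_deriv p (\<lambda>x. c x + d x) i j z = poly_deriv p c i j z + poly_deriv p d i j z"
  by (simp add: poly_deriv_def case_prod_unfold algebra_simps sum.distrib)

lemma poly_deriv_homogeneous:
  assumes d: "d \<le> p" "d \<le> i + j" and c: "\<And>a b. a + b \<noteq> d \<Longrightarrow> c (a, b) = 0"
  shows "poly_deriv p c i j z = (if i + j = d then c (i, j) * fact i * fact j else 0)"
proof -
  have "poly_deriv p c i j z = (\<Sum>x\<in>{(a, b). a + b \<le> p}. if x = (i, j) then c (i, j) * fact i * fact j else 0)"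
    unfolding poly_deriv_def
  proof (rule sum.cong[OF refl])
    fix x :: "nat \<times> nat"
    obtain a b where x: "x = (a, b)" by (cases x)
    show "(case x of (a, b) \<Rightarrow> c (a, b) * mono_deriv a b i j z) =
      (if x = (i, j) then c (i, j) * fact i * fact j else 0)"
    proof (cases "a + b = d")
      case True
      then show ?thesis using mono_deriv_high[of a b i j z] d(2) by (auto simp: x)
    next
      case False
      then show ?thesis using c[OF False] by (auto simp: x)
    qed
  qed
  also have "\<dots> = (if i + j \<le> p then c (i, j) * fact i * fact j else 0)"
    by (subst sum.delta[OF finite_degree_le]) auto
  also have "\<dots> = (if i + j = d then c (i, j) * fact i * fact j else 0)"
    using c[of i j] d by auto
  finally show ?thesis .
qed

lemma poly_deriv_continuous: "continuous_on S (poly_deriv p c i j)"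
  using has_grad_continuous[OF has_grad_poly_deriv] by (auto intro: continuous_at_imp_continuous_on)

lemma continuous_L2_on:
  assumes D: "D \<in> sets lebesgue" "D \<subseteq> cbox a b" and f: "continuous_on UNIV f"
  shows "L2_on D (f :: real \<times> real \<Rightarrow> real)"
proof -
  have "emeasure lebesgue D \<le> emeasure lebesgue (cbox a b)"
    using D(2) by (intro emeasure_mono) auto
  also have "\<dots> < \<infinity>" by (simp add: emeasure_lborel_cbox_eq)
  finally have fin: "emeasure lebesgue D < \<infinity>" .
  have "compact (f ` cbox a b)"
    by (intro compact_continuous_image continuous_on_subset[OF f]) auto
  then obtain M where M: "\<forall>y\<in>f ` cbox a b. norm y \<le> M"
    using compact_imp_bounded[of "f ` cbox a b"] unfolding bounded_iff by blast
  show ?thesis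
    by (rule L2_on_bounded(1)[OF D(1) fin, where M = M])
      (use M D(2) borel_measurable_continuous_onI[OF f] in \<open>auto intro: borel_measurable_lebesgue_on\<close>)
qed

text \<open>Descending induction on the order: after N steps all moments of order greater than p - N
  are right. Adding a homogeneous part of degree d = p - N leaves the derivatives of order greater
  than d unchanged and changes those of order d by constants, which are free.\<close>

lemma poly_moments:
  assumes B: "B \<in> sets lebesgue" "B \<subseteq> cbox u v" "0 < measure lebesgue B"
  shows "\<exists>c. \<forall>i j. i + j \<le> p \<longrightarrow> integral\<^sup>L (lebesgue_on B) (poly_deriv p c i j) = M i j"
proof -
  let ?I = "integral\<^sup>L (lebesgue_on B)"
  define m where "m = measure lebesgue B"
  have fin: "emeasure lebesgue B < \<infinity>"
    using emeasure_mono[OF B(2), of lebesgue] by (auto simp: emeasure_lborel_cbox_eq intro: le_less_trans)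
  have int: "integrable (lebesgue_on B) (poly_deriv p c i j)" for c i j
    by (rule L2_on_integrable[OF B(1) fin continuous_L2_on[OF B(1,2) poly_deriv_continuous]])
  have "\<exists>c. \<forall>i j. i + j \<le> p \<and> p + 1 \<le> i + j + N \<longrightarrow> ?I (poly_deriv p c i j) = M i j" if "N \<le> p + 1" for N
    using that
  proof (induction N)
    case (Suc N)
    then obtain c where c: "\<And>i j. i + j \<le> p \<Longrightarrow> p + 1 \<le> i + j + N \<Longrightarrow> ?I (poly_deriv p c i j) = M i j"
      by auto
    define d where "d = p - N"
    have d: "d \<le> p" "p + 1 = d + Suc N" using Suc.prems by (auto simp: d_def)
    \<comment> \<open>The coefficient is the missing part of the moment, divided by a! b! from
      differentiating the monomial and by the measure of B from integrating the constant.\<close>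
    define e where "e = (\<lambda>(a, b). if a + b = d then (M a b - ?I (poly_deriv p c a b)) / (m * fact a * fact b) else 0)"
    have "?I (poly_deriv p (\<lambda>x. c x + e x) i j) = M i j" if ij: "i + j \<le> p" "p + 1 \<le> i + j + Suc N" for i j
    proof -
      have di: "d \<le> i + j" using ij d by linarith
      have pe: "poly_deriv p e i j = (\<lambda>z. if i + j = d then e (i, j) * fact i * fact j else 0)"
        by (rule ext, rule poly_deriv_homogeneous[OF d(1) di]) (simp add: e_def)
      have "?I (poly_deriv p (\<lambda>x. c x + e x) i j) = ?I (poly_deriv p c i j) + ?I (poly_deriv p e i j)"
        unfolding poly_deriv_add[abs_def] using int by simp
      also have "?I (poly_deriv p e i j) = m * (if i + j = d then e (i, j) * fact i * fact j else 0)"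
        unfolding pe using B(1) by (simp add: measure_restrict_space m_def)
      also have "?I (poly_deriv p c i j) + \<dots> = M i j"
      proof (cases "i + j = d")
        case True
        have "m \<noteq> 0" using B(3) by (simp add: m_def)
        then show ?thesis using True by (simp add: e_def)
      next
        case False
        then have "p + 1 \<le> i + j + N" using di d by linarith
        then show ?thesis using c[OF ij(1)] False by simp
      qed
      finally show ?thesis .
    qed
    then show ?case by blast
  qed simp
  from this[of "p + 1"] show ?thesis by simp
qed

text \<open>Here the first-order derivative is taken of f, as in the recursion of
  \<open>scaled_smooth\<close>, while \<open>weak_partial_trans1\<close> takes it last. No
  reordering arises because \<open>partials\<close> applies \<open>partial1\<close> outermost; the
  analogue for the second variable is for the same reason restricted to i = 0.\<close>

lemma weak_partial_prepend1:
  assumes f: "weak_partial D 1 0 f g" and g: "weak_partial D i j g g'"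
  shows "weak_partial D (Suc i) j f g'"
  unfolding weak_partial_def
proof (intro conjI allI impI)
  fix \<psi> assume \<psi>: "test_function D \<psi>"
  show "(LINT x:D|lebesgue. f x * partials (Suc i) j \<psi> x) =
      (- 1) ^ (Suc i + j) * (LINT x:D|lebesgue. g' x * \<psi> x)"
    using weak_partialD(3)[OF f test_function_partials[OF \<psi>, of i j]] weak_partialD(3)[OF g \<psi>]
    by (simp add: partials_def)
qed (use weak_partialD[OF f] weak_partialD[OF g] in auto)

lemma weak_partial_prepend2:
  assumes f: "weak_partial D 0 1 f g" and g: "weak_partial D 0 j g g'"
  shows "weak_partial D 0 (Suc j) f g'"
  unfolding weak_partial_def
proof (intro conjI allI impI)
  fix \<psi> assume \<psi>: "test_function D \<psi>"
  show "(LINT x:D|lebesgue. f x * partials 0 (Suc j) \<psi> x) =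
      (- 1) ^ (0 + Suc j) * (LINT x:D|lebesgue. g' x * \<psi> x)"
    using weak_partialD(3)[OF f test_function_partials[OF \<psi>, of 0 j]] weak_partialD(3)[OF g \<psi>]
    by (simp add: partials_def)
qed (use weak_partialD[OF f] weak_partialD[OF g] in auto)

lemma weak_partial_poly_deriv:
  assumes D: "open D" shows "weak_partial D i j (poly_deriv p c 0 0) (poly_deriv p c i j)"
proof -
  note cl = weak_partial_classical[OF D has_grad_poly_deriv poly_deriv_continuous poly_deriv_continuous]
  have "weak_partial D 0 j (poly_deriv p c 0 0) (poly_deriv p c 0 j)"
  proof (induction j)
    case 0
    show ?case by (intro weak_partial_0 locally_integrable_continuous poly_deriv_continuous)
  next
    case (Suc j)
    from weak_partial_trans2[OF this cl(2)] show ?case .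
  qed
  then show ?thesis
    by (induction i) (auto intro: weak_partial_trans1[OF _ cl(1)])
qed

text \<open>The squared Sobolev seminorm once \<open>G i j\<close> are the weak derivatives of one
  function. Working with an explicit family avoids the choice operator until
  \<open>sobolev_seminorm_energy\<close>.\<close>

definition deriv_energy :: "(real \<times> real) set \<Rightarrow> (nat \<Rightarrow> nat \<Rightarrow> real \<times> real \<Rightarrow> real) \<Rightarrow> nat \<Rightarrow> real" where
  "deriv_energy D G q = (\<Sum>i\<le>q. (L2_norm D (G i (q - i)))\<^sup>2)"

lemma deriv_energy_nonneg: "0 \<le> deriv_energy D G q"
  unfolding deriv_energy_def by (intro sum_nonneg) auto

text \<open>The Poincare inequality summed over all derivatives of order q. The constant 16 is 4
  from the inequality, 2 from (x + y)^2 \<le> 2 (x^2 + y^2), and 2 because each derivative of order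
  q + 1 arises from at most two of order q.\<close>

lemma deriv_energy_step:
  assumes T: "open T" "convex T" "T \<subseteq> cbox a (a + (l, l))"
    and L: "\<And>i j. i + j \<le> Suc q \<Longrightarrow> L2_on T (G i j)"
    and w: "\<And>i j. i + j = q \<Longrightarrow> weak_partial T 1 0 (G i j) (G (Suc i) j)"
      "\<And>i j. i + j = q \<Longrightarrow> weak_partial T 0 1 (G i j) (G i (Suc j))"
    and B: "B \<in> sets borel" "B \<subseteq> T" "0 < measure lebesgue B"
    and m: "\<And>i j. i + j = q \<Longrightarrow> (LINT x:B|lebesgue. G i j x) = 0"
  shows "measure lebesgue B * deriv_energy T G q \<le> 16 * l ^ 4 * deriv_energy T G (Suc q)"
proof -
  let ?N = "\<lambda>i j. (L2_norm T (G i j))\<^sup>2"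
  have step: "measure lebesgue B * ?N i j \<le> 8 * l ^ 4 * (?N (Suc i) j + ?N i (Suc j))" if ij: "i + j = q" for i j
  proof -
    have "measure lebesgue B * ?N i j \<le> 4 * l ^ 4 * (L2_norm T (G (Suc i) j) + L2_norm T (G i (Suc j)))\<^sup>2"
      using ij by (intro convex_poincare[OF T _ _ _ w[OF ij] B m[OF ij]] L) auto
    also have "\<dots> \<le> 4 * l ^ 4 * (2 * (?N (Suc i) j + ?N i (Suc j)))"
    proof (intro mult_left_mono)
      have "(x + y)\<^sup>2 \<le> 2 * (x\<^sup>2 + y\<^sup>2)" for x y :: real
        using zero_le_power2[of "x - y"] by (simp add: power2_sum power2_diff)
      then show "(L2_norm T (G (Suc i) j) + L2_norm T (G i (Suc j)))\<^sup>2 \<le> 2 * (?N (Suc i) j + ?N i (Suc j))" .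
    qed simp
    finally show ?thesis by (simp add: algebra_simps)
  qed
  have "measure lebesgue B * deriv_energy T G q = (\<Sum>i\<le>q. measure lebesgue B * ?N i (q - i))"
    by (simp add: deriv_energy_def sum_distrib_left)
  also have "\<dots> \<le> (\<Sum>i\<le>q. 8 * l ^ 4 * (?N (Suc i) (q - i) + ?N i (Suc (q - i))))"
    by (intro sum_mono step) auto
  also have "\<dots> = 8 * l ^ 4 * ((\<Sum>i\<le>q. ?N (Suc i) (q - i)) + (\<Sum>i\<le>q. ?N i (Suc (q - i))))"
    by (simp only: sum_distrib_left[symmetric] sum.distrib)
  also have "\<dots> \<le> 8 * l ^ 4 * (deriv_energy T G (Suc q) + deriv_energy T G (Suc q))"
  proof (intro mult_left_mono add_mono)
    have "(\<Sum>i\<le>q. ?N (Suc i) (q - i)) = (\<Sum>i\<le>q. ?N (Suc i) (Suc q - Suc i))" by simp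
    also have "\<dots> \<le> deriv_energy T G (Suc q)"
      unfolding deriv_energy_def sum.atMost_Suc_shift by simp
    finally show "(\<Sum>i\<le>q. ?N (Suc i) (q - i)) \<le> deriv_energy T G (Suc q)" .
    have "(\<Sum>i\<le>q. ?N i (Suc (q - i))) = (\<Sum>i\<le>q. ?N i (Suc q - i))"
      by (intro sum.cong) (auto simp: Suc_diff_le)
    also have "\<dots> \<le> deriv_energy T G (Suc q)" unfolding deriv_energy_def by simp
    finally show "(\<Sum>i\<le>q. ?N i (Suc (q - i))) \<le> deriv_energy T G (Suc q)" .
  qed simp
  finally show ?thesis by simp
qed

text \<open>Iteration of \<open>deriv_energy_step\<close>. K is of order l^4 / |B|, hence of order
  l^2 if B has area comparable to the enclosing square, so that each order of differentiation gains
  a factor l in the seminorm.\<close>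

lemma bramble_hilbert:
  assumes T: "open T" "convex T" "T \<subseteq> cbox a (a + (l, l))"
    and L: "\<And>i j. i + j \<le> Suc p \<Longrightarrow> L2_on T (G i j)"
    and w: "\<And>i j. i + j \<le> p \<Longrightarrow> weak_partial T 1 0 (G i j) (G (Suc i) j)"
      "\<And>i j. i + j \<le> p \<Longrightarrow> weak_partial T 0 1 (G i j) (G i (Suc j))"
    and B: "B \<in> sets borel" "B \<subseteq> T" "0 < measure lebesgue B"
    and m: "\<And>i j. i + j \<le> p \<Longrightarrow> (LINT x:B|lebesgue. G i j x) = 0"
    and K: "16 * l ^ 4 \<le> K * measure lebesgue B"
    and q: "q \<le> Suc p"
  shows "deriv_energy T G q \<le> K ^ (Suc p - q) * deriv_energy T G (Suc p)"
  using q
proof (induction "Suc p - q" arbitrary: q)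
  case 0
  then show ?case by simp
next
  case (Suc r)
  then have q: "q \<le> p" "r = Suc p - Suc q" by auto
  \<comment> \<open>Forced by \<open>K\<close>: the left side is nonnegative and the measure of B is
    positive.\<close>
  have K0: "0 \<le> K"
    using K B(3) by (metis (no_types, lifting) linorder_not_le mult_neg_pos order_le_less_trans
        zero_le_even_power zero_le_mult_iff zero_le_numeral even_numeral)
  have "measure lebesgue B * deriv_energy T G q \<le> 16 * l ^ 4 * deriv_energy T G (Suc q)"
  proof (rule deriv_energy_step[OF T _ _ _ B])
    show "L2_on T (G i j)" if "i + j \<le> Suc q" for i j using that q(1) by (intro L) simp
    show "weak_partial T 1 0 (G i j) (G (Suc i) j)" "weak_partial T 0 1 (G i j) (G i (Suc j))"
      "(LINT x:B|lebesgue. G i j x) = 0" if "i + j = q" for i j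
      using that q(1) by (intro w m; simp)+
  qed
  also have "\<dots> \<le> (K * measure lebesgue B) * deriv_energy T G (Suc q)"
    by (intro mult_right_mono K deriv_energy_nonneg)
  also have "\<dots> \<le> (K * measure lebesgue B) * (K ^ r * deriv_energy T G (Suc p))"
    using Suc.hyps(1)[of "Suc q"] q K0 by (intro mult_left_mono) auto
  finally have "measure lebesgue B * deriv_energy T G q \<le> measure lebesgue B * (K ^ Suc r * deriv_energy T G (Suc p))"
    by (simp add: algebra_simps)
  then have "deriv_energy T G q \<le> K ^ Suc r * deriv_energy T G (Suc p)"
    using B(3) by (rule mult_left_le_imp_le)
  with Suc.hyps(2) show ?case by simp
qed

lemma sobolev_seminorm_energy:
  assumes D: "open D" and w: "\<And>i j. i + j = q \<Longrightarrow> weak_partial D i j f (G i j)"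
    and L: "\<And>i j. i + j = q \<Longrightarrow> L2_on D (G i j)"
  shows "sobolev_seminorm q D f = sqrt (deriv_energy D G q)"
  unfolding sobolev_seminorm_def deriv_energy_def
  by (intro arg_cong[where f = sqrt] sum.cong refl arg_cong[where f = "\<lambda>x. x\<^sup>2"]
      L2_norm_the_weak_partial[OF D w L]) auto

section \<open>Functions with bounded scaled derivatives\<close>

text \<open>All derivatives of \<open>f\<close> up to order \<open>k\<close>, multiplied by the matching power of \<open>h\<close>, are
  bounded by \<open>M\<close> on \<open>D\<close>.\<close>

fun scaled_smooth :: "(real \<times> real) set \<Rightarrow> real \<Rightarrow> nat \<Rightarrow> real \<Rightarrow> (real \<times> real \<Rightarrow> real) \<Rightarrow> bool" where
  "scaled_smooth D h 0 M f \<longleftrightarrow> continuous_on D f \<and> (\<forall>z\<in>D. \<bar>f z\<bar> \<le> M)"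
| "scaled_smooth D h (Suc k) M f \<longleftrightarrow> (\<forall>z\<in>D. \<bar>f z\<bar> \<le> M) \<and>
     (\<exists>fx fy. (\<forall>z\<in>D. has_grad f (fx z / h) (fy z / h) z) \<and>
        scaled_smooth D h k M fx \<and> scaled_smooth D h k M fy)"

lemma scaled_smooth_bound: "scaled_smooth D h k M f \<Longrightarrow> z \<in> D \<Longrightarrow> \<bar>f z\<bar> \<le> M"
  by (cases k) auto

lemma scaled_smooth_continuous: "scaled_smooth D h k M f \<Longrightarrow> continuous_on D f"
  by (cases k) (auto intro!: continuous_at_imp_continuous_on dest: has_grad_continuous)

lemma scaled_smoothI:
  assumes "\<And>z. z \<in> D \<Longrightarrow> \<bar>f z\<bar> \<le> M" "\<And>z. z \<in> D \<Longrightarrow> has_grad f (fx z / h) (fy z / h) z"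
    "scaled_smooth D h k M fx" "scaled_smooth D h k M fy"
  shows "scaled_smooth D h (Suc k) M f"
  using assms unfolding scaled_smooth.simps(2) by blast

lemma scaled_smooth_mono: "scaled_smooth D h k M f \<Longrightarrow> M \<le> N \<Longrightarrow> scaled_smooth D h k N f"
proof (induction k arbitrary: f)
  case 0
  then show ?case by force
next
  case (Suc k)
  obtain fx fy where "\<forall>z\<in>D. \<bar>f z\<bar> \<le> M" "\<forall>z\<in>D. has_grad f (fx z / h) (fy z / h) z"
    "scaled_smooth D h k M fx" "scaled_smooth D h k M fy"
    using Suc.prems(1) unfolding scaled_smooth.simps(2) by blast
  note * = this(1,2)[rule_format] this(3,4)
    show ?case
      by (rule scaled_smoothI[OF _ *(2) Suc.IH[OF *(3) Suc.prems(2)] Suc.IH[OF *(4) Suc.prems(2)]])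
        (use *(1) Suc.prems(2) in force)
qed

lemma scaled_smooth_pred: "scaled_smooth D h (Suc k) M f \<Longrightarrow> scaled_smooth D h k M f"
proof (induction k arbitrary: f)
  case 0
  then show ?case using scaled_smooth_continuous[OF 0] by simp
next
  case (Suc k)
  obtain fx fy where "\<forall>z\<in>D. \<bar>f z\<bar> \<le> M" "\<forall>z\<in>D. has_grad f (fx z / h) (fy z / h) z"
    "scaled_smooth D h (Suc k) M fx" "scaled_smooth D h (Suc k) M fy"
    using Suc.prems unfolding scaled_smooth.simps(2) by blast
  note * = this(1,2)[rule_format] this(3,4)
    show ?case by (rule scaled_smoothI[OF *(1,2) Suc.IH[OF *(3)] Suc.IH[OF *(4)]])
qed

lemma scaled_smooth_const: "\<bar>c\<bar> \<le> M \<Longrightarrow> scaled_smooth D h k M (\<lambda>_. c)"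
proof (induction k arbitrary: c)
  case (Suc k)
  have "0 \<le> M" using Suc.prems by linarith
  then have "scaled_smooth D h k M (\<lambda>_. 0)" using Suc.IH[of 0] by simp
  then show ?case
    by (intro scaled_smoothI[where fx = "\<lambda>_. 0" and fy = "\<lambda>_. 0"]) (use Suc.prems has_grad_const in auto)
qed simp

lemma scaled_smooth_add:
  "scaled_smooth D h k M f \<Longrightarrow> scaled_smooth D h k N g \<Longrightarrow> scaled_smooth D h k (M + N) (\<lambda>z. f z + g z)"
proof (induction k arbitrary: f g)
  case 0
  then show ?case by (auto intro!: continuous_intros order_trans[OF abs_triangle_ineq] add_mono)
next
  case (Suc k)
  obtain fx fy where "\<forall>z\<in>D. \<bar>f z\<bar> \<le> M" "\<forall>z\<in>D. has_grad f (fx z / h) (fy z / h) z"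
    "scaled_smooth D h k M fx" "scaled_smooth D h k M fy"
    using Suc.prems(1) unfolding scaled_smooth.simps(2) by blast
  note f = this(1,2)[rule_format] this(3,4)
  obtain gx gy where "\<forall>z\<in>D. \<bar>g z\<bar> \<le> N" "\<forall>z\<in>D. has_grad g (gx z / h) (gy z / h) z"
    "scaled_smooth D h k N gx" "scaled_smooth D h k N gy"
    using Suc.prems(2) unfolding scaled_smooth.simps(2) by blast
  note g = this(1,2)[rule_format] this(3,4)
  show ?case
  proof (rule scaled_smoothI[OF _ _ Suc.IH[OF f(3) g(3)] Suc.IH[OF f(4) g(4)]])
    fix z assume z: "z \<in> D"
    show "\<bar>f z + g z\<bar> \<le> M + N" using f(1)[OF z] g(1)[OF z] by linarith
    show "has_grad (\<lambda>z. f z + g z) ((fx z + gx z) / h) ((fy z + gy z) / h) z"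
      using has_grad_add[OF f(2)[OF z] g(2)[OF z]] by (simp add: add_divide_distrib)
  qed
qed

text \<open>Each differentiation turns one product into two, hence the factor 2^k. The
  undifferentiated factors are needed at the lower order too, which
  \<open>scaled_smooth_pred\<close> provides.\<close>

lemma scaled_smooth_mult:
  assumes "0 \<le> M" "0 \<le> N"
  shows "scaled_smooth D h k M f \<Longrightarrow> scaled_smooth D h k N g \<Longrightarrow> scaled_smooth D h k (2 ^ k * M * N) (\<lambda>z. f z * g z)"
proof (induction k arbitrary: f g)
  case 0
  then show ?case using assms by (auto intro!: continuous_intros mult_mono simp: abs_mult)
next
  case (Suc k)
  obtain fx fy where "\<forall>z\<in>D. \<bar>f z\<bar> \<le> M" "\<forall>z\<in>D. has_grad f (fx z / h) (fy z / h) z"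
    "scaled_smooth D h k M fx" "scaled_smooth D h k M fy"
    using Suc.prems(1) unfolding scaled_smooth.simps(2) by blast
  note f = this(1,2)[rule_format] this(3,4)
  obtain gx gy where "\<forall>z\<in>D. \<bar>g z\<bar> \<le> N" "\<forall>z\<in>D. has_grad g (gx z / h) (gy z / h) z"
    "scaled_smooth D h k N gx" "scaled_smooth D h k N gy"
    using Suc.prems(2) unfolding scaled_smooth.simps(2) by blast
  note g = this(1,2)[rule_format] this(3,4)
  note p = Suc.prems[THEN scaled_smooth_pred]
  have e: "2 ^ k * M * N + 2 ^ k * M * N = 2 ^ Suc k * M * N" by simp
  show ?case
  proof (rule scaled_smoothI)
    show "scaled_smooth D h k (2 ^ Suc k * M * N) (\<lambda>z. fx z * g z + f z * gx z)"
      "scaled_smooth D h k (2 ^ Suc k * M * N) (\<lambda>z. fy z * g z + f z * gy z)"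
      unfolding e[symmetric] by (intro scaled_smooth_add Suc.IH f g p)+
    fix z assume z: "z \<in> D"
    have "\<bar>f z * g z\<bar> \<le> M * N" using f(1)[OF z] g(1)[OF z] assms by (simp add: abs_mult mult_mono)
    also have "\<dots> \<le> 2 ^ Suc k * (M * N)"
      using assms mult_right_mono[of 1 "2 ^ Suc k" "M * N"] by (simp del: power_Suc)
    finally show "\<bar>f z * g z\<bar> \<le> 2 ^ Suc k * M * N" by (simp add: mult.assoc)
    show "has_grad (\<lambda>z. f z * g z) ((fx z * g z + f z * gx z) / h) ((fy z * g z + f z * gy z) / h) z"
      using has_grad_mult[OF f(2)[OF z] g(2)[OF z]] by (simp add: add_divide_distrib)
  qed
qed

lemma scaled_smooth_cong:
  assumes D: "open D" and eq: "\<And>z. z \<in> D \<Longrightarrow> f z = g z" and f: "scaled_smooth D h k M f"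
  shows "scaled_smooth D h k M g"
proof (cases k)
  case 0
  then show ?thesis using f eq continuous_on_cong[OF refl eq, of D] by auto
next
  case (Suc l)
  obtain fx fy where "\<forall>z\<in>D. \<bar>f z\<bar> \<le> M" "\<forall>z\<in>D. has_grad f (fx z / h) (fy z / h) z"
    "scaled_smooth D h l M fx" "scaled_smooth D h l M fy"
    using f[unfolded Suc] unfolding scaled_smooth.simps(2) by blast
  note * = this(1,2)[rule_format] this(3,4)
    show ?thesis unfolding Suc
      by (rule scaled_smoothI[OF _ has_grad_transform[OF *(2) D _ eq] *(3,4)]) (use *(1) eq in auto)
qed

text \<open>The witnesses in \<open>scaled_smooth\<close> are h times the partial derivatives, so
  undoing the scaling costs one division by h per order.\<close>

lemma scaled_smooth_weak_partials:
  assumes D: "open D"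
  shows "scaled_smooth D h k M f \<Longrightarrow> \<exists>F. \<forall>i j. i + j \<le> k \<longrightarrow> weak_partial D i j f (F i j) \<and>
    continuous_on D (F i j) \<and> (\<forall>z\<in>D. \<bar>F i j z\<bar> \<le> M / \<bar>h\<bar> ^ (i + j))"
proof (induction k arbitrary: f)
  case 0
  then show ?case
    by (intro exI[of _ "\<lambda>i j. f"]) (auto intro: weak_partial_0 locally_integrable_continuous)
next
  case (Suc k)
  obtain fx fy where "\<forall>z\<in>D. \<bar>f z\<bar> \<le> M" "\<forall>z\<in>D. has_grad f (fx z / h) (fy z / h) z"
    "scaled_smooth D h k M fx" "scaled_smooth D h k M fy"
    using Suc.prems(1) unfolding scaled_smooth.simps(2) by blast
  note f = this(1,2)[rule_format] this(3,4)
  obtain X where X: "\<And>i j. i + j \<le> k \<Longrightarrow> weak_partial D i j fx (X i j) \<and>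
    continuous_on D (X i j) \<and> (\<forall>z\<in>D. \<bar>X i j z\<bar> \<le> M / \<bar>h\<bar> ^ (i + j))" using Suc.IH[OF f(3)] by blast
  obtain Y where Y: "\<And>i j. i + j \<le> k \<Longrightarrow> weak_partial D i j fy (Y i j) \<and>
    continuous_on D (Y i j) \<and> (\<forall>z\<in>D. \<bar>Y i j z\<bar> \<le> M / \<bar>h\<bar> ^ (i + j))" using Suc.IH[OF f(4)] by blast
  have sD: "D \<in> sets lebesgue" using D by auto
  have c: "continuous_on D f" "continuous_on D fx" "continuous_on D fy"
    using scaled_smooth_continuous Suc.prems f(3,4) by blast+
  have cd: "continuous_on D (\<lambda>z. fx z / h)" "continuous_on D (\<lambda>z. fy z / h)"
    using c continuous_on_mult[OF _ continuous_on_const[of D "1 / h"]] by fastforce+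
  note cl = weak_partial_classical[OF D f(2) cd]
  \<comment> \<open>A derivative in the first variable is split off as long as there is one, because
    \<open>weak_partial_prepend2\<close> applies only when none is left.\<close>
  define F where "F i j = (if i = 0 then if j = 0 then f else (\<lambda>z. Y 0 (j - 1) z / h) else (\<lambda>z. X (i - 1) j z / h))" for i j
  have div: "weak_partial D i j (\<lambda>z. u z / h) (\<lambda>z. v z / h)" if "weak_partial D i j u v" for i j u v
    using weak_partial_linear[OF sD that that, of "1 / h" 0] by simp
  have cdiv: "continuous_on D (\<lambda>z. u z / h)" if "continuous_on D u" for u
    using continuous_on_mult[OF that continuous_on_const[of D "1 / h"]] by simp
  have bdiv: "\<bar>t / h\<bar> \<le> M / \<bar>h\<bar> ^ Suc n" if "\<bar>t\<bar> \<le> M / \<bar>h\<bar> ^ n" for t n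
    using divide_right_mono[OF that, of "\<bar>h\<bar>"] by (simp add: abs_divide mult.commute)
  have "weak_partial D i j f (F i j) \<and> continuous_on D (F i j) \<and> (\<forall>z\<in>D. \<bar>F i j z\<bar> \<le> M / \<bar>h\<bar> ^ (i + j))"
    if ij: "i + j \<le> Suc k" for i j
  proof (cases i)
    case 0
    show ?thesis
    proof (cases j)
      case 0
      then show ?thesis using \<open>i = 0\<close> f(1) c(1)
        by (auto simp: F_def intro: weak_partial_0 locally_integrable_continuous)
    next
      case (Suc l)
      then have l: "0 + l \<le> k" using ij \<open>i = 0\<close> by simp
      show ?thesis
        using weak_partial_prepend2[OF cl(2) div[of 0 l fy "Y 0 l"]] Y[OF l] cdiv bdiv[of _ l] \<open>i = 0\<close> Suc
        by (simp add: F_def del: power_Suc)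
    qed
  next
    case (Suc l)
    then have l: "l + j \<le> k" using ij by simp
    show ?thesis
      using weak_partial_prepend1[OF cl(1) div[of l j fx "X l j"]] X[OF l] cdiv bdiv[of _ "l + j"] Suc
      by (simp add: F_def del: power_Suc)
  qed
  then show ?case by blast
qed

section \<open>B-splines\<close>

text \<open>Truncated subtraction produces the repeated knot 0 and the minimum the repeated knot 1.
  Order and distance of knots thus become statements on natural numbers.\<close>

lemma open_knot_eq: "open_knot p n i = real (min (i - (p + 1)) (2 ^ n)) / 2 ^ n"
proof -
  have "real (2 ^ n) / 2 ^ n = 1" by simp
  then show ?thesis unfolding open_knot_def min_def by auto
qed

lemma open_knot_mono: "i \<le> j \<Longrightarrow> open_knot p n i \<le> open_knot p n j"
  unfolding open_knot_eq by (intro divide_right_mono) auto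

lemma mono_open_knot: "mono (open_knot p n)"
  by (intro monoI open_knot_mono)

lemma open_knot_bounds: "0 \<le> open_knot p n i" "open_knot p n i \<le> 1"
  unfolding open_knot_eq by (auto simp: divide_simps)

lemma open_knot_0: "i \<le> p + 1 \<Longrightarrow> open_knot p n i = 0"
  by (simp add: open_knot_def)

lemma open_knot_1: "2 ^ n + p + 1 \<le> i \<Longrightarrow> open_knot p n i = 1"
  by (simp add: open_knot_eq)

lemma open_knot_mid: "p + 1 \<le> i \<Longrightarrow> i \<le> 2 ^ n + p + 1 \<Longrightarrow> open_knot p n i = (real i - real p - 1) / 2 ^ n"
  by (subst open_knot_eq, subst min_absorb1) (auto simp: of_nat_diff)

lemma open_knot_gap:
  assumes "open_knot p n i < open_knot p n j" shows "1 / 2 ^ n \<le> open_knot p n j - open_knot p n i"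
proof -
  have "real (min (i - (p + 1)) (2 ^ n)) < real (min (j - (p + 1)) (2 ^ n))"
    using assms unfolding open_knot_eq by (simp add: divide_less_cancel)
  then have "Suc (min (i - (p + 1)) (2 ^ n)) \<le> min (j - (p + 1)) (2 ^ n)"
    unfolding of_nat_less_iff by (rule Suc_leI)
  then have "real (Suc (min (i - (p + 1)) (2 ^ n))) \<le> real (min (j - (p + 1)) (2 ^ n))"
    by (rule of_nat_mono)
  then have "real (min (i - (p + 1)) (2 ^ n)) + 1 \<le> real (min (j - (p + 1)) (2 ^ n))"
    by (simp only: of_nat_Suc add.commute)
  then show ?thesis unfolding open_knot_eq diff_divide_distrib[symmetric]
    by (intro divide_right_mono) auto
qed

lemma open_knot_less:
  assumes "1 \<le> i" "i \<le> 2 ^ n + p" shows "open_knot p n i < open_knot p n (i + p + 1)"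
proof -
  have "0 < (2::nat) ^ n" by simp
  with assms have "i - (p + 1) < 2 ^ n" by linarith
  with assms have "min (i - (p + 1)) (2 ^ n) < min (i + p + 1 - (p + 1)) (2 ^ n)" by auto
  then show ?thesis unfolding open_knot_eq by (simp add: divide_less_cancel del: min_less_iff_conj)
qed

section \<open>Support, positivity and bounds of B-splines\<close>

lemma cox_de_boor_support:
  assumes "mono \<xi>" "\<not> (\<xi> i \<le> s \<and> s < \<xi> (i + d + 1))"
  shows "cox_de_boor \<xi> d i s = 0"
  using assms(2)
proof (induction d arbitrary: i)
  case (Suc d)
  have "\<xi> (i + d + 1) \<le> \<xi> (i + Suc d + 1)" "\<xi> i \<le> \<xi> (i + 1)" using assms(1) by (auto intro: monoD)
  then have "\<not> (\<xi> i \<le> s \<and> s < \<xi> (i + d + 1))" "\<not> (\<xi> (i + 1) \<le> s \<and> s < \<xi> (i + 1 + d + 1))"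
    using Suc.prems by auto
  then show ?case using Suc.IH[of i] Suc.IH[of "i + 1"] by simp
qed auto

lemma cox_de_boor_nonneg:
  assumes "mono \<xi>" shows "0 \<le> cox_de_boor \<xi> d i s"
proof (induction d arbitrary: i)
  case (Suc d)
  have "0 \<le> (s - \<xi> i) / (\<xi> (i + d + 1) - \<xi> i) * cox_de_boor \<xi> d i s"
  proof (cases "\<xi> i \<le> s \<and> s < \<xi> (i + d + 1)")
    case True
    then show ?thesis using Suc.IH[of i] by (intro mult_nonneg_nonneg divide_nonneg_nonneg) auto
  qed (use cox_de_boor_support[OF assms] in simp)
  moreover have "0 \<le> (\<xi> (i + d + 2) - s) / (\<xi> (i + d + 2) - \<xi> (i + 1)) * cox_de_boor \<xi> d (i + 1) s"
  proof (cases "\<xi> (i + 1) \<le> s \<and> s < \<xi> (i + 1 + d + 1)")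
    case True
    then show ?thesis using Suc.IH[of "i + 1"] by (intro mult_nonneg_nonneg divide_nonneg_nonneg) auto
  qed (use cox_de_boor_support[OF assms] in simp)
  ultimately show ?case by simp
qed auto

text \<open>Strictly inside the support and away from the knots, at least one of the two splines of
  lower degree is positive by induction and its weight is positive. Only finitely many points are
  lost, which does not affect closures.\<close>

lemma cox_de_boor_pos:
  assumes "mono \<xi>" "\<xi> i < s" "s < \<xi> (i + d + 1)" "s \<notin> range \<xi>"
  shows "0 < cox_de_boor \<xi> d i s"
  using assms(2,3)
proof (induction d arbitrary: i)
  case (Suc d)
  have nn: "0 \<le> cox_de_boor \<xi> d i s" "0 \<le> cox_de_boor \<xi> d (i + 1) s"
    by (rule cox_de_boor_nonneg[OF assms(1)])+
  have z: "cox_de_boor \<xi> d i s = 0" if "\<xi> (i + d + 1) \<le> s"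
    using that by (intro cox_de_boor_support[OF assms(1)]) auto
  have z': "cox_de_boor \<xi> d (i + 1) s = 0" if "s < \<xi> (i + 1)"
    using that by (intro cox_de_boor_support[OF assms(1)]) auto
  have t1: "0 \<le> (s - \<xi> i) / (\<xi> (i + d + 1) - \<xi> i) * cox_de_boor \<xi> d i s"
  proof (cases "\<xi> (i + d + 1) \<le> s")
    case False
    then show ?thesis using Suc.prems nn by (intro mult_nonneg_nonneg divide_nonneg_nonneg) auto
  qed (simp add: z)
  have t2: "0 \<le> (\<xi> (i + d + 2) - s) / (\<xi> (i + d + 2) - \<xi> (i + 1)) * cox_de_boor \<xi> d (i + 1) s"
  proof (cases "s < \<xi> (i + 1)")
    case False
    then show ?thesis using Suc.prems nn by (intro mult_nonneg_nonneg divide_nonneg_nonneg) auto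
  qed (use z' in simp)
  have ne: "s \<noteq> \<xi> j" for j using assms(4) by auto
  show ?case
  proof (cases "s < \<xi> (i + d + 1)")
    case True
    then have "0 < (s - \<xi> i) / (\<xi> (i + d + 1) - \<xi> i) * cox_de_boor \<xi> d i s"
      using Suc.prems(1) Suc.IH[OF Suc.prems(1)] by (intro mult_pos_pos divide_pos_pos) auto
    then show ?thesis using t2 by simp
  next
    case False
    have "\<xi> (i + 1) \<le> \<xi> (i + d + 1)" using assms(1) by (auto intro: monoD)
    then have "\<xi> (i + 1) < s" using False ne[of "i + d + 1"] by auto
    then have "0 < (\<xi> (i + d + 2) - s) / (\<xi> (i + d + 2) - \<xi> (i + 1)) * cox_de_boor \<xi> d (i + 1) s"
      using Suc.prems(2) Suc.IH[of "i + 1"] by (intro mult_pos_pos divide_pos_pos) auto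
    then show ?thesis using t1 by simp
  qed
qed auto

lemma cox_de_boor_measurable: "cox_de_boor \<xi> d i \<in> borel_measurable borel"
proof (induction d arbitrary: i)
  case 0
  have "cox_de_boor \<xi> 0 i = indicator {\<xi> i..<\<xi> (i + 1)}"
    by (auto simp: indicator_def fun_eq_iff)
  then show ?case by simp
next
  case (Suc d)
  have "cox_de_boor \<xi> (Suc d) i = (\<lambda>s. (s - \<xi> i) / (\<xi> (i + d + 1) - \<xi> i) * cox_de_boor \<xi> d i s +
     (\<xi> (i + d + 2) - s) / (\<xi> (i + d + 2) - \<xi> (i + 1)) * cox_de_boor \<xi> d (i + 1) s)"
    by (auto simp: fun_eq_iff)
  moreover note [measurable] = Suc[of i] Suc[of "i + 1"]
  ultimately show ?case by (simp only:) measurable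
qed

text \<open>A crude bound: the recursion adds two terms with weights in [0, 1] wherever the spline
  is nonzero.\<close>

lemma cox_de_boor_le:
  assumes "mono \<xi>" shows "cox_de_boor \<xi> d i s \<le> 2 ^ d"
proof (induction d arbitrary: i)
  case (Suc d)
  have f: "a * c \<le> 2 ^ d" if "0 \<le> a" "a \<le> 1" "0 \<le> c" "c \<le> 2 ^ d" for a c :: real
    using mult_mono[of a 1 c "2 ^ d"] that by simp
  have "(s - \<xi> i) / (\<xi> (i + d + 1) - \<xi> i) * cox_de_boor \<xi> d i s \<le> 2 ^ d"
  proof (cases "\<xi> i \<le> s \<and> s < \<xi> (i + d + 1)")
    case True
    then show ?thesis using Suc.IH[of i] by (intro f cox_de_boor_nonneg[OF assms]) (auto simp: divide_simps)
  qed (use cox_de_boor_support[OF assms] in simp)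
  moreover have "(\<xi> (i + d + 2) - s) / (\<xi> (i + d + 2) - \<xi> (i + 1)) * cox_de_boor \<xi> d (i + 1) s \<le> 2 ^ d"
  proof (cases "\<xi> (i + 1) \<le> s \<and> s < \<xi> (i + 1 + d + 1)")
    case True
    then show ?thesis using Suc.IH[of "i + 1"] by (intro f cox_de_boor_nonneg[OF assms]) (auto simp: divide_simps)
  qed (use cox_de_boor_support[OF assms] in simp)
  ultimately show ?case by simp
qed auto

lemma bspline_outside: "\<not> (open_knot p n i \<le> s \<and> s < open_knot p n (i + p + 1)) \<Longrightarrow> bspline p n i s = 0"
  unfolding bspline_def by (rule cox_de_boor_support[OF mono_open_knot])

lemma bspline_pos:
  "open_knot p n i < s \<Longrightarrow> s < open_knot p n (i + p + 1) \<Longrightarrow> s \<notin> range (open_knot p n) \<Longrightarrow> 0 < bspline p n i s"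
  unfolding bspline_def by (rule cox_de_boor_pos[OF mono_open_knot])

lemma bspline_measurable: "bspline p n i \<in> borel_measurable borel"
  unfolding bspline_def by (rule cox_de_boor_measurable)

lemma bspline_abs_le: "\<bar>bspline p n i s\<bar> \<le> 2 ^ p"
  unfolding bspline_def
  using cox_de_boor_le[OF mono_open_knot] cox_de_boor_nonneg[OF mono_open_knot] by simp

lemma finite_open_knots: "finite (range (open_knot p n))"
proof (rule finite_subset)
  show "range (open_knot p n) \<subseteq> (\<lambda>k. real k / 2 ^ n) ` {..2 ^ n}"
    unfolding open_knot_eq by auto
qed simp

lemma closure_interval_minus_finite:
  fixes a b :: real
  assumes "finite F" "a < b" shows "closure ({a<..<b} - F) = {a..b}"
proof
  have "closure ({a<..<b} - F) \<subseteq> closure {a<..<b}" by (intro closure_mono) auto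
  then show "closure ({a<..<b} - F) \<subseteq> {a..b}" using assms(2) by simp
  have "closure (- F) = UNIV"
    using empty_interior_finite[OF assms(1)] by (simp add: closure_complement)
  then have "{a<..<b} \<subseteq> closure ({a<..<b} \<inter> - F)"
    using open_Int_closure_subset[of "{a<..<b}" "- F"] by auto
  then have "closure {a<..<b} \<subseteq> closure ({a<..<b} \<inter> - F)" by (simp add: closure_minimal)
  then show "{a..b} \<subseteq> closure ({a<..<b} - F)" using assms(2) by (simp add: Diff_eq)
qed

lemma bspline_supp_eq:
  assumes "1 \<le> i" "i \<le> 2 ^ n + p"
  shows "bspline_supp p n i = {open_knot p n i..open_knot p n (i + p + 1)}"
proof
  let ?a = "open_knot p n i" and ?b = "open_knot p n (i + p + 1)"
  have ab: "?a < ?b" by (rule open_knot_less[OF assms])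
  have "s \<in> {?a..?b}" if "bspline p n i s \<noteq> 0" for s
    using bspline_outside[of p n i s] that by force
  then have "{s \<in> {0<..<1}. bspline p n i s \<noteq> 0} \<subseteq> {?a..?b}" by blast
  then show "bspline_supp p n i \<subseteq> {?a..?b}"
    unfolding bspline_supp_def by (rule closure_minimal) simp
  have "{?a<..<?b} - range (open_knot p n) \<subseteq> {s \<in> {0<..<1}. bspline p n i s \<noteq> 0}"
  proof
    fix s assume s: "s \<in> {?a<..<?b} - range (open_knot p n)"
    have "0 < bspline p n i s" using s by (intro bspline_pos) auto
    then show "s \<in> {s \<in> {0<..<1}. bspline p n i s \<noteq> 0}"
      using s open_knot_bounds(1)[of p n i] open_knot_bounds(2)[of p n "i + p + 1"] by auto
  qed
  then have "closure ({?a<..<?b} - range (open_knot p n)) \<subseteq> bspline_supp p n i"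
    unfolding bspline_supp_def by (rule closure_mono)
  then show "{?a..?b} \<subseteq> bspline_supp p n i"
    unfolding closure_interval_minus_finite[OF finite_open_knots ab] .
qed

text \<open>Marsden's identity, read as an equality of polynomials in an auxiliary variable y: the
  sum of the splines times prod (y - knots) is (y - s)^d. Comparing coefficients of y later expands
  all powers of s at once.\<close>

lemma cox_de_boor_marsden:
  assumes d: "d \<le> p" and s: "0 \<le> s" "s < 1"
  shows "(\<Sum>i\<le>2 ^ n + 2 * p. smult (cox_de_boor (open_knot p n) d i s) (\<Prod>r=1..d. [:- open_knot p n (i + r), 1:])) =
    [:- s, 1:] ^ d"
  using d
proof (induction d)
  case 0
  let ?\<xi> = "open_knot p n" and ?L = "2 ^ n + 2 * p"
  \<comment> \<open>Degree 0: the indicator of a half-open knot interval is a difference of two step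
    functions, so the sum telescopes from the knot 0 to the knot 1. This covers s because 0 \<le> s
    < 1.\<close>
  have "(\<Sum>i\<le>?L. cox_de_boor ?\<xi> 0 i s) = (\<Sum>i\<le>?L. of_bool (?\<xi> i \<le> s) - of_bool (?\<xi> (Suc i) \<le> s))"
  proof (rule sum.cong[OF refl])
    fix i
    show "cox_de_boor ?\<xi> 0 i s = of_bool (?\<xi> i \<le> s) - of_bool (?\<xi> (Suc i) \<le> s)"
      using open_knot_mono[of i "Suc i" p n] by auto
  qed
  also have "\<dots> = of_bool (?\<xi> 0 \<le> s) - of_bool (?\<xi> (Suc ?L) \<le> s)"
    by (rule sum_telescope)
  also have "\<dots> = 1" using s open_knot_0[of 0 p n] open_knot_1[of n p "Suc ?L"] by simp
  finally have "(\<Sum>i\<le>?L. cox_de_boor ?\<xi> 0 i s) = 1" .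
  moreover have "(\<Sum>i\<le>?L. smult (cox_de_boor ?\<xi> 0 i s) (\<Prod>r=1..0. [:- ?\<xi> (i + r), 1:])) =
      smult (\<Sum>i\<le>?L. cox_de_boor ?\<xi> 0 i s) 1"
    unfolding smult_sum by (intro sum.cong) auto
  ultimately show ?case by simp
next
  case (Suc d)
  let ?\<xi> = "open_knot p n" and ?L = "2 ^ n + 2 * p"
  define \<Psi> where "\<Psi> d i = (\<Prod>r=1..d. [:- ?\<xi> (i + r), 1:])" for d i
  define c where "c i = cox_de_boor ?\<xi> d i s" for i
  define w where "w i = (s - ?\<xi> i) / (?\<xi> (i + d + 1) - ?\<xi> i)" for i
  define v where "v i = (?\<xi> (i + d + 1) - s) / (?\<xi> (i + d + 1) - ?\<xi> i)" for i
  \<comment> \<open>The two boundary terms of the index shift. The first p + 1 knots coincide, so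
    the spline of index 0 has empty support for a degree below p; the last one starts at the knot 1,
    beyond s.\<close>
  have c0: "c 0 = 0" unfolding c_def
    by (rule cox_de_boor_support[OF mono_open_knot]) (use Suc.prems open_knot_0[of "d + 1" p n] s in simp)
  have cL: "c (Suc ?L) = 0" unfolding c_def
    by (rule cox_de_boor_support[OF mono_open_knot]) (use open_knot_1[of n p "Suc ?L"] s in simp)
  have \<Psi>1: "\<Psi> (Suc d) i = \<Psi> d i * [:- ?\<xi> (i + d + 1), 1:]" for i
    unfolding \<Psi>_def by (simp add: mult.commute)
  have \<Psi>2: "\<Psi> (Suc d) i = [:- ?\<xi> (i + 1), 1:] * \<Psi> d (i + 1)" for i
  proof -
    have "\<Psi> (Suc d) i = (\<Prod>r\<in>{0..d}. [:- ?\<xi> (i + Suc r), 1:])"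
      unfolding \<Psi>_def One_nat_def prod.shift_bounds_cl_Suc_ivl ..
    also have "\<dots> = [:- ?\<xi> (i + 1), 1:] * (\<Prod>r=1..d. [:- ?\<xi> (i + Suc r), 1:])"
      by (subst prod.atLeast_Suc_atMost) auto
    finally show ?thesis by (simp add: \<Psi>_def)
  qed
  \<comment> \<open>The weights w and v are those of linear interpolation: they add up to 1 and
    recombine the two outer knots to s. If these knots coincide, the spline itself vanishes.\<close>
  have key: "smult (c i) (smult (w i) ([:- ?\<xi> (i + d + 1), 1:]) + smult (v i) [:- ?\<xi> i, 1:]) = smult (c i) [:- s, 1:]" for i
  proof (cases "?\<xi> i < ?\<xi> (i + d + 1)")
    case True
    define A B where "A = ?\<xi> i" and "B = ?\<xi> (i + d + 1)"
    have AB: "B - A \<noteq> 0" using True by (simp add: A_def B_def)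
    have "w i + v i = 1" using AB by (simp add: w_def v_def A_def B_def add_divide_distrib[symmetric])
    moreover have "w i * B + v i * A = s"
    proof -
      have "w i * B + v i * A = ((s - A) * B + (B - s) * A) / (B - A)"
        by (simp add: w_def v_def A_def B_def add_divide_distrib)
      also have "(s - A) * B + (B - s) * A = s * (B - A)" by (simp add: algebra_simps)
      finally show ?thesis using AB by simp
    qed
    ultimately have "smult (w i) ([:- B, 1:]) + smult (v i) [:- A, 1:] = [:- s, 1:]"
      by (simp add: algebra_simps)
    then show ?thesis by (simp only: A_def B_def)
  next
    case False
    then have "c i = 0" unfolding c_def by (intro cox_de_boor_support[OF mono_open_knot]) auto
    then show ?thesis by simp
  qed
  have "(\<Sum>i\<le>?L. smult (cox_de_boor ?\<xi> (Suc d) i s) (\<Psi> (Suc d) i)) =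
    (\<Sum>i\<le>?L. smult (w i * c i) (\<Psi> (Suc d) i)) + (\<Sum>i\<le>?L. smult (v (Suc i) * c (Suc i)) (\<Psi> (Suc d) i))"
    unfolding sum.distrib[symmetric] by (intro sum.cong) (auto simp: w_def v_def c_def smult_add_left)
  also have "(\<Sum>i\<le>?L. smult (v (Suc i) * c (Suc i)) (\<Psi> (Suc d) i)) =
      (\<Sum>i\<le>?L. smult (v (Suc i) * c (Suc i)) ([:- ?\<xi> (Suc i), 1:] * \<Psi> d (Suc i)))"
    by (intro sum.cong) (use \<Psi>2 in auto)
  also have "\<dots> = (\<Sum>i\<le>Suc ?L. smult (v i * c i) ([:- ?\<xi> i, 1:] * \<Psi> d i))"
    unfolding sum.atMost_Suc_shift by (simp add: c0)
  also have "\<dots> = (\<Sum>i\<le>?L. smult (v i * c i) ([:- ?\<xi> i, 1:] * \<Psi> d i))"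
    by (simp add: cL)
  also have "(\<Sum>i\<le>?L. smult (w i * c i) (\<Psi> (Suc d) i)) + \<dots> =
      (\<Sum>i\<le>?L. smult (c i) (smult (w i) ([:- ?\<xi> (i + d + 1), 1:]) + smult (v i) [:- ?\<xi> i, 1:]) * \<Psi> d i)"
    unfolding sum.distrib[symmetric] \<Psi>1
    by (intro sum.cong refl) (simp only: smult_add_right smult_smult distrib_left distrib_right mult_smult_left mult_smult_right mult.commute)
  also have "\<dots> = [:- s, 1:] * (\<Sum>i\<le>?L. smult (c i) (\<Psi> d i))"
    unfolding key sum_distrib_left by (intro sum.cong refl) (simp only: mult_smult_left mult_smult_right)
  also have "(\<Sum>i\<le>?L. smult (c i) (\<Psi> d i)) = [:- s, 1:] ^ d"
    using Suc by (simp add: c_def \<Psi>_def)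
  finally show ?case by (simp add: \<Psi>_def)
qed

text \<open>The coefficient of y^(p - a) in Marsden's identity. The vanishing of the first a
  coefficients is what later allows rows with low degree in t.\<close>

lemma power_bspline_expansion:
  assumes a: "a \<le> p"
  shows "\<exists>c. (\<forall>i. 1 \<le> i \<and> i \<le> a \<longrightarrow> c i = 0) \<and>
    (\<forall>s. 0 \<le> s \<longrightarrow> s < 1 \<longrightarrow> s ^ a = (\<Sum>i\<in>{1..2 ^ n + p}. c i * bspline p n i s))"
proof -
  let ?\<xi> = "open_knot p n" and ?L = "2 ^ n + 2 * p"
  define \<Psi> where "\<Psi> i = (\<Prod>r=1..p. [:- ?\<xi> (i + r), 1:])" for i
  define c where "c i = (- 1) ^ a / real (p choose a) * coeff (\<Psi> i) (p - a)" for i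
  have "c i = 0" if i: "1 \<le> i \<and> i \<le> a" for i
  proof -
    \<comment> \<open>The number of knots equal to 0 among those in the product for row i. Hence the
      product is divisible by y^k, and k > p - a exactly when i \<le> a.\<close>
    define k where "k = p + 1 - i"
    have k: "k \<le> p" "p - a < k" using i a by (auto simp: k_def)
    have "{1..p} = {1..k} \<union> {k + 1..p}" using k by auto
    then have "\<Psi> i = (\<Prod>r=1..k. [:- ?\<xi> (i + r), 1:]) * (\<Prod>r=k + 1..p. [:- ?\<xi> (i + r), 1:])"
      unfolding \<Psi>_def by (simp only:) (rule prod.union_disjoint, auto)
    also have "(\<Prod>r=1..k. [:- ?\<xi> (i + r), 1:]) = (\<Prod>r=1..k. [:0, 1:])"
      by (intro prod.cong) (use i k_def in \<open>auto simp: open_knot_0\<close>)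
    also have "\<dots> = monom 1 k" by (simp add: monom_altdef)
    finally show ?thesis using k(2) by (simp add: c_def coeff_monom_mult)
  qed
  moreover have "s ^ a = (\<Sum>i\<in>{1..2 ^ n + p}. c i * bspline p n i s)" if s: "0 \<le> s" "s < 1" for s
  proof -
    have "coeff ([:- s, 1:] ^ p) (p - a) = (\<Sum>i\<le>?L. bspline p n i s * coeff (\<Psi> i) (p - a))"
      unfolding cox_de_boor_marsden[OF order_refl s, of p n, symmetric] coeff_sum coeff_smult \<Psi>_def bspline_def ..
    also have "\<dots> = (\<Sum>i\<in>{1..2 ^ n + p}. bspline p n i s * coeff (\<Psi> i) (p - a))"
    proof (rule sum.mono_neutral_right)
      show "\<forall>i\<in>{..?L} - {1..2 ^ n + p}. bspline p n i s * coeff (\<Psi> i) (p - a) = 0"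
      proof
        fix i assume i: "i \<in> {..?L} - {1..2 ^ n + p}"
        then have "i = 0 \<or> 2 ^ n + p + 1 \<le> i" by auto
        then have "bspline p n i s = 0"
        proof
          assume "i = 0"
          then show ?thesis using s open_knot_0[of "p + 1" p n] by (intro bspline_outside) simp
        next
          assume "2 ^ n + p + 1 \<le> i"
          from open_knot_1[OF this] s show ?thesis by (intro bspline_outside) simp
        qed
        then show "bspline p n i s * coeff (\<Psi> i) (p - a) = 0" by simp
      qed
    qed auto
    also have "coeff ([:- s, 1:] ^ p) (p - a) = real (p choose a) * (- s) ^ a"
      using a by (simp add: coeff_linear_poly_power binomial_symmetric[of a p])
    finally have "real (p choose a) * (- s) ^ a = (\<Sum>i\<in>{1..2 ^ n + p}. bspline p n i s * coeff (\<Psi> i) (p - a))" .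
    moreover have "real (p choose a) \<noteq> 0" using a by simp
    moreover have "(- 1) ^ a * (- s) ^ a = s ^ a" by (simp add: power_mult_distrib[symmetric])
    ultimately have "s ^ a = (- 1) ^ a / real (p choose a) * (\<Sum>i\<in>{1..2 ^ n + p}. bspline p n i s * coeff (\<Psi> i) (p - a))"
      by (metis mult.left_commute nonzero_mult_div_cancel_left times_divide_eq_left)
    then show ?thesis by (simp add: sum_distrib_left c_def mult_ac)
  qed
  ultimately show ?thesis by blast
qed

section \<open>Scaled derivative bounds for splines, reciprocals and the ratio v/u\<close>

lemma scaled_smooth_cmult: "scaled_smooth D h k M f \<Longrightarrow> scaled_smooth D h k (\<bar>c\<bar> * M) (\<lambda>z. c * f z)"
proof (induction k arbitrary: f)
  case 0
  then show ?case by (auto intro!: continuous_intros mult_left_mono simp: abs_mult)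
next
  case (Suc k)
  obtain fx fy where "\<forall>z\<in>D. \<bar>f z\<bar> \<le> M" "\<forall>z\<in>D. has_grad f (fx z / h) (fy z / h) z"
    "scaled_smooth D h k M fx" "scaled_smooth D h k M fy"
    using Suc.prems unfolding scaled_smooth.simps(2) by blast
  note f = this(1,2)[rule_format] this(3,4)
  show ?case
  proof (rule scaled_smoothI[OF _ _ Suc.IH[OF f(3)] Suc.IH[OF f(4)]])
    fix z assume z: "z \<in> D"
    show "\<bar>c * f z\<bar> \<le> \<bar>c\<bar> * M" unfolding abs_mult by (intro mult_left_mono f(1) z) simp
    show "has_grad (\<lambda>z. c * f z) (c * fx z / h) (c * fy z / h) z"
      using has_grad_cmult[OF f(2)[OF z], of c] by simp
  qed
qed

lemma scaled_smooth_zero: "0 \<le> M \<Longrightarrow> scaled_smooth D h k M (\<lambda>_. 0)"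
  by (rule scaled_smooth_const) simp

lemma scaled_smooth_power:
  assumes "1 \<le> M" "scaled_smooth D h k M f"
  shows "scaled_smooth D h k ((2 ^ k * M) ^ e) (\<lambda>z. f z ^ e)"
proof (induction e)
  case 0
  show ?case by (simp add: scaled_smooth_const)
next
  case (Suc e)
  have "scaled_smooth D h k (2 ^ k * M * (2 ^ k * M) ^ e) (\<lambda>z. f z * f z ^ e)"
    using assms by (intro scaled_smooth_mult Suc) auto
  then show ?case by simp
qed

text \<open>No knot lies between \<alpha> and \<beta>, where \<sigma> takes its values. A spline
  whose knot interval does not cover this span is 0 on D, so only quotients with end knots on
  opposite sides of the span occur, and these are controlled by \<open>lin\<close>. Keeping \<sigma>
  abstract serves both \<sigma> = u and \<sigma> = v/u.\<close>

lemma cox_de_boor_scaled_smooth: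
  assumes \<xi>: "mono \<xi>" and D: "open D" and M: "0 \<le> M"
    and kn: "\<And>i. \<xi> i \<le> \<alpha> \<or> \<beta> \<le> \<xi> i" and \<sigma>: "\<And>z. z \<in> D \<Longrightarrow> \<alpha> < \<sigma> z" "\<And>z. z \<in> D \<Longrightarrow> \<sigma> z < \<beta>"
    and lin: "\<And>i j. \<xi> i \<le> \<alpha> \<Longrightarrow> \<beta> \<le> \<xi> j \<Longrightarrow> scaled_smooth D h k M (\<lambda>z. (\<sigma> z - \<xi> i) / (\<xi> j - \<xi> i))"
  shows "scaled_smooth D h k ((2 * 2 ^ k * (1 + M)) ^ d) (\<lambda>z. cox_de_boor \<xi> d i (\<sigma> z))"
proof (cases "D = {}")
  case True
  then show ?thesis by (intro scaled_smooth_cong[OF D _ scaled_smooth_zero]) (use M in auto)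
next
  case False
  then have \<alpha>\<beta>: "\<alpha> < \<beta>" using \<sigma> by force
  have lin2: "scaled_smooth D h k (1 + M) (\<lambda>z. (\<xi> j - \<sigma> z) / (\<xi> j - \<xi> i))" if "\<xi> i \<le> \<alpha>" "\<beta> \<le> \<xi> j" for i j
  proof (rule scaled_smooth_cong[OF D])
    show "scaled_smooth D h k (1 + M) (\<lambda>z. 1 + (- 1) * ((\<sigma> z - \<xi> i) / (\<xi> j - \<xi> i)))"
      using scaled_smooth_cmult[OF lin[OF that], of "- 1"] by (intro scaled_smooth_add scaled_smooth_const) auto
    have "\<xi> j - \<xi> i \<noteq> 0" using that \<alpha>\<beta> by simp
    then show "1 + (- 1) * ((\<sigma> z - \<xi> i) / (\<xi> j - \<xi> i)) = (\<xi> j - \<sigma> z) / (\<xi> j - \<xi> i)" for z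
      by (simp add: field_simps)
  qed
  have vanish: "cox_de_boor \<xi> d i (\<sigma> z) = 0" if "\<not> (\<xi> i \<le> \<alpha> \<and> \<beta> \<le> \<xi> (i + d + 1))" "z \<in> D" for d i z
    using kn[of i] kn[of "i + d + 1"] \<sigma>[OF that(2)] that(1) by (intro cox_de_boor_support[OF \<xi>]) auto
  show ?thesis
  proof (induction d arbitrary: i)
    case 0
    show ?case
    proof (cases "\<xi> i \<le> \<alpha> \<and> \<beta> \<le> \<xi> (i + 1)")
      case True
      show ?thesis
        by (rule scaled_smooth_cong[OF D _ scaled_smooth_const[of 1]]) (use True \<sigma> in force)+
    next
      case False
      show ?thesis
      proof (rule scaled_smooth_cong[OF D _ scaled_smooth_zero])
        have "cox_de_boor \<xi> 0 i (\<sigma> z) = 0" if "z \<in> D" for z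
          by (rule vanish) (use False that in auto)
        then show "0 = cox_de_boor \<xi> 0 i (\<sigma> z)" if "z \<in> D" for z using that by metis
      qed simp
    qed
  next
    case (Suc d)
    define C where "C = (2 * 2 ^ k * (1 + M)) ^ d"
    have C: "0 \<le> C" using M by (simp add: C_def)
    have E: "0 \<le> 2 ^ k * (1 + M) * C" using M C by simp
    have 1: "scaled_smooth D h k (2 ^ k * (1 + M) * C)
        (\<lambda>z. (\<sigma> z - \<xi> i) / (\<xi> (i + d + 1) - \<xi> i) * cox_de_boor \<xi> d i (\<sigma> z))"
    proof (cases "\<xi> i \<le> \<alpha> \<and> \<beta> \<le> \<xi> (i + d + 1)")
      case True
      have "scaled_smooth D h k (1 + M) (\<lambda>z. (\<sigma> z - \<xi> i) / (\<xi> (i + d + 1) - \<xi> i))"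
        by (rule scaled_smooth_mono[OF lin]) (use True in auto)
      then show ?thesis
        using Suc.IH[of i] M C unfolding C_def by (intro scaled_smooth_mult) auto
    next
      case False
      show ?thesis
        by (rule scaled_smooth_cong[OF D _ scaled_smooth_zero[OF E]]) (use vanish[OF False] in simp)
    qed
    have 2: "scaled_smooth D h k (2 ^ k * (1 + M) * C)
        (\<lambda>z. (\<xi> (i + d + 2) - \<sigma> z) / (\<xi> (i + d + 2) - \<xi> (i + 1)) * cox_de_boor \<xi> d (i + 1) (\<sigma> z))"
    proof (cases "\<xi> (i + 1) \<le> \<alpha> \<and> \<beta> \<le> \<xi> (i + 1 + d + 1)")
      case True
      then have "scaled_smooth D h k (1 + M) (\<lambda>z. (\<xi> (i + d + 2) - \<sigma> z) / (\<xi> (i + d + 2) - \<xi> (i + 1)))"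
        by (intro lin2) auto
      then show ?thesis
        using Suc.IH[of "i + 1"] M C unfolding C_def by (intro scaled_smooth_mult) auto
    next
      case False
      show ?thesis
        by (rule scaled_smooth_cong[OF D _ scaled_smooth_zero[OF E]]) (use vanish[OF False] in simp)
    qed
    have "2 ^ k * (1 + M) * C + 2 ^ k * (1 + M) * C = (2 * 2 ^ k * (1 + M)) ^ Suc d"
      by (simp add: C_def)
    with scaled_smooth_add[OF 1 2] show ?case by simp
  qed
qed

lemma has_grad_affine_fst: "has_grad (\<lambda>z. (fst z - a) / b) (1 / b) 0 z"
  using has_grad_affine[of "1 / b" 0 "- a / b" z] by (simp add: diff_divide_distrib)

lemma scaled_smooth_fst:
  assumes h: "0 < h" "h \<le> b - a" and D: "\<And>z. z \<in> D \<Longrightarrow> a \<le> fst z \<and> fst z \<le> b"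
  shows "scaled_smooth D h k 1 (\<lambda>z. (fst z - a) / (b - a))"
proof -
  have b: "\<bar>(fst z - a) / (b - a)\<bar> \<le> 1" if "z \<in> D" for z
    using D[OF that] h by (simp add: divide_simps)
  show ?thesis
  proof (cases k)
    case 0
    then show ?thesis using b h by (auto intro!: continuous_intros)
  next
    case (Suc l)
    have g: "has_grad (\<lambda>z. (fst z - a) / (b - a)) (h / (b - a) / h) (0 / h) z" for z
      using has_grad_affine_fst[of a "b - a" z] h by simp
    have "\<bar>h / (b - a)\<bar> \<le> 1" using h by (simp add: divide_simps)
    then show ?thesis unfolding Suc
      by (intro scaled_smoothI[where fx = "\<lambda>_. h / (b - a)" and fy = "\<lambda>_. 0"] b g
          scaled_smooth_const scaled_smooth_zero) auto
  qed
qed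

lemma has_grad_recip_fst: "fst z \<noteq> 0 \<Longrightarrow> has_grad (\<lambda>z. c / fst z) (- (c / fst z * (1 / fst z))) 0 z"
  by (auto simp: has_grad_def power2_eq_square intro!: derivative_eq_intros)

text \<open>The class is closed: h times the derivative of c/u is -(c/u)(h/u), and h satisfies the
  condition on c. The slack 2 in c \<le> 2 u is needed for c = h / L in a layer where u \<ge> 2^(m -
  1) h and 1 / L may be as large as 2^m.\<close>

lemma scaled_smooth_recip:
  "\<exists>M\<ge>2. \<forall>D h c. 0 < h \<and> 0 \<le> c \<and> (\<forall>z\<in>D. h \<le> fst z \<and> c \<le> 2 * fst z) \<longrightarrow>
    scaled_smooth D h k M (\<lambda>z. c / fst z)"
proof (induction k)
  case 0
  have "continuous_on D (\<lambda>z. c / fst z) \<and> (\<forall>z\<in>D. \<bar>c / fst z\<bar> \<le> 2)"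
    if "0 < h" "0 \<le> c" "\<forall>z\<in>D. h \<le> fst z \<and> c \<le> 2 * fst z" for D :: "(real \<times> real) set" and h c
  proof (intro conjI ballI)
    have p: "0 < fst z" if "z \<in> D" for z using that \<open>0 < h\<close> \<open>\<forall>z\<in>D. _\<close> by fastforce
    show "continuous_on D (\<lambda>z. c / fst z)" using p by (intro continuous_intros) fastforce
    show "\<bar>c / fst z\<bar> \<le> 2" if "z \<in> D" for z
      using p[OF that] \<open>0 \<le> c\<close> \<open>\<forall>z\<in>D. _\<close> that by (auto simp: divide_simps)
  qed
  then show ?case by (intro exI[of _ 2]) auto
next
  case (Suc k)
  then obtain M where M: "2 \<le> M" and IH: "\<And>D h c. 0 < h \<Longrightarrow> 0 \<le> c \<Longrightarrow> (\<forall>z\<in>D. h \<le> fst z \<and> c \<le> 2 * fst z) \<Longrightarrow>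
    scaled_smooth D h k M (\<lambda>z. c / fst z)" by blast
  have M': "M \<le> 2 ^ k * M * M"
  proof -
    have "1 \<le> (2::real) ^ k" by simp
    then have "1 * 1 \<le> 2 ^ k * M" using M by (intro mult_mono) auto
    then show ?thesis using M mult_right_mono[of 1 "2 ^ k * M" M] by simp
  qed
  have claim: "scaled_smooth D h (Suc k) (2 ^ k * M * M) (\<lambda>z. c / fst z)"
    if h: "0 < h" "0 \<le> c" and D: "\<forall>z\<in>D. h \<le> fst z \<and> c \<le> 2 * fst z" for D h c
  proof (rule scaled_smoothI[where fx = "\<lambda>z. (- 1) * (c / fst z * (h / fst z))" and fy = "\<lambda>_. 0"])
    have s: "scaled_smooth D h k M (\<lambda>z. c / fst z)" "scaled_smooth D h k M (\<lambda>z. h / fst z)"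
      using IH[OF h D] IH[of h h D] h D by fastforce+
    show "scaled_smooth D h k (2 ^ k * M * M) (\<lambda>z. (- 1) * (c / fst z * (h / fst z)))"
      using scaled_smooth_cmult[OF scaled_smooth_mult[OF _ _ s], of "- 1"] M by simp
    show "scaled_smooth D h k (2 ^ k * M * M) (\<lambda>_. 0)" using M by (intro scaled_smooth_zero) simp
    fix z assume z: "z \<in> D"
    show "\<bar>c / fst z\<bar> \<le> 2 ^ k * M * M" using scaled_smooth_bound[OF s(1) z] M' by linarith
    have "fst z \<noteq> 0" using D h z by force
    then show "has_grad (\<lambda>z. c / fst z) ((- 1) * (c / fst z * (h / fst z)) / h) (0 / h) z"
      using has_grad_recip_fst[of z c] h by simp
  qed
  have "2 \<le> 2 ^ k * M * M" using M M' by linarith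
  with claim show ?case by blast
qed

lemma has_grad_ratio: "fst z \<noteq> 0 \<Longrightarrow> has_grad (\<lambda>z. snd z / fst z) (- (snd z / fst z * (1 / fst z))) (1 / fst z) z"
  by (auto simp: has_grad_def power2_eq_square field_simps intro!: derivative_eq_intros)

lemma scaled_smooth_ratio:
  "\<exists>M\<ge>1. \<forall>D h. 0 < h \<and> (\<forall>z\<in>D. h \<le> fst z \<and> 0 \<le> snd z \<and> snd z \<le> fst z) \<longrightarrow>
    scaled_smooth D h k M (\<lambda>z. snd z / fst z)"
proof (induction k)
  case 0
  have "continuous_on D (\<lambda>z. snd z / fst z) \<and> (\<forall>z\<in>D. \<bar>snd z / fst z\<bar> \<le> 1)"
    if "0 < h" "\<forall>z\<in>D. h \<le> fst z \<and> 0 \<le> snd z \<and> snd z \<le> fst z" for D :: "(real \<times> real) set" and h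
  proof (intro conjI ballI)
    have p: "0 < fst z" if "z \<in> D" for z using that \<open>0 < h\<close> \<open>\<forall>z\<in>D. _\<close> by fastforce
    show "continuous_on D (\<lambda>z. snd z / fst z)" using p by (intro continuous_intros) fastforce
    show "\<bar>snd z / fst z\<bar> \<le> 1" if "z \<in> D" for z
      using p[OF that] \<open>\<forall>z\<in>D. _\<close> that by (auto simp: divide_simps)
  qed
  then show ?case by (intro exI[of _ 1]) auto
next
  case (Suc k)
  then obtain M where M: "1 \<le> M" and IH: "\<And>D h. 0 < h \<Longrightarrow> (\<forall>z\<in>D. h \<le> fst z \<and> 0 \<le> snd z \<and> snd z \<le> fst z) \<Longrightarrow>
    scaled_smooth D h k M (\<lambda>z. snd z / fst z)" by blast
  obtain R where R: "2 \<le> R" and r: "\<And>D h c. 0 < h \<Longrightarrow> 0 \<le> c \<Longrightarrow> (\<forall>z\<in>D. h \<le> fst z \<and> c \<le> 2 * fst z) \<Longrightarrow>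
    scaled_smooth D h k R (\<lambda>z. c / fst z)" using scaled_smooth_recip[of k] by blast
  have k1: "1 \<le> (2::real) ^ k" by simp
  have "1 * 1 \<le> 2 ^ k * R" "1 * 1 \<le> 2 ^ k * M" using M R k1 by (intro mult_mono; simp)+
  then have M': "M \<le> 2 ^ k * M * R" "R \<le> 2 ^ k * M * R"
    using M R mult_right_mono[of 1 "2 ^ k * R" M] mult_right_mono[of 1 "2 ^ k * M" R] by (auto simp: mult_ac)
  have claim: "scaled_smooth D h (Suc k) (2 ^ k * M * R) (\<lambda>z. snd z / fst z)"
    if h: "0 < h" and D: "\<forall>z\<in>D. h \<le> fst z \<and> 0 \<le> snd z \<and> snd z \<le> fst z" for D h
  proof (rule scaled_smoothI[where fx = "\<lambda>z. (- 1) * (snd z / fst z * (h / fst z))" and fy = "\<lambda>z. h / fst z"])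
    have s: "scaled_smooth D h k M (\<lambda>z. snd z / fst z)" "scaled_smooth D h k R (\<lambda>z. h / fst z)"
      using IH[OF h D] r[of h h D] h D by fastforce+
    show "scaled_smooth D h k (2 ^ k * M * R) (\<lambda>z. (- 1) * (snd z / fst z * (h / fst z)))"
      using scaled_smooth_cmult[OF scaled_smooth_mult[OF _ _ s], of "- 1"] M R by simp
    show "scaled_smooth D h k (2 ^ k * M * R) (\<lambda>z. h / fst z)" by (rule scaled_smooth_mono[OF s(2) M'(2)])
    fix z assume z: "z \<in> D"
    show "\<bar>snd z / fst z\<bar> \<le> 2 ^ k * M * R" using scaled_smooth_bound[OF s(1) z] M' by linarith
    have "fst z \<noteq> 0" using D h z by force
    then show "has_grad (\<lambda>z. snd z / fst z) ((- 1) * (snd z / fst z * (h / fst z)) / h) (h / fst z / h) z"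
      using has_grad_ratio[of z] h by simp
  qed
  have "1 \<le> 2 ^ k * M * R" using M M' by linarith
  with claim show ?case by blast
qed

text \<open>The first derivatives of v/u are at most 1/u, so those of (v/u) / L are at most 1/(L u).
  They are of order 1/h as soon as h/L \<le> 2 u: the knots in t must not be finer than h/u, which
  is the reason for the hierarchical coarsening towards the vertex.\<close>

lemma scaled_smooth_ratio_affine:
  "\<exists>M\<ge>1. \<forall>D h \<eta> L. 0 < h \<and> 0 < L \<and> (\<forall>z\<in>D. h \<le> fst z \<and> h / L \<le> 2 * fst z \<and> 0 \<le> snd z \<and> snd z \<le> fst z \<and>
      \<eta> \<le> snd z / fst z \<and> snd z / fst z \<le> \<eta> + L) \<longrightarrow>
    scaled_smooth D h k M (\<lambda>z. (snd z / fst z - \<eta>) / L)"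
proof -
  obtain M where M: "1 \<le> M" and m: "\<And>D h. 0 < h \<Longrightarrow> (\<forall>z\<in>D. h \<le> fst z \<and> 0 \<le> snd z \<and> snd z \<le> fst z) \<Longrightarrow>
    scaled_smooth D h k M (\<lambda>z. snd z / fst z)" using scaled_smooth_ratio[of k] by blast
  obtain R where R: "2 \<le> R" and r: "\<And>D h c. 0 < h \<Longrightarrow> 0 \<le> c \<Longrightarrow> (\<forall>z\<in>D. h \<le> fst z \<and> c \<le> 2 * fst z) \<Longrightarrow>
    scaled_smooth D h k R (\<lambda>z. c / fst z)" using scaled_smooth_recip[of k] by blast
  have k1: "1 \<le> (2::real) ^ k" by simp
  have "1 * 1 \<le> 2 ^ k * R" "1 * 1 \<le> 2 ^ k * M" using M R k1 by (intro mult_mono; simp)+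
  then have M': "M \<le> 2 ^ k * M * R" "R \<le> 2 ^ k * M * R"
    using M R mult_right_mono[of 1 "2 ^ k * R" M] mult_right_mono[of 1 "2 ^ k * M" R] by (auto simp: mult_ac)
  have claim: "scaled_smooth D h (Suc k) (2 ^ k * M * R) (\<lambda>z. (snd z / fst z - \<eta>) / L)"
    if h: "0 < h" "0 < L" and D: "\<forall>z\<in>D. h \<le> fst z \<and> h / L \<le> 2 * fst z \<and> 0 \<le> snd z \<and> snd z \<le> fst z \<and>
      \<eta> \<le> snd z / fst z \<and> snd z / fst z \<le> \<eta> + L" for D h \<eta> L
  proof (rule scaled_smoothI[where fx = "\<lambda>z. (- 1) * (snd z / fst z * ((h / L) / fst z))" and fy = "\<lambda>z. (h / L) / fst z"])
    have s: "scaled_smooth D h k M (\<lambda>z. snd z / fst z)" "scaled_smooth D h k R (\<lambda>z. (h / L) / fst z)"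
      using m[of h D] r[of h "h / L" D] h D by auto
    show "scaled_smooth D h k (2 ^ k * M * R) (\<lambda>z. (- 1) * (snd z / fst z * ((h / L) / fst z)))"
      using scaled_smooth_cmult[OF scaled_smooth_mult[OF _ _ s], of "- 1"] M R by simp
    show "scaled_smooth D h k (2 ^ k * M * R) (\<lambda>z. (h / L) / fst z)" by (rule scaled_smooth_mono[OF s(2) M'(2)])
    fix z assume z: "z \<in> D"
    have "\<bar>(snd z / fst z - \<eta>) / L\<bar> \<le> 1" using bspec[OF D z] h by (simp add: pos_divide_le_eq abs_le_iff)
    then show "\<bar>(snd z / fst z - \<eta>) / L\<bar> \<le> 2 ^ k * M * R" using M M' by linarith
    have "fst z \<noteq> 0" using D h z by force
    then have "has_grad (\<lambda>z. 1 / L * (snd z / fst z + - \<eta>)) (1 / L * (- (snd z / fst z * (1 / fst z)) + 0)) (1 / L * (1 / fst z + 0)) z"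
      by (intro has_grad_cmult has_grad_add has_grad_ratio has_grad_const)
    then show "has_grad (\<lambda>z. (snd z / fst z - \<eta>) / L) ((- 1) * (snd z / fst z * ((h / L) / fst z)) / h) ((h / L) / fst z / h) z"
      using h by (simp add: mult_ac)
  qed
  have "1 \<le> 2 ^ k * M * R" using M M' by linarith
  \<comment> \<open>The gradient is expressed by functions treated at order k, so the claim comes
    out at order k + 1 and is weakened.\<close>
  with claim[THEN scaled_smooth_pred] show ?thesis by blast
qed

text \<open>The knots from i to p + 1 all equal 0, so a spline of degree d vanishes at 0 to order d
  - (p + 1 - i). Splitting off this power of s/h leaves a factor with bounded scaled derivatives on
  the first knot interval; for d = p the power is i - 1.\<close>

lemma cox_de_boor_corner:
  "\<exists>C\<ge>0. \<forall>n D i. open D \<and> (\<forall>z\<in>D. 0 < fst z \<and> fst z < 1 / 2 ^ n) \<and> i \<le> p + 1 \<and> p + 1 \<le> d + i \<longrightarrow>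
    (\<exists>g. scaled_smooth D (1 / 2 ^ n) k C g \<and>
      (\<forall>z\<in>D. cox_de_boor (open_knot p n) d i (fst z) = (fst z / (1 / 2 ^ n)) ^ (d + i - (p + 1)) * g z))"
proof (induction d)
  case 0
  show ?case
  proof (intro exI[of _ 1] conjI allI impI, simp, elim conjE)
    fix n and D :: "(real \<times> real) set" and i
    assume *: "\<forall>z\<in>D. 0 < fst z \<and> fst z < 1 / 2 ^ n" "i \<le> p + 1" "p + 1 \<le> 0 + i"
    then have i: "i = p + 1" by simp
    have "open_knot p n (p + 2) = 1 / 2 ^ n" by (subst open_knot_mid) auto
    then have "\<forall>z\<in>D. cox_de_boor (open_knot p n) 0 i (fst z) = 1"
      using * unfolding i by (auto simp: open_knot_0)
    then show "\<exists>g. scaled_smooth D (1 / 2 ^ n) k 1 g \<and> (\<forall>z\<in>D. cox_de_boor (open_knot p n) 0 i (fst z) =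
        (fst z / (1 / 2 ^ n)) ^ (0 + i - (p + 1)) * g z)"
      by (intro exI[of _ "\<lambda>_. 1"]) (auto simp: i intro: scaled_smooth_const)
  qed
next
  case (Suc d)
  then obtain C where C: "0 \<le> C" and IH0: "\<forall>n D i. open D \<and> (\<forall>z\<in>D. 0 < fst z \<and> fst z < 1 / 2 ^ n) \<and> i \<le> p + 1 \<and>
    p + 1 \<le> d + i \<longrightarrow> (\<exists>g. scaled_smooth D (1 / 2 ^ n) k C g \<and>
      (\<forall>z\<in>D. cox_de_boor (open_knot p n) d i (fst z) = (fst z / (1 / 2 ^ n)) ^ (d + i - (p + 1)) * g z))"
    by (elim exE conjE) (rule that)
  note IH = IH0[rule_format, OF conjI[OF _ conjI[OF _ conjI]]]
  define E where "E = C + 2 ^ k * 2 * C"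
  have E: "0 \<le> E" using C by (simp add: E_def)
  have "\<exists>g. scaled_smooth D (1 / 2 ^ n) k E g \<and>
      (\<forall>z\<in>D. cox_de_boor (open_knot p n) (Suc d) i (fst z) = (fst z / (1 / 2 ^ n)) ^ (Suc d + i - (p + 1)) * g z)"
    if D: "open D" "\<forall>z\<in>D. 0 < fst z \<and> fst z < 1 / 2 ^ n" and i: "i \<le> p + 1" "p + 1 \<le> Suc d + i" for n D i
  proof -
    define h :: real where "h = 1 / 2 ^ n"
    have h: "0 < h" by (simp add: h_def)
    let ?\<xi> = "open_knot p n"
    define r where "r = Suc d + i - (p + 1)"
    have x0: "?\<xi> i = 0" using i by (simp add: open_knot_0)
    have xh: "?\<xi> (p + 2) = h" unfolding h_def by (subst open_knot_mid) auto
    have hge: "h \<le> ?\<xi> j" if "p + 2 \<le> j" for j using open_knot_mono[OF that, of p n] xh by simp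
    have "\<exists>g. scaled_smooth D h k C g \<and> (\<forall>z\<in>D. (fst z - ?\<xi> i) / (?\<xi> (i + d + 1) - ?\<xi> i) *
        cox_de_boor ?\<xi> d i (fst z) = (fst z / h) ^ r * g z)"
    proof (cases "p + 1 \<le> d + i")
      case True
      obtain g where g: "scaled_smooth D h k C g"
        "\<And>z. z \<in> D \<Longrightarrow> cox_de_boor ?\<xi> d i (fst z) = (fst z / h) ^ (d + i - (p + 1)) * g z"
        using IH[OF D i(1) True] unfolding h_def by blast
      define c where "c = h / ?\<xi> (i + d + 1)"
      have hx: "h \<le> ?\<xi> (i + d + 1)" using True by (intro hge) simp
      have c: "\<bar>c\<bar> \<le> 1" unfolding c_def using h hx by (simp add: divide_simps)
      have "\<bar>c\<bar> * C \<le> C" using mult_right_mono[OF c C] by simp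
      then have "scaled_smooth D h k C (\<lambda>z. c * g z)"
        by (rule scaled_smooth_mono[OF scaled_smooth_cmult[OF g(1)]])
      moreover have "(fst z - ?\<xi> i) / (?\<xi> (i + d + 1) - ?\<xi> i) * cox_de_boor ?\<xi> d i (fst z) =
          (fst z / h) ^ r * (c * g z)" if "z \<in> D" for z
      proof -
        have "r = Suc (d + i - (p + 1))" using True by (simp add: r_def)
        then show ?thesis using h hx by (simp add: g(2)[OF that] x0 c_def)
      qed
      ultimately show ?thesis by (intro exI[of _ "\<lambda>z. c * g z"]) blast
    next
      \<comment> \<open>Here d + i = p, so both ends of the support of the left spline are the knot
        0 and it vanishes.\<close>
      case False
      have "cox_de_boor ?\<xi> d i (fst z) = 0" if "z \<in> D" for z
        by (rule cox_de_boor_support[OF mono_open_knot]) (use False D(2) that in \<open>force simp: open_knot_0\<close>)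
      then show ?thesis by (intro exI[of _ "\<lambda>_. 0"]) (auto intro: scaled_smooth_zero C)
    qed
    then obtain g1 where g1: "scaled_smooth D h k C g1" "\<And>z. z \<in> D \<Longrightarrow> (fst z - ?\<xi> i) / (?\<xi> (i + d + 1) - ?\<xi> i) *
        cox_de_boor ?\<xi> d i (fst z) = (fst z / h) ^ r * g1 z" by blast
    have "\<exists>g. scaled_smooth D h k (2 ^ k * 2 * C) g \<and> (\<forall>z\<in>D. (?\<xi> (i + d + 2) - fst z) / (?\<xi> (i + d + 2) - ?\<xi> (i + 1)) *
        cox_de_boor ?\<xi> d (i + 1) (fst z) = (fst z / h) ^ r * g z)"
    proof (cases "i + 1 \<le> p + 1")
      case True
      have i2: "p + 1 \<le> d + (i + 1)" using i(2) by simp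
      obtain g where g: "scaled_smooth D h k C g"
        "\<And>z. z \<in> D \<Longrightarrow> cox_de_boor ?\<xi> d (i + 1) (fst z) = (fst z / h) ^ (d + (i + 1) - (p + 1)) * g z"
        using IH[OF D True i2] unfolding h_def by blast
      define b where "b = ?\<xi> (i + d + 2)"
      have hx: "h \<le> b" unfolding b_def using i(2) by (intro hge) simp
      have "scaled_smooth D h k 1 (\<lambda>z. (fst z - 0) / (b - 0))"
        using D(2) hx h by (intro scaled_smooth_fst) (auto simp: h_def)
      then have "scaled_smooth D h k 2 (\<lambda>z. 1 + (- 1) * ((fst z - 0) / (b - 0)))"
        using scaled_smooth_add[OF scaled_smooth_const[of 1 1 D h k] scaled_smooth_cmult[of D h k 1 _ "- 1"]] by simp
      then have "scaled_smooth D h k (2 ^ k * 2 * C) (\<lambda>z. (1 + (- 1) * ((fst z - 0) / (b - 0))) * g z)"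
        using C g(1) by (intro scaled_smooth_mult) auto
      moreover have "(?\<xi> (i + d + 2) - fst z) / (?\<xi> (i + d + 2) - ?\<xi> (i + 1)) * cox_de_boor ?\<xi> d (i + 1) (fst z) =
          (fst z / h) ^ r * ((1 + (- 1) * ((fst z - 0) / (b - 0))) * g z)" if "z \<in> D" for z
      proof -
        have "?\<xi> (i + 1) = 0" using True by (rule open_knot_0)
        moreover have "d + (i + 1) - (p + 1) = r" by (simp add: r_def)
        moreover have "(b - fst z) / b = 1 + (- 1) * (fst z / b)" using h hx by (simp add: diff_divide_distrib)
        ultimately show ?thesis using g(2)[OF that] unfolding b_def[symmetric] by simp
      qed
      ultimately show ?thesis by (intro exI[of _ "\<lambda>z. (1 + (- 1) * ((fst z - 0) / (b - 0))) * g z"]) blast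
    next
      case False
      then have i': "i + 1 = p + 2" using i by simp
      have "cox_de_boor ?\<xi> d (i + 1) (fst z) = 0" if "z \<in> D" for z
        unfolding i' by (rule cox_de_boor_support[OF mono_open_knot]) (use D(2) that xh in \<open>force simp: h_def\<close>)
      then show ?thesis using C by (intro exI[of _ "\<lambda>_. 0"]) (auto intro: scaled_smooth_zero)
    qed
    then obtain g2 where g2: "scaled_smooth D h k (2 ^ k * 2 * C) g2"
      "\<And>z. z \<in> D \<Longrightarrow> (?\<xi> (i + d + 2) - fst z) / (?\<xi> (i + d + 2) - ?\<xi> (i + 1)) *
        cox_de_boor ?\<xi> d (i + 1) (fst z) = (fst z / h) ^ r * g2 z" by blast
    have "scaled_smooth D h k E (\<lambda>z. g1 z + g2 z)" unfolding E_def by (rule scaled_smooth_add[OF g1(1) g2(1)])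
    moreover have "cox_de_boor ?\<xi> (Suc d) i (fst z) = (fst z / h) ^ r * (g1 z + g2 z)" if "z \<in> D" for z
      unfolding cox_de_boor.simps(2) g1(2)[OF that] g2(2)[OF that] by (simp add: distrib_left)
    ultimately show ?thesis unfolding h_def r_def by blast
  qed
  with E show ?case by blast
qed

section \<open>Tensor products of functionals\<close>

lemma L2_on_borel_iff:
  assumes D: "D \<in> sets borel" and f: "f \<in> borel_measurable borel"
  shows "L2_on D f \<longleftrightarrow> (\<integral>\<^sup>+x. indicator D x * ennreal ((f x)\<^sup>2) \<partial>lborel) < \<infinity>"
    "L2_on D f \<Longrightarrow> (\<integral>\<^sup>+x. indicator D x * ennreal ((f x)\<^sup>2) \<partial>lborel) = ennreal ((L2_norm D f)\<^sup>2)"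
proof -
  have sD: "D \<in> sets lebesgue" using D by auto
  have m: "(\<lambda>x. (f x)\<^sup>2) \<in> borel_measurable borel" using f by simp
  have m': "(\<lambda>x. indicator D x * (f x)\<^sup>2) \<in> borel_measurable lborel" using D m by simp
  have eq: "(\<integral>\<^sup>+x. indicator D x * ennreal ((f x)\<^sup>2) \<partial>lborel) = (\<integral>\<^sup>+x. ennreal (indicator D x * (f x)\<^sup>2) \<partial>lborel)"
    by (intro nn_integral_cong) (auto simp: indicator_def)
  have nrm: "norm (indicator D x * (f x)\<^sup>2) = indicator D x * (f x)\<^sup>2" for x by (simp add: abs_mult)
  have i: "L2_on D f \<longleftrightarrow> integrable lborel (\<lambda>x. indicator D x * (f x)\<^sup>2)"
    using integral_lebesgue_on_borel(2)[OF D m] borel_measurable_lebesgue_on[OF f] by (simp add: L2_on_iff[OF sD])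
  show "L2_on D f \<longleftrightarrow> (\<integral>\<^sup>+x. indicator D x * ennreal ((f x)\<^sup>2) \<partial>lborel) < \<infinity>"
    unfolding i integrable_iff_bounded nrm eq using m' by simp
  assume L: "L2_on D f"
  have "(\<integral>\<^sup>+x. ennreal (indicator D x * (f x)\<^sup>2) \<partial>lborel) = ennreal (LINT x|lborel. indicator D x * (f x)\<^sup>2)"
    using L i by (intro nn_integral_eq_integral) auto
  then show "(\<integral>\<^sup>+x. indicator D x * ennreal ((f x)\<^sup>2) \<partial>lborel) = ennreal ((L2_norm D f)\<^sup>2)"
    unfolding eq using integral_lebesgue_on_borel(1)[OF D m] by (simp add: L2_norm_sq_eq[OF sD])
qed

section \<open>Bounded functionals applied to sections\<close>

abbreviation unit_interval :: "real set" where "unit_interval \<equiv> {0<..<1}"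

lemma unit_interval_measure:
  "unit_interval \<in> sets lebesgue" "emeasure lebesgue unit_interval < \<infinity>"
  by (auto simp: emeasure_lborel_Ioo)

lemma AE_not_endpoints: "AE x in lebesgue. x \<noteq> a \<and> x \<noteq> (b::real)"
proof -
  have "AE x in lborel. x \<noteq> a \<and> x \<noteq> b"
    using AE_lborel_singleton[of a] AE_lborel_singleton[of b] by eventually_elim auto
  then show ?thesis by (rule AE_completion)
qed

lemma L2_norm_unit_le:
  assumes J: "J \<in> sets borel" "J \<subseteq> {0..1}" and f: "L2_on unit_interval f"
  shows "L2_norm J f \<le> L2_norm unit_interval f"
proof -
  let ?K = "J \<inter> unit_interval"
  have K: "?K \<in> sets lebesgue" using J(1) by auto
  have fK: "L2_on ?K f" by (rule L2_on_subset[OF f _ K unit_interval_measure(1)]) auto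
  have m: "(\<lambda>x. indicator ?K x *\<^sub>R (f x)\<^sup>2) \<in> borel_measurable lebesgue"
    using fK by (auto simp: L2_on_def set_integrable_def)
  have ae: "AE x in lebesgue. indicator ?K x *\<^sub>R (f x)\<^sup>2 = indicator J x *\<^sub>R (f x)\<^sup>2"
    using AE_not_endpoints[of 0 1] by eventually_elim (use J(2) in \<open>auto simp: indicator_def\<close>)
  have "L2_norm ?K f = L2_norm J f"
    unfolding L2_norm_def set_lebesgue_integral_def
    by (intro arg_cong[where f = sqrt] integral_cong_AE m lebesgue_measurable_cong_AE[OF m ae] ae)
  with L2_norm_mono[OF f _ K unit_interval_measure(1)] show ?thesis by auto
qed

context
  fixes L :: "(real \<Rightarrow> real) \<Rightarrow> real" and M :: real and J :: "real set"
  assumes lin: "L2_linear unit_interval L" and J: "J \<in> sets borel" "J \<subseteq> {0..1}" and M: "0 \<le> M"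
    and bd: "\<And>f. L2_on unit_interval f \<Longrightarrow> \<bar>L f\<bar> \<le> M * L2_norm J f"
begin

lemma functional_linear:
  "L2_on unit_interval f \<Longrightarrow> L2_on unit_interval g \<Longrightarrow> L (\<lambda>x. a * f x + b * g x) = a * L f + b * L g"
  using lin unfolding L2_linear_def by blast

lemma functional_zero: "L (\<lambda>x. 0) = 0"
  using bd[OF L2_on_zero[OF unit_interval_measure(1)]] by (simp add: L2_norm_zero)

text \<open>The functional acts on representatives; the bound alone forces it to ignore null
  sets.\<close>

lemma functional_cong:
  assumes f: "L2_on unit_interval f" and eq: "AE x in lebesgue. x \<in> unit_interval \<longrightarrow> f x = g x"
  shows "L g = L f"
proof -
  note g = L2_on_cong_AE(1)[OF unit_interval_measure(1) f eq]
  have "L2_norm J (\<lambda>x. 1 * f x + (- 1) * g x) = 0"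
  proof -
    have "AE x in lebesgue. indicator J x *\<^sub>R (1 * f x + (- 1) * g x)\<^sup>2 = 0"
      using eq AE_not_endpoints[of 0 1]
    proof eventually_elim
      case (elim x)
      then have "x \<in> J \<Longrightarrow> f x = g x" using J(2) by force
      then show ?case by (auto simp: indicator_def)
    qed
    then show ?thesis
      unfolding L2_norm_def set_lebesgue_integral_def by (simp add: integral_eq_zero_AE)
  qed
  with bd[OF L2_on_linear[OF unit_interval_measure(1) f g, of 1 "- 1"]]
  have "L (\<lambda>x. 1 * f x + (- 1) * g x) = 0" by simp
  with functional_linear[OF f g, of 1 "- 1"] show ?thesis by simp
qed

lemma functional_sum:
  assumes "\<And>i. i \<in> I \<Longrightarrow> L2_on unit_interval (f i)"
  shows "L (\<lambda>x. \<Sum>i\<in>I. c i * f i x) = (\<Sum>i\<in>I. c i * L (f i))"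
  using assms
proof (induction I rule: infinite_finite_induct)
  case (insert i I)
  have s: "L2_on unit_interval (\<lambda>x. \<Sum>i\<in>I. c i * f i x)"
    using insert.prems by (intro L2_on_sum L2_on_cmult unit_interval_measure) auto
  show ?case
    using functional_linear[OF insert.prems[of i] s, of "c i" 1] insert by simp
qed (auto simp: functional_zero)

lemma functional_tendsto:
  assumes f: "L2_on unit_interval f" and g: "\<And>n. L2_on unit_interval (g n)"
    and lim: "(\<lambda>n::nat. L2_norm unit_interval (\<lambda>x. f x - g n x)) \<longlonglongrightarrow> 0"
  shows "(\<lambda>n. L (g n)) \<longlonglongrightarrow> L f"
proof -
  have "(\<lambda>n. L f - L (g n)) \<longlonglongrightarrow> 0"
  proof (rule Lim_null_comparison)
    show "(\<lambda>n. M * L2_norm unit_interval (\<lambda>x. f x - g n x)) \<longlonglongrightarrow> 0"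
      using tendsto_mult[OF tendsto_const[of M] lim] by simp
    have "\<bar>L f - L (g n)\<bar> \<le> M * L2_norm unit_interval (\<lambda>x. f x - g n x)" for n
    proof -
      have d: "L2_on unit_interval (\<lambda>x. f x - g n x)" by (rule L2_on_diff[OF unit_interval_measure(1) f g])
      have "L f - L (g n) = L (\<lambda>x. f x - g n x)" using functional_linear[OF f g[of n], of 1 "- 1"] by simp
      also have "\<bar>\<dots>\<bar> \<le> M * L2_norm J (\<lambda>x. f x - g n x)" by (rule bd[OF d])
      also have "\<dots> \<le> M * L2_norm unit_interval (\<lambda>x. f x - g n x)"
        by (intro mult_left_mono L2_norm_unit_le J d M)
      finally show ?thesis .
    qed
    then show "\<forall>\<^sub>F n in sequentially. norm (L f - L (g n)) \<le> M * L2_norm unit_interval (\<lambda>x. f x - g n x)"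
      by simp
  qed
  from tendsto_diff[OF tendsto_const[of "L f"] this] show ?thesis by simp
qed

lemma L2_on_unit_bounded:
  assumes "f \<in> borel_measurable borel" "\<And>x. \<bar>f x\<bar> \<le> c" shows "L2_on unit_interval f"
  using L2_on_bounded(1)[OF unit_interval_measure borel_measurable_lebesgue_on[OF assms(1)]] assms(2) by blast

lemma section_measurable:
  "G \<in> borel_measurable borel \<Longrightarrow> (\<lambda>t. G (s, t)) \<in> borel_measurable (borel :: real measure)" for G :: "real \<times> real \<Rightarrow> real"
  by (rule measurable_compose[where N = borel]) (auto intro!: borel_measurable_continuous_onI continuous_intros)

lemma section_indicator_L2:
  assumes "A \<in> sets (borel :: (real \<times> real) measure)"
  shows "L2_on unit_interval (\<lambda>t. indicator A (s, t))"
proof -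
  have "(indicator A :: _ \<Rightarrow> real) \<in> borel_measurable borel" using assms by simp
  from section_measurable[OF this] show ?thesis
    by (rule L2_on_unit_bounded[where c = 1]) (auto simp: indicator_def)
qed

text \<open>The functional is abstract, without an integral kernel, so measurability in the
  parameter s is not an instance of Fubini. It holds for rectangles, where the section is constant
  up to an indicator in s, and passes to all Borel sets by Dynkin's theorem and continuity of the
  functional.\<close>

lemma functional_section_indicator:
  assumes "A \<in> sets (borel :: (real \<times> real) measure)"
  shows "(\<lambda>s. L (\<lambda>t. indicator A (s, t))) \<in> borel_measurable borel"
proof -
  let ?E = "{a \<times> b | a b. a \<in> sets (borel :: real measure) \<and> b \<in> sets (borel :: real measure)}"
  have sb: "sets (borel :: (real \<times> real) measure) = sigma_sets UNIV ?E"
    using sets_pair_measure[of "borel :: real measure" "borel :: real measure"]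
    unfolding borel_prod space_borel UNIV_Times_UNIV .
  have "A \<in> sigma_sets UNIV ?E" using assms sb by simp
  from Int_stable_pair_measure_generator[of "borel :: real measure" "borel :: real measure"] _ this show ?thesis
  proof (rule sigma_sets_induct_disjoint)
    fix A assume "A \<in> ?E"
    then obtain a b where ab: "A = a \<times> b" "a \<in> sets borel" "b \<in> sets borel" by blast
    have b: "L2_on unit_interval (indicator b)"
      by (rule L2_on_unit_bounded[where c = 1]) (use ab in \<open>auto simp: indicator_def\<close>)
    have "(\<lambda>s. L (\<lambda>t. indicator A (s, t))) = (\<lambda>s. indicator a s * L (indicator b))"
      using functional_linear[OF b b, of _ 0] by (auto simp: ab indicator_times)
    then show "(\<lambda>s. L (\<lambda>t. indicator A (s, t))) \<in> borel_measurable borel" using ab by simp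
  next
    show "(\<lambda>s. L (\<lambda>t. indicator {} (s, t))) \<in> borel_measurable borel" by (simp add: functional_zero)
  next
    fix A assume A: "A \<in> sigma_sets UNIV ?E" "(\<lambda>s. L (\<lambda>t. indicator A (s, t))) \<in> borel_measurable borel"
    have 1: "L2_on unit_interval (\<lambda>t. 1)" by (rule L2_on_unit_bounded[where c = 1]) auto
    have 2: "L2_on unit_interval (\<lambda>t. indicator A (s, t))" for s
      using A(1) sb by (intro section_indicator_L2) simp
    have "(\<lambda>s. L (\<lambda>t. indicator (UNIV - A) (s, t))) = (\<lambda>s. L (\<lambda>t. 1 * 1 + (- 1) * indicator A (s, t)))"
      by (intro ext arg_cong[where f = L]) (auto simp: indicator_def)
    also have "\<dots> = (\<lambda>s. L (\<lambda>t. 1) - L (\<lambda>t. indicator A (s, t)))"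
      using functional_linear[OF 1 2, of 1 "- 1"] by simp
    finally show "(\<lambda>s. L (\<lambda>t. indicator (UNIV - A) (s, t))) \<in> borel_measurable borel" using A(2) by simp
  next
    fix A :: "nat \<Rightarrow> (real \<times> real) set"
    assume A: "disjoint_family A" "range A \<subseteq> sigma_sets UNIV ?E"
      "\<And>i. (\<lambda>s. L (\<lambda>t. indicator (A i) (s, t))) \<in> borel_measurable borel"
    have Ab: "A i \<in> sets borel" for i using A(2) sb by auto
    have sec: "L2_on unit_interval (\<lambda>t. indicator (A i) (s, t))" for i s by (rule section_indicator_L2[OF Ab])
    have U: "(\<Union>i. A i) \<in> sets borel" using Ab by auto
    have eq: "(\<Sum>i<n. 1 * indicator (A i) x) = (indicator (\<Union>i<n. A i) x :: real)" for n x
      using A(1) by (subst indicator_UN_disjoint) (auto simp: disjoint_family_on_def)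
    show "(\<lambda>s. L (\<lambda>t. indicator (\<Union>i. A i) (s, t))) \<in> borel_measurable borel"
    proof (rule borel_measurable_LIMSEQ_real)
      fix s
      have "(\<lambda>n. L (\<lambda>t. \<Sum>i<n. 1 * indicator (A i) (s, t))) \<longlonglongrightarrow> L (\<lambda>t. indicator (\<Union>i. A i) (s, t))"
      proof (rule functional_tendsto)
        show "L2_on unit_interval (\<lambda>t. indicator (\<Union>i. A i) (s, t))" by (rule section_indicator_L2[OF U])
        show "L2_on unit_interval (\<lambda>t. \<Sum>i<n. 1 * indicator (A i) (s, t))" for n
          using sec by (intro L2_on_sum L2_on_cmult unit_interval_measure)
        show "(\<lambda>n. L2_norm unit_interval (\<lambda>t. indicator (\<Union>i. A i) (s, t) - (\<Sum>i<n. 1 * indicator (A i) (s, t)))) \<longlonglongrightarrow> 0"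
          unfolding eq
        proof (rule L2_norm_tendsto_0[OF unit_interval_measure(1)])
          show "L2_on unit_interval (\<lambda>t. 1)" by (rule L2_on_unit_bounded[where c = 1]) auto
          show "(\<lambda>t. indicator (\<Union>i. A i) (s, t) - indicator (\<Union>i<n. A i) (s, t) :: real) \<in>
            borel_measurable (lebesgue_on unit_interval)" for n
            by (intro borel_measurable_lebesgue_on borel_measurable_diff section_measurable borel_measurable_indicator U)
              (use Ab in auto)
          show "\<bar>indicator (\<Union>i. A i) (s, t) - indicator (\<Union>i<n. A i) (s, t) :: real\<bar> \<le> 1" for n t
            by (auto simp: indicator_def)
          show "(\<lambda>n. indicator (\<Union>i. A i) (s, t) - indicator (\<Union>i<n. A i) (s, t) :: real) \<longlonglongrightarrow> 0" for t
          proof (rule tendsto_eventually)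
            show "\<forall>\<^sub>F n in sequentially. indicator (\<Union>i. A i) (s, t) - indicator (\<Union>i<n. A i) (s, t) = (0::real)"
            proof (cases "(s, t) \<in> (\<Union>i. A i)")
              case True
              then obtain i where i: "(s, t) \<in> A i" by blast
              show ?thesis using eventually_gt_at_top[of i]
              proof eventually_elim
                case (elim n)
                then have "(s, t) \<in> (\<Union>i<n. A i)" using i by blast
                with True show ?case by (simp only: indicator_simps)
              qed
            qed (auto simp: indicator_def)
          qed
        qed
      qed
      then show "(\<lambda>n. \<Sum>i<n. 1 * L (\<lambda>t. indicator (A i) (s, t))) \<longlonglongrightarrow> L (\<lambda>t. indicator (\<Union>i. A i) (s, t))"
        by (subst (asm) functional_sum) (rule sec)
    qed (use A(3) in simp)
  qed simp
qed

text \<open>Sections of simple functions are combinations of indicators; they converge in L2 by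
  domination. The default 0 is needed because nothing is known about the functional off L2.\<close>

lemma functional_section_measurable:
  fixes G :: "real \<times> real \<Rightarrow> real"
  assumes G: "G \<in> borel_measurable borel"
  shows "(\<lambda>s. if L2_on unit_interval (\<lambda>t. G (s, t)) then L (\<lambda>t. G (s, t)) else 0) \<in> borel_measurable borel"
proof -
  let ?P = "\<lambda>s. L2_on unit_interval (\<lambda>t. G (s, t))"
  have P: "Measurable.pred borel ?P"
  proof -
    have [measurable]: "G \<in> borel_measurable (borel \<Otimes>\<^sub>M borel)" using G by (simp add: borel_prod)
    have "(\<lambda>s. \<integral>\<^sup>+t. indicator unit_interval t * ennreal ((G (s, t))\<^sup>2) \<partial>lborel) \<in> borel_measurable borel"
      by measurable
    then show ?thesis
      using L2_on_borel_iff(1)[OF _ section_measurable[OF G]] by simp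
  qed
  obtain u where u: "\<And>i. simple_function borel (u i)" "\<And>x. (\<lambda>i. u i x) \<longlonglongrightarrow> G x"
    "\<And>i x. dist (u i x) 0 \<le> 2 * dist (G x) 0"
    using borel_measurable_implies_sequence_metric[OF G, of 0] by auto
  have um: "u i \<in> borel_measurable borel" for i using borel_measurable_simple_function[OF u(1)] by simp
  have Ai: "u i -` {y} \<in> sets borel" for i y using measurable_sets[OF um, of "{y}"] by simp
  have rep: "(\<Sum>y\<in>range (u i). y * indicator (u i -` {y}) x) = u i x" for i x
  proof -
    have "(\<Sum>y\<in>range (u i). y * indicator (u i -` {y}) x) =
        (\<Sum>y\<in>u i ` space borel. indicator (u i -` {y} \<inter> space borel) x *\<^sub>R y)"
      by (simp only: space_borel Int_UNIV_right real_scaleR_def mult.commute)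
    also have "\<dots> = u i x"
      by (rule simple_function_indicator_representation_banach[OF u(1), symmetric]) simp
    finally show ?thesis .
  qed
  have Lu: "(\<lambda>s. L (\<lambda>t. u i (s, t))) \<in> borel_measurable borel" for i
  proof -
    have "L (\<lambda>t. u i (s, t)) = (\<Sum>y\<in>range (u i). y * L (\<lambda>t. indicator (u i -` {y}) (s, t)))" for s
      unfolding rep[symmetric, of i "(s, _)"] by (rule functional_sum[OF section_indicator_L2[OF Ai]])
    then show ?thesis
      using functional_section_indicator[OF Ai] by (simp only:) (intro borel_measurable_sum borel_measurable_times borel_measurable_const)
  qed
  show ?thesis
  proof (rule borel_measurable_LIMSEQ_real)
    show "(\<lambda>s. if ?P s then L (\<lambda>t. u i (s, t)) else 0) \<in> borel_measurable borel" for i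
      using P Lu[of i] by (intro measurable_If) (auto simp: pred_def)
    fix s
    show "(\<lambda>i. if ?P s then L (\<lambda>t. u i (s, t)) else 0) \<longlonglongrightarrow> (if ?P s then L (\<lambda>t. G (s, t)) else 0)"
    proof (cases "?P s")
      case True
      have l3: "L2_on unit_interval (\<lambda>t. 3 * \<bar>G (s, t)\<bar>)"
        using L2_on_cmult[OF unit_interval_measure(1) True, of 3]
          borel_measurable_lebesgue_on[of "\<lambda>t. 3 * \<bar>G (s, t)\<bar>"] section_measurable[OF G, of s]
        by (auto simp: L2_on_iff[OF unit_interval_measure(1)] power_mult_distrib)
      have "L2_on unit_interval (\<lambda>t. u i (s, t))" for i
      proof -
        have ub: "\<bar>u i (s, t)\<bar> \<le> 2 * \<bar>G (s, t)\<bar>" for t using u(3)[of i "(s, t)"] by simp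
        have "integrable (lebesgue_on unit_interval) (\<lambda>t. (u i (s, t))\<^sup>2)"
        proof (rule Bochner_Integration.integrable_bound)
          show "integrable (lebesgue_on unit_interval) (\<lambda>t. (3 * \<bar>G (s, t)\<bar>)\<^sup>2)"
            using l3 by (simp add: L2_on_iff[OF unit_interval_measure(1)])
          have "(u i (s, t))\<^sup>2 \<le> (3 * \<bar>G (s, t)\<bar>)\<^sup>2" for t
            using power_mono[of "\<bar>u i (s, t)\<bar>" "3 * \<bar>G (s, t)\<bar>" 2] ub[of t] by simp
          then show "AE t in lebesgue_on unit_interval. norm ((u i (s, t))\<^sup>2) \<le> norm ((3 * \<bar>G (s, t)\<bar>)\<^sup>2)"
            by (intro AE_I2) simp
          show "(\<lambda>t. (u i (s, t))\<^sup>2) \<in> borel_measurable (lebesgue_on unit_interval)"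
            using section_measurable[OF um[of i], of s] by (intro borel_measurable_lebesgue_on) simp
        qed
        then show ?thesis
          using borel_measurable_lebesgue_on[OF section_measurable[OF um[of i], of s]]
          by (simp add: L2_on_iff[OF unit_interval_measure(1)])
      qed
      moreover have "(\<lambda>i. L2_norm unit_interval (\<lambda>t. G (s, t) - u i (s, t))) \<longlonglongrightarrow> 0"
      proof (rule L2_norm_tendsto_0[OF unit_interval_measure(1) l3])
        show "(\<lambda>t. G (s, t) - u i (s, t)) \<in> borel_measurable (lebesgue_on unit_interval)" for i
          by (intro borel_measurable_lebesgue_on borel_measurable_diff section_measurable G um)
        show "(\<lambda>i. G (s, t) - u i (s, t)) \<longlonglongrightarrow> 0" for t
          using tendsto_diff[OF tendsto_const[of "G (s, t)"] u(2)[of "(s, t)"]] by simp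
        show "\<bar>G (s, t) - u i (s, t)\<bar> \<le> 3 * \<bar>G (s, t)\<bar>" for i t
          using u(3)[of i "(s, t)"] by simp
      qed
      ultimately have "(\<lambda>i. L (\<lambda>t. u i (s, t))) \<longlonglongrightarrow> L (\<lambda>t. G (s, t))"
        by (rule functional_tendsto[OF True])
      then show ?thesis using True by simp
    qed simp
  qed
qed

text \<open>The squared value of the functional on a section is at most M^2 times the squared norm
  of that section; integrating in s by Tonelli gives M N. G is a Borel representative, and
  \<open>eq\<close> transfers the result to F on almost every line.\<close>

lemma functional_section_L2:
  fixes F G :: "real \<times> real \<Rightarrow> real"
  assumes G: "G \<in> borel_measurable borel" and fin: "(\<integral>\<^sup>+z. ennreal ((G z)\<^sup>2) \<partial>lborel) \<le> ennreal (N\<^sup>2)" and N: "0 \<le> N"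
    and eq: "AE s in lborel. AE t in lborel. F (s, t) = G (s, t)"
    and I: "I \<in> sets borel"
  shows "AE s in lborel. L2_on unit_interval (\<lambda>t. F (s, t))"
    "L2_on unit_interval (\<lambda>s. L (\<lambda>t. F (s, t)))"
    "L2_norm I (\<lambda>s. L (\<lambda>t. F (s, t))) \<le> M * N"
proof -
  let ?P = "\<lambda>s. L2_on unit_interval (\<lambda>t. G (s, t))"
  define \<Phi> where "\<Phi> s = (if ?P s then L (\<lambda>t. G (s, t)) else 0)" for s
  have \<Phi>m: "\<Phi> \<in> borel_measurable borel" unfolding \<Phi>_def by (rule functional_section_measurable[OF G])
  define q where "q s = (\<integral>\<^sup>+t. ennreal ((G (s, t))\<^sup>2) \<partial>lborel)" for s
  have Gp [measurable]: "G \<in> borel_measurable (borel \<Otimes>\<^sub>M borel)" using G by (simp add: borel_prod)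
  have qm: "q \<in> borel_measurable borel" unfolding q_def by measurable
  have "(\<lambda>z. ennreal ((G z)\<^sup>2)) \<in> borel_measurable (lborel \<Otimes>\<^sub>M lborel)"
    by measurable
  from lborel.nn_integral_fst[OF this]
  have qint: "(\<integral>\<^sup>+s. q s \<partial>lborel) = (\<integral>\<^sup>+z. ennreal ((G z)\<^sup>2) \<partial>lborel)"
    by (simp add: q_def lborel_prod)
  then have "(\<integral>\<^sup>+s. q s \<partial>lborel) \<noteq> \<infinity>" using fin by (auto simp: top_unique)
  then have "AE s in lborel. q s \<noteq> \<infinity>"
    using qm by (intro nn_integral_PInf_AE) auto
  then have AEP: "AE s in lborel. ?P s"
  proof eventually_elim
    case (elim s)
    have "(\<integral>\<^sup>+t. indicator unit_interval t * ennreal ((G (s, t))\<^sup>2) \<partial>lborel) \<le> q s"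
      unfolding q_def by (intro nn_integral_mono) (auto simp: indicator_def)
    also have "\<dots> < \<infinity>" using elim by (simp add: less_top)
    finally show ?case using L2_on_borel_iff(1)[OF _ section_measurable[OF G, of s], of unit_interval] by simp
  qed
  have sec: "L2_on unit_interval (\<lambda>t. F (s, t)) \<and> L (\<lambda>t. F (s, t)) = \<Phi> s"
    if P: "?P s" and ae: "AE t in lborel. F (s, t) = G (s, t)" for s
  proof -
    have "AE t in lebesgue. t \<in> unit_interval \<longrightarrow> G (s, t) = F (s, t)"
      using AE_completion[OF ae] by eventually_elim auto
    from L2_on_cong_AE(1)[OF unit_interval_measure(1) P this] functional_cong[OF P this] P
    show ?thesis by (simp add: \<Phi>_def)
  qed
  have ae: "AE s in lborel. L2_on unit_interval (\<lambda>t. F (s, t)) \<and> L (\<lambda>t. F (s, t)) = \<Phi> s"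
    using AEP eq by eventually_elim (rule sec)
  then show "AE s in lborel. L2_on unit_interval (\<lambda>t. F (s, t))" by eventually_elim auto
  have ael: "AE s in lebesgue. \<Phi> s = L (\<lambda>t. F (s, t))" using AE_completion[OF ae] by eventually_elim auto
  have \<Phi>le: "ennreal ((\<Phi> s)\<^sup>2) \<le> ennreal (M\<^sup>2) * q s" for s
  proof (cases "?P s")
    case True
    have "\<bar>\<Phi> s\<bar> \<le> M * L2_norm J (\<lambda>t. G (s, t))" using bd[OF True] True by (simp add: \<Phi>_def)
    also have "\<dots> \<le> M * L2_norm unit_interval (\<lambda>t. G (s, t))" by (intro mult_left_mono L2_norm_unit_le J True M)
    finally have "(\<Phi> s)\<^sup>2 \<le> (M * L2_norm unit_interval (\<lambda>t. G (s, t)))\<^sup>2"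
      using power_mono[of "\<bar>\<Phi> s\<bar>" _ 2] by simp
    then have "ennreal ((\<Phi> s)\<^sup>2) \<le> ennreal (M\<^sup>2) * ennreal ((L2_norm unit_interval (\<lambda>t. G (s, t)))\<^sup>2)"
      by (subst ennreal_mult[symmetric]) (auto simp: power_mult_distrib intro: ennreal_leI)
    also have "ennreal ((L2_norm unit_interval (\<lambda>t. G (s, t)))\<^sup>2) =
        (\<integral>\<^sup>+t. indicator unit_interval t * ennreal ((G (s, t))\<^sup>2) \<partial>lborel)"
      using L2_on_borel_iff(2)[OF _ section_measurable[OF G] True] by simp
    also have "\<dots> \<le> q s" unfolding q_def by (intro nn_integral_mono) (auto simp: indicator_def)
    finally show ?thesis by (simp add: mult_left_mono)
  qed (simp add: \<Phi>_def)
  have tot: "(\<integral>\<^sup>+s. indicator K s * ennreal ((\<Phi> s)\<^sup>2) \<partial>lborel) \<le> ennreal ((M * N)\<^sup>2)" for K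
  proof -
    have "(\<integral>\<^sup>+s. indicator K s * ennreal ((\<Phi> s)\<^sup>2) \<partial>lborel) \<le> (\<integral>\<^sup>+s. ennreal (M\<^sup>2) * q s \<partial>lborel)"
      by (intro nn_integral_mono) (use \<Phi>le in \<open>auto simp: indicator_def\<close>)
    also have "\<dots> = ennreal (M\<^sup>2) * (\<integral>\<^sup>+s. q s \<partial>lborel)" using qm by (intro nn_integral_cmult) simp
    also have "\<dots> \<le> ennreal (M\<^sup>2) * ennreal (N\<^sup>2)" unfolding qint by (intro mult_left_mono fin) simp
    also have "\<dots> = ennreal ((M * N)\<^sup>2)" by (simp add: ennreal_mult power_mult_distrib)
    finally show ?thesis .
  qed
  have \<Phi>L: "L2_on K \<Phi>" "L2_norm K \<Phi> \<le> M * N" if K: "K \<in> sets borel" for K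
  proof -
    show L: "L2_on K \<Phi>"
      using tot[of K] by (subst L2_on_borel_iff(1)[OF K \<Phi>m]) (auto simp: less_top[symmetric] top_unique)
    have "(L2_norm K \<Phi>)\<^sup>2 \<le> (M * N)\<^sup>2"
      using tot[of K] unfolding L2_on_borel_iff(2)[OF K \<Phi>m L] by (simp add: ennreal_le_iff)
    then show "L2_norm K \<Phi> \<le> M * N" by (rule power2_le_imp_le) (use M N in simp)
  qed
  have c: "AE x in lebesgue. x \<in> K \<longrightarrow> \<Phi> x = L (\<lambda>t. F (x, t))" for K
    using ael by eventually_elim auto
  show "L2_on unit_interval (\<lambda>s. L (\<lambda>t. F (s, t)))"
    by (rule L2_on_cong_AE(1)[OF unit_interval_measure(1) \<Phi>L(1) c]) simp
  have "I \<in> sets lebesgue" using I by auto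
  from L2_on_cong_AE(2)[OF this \<Phi>L(1)[OF I] c] \<Phi>L(2)[OF I]
  show "L2_norm I (\<lambda>s. L (\<lambda>t. F (s, t))) \<le> M * N" by simp
qed

end

text \<open>The image of a parameter rectangle under the singular map (for s1 \<ge> 0), described by
  linear inequalities, from which openness and convexity are evident.\<close>

definition trapezoid :: "real \<Rightarrow> real \<Rightarrow> real \<Rightarrow> real \<Rightarrow> (real \<times> real) set" where
  "trapezoid s1 s2 t1 t2 = {z. s1 < fst z \<and> fst z < s2 \<and> t1 * fst z < snd z \<and> snd z < t2 * fst z}"

lemma open_trapezoid: "open (trapezoid s1 s2 t1 t2)"
  unfolding trapezoid_def by (intro open_Collect_conj open_Collect_less continuous_intros)

lemma convex_trapezoid: "convex (trapezoid s1 s2 t1 t2)"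
proof -
  have "trapezoid s1 s2 t1 t2 = {z. inner (1, 0) z > s1} \<inter> {z. inner (1, 0) z < s2} \<inter>
      {z. inner (- t1, 1) z > 0} \<inter> {z. inner (- t2, 1) z < 0}"
    by (auto simp: trapezoid_def inner_prod_def)
  then show ?thesis
    by (simp only:) (intro convex_Int convex_halfspace_gt convex_halfspace_lt)
qed

lemma AE_lborel_scale:
  fixes s :: real
  assumes P: "AE v in lborel. P v" and s: "s \<noteq> 0"
  shows "AE t in lborel. P (s * t)"
proof -
  obtain N where N: "{v. \<not> P v} \<subseteq> N" "N \<in> null_sets lborel"
    using P by (auto simp: eventually_ae_filter)
  have Nb: "N \<in> sets borel" using N(2) by auto
  have "(\<integral>\<^sup>+v. indicator N v \<partial>lborel) = ennreal \<bar>s\<bar> * (\<integral>\<^sup>+t. indicator N (0 + s * t) \<partial>lborel)"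
    using Nb by (intro nn_integral_real_affine s) simp
  moreover have "(\<integral>\<^sup>+v. indicator N v \<partial>lborel) = 0" using N(2) Nb by auto
  ultimately have "(\<integral>\<^sup>+t. indicator N (s * t) \<partial>lborel) = 0" using s by simp
  then have "AE t in lborel. indicator N (s * t) = (0 :: ennreal)"
    using Nb by (subst (asm) nn_integral_0_iff_AE) auto
  then show ?thesis by eventually_elim (use N(1) in \<open>auto simp: indicator_def split: if_splits\<close>)
qed

text \<open>On the line u = s the substitution v = s t has Jacobian s, and 1/s \<le> 1/s1 on I. The
  pull-back is therefore square integrable away from the vertex.\<close>

lemma duffy_nn_integral_le:
  assumes f: "f \<in> borel_measurable borel" and s1: "0 < s1" and I: "I \<subseteq> {s1..}"
    and IJ: "I \<in> sets borel" "J \<in> sets borel"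
  shows "(\<integral>\<^sup>+z. ennreal ((indicator (I \<times> J) z * f (duffy z))\<^sup>2) \<partial>lborel) \<le>
    ennreal (1 / s1) * (\<integral>\<^sup>+z. ennreal ((f z)\<^sup>2) \<partial>lborel)"
proof -
  have dm: "duffy \<in> borel_measurable borel"
    unfolding duffy_def case_prod_unfold by (intro borel_measurable_continuous_onI continuous_intros)
  have [measurable]: "f \<in> borel_measurable (borel \<Otimes>\<^sub>M borel)" using f by (simp add: borel_prod)
  have IJp: "I \<times> J \<in> sets borel"
    using pair_measureI[OF IJ] unfolding borel_prod .
  have m: "(\<lambda>z. indicator (I \<times> J) z * f (duffy z)) \<in> borel_measurable borel"
    using IJp measurable_compose[OF dm f] by simp
  have m': "(\<lambda>z. ennreal ((indicator (I \<times> J) z * f (duffy z))\<^sup>2)) \<in> borel_measurable (lborel \<Otimes>\<^sub>M lborel)"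
    using m by (simp add: lborel_prod)
  have f2: "(\<lambda>z. ennreal ((f z)\<^sup>2)) \<in> borel_measurable (lborel \<Otimes>\<^sub>M lborel)"
    using f by (simp add: lborel_prod)
  have sec: "(\<lambda>v. f (s, v)) \<in> borel_measurable borel" for s by measurable
  have "(\<integral>\<^sup>+z. ennreal ((indicator (I \<times> J) z * f (duffy z))\<^sup>2) \<partial>lborel) =
      (\<integral>\<^sup>+s. \<integral>\<^sup>+t. ennreal ((indicator (I \<times> J) (s, t) * f (duffy (s, t)))\<^sup>2) \<partial>lborel \<partial>lborel)"
    using lborel.nn_integral_fst[OF m'] by (simp add: lborel_prod)
  also have "\<dots> \<le> (\<integral>\<^sup>+s. ennreal (1 / s1) * (\<integral>\<^sup>+v. ennreal ((f (s, v))\<^sup>2) \<partial>lborel) \<partial>lborel)"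
  proof (intro nn_integral_mono)
    fix s
    let ?X = "\<integral>\<^sup>+v. ennreal ((f (s, v))\<^sup>2) \<partial>lborel"
    show "(\<integral>\<^sup>+t. ennreal ((indicator (I \<times> J) (s, t) * f (duffy (s, t)))\<^sup>2) \<partial>lborel) \<le> ennreal (1 / s1) * ?X"
    proof (cases "s \<in> I")
      case True
      then have s: "s1 \<le> s" "0 < s" using I s1 by auto
      have "?X = ennreal \<bar>s\<bar> * (\<integral>\<^sup>+t. ennreal ((f (s, 0 + s * t))\<^sup>2) \<partial>lborel)"
        by (rule nn_integral_real_affine) (use s sec in auto)
      then have "ennreal (1 / s) * ?X = (ennreal (1 / s) * ennreal s) * (\<integral>\<^sup>+t. ennreal ((f (s, s * t))\<^sup>2) \<partial>lborel)"
        using s by (simp add: mult.assoc)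
      also have "ennreal (1 / s) * ennreal s = 1" using s by (simp add: ennreal_mult[symmetric])
      finally have X: "(\<integral>\<^sup>+t. ennreal ((f (s, s * t))\<^sup>2) \<partial>lborel) = ennreal (1 / s) * ?X" by simp
      have "(\<integral>\<^sup>+t. ennreal ((indicator (I \<times> J) (s, t) * f (duffy (s, t)))\<^sup>2) \<partial>lborel) \<le>
          (\<integral>\<^sup>+t. ennreal ((f (s, s * t))\<^sup>2) \<partial>lborel)"
        by (intro nn_integral_mono) (auto simp: indicator_def duffy_def)
      also have "\<dots> \<le> ennreal (1 / s1) * ?X"
        unfolding X using s s1 by (intro mult_right_mono ennreal_leI) (auto simp: divide_simps)
      finally show ?thesis .
    qed (simp add: indicator_def)
  qed
  also have "\<dots> = ennreal (1 / s1) * (\<integral>\<^sup>+s. \<integral>\<^sup>+v. ennreal ((f (s, v))\<^sup>2) \<partial>lborel \<partial>lborel)"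
    by (intro nn_integral_cmult) measurable
  also have "(\<integral>\<^sup>+s. \<integral>\<^sup>+v. ennreal ((f (s, v))\<^sup>2) \<partial>lborel \<partial>lborel) = (\<integral>\<^sup>+z. ennreal ((f z)\<^sup>2) \<partial>lborel)"
    using lborel.nn_integral_fst[OF f2] by (simp add: lborel_prod)
  finally show ?thesis .
qed

text \<open>The absolute value, since \<open>bspline_dual\<close> does not state the sign of its
  constant.\<close>

definition dual_const :: "nat \<Rightarrow> real \<Rightarrow> nat \<Rightarrow> nat \<Rightarrow> real" where
  "dual_const p Cp n k = \<bar>Cp\<bar> * measure lebesgue (bspline_supp p n k) powr (- 1 / 2)"

abbreviation tensor_trapezoid :: "nat \<Rightarrow> nat \<Rightarrow> nat \<Rightarrow> nat \<Rightarrow> nat \<Rightarrow> (real \<times> real) set" where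
  "tensor_trapezoid p n k m l \<equiv> trapezoid (open_knot p n k) (open_knot p n (k + p + 1))
     (open_knot p m l) (open_knot p m (l + p + 1))"

context
  fixes p :: nat and Cp :: real and lam :: "nat \<Rightarrow> nat \<Rightarrow> (real \<Rightarrow> real) \<Rightarrow> real"
  assumes dual: "bspline_dual p Cp lam"
begin

lemma dual_functional:
  assumes k: "k \<in> {1..2 ^ n + p}"
  shows "L2_linear unit_interval (lam n k)" "bspline_supp p n k \<in> sets borel" "bspline_supp p n k \<subseteq> {0..1}"
    "0 \<le> dual_const p Cp n k"
    "L2_on unit_interval f \<Longrightarrow> \<bar>lam n k f\<bar> \<le> dual_const p Cp n k * L2_norm (bspline_supp p n k) f"
proof -
  have k': "1 \<le> k" "k \<le> 2 ^ n + p" using k by auto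
  show "L2_linear unit_interval (lam n k)" using dual k unfolding bspline_dual_def by blast
  show "bspline_supp p n k \<in> sets borel" unfolding bspline_supp_def by simp
  show "bspline_supp p n k \<subseteq> {0..1}"
    unfolding bspline_supp_eq[OF k'] using open_knot_bounds(1)[of p n k] open_knot_bounds(2)[of p n "k + p + 1"] by auto
  show "0 \<le> dual_const p Cp n k" unfolding dual_const_def by simp
  assume f: "L2_on unit_interval f"
  have "\<bar>lam n k f\<bar> \<le> Cp * measure lebesgue (bspline_supp p n k) powr (- 1 / 2) * L2_norm (bspline_supp p n k) f"
    using dual k f unfolding bspline_dual_def by blast
  also have "\<dots> \<le> dual_const p Cp n k * L2_norm (bspline_supp p n k) f"
    unfolding dual_const_def by (intro mult_right_mono L2_norm_nonneg) auto
  finally show "\<bar>lam n k f\<bar> \<le> dual_const p Cp n k * L2_norm (bspline_supp p n k) f" .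
qed

context
  fixes n k m l :: nat
  assumes k: "k \<in> {1..2 ^ n + p}" and l: "l \<in> {1..2 ^ m + p}" and pos: "0 < open_knot p n k"
begin

text \<open>The inner functional, applied in t, yields a square integrable function of s. The
  support starts at s = \<open>open_knot p n k\<close>, so the Jacobian costs the reciprocal square
  root of this knot.\<close>

lemma tensor_section:
  assumes \<phi>: "L2_on (tensor_trapezoid p n k m l) \<phi>"
  defines "F \<equiv> \<lambda>s t. indicator (bspline_supp p n k \<times> bspline_supp p m l) (s, t) * (\<phi> \<circ> duffy) (s, t)"
  shows "AE s in lborel. L2_on unit_interval (F s)"
    "L2_on unit_interval (\<lambda>s. lam m l (F s))"
    "L2_norm (bspline_supp p n k) (\<lambda>s. lam m l (F s)) \<le>
      dual_const p Cp m l * (L2_norm (tensor_trapezoid p n k m l) \<phi> / sqrt (open_knot p n k))"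
proof -
  let ?T = "tensor_trapezoid p n k m l" and ?I = "bspline_supp p n k" and ?J = "bspline_supp p m l"
  have k': "1 \<le> k" "k \<le> 2 ^ n + p" and l': "1 \<le> l" "l \<le> 2 ^ m + p" using k l by auto
  note I = bspline_supp_eq[OF k'] and J = bspline_supp_eq[OF l']
  have Tb: "?T \<in> sets borel" using open_trapezoid by auto
  then have Tl: "?T \<in> sets lebesgue" by auto
  have "(\<lambda>x. indicator ?T x *\<^sub>R \<phi> x) \<in> borel_measurable lebesgue"
    using \<phi> by (simp add: L2_on_def set_borel_measurable_def)
  then obtain f0 where f0: "f0 \<in> borel_measurable borel" "AE x in lborel. indicator ?T x *\<^sub>R \<phi> x = f0 x"
    by (rule lebesgue_borel_representative)
  define f where "f x = indicator ?T x * f0 x" for x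
  have f: "f \<in> borel_measurable borel" unfolding f_def using Tb f0(1) by simp
  have ae: "AE x in lborel. x \<in> ?T \<longrightarrow> \<phi> x = f x"
    using f0(2) by eventually_elim (auto simp: f_def)
  have ael: "AE x in lebesgue. x \<in> ?T \<longrightarrow> \<phi> x = f x" by (rule AE_completion[OF ae])
  note fL = L2_on_cong_AE[OF Tl \<phi> ael]
  define N where "N = L2_norm ?T \<phi> / sqrt (open_knot p n k)"
  have N: "0 \<le> N" unfolding N_def using pos by (simp add: L2_norm_nonneg)
  define G where "G z = indicator (?I \<times> ?J) z * f (duffy z)" for z
  have IJb: "?I \<in> sets borel" "?J \<in> sets borel" using I J by auto
  have dm: "duffy \<in> borel_measurable borel"
    unfolding duffy_def case_prod_unfold by (intro borel_measurable_continuous_onI continuous_intros)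
  have "?I \<times> ?J \<in> sets borel" using pair_measureI[OF IJb] unfolding borel_prod .
  then have Gm: "G \<in> borel_measurable borel"
    unfolding G_def using measurable_compose[OF dm f] by simp
  have "(\<integral>\<^sup>+z. ennreal ((G z)\<^sup>2) \<partial>lborel) \<le> ennreal (1 / open_knot p n k) * (\<integral>\<^sup>+z. ennreal ((f z)\<^sup>2) \<partial>lborel)"
    unfolding G_def by (rule duffy_nn_integral_le[OF f pos _ IJb]) (use I in auto)
  also have "(\<integral>\<^sup>+z. ennreal ((f z)\<^sup>2) \<partial>lborel) = (\<integral>\<^sup>+z. indicator ?T z * ennreal ((f z)\<^sup>2) \<partial>lborel)"
    by (intro nn_integral_cong) (auto simp: f_def indicator_def)
  also have "\<dots> = ennreal ((L2_norm ?T f)\<^sup>2)" by (rule L2_on_borel_iff(2)[OF Tb f fL(1)])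
  also have "ennreal (1 / open_knot p n k) * ennreal ((L2_norm ?T f)\<^sup>2) = ennreal (N\<^sup>2)"
    using pos fL(2) by (subst ennreal_mult[symmetric]) (auto simp: N_def power_divide)
  finally have fin: "(\<integral>\<^sup>+z. ennreal ((G z)\<^sup>2) \<partial>lborel) \<le> ennreal (N\<^sup>2)" .
  have "AE z in lborel \<Otimes>\<^sub>M lborel. z \<in> ?T \<longrightarrow> \<phi> z = f z"
    unfolding lborel_prod by (rule ae)
  then have "AE s in lborel. AE v in lborel. (s, v) \<in> ?T \<longrightarrow> \<phi> (s, v) = f (s, v)"
    by (rule lborel_pair.AE_pair)
  moreover have "AE s in lborel. s \<noteq> open_knot p n k \<and> s \<noteq> open_knot p n (k + p + 1)"
    using AE_lborel_singleton[of "open_knot p n k"] AE_lborel_singleton[of "open_knot p n (k + p + 1)"]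
    by eventually_elim auto
  \<comment> \<open>Equality almost everywhere in the plane gives equality on almost every vertical
    line, and the scaling v = s t preserves null sets as s > 0. The boundary of the support
    rectangle is removed separately, because the trapezoid is open and the support closed.\<close>
  ultimately have eq: "AE s in lborel. AE t in lborel. F s t = G (s, t)"
  proof eventually_elim
    case (elim s)
    show ?case
    proof (cases "s \<in> ?I")
      case True
      then have s: "open_knot p n k < s" "s < open_knot p n (k + p + 1)" using elim(2) I by auto
      then have s0: "0 < s" using pos by simp
      then have "AE t in lborel. (s, s * t) \<in> ?T \<longrightarrow> \<phi> (s, s * t) = f (s, s * t)"
        using AE_lborel_scale[OF elim(1), of s] by simp
      then show ?thesis
        using AE_lborel_singleton[of "open_knot p m l"] AE_lborel_singleton[of "open_knot p m (l + p + 1)"]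
      proof eventually_elim
        case (elim t)
        show ?case
        proof (cases "t \<in> ?J")
          case True
          then have t: "open_knot p m l < t" "t < open_knot p m (l + p + 1)" using elim(2,3) J by auto
          then have "(s, s * t) \<in> ?T" using s s0 by (simp add: trapezoid_def mult.commute)
          then show ?thesis using elim(1) by (simp add: F_def G_def duffy_def)
        qed (simp add: F_def G_def)
      qed
    qed (simp add: F_def G_def)
  qed
  show "AE s in lborel. L2_on unit_interval (F s)"
    using functional_section_L2(1)[OF dual_functional(1-4)[OF l] dual_functional(5)[OF l] Gm fin N _ IJb(1), of "\<lambda>z. F (fst z) (snd z)"] eq
    by simp
  show "L2_on unit_interval (\<lambda>s. lam m l (F s))"
    using functional_section_L2(2)[OF dual_functional(1-4)[OF l] dual_functional(5)[OF l] Gm fin N _ IJb(1), of "\<lambda>z. F (fst z) (snd z)"] eq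
    by simp
  show "L2_norm ?I (\<lambda>s. lam m l (F s)) \<le> dual_const p Cp m l * (L2_norm ?T \<phi> / sqrt (open_knot p n k))"
    using functional_section_L2(3)[OF dual_functional(1-4)[OF l] dual_functional(5)[OF l] Gm fin N _ IJb(1), of "\<lambda>z. F (fst z) (snd z)"] eq
    by (simp add: N_def)
qed

lemma tensor_functional_bound:
  assumes \<phi>: "L2_on (tensor_trapezoid p n k m l) \<phi>"
  shows "\<bar>tensor_functional p lam n k m l (\<phi> \<circ> duffy)\<bar> \<le>
    dual_const p Cp n k * dual_const p Cp m l * (L2_norm (tensor_trapezoid p n k m l) \<phi> / sqrt (open_knot p n k))"
proof -
  note s = tensor_section[OF \<phi>]
  show ?thesis
    unfolding tensor_functional_def mult.assoc
    by (rule order_trans[OF dual_functional(5)[OF k s(2)] mult_left_mono[OF s(3) dual_functional(4)[OF k]]])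
qed

text \<open>Linearity of the inner functional is available only for those s whose sections are
  square integrable, hence almost everywhere; the outer functional ignores the exceptional null
  set.\<close>

lemma tensor_functional_linear:
  assumes \<phi>: "L2_on (tensor_trapezoid p n k m l) \<phi>" and \<chi>: "L2_on (tensor_trapezoid p n k m l) \<eta>"
  shows "tensor_functional p lam n k m l ((\<lambda>x. a * \<phi> x + b * \<eta> x) \<circ> duffy) =
    a * tensor_functional p lam n k m l (\<phi> \<circ> duffy) + b * tensor_functional p lam n k m l (\<eta> \<circ> duffy)"
proof -
  let ?i = "indicator (bspline_supp p n k \<times> bspline_supp p m l) :: _ \<Rightarrow> real"
  define F where "F \<phi> s t = ?i (s, t) * (\<phi> \<circ> duffy) (s, t)" for \<phi> :: "real \<times> real \<Rightarrow> real" and s t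
  note s = tensor_section[OF \<phi>, folded F_def] tensor_section[OF \<chi>, folded F_def]
  have lin: "F (\<lambda>x. a * \<phi> x + b * \<eta> x) s = (\<lambda>t. a * F \<phi> s t + b * F \<eta> s t)" for s
    by (auto simp: F_def algebra_simps)
  have "AE s in lborel. a * lam m l (F \<phi> s) + b * lam m l (F \<eta> s) = lam m l (F (\<lambda>x. a * \<phi> x + b * \<eta> x) s)"
    using s(1,4)
  proof eventually_elim
    case (elim s)
    have "L2_linear unit_interval (lam m l)" by (rule dual_functional(1)[OF l])
    with elim show ?case unfolding lin L2_linear_def by simp
  qed
  then have ae: "AE s in lebesgue. s \<in> unit_interval \<longrightarrow>
      a * lam m l (F \<phi> s) + b * lam m l (F \<eta> s) = lam m l (F (\<lambda>x. a * \<phi> x + b * \<eta> x) s)"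
    by (rule AE_completion[OF eventually_mono]) simp
  note L = L2_on_linear[OF unit_interval_measure(1) s(2,5), of a b]
  have "lam n k (\<lambda>s. lam m l (F (\<lambda>x. a * \<phi> x + b * \<eta> x) s)) = lam n k (\<lambda>s. a * lam m l (F \<phi> s) + b * lam m l (F \<eta> s))"
    by (rule functional_cong[OF dual_functional(1-4)[OF k] dual_functional(5)[OF k] L ae])
  also have "\<dots> = a * lam n k (\<lambda>s. lam m l (F \<phi> s)) + b * lam n k (\<lambda>s. lam m l (F \<eta> s))"
    using dual_functional(1)[OF k] s(2,5) unfolding L2_linear_def by blast
  finally show ?thesis unfolding tensor_functional_def F_def[abs_def] .
qed

end

end

section \<open>Geometry of the hierarchical mesh\<close>

lemma row_level_bounds:
  assumes "p + 2 \<le> k"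
  shows "1 \<le> row_level p k" "2 ^ (row_level p k - 1) < k - p" "k - p \<le> 2 ^ row_level p k"
proof -
  define x where "x = real (k - p)"
  define m where "m = row_level p k"
  have x: "2 \<le> x" unfolding x_def using assms by linarith
  have l1: "1 \<le> log 2 x" using x by (simp add: le_log_iff)
  have m: "real m = of_int \<lceil>log 2 x\<rceil>" unfolding m_def row_level_def x_def[symmetric] using l1 by simp
  have u: "log 2 x \<le> real m" and lo: "real m < log 2 x + 1"
    unfolding m by (rule le_of_int_ceiling) linarith
  from l1 u have "1 \<le> real m" by linarith
  then show m1: "1 \<le> row_level p k" unfolding m_def by simp
  have "x \<le> 2 powr real m" using u x by (simp add: log_le_iff)
  then have "x \<le> real (2 ^ m)" by (simp add: powr_realpow)
  then show "k - p \<le> 2 ^ row_level p k" unfolding m_def[symmetric] x_def of_nat_le_iff .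
  have "real (m - 1) < log 2 x" using lo m1 unfolding m_def[symmetric] by (simp add: of_nat_diff)
  then have "2 powr real (m - 1) < x" using x by (simp add: less_log_iff)
  then have "real (2 ^ (m - 1)) < x" by (simp add: powr_realpow)
  then show "2 ^ (row_level p k - 1) < k - p" unfolding m_def[symmetric] x_def of_nat_less_iff .
qed

lemma open_triangle_trapezoid: "open_triangle \<gamma> = trapezoid 0 \<gamma> 0 1"
  by (auto simp: open_triangle_def trapezoid_def)

lemma duffy_image_trapezoid:
  assumes "0 \<le> s1"
  shows "duffy ` ({s1<..<s2} \<times> {t1<..<t2}) = trapezoid s1 s2 t1 t2"
proof
  show "duffy ` ({s1<..<s2} \<times> {t1<..<t2}) \<subseteq> trapezoid s1 s2 t1 t2"
    using assms by (auto simp: duffy_def trapezoid_def mult.commute)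
  show "trapezoid s1 s2 t1 t2 \<subseteq> duffy ` ({s1<..<s2} \<times> {t1<..<t2})"
  proof
    fix z assume z: "z \<in> trapezoid s1 s2 t1 t2"
    then have "0 < fst z" using assms by (auto simp: trapezoid_def)
    with z have "z = duffy (fst z, snd z / fst z)" "(fst z, snd z / fst z) \<in> {s1<..<s2} \<times> {t1<..<t2}"
      by (auto simp: duffy_def trapezoid_def divide_simps prod_eq_iff mult.commute)
    then show "z \<in> duffy ` ({s1<..<s2} \<times> {t1<..<t2})" by blast
  qed
qed

lemma half_trapezoid:
  "(\<lambda>(u, v). (u / 2, v / 2)) ` trapezoid s1 s2 t1 t2 = trapezoid (s1 / 2) (s2 / 2) t1 t2"
proof
  show "(\<lambda>(u, v). (u / 2, v / 2)) ` trapezoid s1 s2 t1 t2 \<subseteq> trapezoid (s1 / 2) (s2 / 2) t1 t2"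
    by (auto simp: trapezoid_def)
  show "trapezoid (s1 / 2) (s2 / 2) t1 t2 \<subseteq> (\<lambda>(u, v). (u / 2, v / 2)) ` trapezoid s1 s2 t1 t2"
  proof
    fix z assume "z \<in> trapezoid (s1 / 2) (s2 / 2) t1 t2"
    then have "(2 * fst z, 2 * snd z) \<in> trapezoid s1 s2 t1 t2" by (auto simp: trapezoid_def)
    then show "z \<in> (\<lambda>(u, v). (u / 2, v / 2)) ` trapezoid s1 s2 t1 t2"
      by (intro image_eqI[of _ _ "(2 * fst z, 2 * snd z)"]) auto
  qed
qed

text \<open>A cell of level m after n - m halvings: halving shrinks u but preserves v/u, so the
  width in u is 2^-n while the grid in t keeps the step 2^-m.\<close>

definition cell :: "nat \<Rightarrow> nat \<Rightarrow> nat \<Rightarrow> nat \<Rightarrow> (real \<times> real) set" where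
  "cell n m a c = trapezoid ((real a - 1) / 2 ^ n) (real a / 2 ^ n) ((real c - 1) / 2 ^ m) (real c / 2 ^ m)"

text \<open>Besides the corner triangle, each cell lies in a layer where u is between 2^(m - 1) h
  and 2^m h, and there the angular step is 2^-m.\<close>

lemma hier_mesh_cases:
  assumes "\<delta> \<in> hier_mesh n"
  obtains "\<delta> = trapezoid 0 (1 / 2 ^ n) 0 1"
  | m a c where "1 \<le> m" "m \<le> n" "2 ^ (m - 1) < a" "a \<le> 2 ^ m" "1 \<le> c" "c \<le> 2 ^ m" "\<delta> = cell n m a c"
proof -
  have "\<delta> = trapezoid 0 (1 / 2 ^ n) 0 1 \<or> (\<exists>m a c. 1 \<le> m \<and> m \<le> n \<and> 2 ^ (m - 1) < a \<and> a \<le> 2 ^ m \<and>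
      1 \<le> c \<and> c \<le> 2 ^ m \<and> \<delta> = cell n m a c)"
    using assms
  proof (induction n arbitrary: \<delta>)
    case 0
    then show ?case by (simp add: open_triangle_trapezoid)
  next
    case (Suc n)
    from Suc.prems consider "\<delta> \<in> mesh (Suc n)" "\<delta> \<subseteq> open_triangle 1 - open_triangle (1 / 2)"
      | \<delta>' where "\<delta>' \<in> hier_mesh n" "\<delta> = (\<lambda>(u, v). (u / 2, v / 2)) ` \<delta>'"
      by auto
    then show ?case
    proof cases
      case 1
      let ?N = "2 ^ Suc n :: real"
      obtain a c where ac: "1 \<le> a" "a \<le> 2 ^ Suc n" "1 \<le> c" "c \<le> 2 ^ Suc n"
        "\<delta> = duffy ` ({(real a - 1) / ?N<..<real a / ?N} \<times> {(real c - 1) / ?N<..<real c / ?N})"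
        using 1(1) unfolding mesh_def by auto
      have \<delta>: "\<delta> = cell (Suc n) (Suc n) a c"
        unfolding ac(5) cell_def by (rule duffy_image_trapezoid) (use ac(1) in simp)
      have "2 ^ n < a"
      proof (rule ccontr)
        assume "\<not> 2 ^ n < a"
        then have "a \<le> 2 ^ n" by simp
        then have an: "real a \<le> 2 ^ n" by (metis of_nat_le_iff of_nat_numeral of_nat_power)
        \<comment> \<open>The centre of the parameter rectangle; for a \<le> 2^n its image would lie
          in the excluded half-size triangle.\<close>
        define s t where "s = (real a - 1 / 2) / ?N" and "t = (real c - 1 / 2) / ?N"
        have "duffy (s, t) \<in> \<delta>" unfolding ac(5) s_def t_def
          by (intro imageI) (auto intro!: divide_strict_right_mono)
        moreover have "0 < s" using ac(1) by (simp add: s_def)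
        moreover have "s < 1 / 2"
        proof -
          have "real a - 1 / 2 < 1 / 2 * ?N" using an unfolding power_Suc by linarith
          then show ?thesis unfolding s_def by (rule pos_divide_less_eq[THEN iffD2, rotated]) simp
        qed
        moreover have "0 < t" using ac(3) by (simp add: t_def)
        moreover have "t < 1"
        proof -
          have "real c \<le> 2 ^ Suc n" using ac(4) by (metis of_nat_le_iff of_nat_numeral of_nat_power)
          then show ?thesis by (simp add: t_def divide_simps)
        qed
        ultimately have "duffy (s, t) \<in> open_triangle (1 / 2)" "duffy (s, t) \<in> \<delta>"
          by (auto simp: open_triangle_def duffy_def)
        then show False using 1(2) by blast
      qed
      with \<delta> ac show ?thesis
        by (intro disjI2 exI[of _ "Suc n"] exI[of _ a] exI[of _ c]) simp
    next
      case (2 \<delta>')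
      from Suc.IH[OF 2(1)] show ?thesis
      proof (elim disjE exE conjE)
        assume "\<delta>' = trapezoid 0 (1 / 2 ^ n) 0 1"
        then show ?thesis unfolding 2(2) by (simp add: half_trapezoid mult.commute)
      next
        fix m a c assume *: "1 \<le> m" "m \<le> n" "2 ^ (m - 1) < a" "a \<le> 2 ^ m" "1 \<le> c" "c \<le> 2 ^ m" "\<delta>' = cell n m a c"
        have "\<delta> = cell (Suc n) m a c" unfolding 2(2) *(7) cell_def half_trapezoid by (simp add: mult.commute)
        with * show ?thesis by (intro disjI2 exI[of _ m] exI[of _ a] exI[of _ c]) simp
      qed
    qed
  qed
  with that show thesis by blast
qed

text \<open>The convex region on which the basis function is positive up to finitely many knot
  lines. In the first p + 1 rows the left knot is 0 and the Bernstein polynomials are positive on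
  ]0, 1[, so it is a full corner triangle.\<close>

definition basis_region :: "nat \<Rightarrow> nat \<Rightarrow> nat \<Rightarrow> nat \<Rightarrow> (real \<times> real) set" where
  "basis_region p n k l = (if k \<le> p + 1 then trapezoid 0 (open_knot p n (k + p + 1)) 0 1
     else tensor_trapezoid p n k (row_level p k) l)"

lemma open_basis_region: "open (basis_region p n k l)"
  unfolding basis_region_def by (simp add: open_trapezoid)

lemma convex_basis_region: "convex (basis_region p n k l)"
  unfolding basis_region_def by (simp add: convex_trapezoid)

lemma trapezoid_subset_triangle:
  assumes "0 \<le> s1" "s2 \<le> 1" "0 \<le> t1" "t2 \<le> 1"
  shows "trapezoid s1 s2 t1 t2 \<subseteq> open_triangle 1"
proof
  fix z assume z: "z \<in> trapezoid s1 s2 t1 t2"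
  then have u: "0 < fst z" "fst z < 1" using assms by (auto simp: trapezoid_def)
  have "0 \<le> t1 * fst z" "t2 * fst z \<le> 1 * fst z" using u assms by (auto intro: mult_right_mono)
  with z u show "z \<in> open_triangle 1" by (auto simp: trapezoid_def open_triangle_def)
qed

lemma basis_region_triangle: "basis_region p n k l \<subseteq> open_triangle 1"
  unfolding basis_region_def
  by (split if_split) (intro conjI impI trapezoid_subset_triangle; simp add: open_knot_bounds)

lemma open_knot_diff_le: "open_knot p n (i + r) - open_knot p n i \<le> real r / 2 ^ n"
proof -
  have "real (min (i + r - (p + 1)) (2 ^ n)) \<le> real (min (i - (p + 1)) (2 ^ n)) + real r"
    unfolding of_nat_add[symmetric] of_nat_le_iff by auto
  then show ?thesis unfolding open_knot_eq diff_divide_distrib[symmetric]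
    by (intro divide_right_mono) auto
qed

lemma hier_indexD:
  assumes "(k, l) \<in> hier_index p n"
  shows "1 \<le> k" "k \<le> 2 ^ n + p" "1 \<le> l" "k \<le> p + 1 \<Longrightarrow> l \<le> k" "p + 2 \<le> k \<Longrightarrow> l \<le> 2 ^ row_level p k + p"
  using assms by (auto simp: hier_index_def row_dim_def split: if_splits)

lemma finite_hier_index: "finite (hier_index p n)"
  unfolding hier_index_def by auto

text \<open>The left end of the support in a row of level m is comparable to 2^m h. Both bounds
  matter: the lower one controls the Jacobian, the upper one the extent in v.\<close>

lemma open_knot_row:
  assumes k: "p + 2 \<le> k" "k \<le> 2 ^ n + p"
  shows "2 ^ (row_level p k - 1) / 2 ^ n \<le> open_knot p n k" "open_knot p n k \<le> 2 ^ row_level p k / 2 ^ n"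
proof -
  note r = row_level_bounds[OF k(1)]
  have e: "open_knot p n k = real (k - p - 1) / 2 ^ n" using k by (subst open_knot_mid) (auto simp: of_nat_diff)
  have "2 ^ (row_level p k - 1) \<le> k - p - 1" "k - p - 1 \<le> 2 ^ row_level p k" using r by auto
  then have "real (2 ^ (row_level p k - 1)) \<le> real (k - p - 1)" "real (k - p - 1) \<le> real (2 ^ row_level p k)"
    by (simp_all only: of_nat_le_iff)
  then show "2 ^ (row_level p k - 1) / 2 ^ n \<le> open_knot p n k" "open_knot p n k \<le> 2 ^ row_level p k / 2 ^ n"
    unfolding e by (auto intro: divide_right_mono)
qed

text \<open>Every region has extent of order h in both directions, uniformly in the row: the knots
  in t have step 2^-m, and u at the left end is at most 2^m h.\<close>

lemma basis_region_box:
  assumes kl: "(k, l) \<in> hier_index p n"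
  shows "\<exists>z. basis_region p n k l \<subseteq> cbox z (z + (2 * (real p + 1) / 2 ^ n, 2 * (real p + 1) / 2 ^ n))"
proof (cases "k \<le> p + 1")
  case True
  have "open_knot p n (k + p + 1) \<le> open_knot p n (p + 1 + (p + 1))"
    using True by (intro open_knot_mono) simp
  also have "\<dots> \<le> (real p + 1) / 2 ^ n"
    using open_knot_diff_le[of p n "p + 1" "p + 1"] open_knot_0[of "p + 1" p n] by (simp add: add.commute)
  finally have k: "open_knot p n (k + p + 1) \<le> (real p + 1) / 2 ^ n" .
  have "(real p + 1) / 2 ^ n \<le> 2 * (real p + 1) / 2 ^ n" by (intro divide_right_mono) auto
  then have "basis_region p n k l \<subseteq> cbox (0, 0) ((0, 0) + (2 * (real p + 1) / 2 ^ n, 2 * (real p + 1) / 2 ^ n))"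
    using True k by (auto simp: basis_region_def trapezoid_def mem_box_plane)
  then show ?thesis by blast
next
  case False
  define m where "m = row_level p k"
  define s1 s2 t1 t2 where "s1 = open_knot p n k" and "s2 = open_knot p n (k + p + 1)"
    and "t1 = open_knot p m l" and "t2 = open_knot p m (l + p + 1)"
  have k: "p + 2 \<le> k" "k \<le> 2 ^ n + p" using False hier_indexD[OF kl] by auto
  have T: "basis_region p n k l = trapezoid s1 s2 t1 t2"
    using False by (simp add: basis_region_def s1_def s2_def t1_def t2_def m_def)
  have ds: "s2 - s1 \<le> (real p + 1) / 2 ^ n" using open_knot_diff_le[of p n k "p + 1"] by (simp add: s1_def s2_def add_ac)
  have dt: "t2 - t1 \<le> (real p + 1) / 2 ^ m" using open_knot_diff_le[of p m l "p + 1"] by (simp add: t1_def t2_def add_ac)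
  have t: "0 \<le> t1" "t2 \<le> 1" "t1 \<le> t2" unfolding t1_def t2_def by (auto intro: open_knot_bounds open_knot_mono)
  have s: "0 \<le> s1" "s1 \<le> s2" "s1 \<le> 2 ^ m / 2 ^ n"
    unfolding s1_def s2_def m_def using open_knot_row[OF k] by (auto intro: open_knot_bounds open_knot_mono)
  \<comment> \<open>The extent in v splits into the part caused by the width in s and the part
    caused by the width in t at the left end. Each is at most (p + 1) h, hence the factor 2 in the
    size of the box.\<close>
  have "t2 * s2 - t1 * s1 = t2 * (s2 - s1) + (t2 - t1) * s1" by (simp add: algebra_simps)
  also have "\<dots> \<le> 1 * ((real p + 1) / 2 ^ n) + (real p + 1) / 2 ^ m * (2 ^ m / 2 ^ n)"
    using ds dt t s by (intro add_mono mult_mono) auto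
  also have "\<dots> = 2 * (real p + 1) / 2 ^ n" by simp
  finally have dv: "t2 * s2 - t1 * s1 \<le> 2 * (real p + 1) / 2 ^ n" .
  have "(real p + 1) / 2 ^ n \<le> 2 * (real p + 1) / 2 ^ n" by (intro divide_right_mono) auto
  with ds have du: "s2 - s1 \<le> 2 * (real p + 1) / 2 ^ n" by linarith
  have "trapezoid s1 s2 t1 t2 \<subseteq> cbox (s1, t1 * s1) ((s1, t1 * s1) + (2 * (real p + 1) / 2 ^ n, 2 * (real p + 1) / 2 ^ n))"
  proof
    fix z assume z: "z \<in> trapezoid s1 s2 t1 t2"
    then have "t1 * s1 \<le> t1 * fst z" "t2 * fst z \<le> t2 * s2"
      using t by (auto simp: trapezoid_def intro!: mult_left_mono)
    with z du dv show "z \<in> cbox (s1, t1 * s1) ((s1, t1 * s1) + (2 * (real p + 1) / 2 ^ n, 2 * (real p + 1) / 2 ^ n))"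
      by (auto simp: trapezoid_def mem_box_plane)
  qed
  with T show ?thesis by auto
qed

text \<open>The vertical slice at u has length (t2 - t1) u.\<close>

lemma measure_trapezoid:
  assumes s: "0 \<le> s1" "s1 \<le> s2" and t: "t1 \<le> t2"
  shows "measure lebesgue (trapezoid s1 s2 t1 t2) = (t2 - t1) * (s2\<^sup>2 - s1\<^sup>2) / 2"
proof -
  let ?T = "trapezoid s1 s2 t1 t2"
  have Tb: "?T \<in> sets borel" using open_trapezoid by auto
  then have Tp: "?T \<in> sets (lborel \<Otimes>\<^sub>M lborel)" unfolding lborel_prod by simp
  have "emeasure lborel ?T = emeasure (lborel \<Otimes>\<^sub>M lborel) ?T" by (simp add: lborel_prod)
  also have "\<dots> = (\<integral>\<^sup>+u. emeasure lborel (Pair u -` ?T) \<partial>lborel)"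
    by (rule lborel.emeasure_pair_measure_alt[OF Tp])
  also have "\<dots> = (\<integral>\<^sup>+u. ennreal ((t2 - t1) * u) * indicator {s1..s2} u \<partial>lborel)"
  proof (rule nn_integral_cong_AE)
    show "AE u in lborel. emeasure lborel (Pair u -` ?T) = ennreal ((t2 - t1) * u) * indicator {s1..s2} u"
      using AE_lborel_singleton[of s1] AE_lborel_singleton[of s2]
    proof eventually_elim
      case (elim u)
      show ?case
      proof (cases "s1 < u \<and> u < s2")
        case True
        then have "Pair u -` ?T = {t1 * u<..<t2 * u}" by (auto simp: trapezoid_def)
        moreover have "t1 * u \<le> t2 * u" using True s t by (intro mult_right_mono) auto
        ultimately show ?thesis using True by (simp add: left_diff_distrib)
      next
        case False
        then have "Pair u -` ?T = {}" by (auto simp: trapezoid_def)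
        with False elim show ?thesis by (auto simp: indicator_def)
      qed
    qed
  qed
  also have "\<dots> = ennreal ((t2 - t1) * s2\<^sup>2 / 2 - (t2 - t1) * s1\<^sup>2 / 2)"
    using s t by (intro nn_integral_FTC_Icc) (auto intro!: derivative_eq_intros)
  also have "(t2 - t1) * s2\<^sup>2 / 2 - (t2 - t1) * s1\<^sup>2 / 2 = (t2 - t1) * (s2\<^sup>2 - s1\<^sup>2) / 2"
    by (simp add: algebra_simps diff_divide_distrib)
  finally have "emeasure lebesgue ?T = ennreal ((t2 - t1) * (s2\<^sup>2 - s1\<^sup>2) / 2)" using Tb by simp
  moreover have "0 \<le> (t2 - t1) * (s2\<^sup>2 - s1\<^sup>2) / 2" using s t by (auto intro: power_mono)
  ultimately show ?thesis by (simp add: measure_def)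
qed

text \<open>A cell of layer m has area h^2 (2 a - 1) / (2 * 2^m), and 2^(m - 1) < a \<le> 2^m keeps
  the fraction between 1/2 and 1; the corner triangle has area h^2 / 2. Cells are thus large enough
  to fix mean values in every region containing them.\<close>

lemma measure_hier_cell:
  assumes "\<delta> \<in> hier_mesh n"
  shows "(1 / 2 ^ n)\<^sup>2 / 2 \<le> measure lebesgue \<delta>" "measure lebesgue \<delta> \<le> (1 / 2 ^ n)\<^sup>2"
proof -
  have "(1 / 2 ^ n)\<^sup>2 / 2 \<le> measure lebesgue \<delta> \<and> measure lebesgue \<delta> \<le> (1 / 2 ^ n)\<^sup>2"
    using assms
  proof (cases rule: hier_mesh_cases)
    case 1
    then show ?thesis by (simp add: measure_trapezoid)
  next
    case (2 m a c)
    let ?h = "1 / 2 ^ n :: real"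
    have a: "2 ^ (m - 1) + 1 \<le> a" using 2 by simp
    then have "real (2 ^ (m - 1) + 1) \<le> real a" by (rule of_nat_mono)
    then have a1: "2 ^ (m - 1) + 1 \<le> real a" by simp
    have a2: "real a \<le> 2 ^ m" using 2(4) by (metis of_nat_le_iff of_nat_numeral of_nat_power)
    have mm: "(2::real) ^ m = 2 * 2 ^ (m - 1)" using 2(1) by (metis One_nat_def Suc_pred less_eq_Suc_le power_Suc)
    have "measure lebesgue \<delta> = (real c / 2 ^ m - (real c - 1) / 2 ^ m) * ((real a / 2 ^ n)\<^sup>2 - ((real a - 1) / 2 ^ n)\<^sup>2) / 2"
      unfolding 2(7) cell_def using a by (intro measure_trapezoid) (auto simp: divide_right_mono)
    also have "real c / 2 ^ m - (real c - 1) / 2 ^ m = 1 / 2 ^ m" by (simp add: diff_divide_distrib[symmetric])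
    also have "(real a / 2 ^ n)\<^sup>2 - ((real a - 1) / 2 ^ n)\<^sup>2 = ?h\<^sup>2 * (2 * real a - 1)"
      by (simp add: power2_eq_square field_simps)
    finally have M: "measure lebesgue \<delta> = ?h\<^sup>2 * ((2 * real a - 1) / (2 * 2 ^ m))" by simp
    have "1 / 2 \<le> (2 * real a - 1) / (2 * 2 ^ m)" using a1 by (simp add: divide_simps mm)
    moreover have "(2 * real a - 1) / (2 * 2 ^ m) \<le> 1"
    proof -
      have "2 * real a - 1 \<le> 1 * (2 * 2 ^ m)" using a2 by linarith
      then show ?thesis by (rule pos_divide_le_eq[THEN iffD2, rotated]) simp
    qed
    ultimately show ?thesis unfolding M
      using mult_left_mono[of "1 / 2" "(2 * real a - 1) / (2 * 2 ^ m)" "?h\<^sup>2"]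
        mult_left_mono[of "(2 * real a - 1) / (2 * 2 ^ m)" 1 "?h\<^sup>2"] by simp
  qed
  then show "(1 / 2 ^ n)\<^sup>2 / 2 \<le> measure lebesgue \<delta>" "measure lebesgue \<delta> \<le> (1 / 2 ^ n)\<^sup>2" by auto
qed

lemma hier_cell_open_convex:
  assumes "\<delta> \<in> hier_mesh n" shows "open \<delta>" "convex \<delta>"
  using assms by (cases rule: hier_mesh_cases; simp add: cell_def open_trapezoid convex_trapezoid)+

text \<open>Knots of a coarser level are points of the finer grid, so none lies strictly inside a
  grid interval. A comparison with one interior point u therefore extends to the whole
  interval.\<close>

lemma open_knot_grid:
  assumes u: "(real a - 1) / 2 ^ n' < u" "u < real a / 2 ^ n'" and n: "n \<le> n'"
  shows "open_knot p n i \<le> u \<Longrightarrow> open_knot p n i \<le> (real a - 1) / 2 ^ n'"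
    "u < open_knot p n i \<Longrightarrow> real a / 2 ^ n' \<le> open_knot p n i"
proof -
  define j where "j = min (i - (p + 1)) (2 ^ n) * 2 ^ (n' - n)"
  have "(2::real) ^ n' = 2 ^ n * 2 ^ (n' - n)" using n by (simp add: power_add[symmetric])
  then have e: "open_knot p n i = real j / 2 ^ n'" by (simp add: open_knot_eq j_def)
  show "open_knot p n i \<le> (real a - 1) / 2 ^ n'" if "open_knot p n i \<le> u"
  proof -
    have "real j / 2 ^ n' < real a / 2 ^ n'" using that u e by linarith
    then have "real j < real a" by (simp add: divide_less_cancel)
    then have "real (Suc j) \<le> real a" unfolding of_nat_less_iff of_nat_le_iff by (rule Suc_leI)
    then have "real j \<le> real a - 1" by simp
    then show ?thesis unfolding e by (intro divide_right_mono) auto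
  qed
  show "real a / 2 ^ n' \<le> open_knot p n i" if "u < open_knot p n i"
  proof -
    have "(real a - 1) / 2 ^ n' < real j / 2 ^ n'" using that u e by linarith
    then have "real a - 1 < real j" by (simp add: divide_less_cancel)
    then have "real a < real (Suc j)" by simp
    then have "real a \<le> real j" unfolding of_nat_less_iff of_nat_le_iff by (rule less_Suc_eq_le[THEN iffD1])
    then show ?thesis unfolding e by (intro divide_right_mono) auto
  qed
qed

lemma trapezoid_mono:
  assumes "0 \<le> s1'" "s1 \<le> s1'" "s2' \<le> s2" "t1 \<le> t1'" "t2' \<le> t2"
  shows "trapezoid s1' s2' t1' t2' \<subseteq> trapezoid s1 s2 t1 t2"
proof
  fix z assume z: "z \<in> trapezoid s1' s2' t1' t2'"
  then have le: "t1 * fst z \<le> t1' * fst z" "t2' * fst z \<le> t2 * fst z"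
    using assms by (auto simp: trapezoid_def intro!: mult_right_mono)
  show "z \<in> trapezoid s1 s2 t1 t2"
    using z le assms(2,3) unfolding trapezoid_def mem_Collect_eq by linarith
qed

section \<open>Cells and active basis functions\<close>

lemma hier_basis_eq:
  "hier_basis p n k l z = (if k \<le> p + 1 then bspline p n k (fst z) * Bernstein (k - 1) (l - 1) (snd z / fst z)
     else bspline p n k (fst z) * bspline p (row_level p k) l (snd z / fst z))"
  by (simp add: hier_basis_def hier_param_def duffy_inv_def case_prod_unfold)

text \<open>A row that is active in layer m starts to the left of the cell, so k - p \<le> a \<le>
  2^m. Its knots in t are therefore no finer than the angular grid of the cell, and no knot line
  crosses the cell.\<close>

lemma active_row_level:
  assumes k: "p + 2 \<le> k" "k \<le> 2 ^ n + p" and b: "bspline p n k u \<noteq> 0" "u < real a / 2 ^ n" "a \<le> 2 ^ m" "1 \<le> a"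
    "(real a - 1) / 2 ^ n < u"
  shows "row_level p k \<le> m"
proof -
  note r = row_level_bounds[OF k(1)]
  have "open_knot p n k \<le> u" using b(1) bspline_outside[of p n k u] by auto
  then have "open_knot p n k \<le> (real a - 1) / 2 ^ n" by (rule open_knot_grid(1)[OF b(5) b(2) order_refl])
  moreover have "open_knot p n k = (real k - real p - 1) / 2 ^ n" using k by (intro open_knot_mid) auto
  ultimately have "real k - real p \<le> real a" by (simp add: divide_le_cancel)
  then have "k - p \<le> a" by linarith
  then have "(2::nat) ^ (row_level p k - 1) < 2 ^ m" using r(2) b(3) by linarith
  then have "row_level p k - 1 < m" by simp
  then show ?thesis using r(1) by linarith
qed

text \<open>Knot lines do not cross cells, in u by construction and in t by
  \<open>active_row_level\<close>. One point where the basis function is nonzero thus places the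
  whole cell in its region.\<close>

lemma active_contains_cell:
  assumes kl: "(k, l) \<in> hier_index p n" and \<delta>: "\<delta> \<in> hier_mesh n"
    and x: "x \<in> \<delta>" "hier_basis p n k l x \<noteq> 0"
  shows "\<delta> \<subseteq> basis_region p n k l"
proof -
  note hi = hier_indexD[OF kl]
  have b: "bspline p n k (fst x) \<noteq> 0" using x(2) by (auto simp: hier_basis_eq split: if_splits)
  then have kn: "open_knot p n k \<le> fst x" "fst x < open_knot p n (k + p + 1)"
    using bspline_outside[of p n k "fst x"] by auto
  from \<delta> show ?thesis
  proof (cases rule: hier_mesh_cases)
    case 1
    then have u: "(real 1 - 1) / 2 ^ n < fst x" "fst x < real 1 / 2 ^ n" using x(1) by (auto simp: trapezoid_def)
    note g = open_knot_grid[OF u order_refl, of p]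
    \<comment> \<open>Rows with k \<ge> p + 2 start at u \<ge> h, to the right of the corner
      triangle.\<close>
    have "k \<le> p + 1"
    proof (rule ccontr)
      assume "\<not> k \<le> p + 1"
      then have "open_knot p n (p + 2) \<le> open_knot p n k" by (intro open_knot_mono) simp
      moreover have "open_knot p n (p + 2) = 1 / 2 ^ n" by (subst open_knot_mid) auto
      moreover have "open_knot p n k \<le> 0" using g(1)[OF kn(1)] by simp
      moreover have "(0::real) < 1 / 2 ^ n" by simp
      ultimately show False by linarith
    qed
    moreover have "1 / 2 ^ n \<le> open_knot p n (k + p + 1)" using g(2)[OF kn(2)] by simp
    ultimately show ?thesis unfolding 1 basis_region_def by (simp only: if_True) (intro trapezoid_mono; simp)
  next
    case (2 m a c)
    have xx: "(real a - 1) / 2 ^ n < fst x" "fst x < real a / 2 ^ n"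
      "(real c - 1) / 2 ^ m * fst x < snd x" "snd x < real c / 2 ^ m * fst x"
      using x(1) unfolding 2(7) by (auto simp: cell_def trapezoid_def)
    note g = open_knot_grid[OF xx(1,2) order_refl, of p]
    have a1: "1 \<le> a" using 2(3) by simp
    then have a0: "0 \<le> (real a - 1) / 2 ^ n" by simp
    show ?thesis
    proof (cases "k \<le> p + 1")
      case True
      have "0 \<le> (real c - 1) / 2 ^ m" "real c / 2 ^ m \<le> 1"
      proof -
        show "0 \<le> (real c - 1) / 2 ^ m" using 2(5) by simp
        have "real c \<le> 2 ^ m" using 2(6) by (metis of_nat_le_iff of_nat_numeral of_nat_power)
        then show "real c / 2 ^ m \<le> 1" by simp
      qed
      then show ?thesis unfolding 2(7) cell_def basis_region_def using True a0 g(2)[OF kn(2)]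
        by (simp only: if_True) (intro trapezoid_mono, auto)
    next
      case False
      then have k: "p + 2 \<le> k" by simp
      define m' where "m' = row_level p k"
      have m': "m' \<le> m" unfolding m'_def
        by (rule active_row_level[OF k hi(2) b xx(2) 2(4) a1 xx(1)])
      have u0: "0 < fst x" using xx(1) a0 by linarith
      have t: "(real c - 1) / 2 ^ m < snd x / fst x" "snd x / fst x < real c / 2 ^ m"
        using xx(3,4) u0 by (auto simp: less_divide_eq divide_less_eq)
      have "bspline p m' l (snd x / fst x) \<noteq> 0" using x(2) False by (simp add: hier_basis_eq m'_def)
      then have tn: "open_knot p m' l \<le> snd x / fst x" "snd x / fst x < open_knot p m' (l + p + 1)"
        using bspline_outside[of p m' l "snd x / fst x"] by auto
      note g' = open_knot_grid[OF t m', of p]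
      show ?thesis unfolding 2(7) cell_def basis_region_def m'_def[symmetric]
        using False a0 g(1)[OF kn(1)] g(2)[OF kn(2)] g'(1)[OF tn(1)] g'(2)[OF tn(2)]
        by (simp only: if_False) (intro trapezoid_mono, auto)
    qed
  qed
qed

lemma trapezoid_closure_dense:
  assumes s: "0 \<le> s1" "s1 < s2" and t: "t1 < t2" and F: "finite F" "finite F'"
  shows "trapezoid s1 s2 t1 t2 \<subseteq> closure (duffy ` (({s1<..<s2} - F) \<times> ({t1<..<t2} - F')))"
proof -
  have "{s1<..<s2} \<times> {t1<..<t2} \<subseteq> closure (({s1<..<s2} - F) \<times> ({t1<..<t2} - F'))"
    unfolding closure_Times closure_interval_minus_finite[OF F(1) s(2)] closure_interval_minus_finite[OF F(2) t] by auto
  then have "duffy ` ({s1<..<s2} \<times> {t1<..<t2}) \<subseteq> duffy ` closure (({s1<..<s2} - F) \<times> ({t1<..<t2} - F'))"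
    by (rule image_mono)
  also have "\<dots> \<subseteq> closure (duffy ` (({s1<..<s2} - F) \<times> ({t1<..<t2} - F')))"
    by (rule image_closure_subset)
      (auto simp: duffy_def case_prod_unfold closure_subset intro!: continuous_intros)
  finally show ?thesis by (simp add: duffy_image_trapezoid[OF s(1)])
qed

lemma Bernstein_pos: "0 < t \<Longrightarrow> t < 1 \<Longrightarrow> k \<le> n \<Longrightarrow> 0 < Bernstein n k t"
  unfolding Bernstein_def by (intro mult_pos_pos) auto

text \<open>The knots removed for strict positivity are finitely many, and the singular map is
  continuous, so the points of positivity are dense in the region.\<close>

lemma basis_region_closure:
  assumes kl: "(k, l) \<in> hier_index p n"
  shows "basis_region p n k l \<subseteq> closure {x \<in> open_triangle 1. hier_basis p n k l x \<noteq> 0}"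
proof -
  note hi = hier_indexD[OF kl]
  let ?F = "range (open_knot p n)"
  have sp: "bspline p n k s > 0" if "s \<in> {open_knot p n k<..<open_knot p n (k + p + 1)} - ?F" for s
    using that by (intro bspline_pos) auto
  have s12: "open_knot p n k < open_knot p n (k + p + 1)" by (rule open_knot_less[OF hi(1,2)])
  have s0: "0 \<le> open_knot p n k" by (rule open_knot_bounds)
  show ?thesis
  proof (cases "k \<le> p + 1")
    case True
    then have k0: "open_knot p n k = 0" by (rule open_knot_0)
    have "duffy ` (({0<..<open_knot p n (k + p + 1)} - ?F) \<times> ({0<..<1} - {})) \<subseteq>
        {x \<in> open_triangle 1. hier_basis p n k l x \<noteq> 0}"
    proof (intro image_subsetI, clarify)
      fix s t assume st: "s \<in> {0<..<open_knot p n (k + p + 1)}" "s \<notin> ?F" "t \<in> {0<..<1::real}"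
      have "0 < bspline p n k s" using sp[of s] st k0 by simp
      moreover have "0 < Bernstein (k - 1) (l - 1) t" using st(3) hi(1,3,4) True by (intro Bernstein_pos) auto
      moreover have "duffy (s, t) \<in> open_triangle 1"
        using st open_knot_bounds(2)[of p n "k + p + 1"] by (auto simp: duffy_def open_triangle_def)
      ultimately show "duffy (s, t) \<in> open_triangle 1 \<and> hier_basis p n k l (duffy (s, t)) \<noteq> 0"
        using True st by (simp add: hier_basis_eq duffy_def)
    qed
    from closure_mono[OF this] trapezoid_closure_dense[of 0 "open_knot p n (k + p + 1)" 0 1 ?F "{}"] s12 k0
    show ?thesis using True finite_open_knots by (auto simp: basis_region_def)
  next
    case False
    define m where "m = row_level p k"
    let ?F' = "range (open_knot p m)"
    have l: "1 \<le> l" "l \<le> 2 ^ m + p" using hi(3,5) False by (auto simp: m_def)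
    have "duffy ` (({open_knot p n k<..<open_knot p n (k + p + 1)} - ?F) \<times>
        ({open_knot p m l<..<open_knot p m (l + p + 1)} - ?F')) \<subseteq>
        {x \<in> open_triangle 1. hier_basis p n k l x \<noteq> 0}"
    proof (intro image_subsetI, clarify)
      fix s t assume st: "s \<in> {open_knot p n k<..<open_knot p n (k + p + 1)}" "s \<notin> ?F"
        "t \<in> {open_knot p m l<..<open_knot p m (l + p + 1)}" "t \<notin> ?F'"
      have b: "0 < bspline p n k s" "0 < bspline p m l t" using sp[of s] st by (auto intro!: bspline_pos)
      have r: "0 < s" "s < 1" "0 < t" "t < 1"
        using st s0 open_knot_bounds(2)[of p n "k + p + 1"] open_knot_bounds(1)[of p m l]
          open_knot_bounds(2)[of p m "l + p + 1"] by auto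
      then have "duffy (s, t) \<in> open_triangle 1" by (auto simp: duffy_def open_triangle_def)
      with b r show "duffy (s, t) \<in> open_triangle 1 \<and> hier_basis p n k l (duffy (s, t)) \<noteq> 0"
        using False by (simp add: hier_basis_eq duffy_def m_def)
    qed
    from closure_mono[OF this] trapezoid_closure_dense[OF s0 s12 open_knot_less[OF l] finite_open_knots finite_open_knots, of p n p m]
    show ?thesis using False by (auto simp: basis_region_def m_def)
  qed
qed

lemma basis_region_support_extension:
  assumes kl: "(k, l) \<in> hier_index p n" and x: "x \<in> \<delta>" "hier_basis p n k l x \<noteq> 0"
  shows "basis_region p n k l \<subseteq> support_extension p n \<delta>"
  unfolding support_extension_def
proof (rule interior_maximal[OF _ open_basis_region])
  have "(k, l) \<in> {(i, j) \<in> hier_index p n. \<exists>x\<in>\<delta>. hier_basis p n i j x \<noteq> 0}" using kl x by auto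
  then show "basis_region p n k l \<subseteq> (\<Union>(i, j)\<in>{(i, j) \<in> hier_index p n. \<exists>x\<in>\<delta>. hier_basis p n i j x \<noteq> 0}.
       closure {x \<in> open_triangle 1. hier_basis p n i j x \<noteq> 0})"
    using basis_region_closure[OF kl] by blast
qed

text \<open>Closed supports may touch the boundary of the triangle, but an open convex set is the
  interior of its closure.\<close>

lemma support_extension_triangle: "support_extension p n \<delta> \<subseteq> open_triangle 1"
proof -
  have c: "convex (open_triangle 1)" "open (open_triangle 1)"
    by (simp_all add: open_triangle_trapezoid convex_trapezoid open_trapezoid)
  have "support_extension p n \<delta> \<subseteq> interior (closure (open_triangle 1))"
    unfolding support_extension_def by (intro interior_mono UN_least) (auto intro!: closure_mono)
  also have "\<dots> = interior (open_triangle 1)" by (rule convex_interior_closure[OF c(1)])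
  also have "\<dots> = open_triangle 1" using c(2) by (rule interior_open)
  finally show ?thesis .
qed

lemma open_support_extension: "open (support_extension p n \<delta>)"
  unfolding support_extension_def by simp

section \<open>Smoothness of the basis functions on mesh cells\<close>

lemma scaled_smooth_linear_form:
  assumes h: "0 < h" and ab: "\<bar>a\<bar> \<le> 1" "\<bar>b\<bar> \<le> 1" and D: "\<And>z. z \<in> D \<Longrightarrow> \<bar>a * fst z + b * snd z\<bar> \<le> h"
  shows "scaled_smooth D h k 1 (\<lambda>z. (a * fst z + b * snd z) / h)"
proof -
  have bnd: "\<bar>(a * fst z + b * snd z) / h\<bar> \<le> 1" if "z \<in> D" for z
    using D[OF that] h by (simp add: abs_divide)
  show ?thesis
  proof (cases k)
    case 0
    then show ?thesis using bnd h by (auto intro!: continuous_intros)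
  next
    case (Suc l)
    have g: "has_grad (\<lambda>z. (a * fst z + b * snd z) / h) (a / h) (b / h) z" for z
      using has_grad_affine[of "a / h" "b / h" 0 z] by (simp add: add_divide_distrib)
    show ?thesis unfolding Suc
      by (intro scaled_smoothI[where fx = "\<lambda>_. a" and fy = "\<lambda>_. b"] bnd g scaled_smooth_const ab)
  qed
qed

text \<open>The constant uses the exponent p for both powers and is thus uniform in the index. The
  lemma serves v/h and (u - v)/h at the vertex, and v/u and 1 - v/u elsewhere.\<close>

lemma scaled_smooth_bernstein_form:
  assumes M: "1 \<le> M" and f: "scaled_smooth D h q M f" and g: "scaled_smooth D h q M g"
    and e: "e \<le> p" "e' \<le> p" and c: "\<bar>c\<bar> \<le> 2 ^ p"
  shows "scaled_smooth D h q (2 ^ p * (2 ^ q * (2 ^ q * M) ^ p * (2 ^ q * M) ^ p)) (\<lambda>z. c * (f z ^ e * g z ^ e'))"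
proof -
  have qm: "1 \<le> 2 ^ q * M" using mult_mono[of 1 "2 ^ q" 1 M] M by simp
  have 1: "scaled_smooth D h q ((2 ^ q * M) ^ p) (\<lambda>z. f z ^ e)"
    by (rule scaled_smooth_mono[OF scaled_smooth_power[OF M f] power_increasing[OF e(1) qm]])
  have 2: "scaled_smooth D h q ((2 ^ q * M) ^ p) (\<lambda>z. g z ^ e')"
    by (rule scaled_smooth_mono[OF scaled_smooth_power[OF M g] power_increasing[OF e(2) qm]])
  have nn: "0 \<le> (2 ^ q * M) ^ p" using M by simp
  have 3: "scaled_smooth D h q (2 ^ q * (2 ^ q * M) ^ p * (2 ^ q * M) ^ p) (\<lambda>z. f z ^ e * g z ^ e')"
    by (rule scaled_smooth_mult[OF nn nn 1 2])
  show ?thesis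
  proof (rule scaled_smooth_mono[OF scaled_smooth_cmult[OF 3, of c]])
    show "\<bar>c\<bar> * (2 ^ q * (2 ^ q * M) ^ p * (2 ^ q * M) ^ p) \<le> 2 ^ p * (2 ^ q * (2 ^ q * M) ^ p * (2 ^ q * M) ^ p)"
      using c nn by (intro mult_right_mono) auto
  qed
qed

lemma open_knot_grid_cases:
  assumes "n \<le> n'"
  shows "open_knot p n i \<le> (real a - 1) / 2 ^ n' \<or> real a / 2 ^ n' \<le> open_knot p n i"
proof -
  define u where "u = (real a - 1 / 2) / 2 ^ n'"
  have "(real a - 1) / 2 ^ n' < u" "u < real a / 2 ^ n'" unfolding u_def by (auto intro: divide_strict_right_mono)
  from open_knot_grid[OF this assms, of p i] show ?thesis by linarith
qed

lemma basis_scaled_smooth_corner: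
  "\<exists>M\<ge>0. \<forall>n k l. (k, l) \<in> hier_index p n \<and> k \<le> p + 1 \<longrightarrow>
    scaled_smooth (trapezoid 0 (1 / 2 ^ n) 0 1) (1 / 2 ^ n) q M (hier_basis p n k l)"
proof -
  obtain C where C: "0 \<le> C" and corner: "\<forall>n D i. open D \<and> (\<forall>z\<in>D. 0 < fst z \<and> fst z < 1 / 2 ^ n) \<and> i \<le> p + 1 \<and> p + 1 \<le> p + i \<longrightarrow>
    (\<exists>g. scaled_smooth D (1 / 2 ^ n) q C g \<and>
      (\<forall>z\<in>D. cox_de_boor (open_knot p n) p i (fst z) = (fst z / (1 / 2 ^ n)) ^ (p + i - (p + 1)) * g z))"
    using cox_de_boor_corner[where p = p and k = q and d = p] by (elim exE conjE) (rule that)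
  define B :: real where "B = 2 ^ p * (2 ^ q * (2 ^ q * 1) ^ p * (2 ^ q * 1) ^ p)"
  have B: "0 \<le> B" by (simp add: B_def)
  have "scaled_smooth (trapezoid 0 (1 / 2 ^ n) 0 1) (1 / 2 ^ n) q (2 ^ q * C * B) (hier_basis p n k l)"
    if kl: "(k, l) \<in> hier_index p n" "k \<le> p + 1" for n k l
  proof -
    define D0 where "D0 = trapezoid 0 (1 / 2 ^ n) 0 1"
    have oD: "open D0" unfolding D0_def by (rule open_trapezoid)
    define h :: real where "h = 1 / 2 ^ n"
    have h: "0 < h" by (simp add: h_def)
    note hi = hier_indexD[OF kl(1)]
    have lk: "l \<le> k" using hi(4) kl(2) by simp
    have D: "0 < fst z" "fst z < h" "0 < snd z" "snd z < fst z" if "z \<in> D0" for z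
      using that by (auto simp: trapezoid_def h_def D0_def)
    have "\<forall>z\<in>D0. 0 < fst z \<and> fst z < 1 / 2 ^ n" using D unfolding h_def by blast
    then have "\<exists>g. scaled_smooth D0 (1 / 2 ^ n) q C g \<and>
      (\<forall>z\<in>D0. cox_de_boor (open_knot p n) p k (fst z) = (fst z / (1 / 2 ^ n)) ^ (p + k - (p + 1)) * g z)"
      by (intro corner[rule_format] conjI oD) (use kl(2) hi(1) in auto)
    then obtain g where g: "scaled_smooth D0 h q C g"
      "\<And>z. z \<in> D0 \<Longrightarrow> bspline p n k (fst z) = (fst z / h) ^ (k - 1) * g z"
      unfolding bspline_def h_def by (auto simp: algebra_simps)
    have f1: "scaled_smooth D0 h q 1 (\<lambda>z. (0 * fst z + 1 * snd z) / h)"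
      by (rule scaled_smooth_linear_form[OF h]) (use D in force)+
    have f2: "scaled_smooth D0 h q 1 (\<lambda>z. (1 * fst z + (- 1) * snd z) / h)"
      by (rule scaled_smooth_linear_form[OF h]) (use D in force)+
    have c: "\<bar>real ((k - 1) choose (l - 1))\<bar> \<le> 2 ^ p"
    proof -
      have "(k - 1) choose (l - 1) \<le> 2 ^ (k - 1)" by (rule binomial_le_pow2)
      also have "\<dots> \<le> 2 ^ p" using kl(2) by (intro power_increasing) auto
      finally have "real ((k - 1) choose (l - 1)) \<le> real (2 ^ p)" by (rule of_nat_mono)
      then show ?thesis by simp
    qed
    have e: "l - 1 \<le> p" "k - l \<le> p" using kl(2) lk hi(3) by auto
    have s: "scaled_smooth D0 h q B (\<lambda>z. real ((k - 1) choose (l - 1)) *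
        (((0 * fst z + 1 * snd z) / h) ^ (l - 1) * ((1 * fst z + (- 1) * snd z) / h) ^ (k - l)))"
      unfolding B_def by (rule scaled_smooth_bernstein_form[OF order_refl f1 f2 e c])
    have "scaled_smooth D0 h q (2 ^ q * C * B) (hier_basis p n k l)"
    proof (rule scaled_smooth_cong[OF oD _ scaled_smooth_mult[OF C B g(1) s]])
      fix z assume z: "z \<in> D0"
      have u: "0 < fst z" using D[OF z] by simp
      have kk: "k - 1 = (l - 1) + (k - l)" "(k - 1) - (l - 1) = k - l" using lk hi(3) by auto
      \<comment> \<open>The power of u/h from \<open>cox_de_boor_corner\<close> is distributed over
        the k - 1 linear factors of the Bernstein polynomial: t turns into v/h and 1 - t into (u -
        v)/h.\<close>
      have "(fst z / h) ^ (k - 1) * Bernstein (k - 1) (l - 1) (snd z / fst z) =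
          real ((k - 1) choose (l - 1)) * (((fst z / h) * (snd z / fst z)) ^ (l - 1) * ((fst z / h) * (1 - snd z / fst z)) ^ (k - l))"
        unfolding Bernstein_def kk(2) power_mult_distrib by (subst kk(1), subst power_add) (simp add: mult_ac)
      also have "(fst z / h) * (snd z / fst z) = (0 * fst z + 1 * snd z) / h" using u by simp
      also have "(fst z / h) * (1 - snd z / fst z) = (1 * fst z + (- 1) * snd z) / h"
        using u h by (simp add: field_simps)
      finally show "g z * (real ((k - 1) choose (l - 1)) *
        (((0 * fst z + 1 * snd z) / h) ^ (l - 1) * ((1 * fst z + (- 1) * snd z) / h) ^ (k - l))) = hier_basis p n k l z"
        using kl(2) by (simp only: hier_basis_eq if_True g(2)[OF z]) (simp add: mult_ac)
    qed
    then show ?thesis unfolding D0_def h_def .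
  qed
  then show ?thesis using C B by (intro exI[of _ "2 ^ q * C * B"]) auto
qed

text \<open>In layer m one has u \<ge> 2^(m - 1) h, and a row of level at most m has knots in t at
  distance at least 2^-m. So h/L \<le> 2^m h \<le> 2 u for every knot difference L, as
  \<open>scaled_smooth_ratio_affine\<close> requires. For the first p + 1 rows L = 1 suffices, as u
  \<ge> h.\<close>

lemma basis_scaled_smooth_cell:
  "\<exists>M\<ge>0. \<forall>n k l m a c. (k, l) \<in> hier_index p n \<and> 1 \<le> m \<and> m \<le> n \<and> 2 ^ (m - 1) < a \<and> a \<le> 2 ^ m \<and> 1 \<le> c \<and> c \<le> 2 ^ m \<and>
      (p + 2 \<le> k \<longrightarrow> row_level p k \<le> m) \<longrightarrow>
    scaled_smooth (cell n m a c) (1 / 2 ^ n) q M (hier_basis p n k l)"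
proof -
  obtain R where R: "1 \<le> R" and ratio: "\<And>D h \<eta> L. 0 < h \<Longrightarrow> 0 < L \<Longrightarrow> (\<forall>z\<in>D. h \<le> fst z \<and> h / L \<le> 2 * fst z \<and> 0 \<le> snd z \<and> snd z \<le> fst z \<and>
      \<eta> \<le> snd z / fst z \<and> snd z / fst z \<le> \<eta> + L) \<Longrightarrow>
    scaled_smooth D h q R (\<lambda>z. (snd z / fst z - \<eta>) / L)"
    using scaled_smooth_ratio_affine[of q] by blast
  define A :: real where "A = (2 * 2 ^ q * (1 + 1)) ^ p"
  define B where "B = (2 * 2 ^ q * (1 + R)) ^ p"
  define E where "E = 2 ^ p * (2 ^ q * (2 ^ q * (1 + R)) ^ p * (2 ^ q * (1 + R)) ^ p)"
  have nn: "0 \<le> A" "0 \<le> B" "0 \<le> E" using R by (simp_all add: A_def B_def E_def)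
  have "scaled_smooth (cell n m a c) (1 / 2 ^ n) q (2 ^ q * A * (B + E)) (hier_basis p n k l)"
    if kl: "(k, l) \<in> hier_index p n" and m: "1 \<le> m" "m \<le> n" and a: "2 ^ (m - 1) < a" "a \<le> 2 ^ m"
      and c: "1 \<le> c" "c \<le> 2 ^ m" and rl: "p + 2 \<le> k \<longrightarrow> row_level p k \<le> m" for n k l m a c
  proof -
    let ?D = "cell n m a c"
    define h :: real where "h = 1 / 2 ^ n"
    have h: "0 < h" by (simp add: h_def)
    note hi = hier_indexD[OF kl]
    have oD: "open ?D" by (simp add: cell_def open_trapezoid)
    have mm: "(2::real) ^ m = 2 * 2 ^ (m - 1)" using m(1) by (metis One_nat_def Suc_pred less_eq_Suc_le power_Suc)
    have "real (2 ^ (m - 1) + 1) \<le> real a" using a(1) by (intro of_nat_mono) simp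
    then have a1: "2 ^ (m - 1) \<le> real a - 1" by simp
    have one: "1 \<le> (2::real) ^ (m - 1)" by simp
    have c2: "real c \<le> 2 ^ m" using c(2) by (metis of_nat_le_iff of_nat_numeral of_nat_power)
    have D: "(real a - 1) / 2 ^ n < fst z" "fst z < real a / 2 ^ n"
       "(real c - 1) / 2 ^ m * fst z < snd z" "snd z < real c / 2 ^ m * fst z" if "z \<in> ?D" for z
      using that by (auto simp: cell_def trapezoid_def)
    have hu: "2 ^ (m - 1) * h \<le> fst z" if "z \<in> ?D" for z
    proof -
      have "2 ^ (m - 1) * h \<le> (real a - 1) * h" using a1 h by (intro mult_right_mono) auto
      then show ?thesis using D(1)[OF that] by (simp add: h_def)
    qed
    have u: "h \<le> fst z" if "z \<in> ?D" for z
    proof -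
      have "1 * h \<le> 2 ^ (m - 1) * h" using one h by (intro mult_right_mono) auto
      then show ?thesis using hu[OF that] by linarith
    qed
    have t: "(real c - 1) / 2 ^ m < snd z / fst z" "snd z / fst z < real c / 2 ^ m" if "z \<in> ?D" for z
      using D(3,4)[OF that] u[OF that] h by (auto simp: less_divide_eq divide_less_eq)
    have v: "0 \<le> snd z" "snd z \<le> fst z" if "z \<in> ?D" for z
    proof -
      have "0 \<le> (real c - 1) / 2 ^ m * fst z" using c(1) u[OF that] h by (intro mult_nonneg_nonneg) auto
      then show "0 \<le> snd z" using D(3)[OF that] by linarith
      have "real c / 2 ^ m * fst z \<le> 1 * fst z" using c2 u[OF that] h by (intro mult_right_mono) auto
      then show "snd z \<le> fst z" using D(4)[OF that] by linarith
    qed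
    have s1: "scaled_smooth ?D h q A (\<lambda>z. bspline p n k (fst z))"
      unfolding A_def bspline_def
    proof (rule cox_de_boor_scaled_smooth[OF mono_open_knot oD, where \<alpha> = "(real a - 1) / 2 ^ n" and \<beta> = "real a / 2 ^ n"])
      show "open_knot p n i \<le> (real a - 1) / 2 ^ n \<or> real a / 2 ^ n \<le> open_knot p n i" for i
        by (rule open_knot_grid_cases) simp
      fix i j assume ij: "open_knot p n i \<le> (real a - 1) / 2 ^ n" "real a / 2 ^ n \<le> open_knot p n j"
      have "real a / 2 ^ n - (real a - 1) / 2 ^ n = h" by (simp add: h_def diff_divide_distrib)
      then have "h \<le> open_knot p n j - open_knot p n i" using ij by linarith
      then show "scaled_smooth ?D h q 1 (\<lambda>z. (fst z - open_knot p n i) / (open_knot p n j - open_knot p n i))"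
        by (rule scaled_smooth_fst[OF h]) (use ij D(1,2) in force)
    qed (use D in auto)
    show ?thesis
    proof (cases "k \<le> p + 1")
      case True
      have r0: "scaled_smooth ?D h q R (\<lambda>z. (snd z / fst z - 0) / 1)"
      proof (rule ratio[OF h])
        show "\<forall>z\<in>?D. h \<le> fst z \<and> h / 1 \<le> 2 * fst z \<and> 0 \<le> snd z \<and> snd z \<le> fst z \<and> 0 \<le> snd z / fst z \<and> snd z / fst z \<le> 0 + 1"
        proof
          fix z assume z: "z \<in> ?D"
          show "h \<le> fst z \<and> h / 1 \<le> 2 * fst z \<and> 0 \<le> snd z \<and> snd z \<le> fst z \<and> 0 \<le> snd z / fst z \<and> snd z / fst z \<le> 0 + 1"
            using u[OF z] v[OF z] h by (auto simp: divide_le_eq)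
        qed
      qed simp
      then have r1: "scaled_smooth ?D h q (1 + R) (\<lambda>z. snd z / fst z)" by (simp add: scaled_smooth_mono)
      have "scaled_smooth ?D h q (1 + \<bar>- 1\<bar> * R) (\<lambda>z. 1 + (- 1) * ((snd z / fst z - 0) / 1))"
        by (intro scaled_smooth_add scaled_smooth_const scaled_smooth_cmult r0) simp
      then have r2: "scaled_smooth ?D h q (1 + R) (\<lambda>z. 1 - snd z / fst z)" by simp
      have cc: "\<bar>real ((k - 1) choose (l - 1))\<bar> \<le> 2 ^ p"
      proof -
        have "(k - 1) choose (l - 1) \<le> 2 ^ (k - 1)" by (rule binomial_le_pow2)
        also have "\<dots> \<le> 2 ^ p" using True by (intro power_increasing) auto
        finally have "real ((k - 1) choose (l - 1)) \<le> real (2 ^ p)" by (rule of_nat_mono)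
        then show ?thesis by simp
      qed
      have e: "l - 1 \<le> p" "(k - 1) - (l - 1) \<le> p" using True hi(4) by auto
      have R1: "1 \<le> 1 + R" using R by simp
      have s2: "scaled_smooth ?D h q E (\<lambda>z. Bernstein (k - 1) (l - 1) (snd z / fst z))"
        using scaled_smooth_bernstein_form[OF R1 r1 r2 e cc] unfolding E_def Bernstein_def by (simp add: mult.assoc)
      have "scaled_smooth ?D h q (2 ^ q * A * E) (\<lambda>z. bspline p n k (fst z) * Bernstein (k - 1) (l - 1) (snd z / fst z))"
        by (rule scaled_smooth_mult[OF nn(1) nn(3) s1 s2])
      moreover have "2 ^ q * A * E \<le> 2 ^ q * A * (B + E)" using nn by (intro mult_left_mono) auto
      ultimately show ?thesis unfolding h_def[symmetric]
        using True by (simp add: hier_basis_eq[abs_def] scaled_smooth_mono)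
    next
      case False
      define m' where "m' = row_level p k"
      have m': "m' \<le> m" using rl False by (simp add: m'_def)
      have s2: "scaled_smooth ?D h q B (\<lambda>z. bspline p m' l (snd z / fst z))"
        unfolding B_def bspline_def
      proof (rule cox_de_boor_scaled_smooth[OF mono_open_knot oD, where \<alpha> = "(real c - 1) / 2 ^ m" and \<beta> = "real c / 2 ^ m"])
        show "0 \<le> R" using R by simp
        show "open_knot p m' i \<le> (real c - 1) / 2 ^ m \<or> real c / 2 ^ m \<le> open_knot p m' i" for i
          by (rule open_knot_grid_cases[OF m'])
        show "(real c - 1) / 2 ^ m < snd z / fst z" "snd z / fst z < real c / 2 ^ m" if "z \<in> ?D" for z
          by (rule t[OF that])+
        fix i j assume ij: "open_knot p m' i \<le> (real c - 1) / 2 ^ m" "real c / 2 ^ m \<le> open_knot p m' j"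
        define L where "L = open_knot p m' j - open_knot p m' i"
        have "(real c - 1) / 2 ^ m < real c / 2 ^ m" by (intro divide_strict_right_mono) auto
        then have "open_knot p m' i < open_knot p m' j" using ij by linarith
        from open_knot_gap[OF this] have L: "1 / 2 ^ m' \<le> L" by (simp add: L_def)
        have "0 < 1 / (2::real) ^ m'" by simp
        with L have L0: "0 < L" by linarith
        have "1 / (2::real) ^ m \<le> 1 / 2 ^ m'" using m' by (simp add: divide_simps power_increasing)
        with L have L1: "1 / 2 ^ m \<le> L" by linarith
        have hL: "h / L \<le> 2 * fst z" if "z \<in> ?D" for z
        proof -
          have "h / L \<le> h / (1 / 2 ^ m)" using L1 L0 h by (intro divide_left_mono) auto
          also have "\<dots> = 2 * (2 ^ (m - 1) * h)" by (simp add: mm)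
          also have "\<dots> \<le> 2 * fst z" using hu[OF that] by simp
          finally show ?thesis .
        qed
        show "scaled_smooth ?D h q R (\<lambda>z. (snd z / fst z - open_knot p m' i) / (open_knot p m' j - open_knot p m' i))"
          unfolding L_def[symmetric]
        proof (rule ratio[OF h L0], intro ballI conjI)
          fix z assume z: "z \<in> ?D"
          show "h \<le> fst z" "h / L \<le> 2 * fst z" "0 \<le> snd z" "snd z \<le> fst z" by (rule u[OF z] hL[OF z] v[OF z])+
          show "open_knot p m' i \<le> snd z / fst z" "snd z / fst z \<le> open_knot p m' i + L"
            using t[OF z] ij unfolding L_def by linarith+
        qed
      qed
      have "scaled_smooth ?D h q (2 ^ q * A * B) (\<lambda>z. bspline p n k (fst z) * bspline p m' l (snd z / fst z))"
        by (rule scaled_smooth_mult[OF nn(1) nn(2) s1 s2])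
      moreover have "2 ^ q * A * B \<le> 2 ^ q * A * (B + E)" using nn by (intro mult_left_mono) auto
      ultimately show ?thesis unfolding h_def[symmetric]
        using False by (simp add: hier_basis_eq[abs_def] m'_def scaled_smooth_mono)
    qed
  qed
  then show ?thesis using nn by (intro exI[of _ "2 ^ q * A * (B + E)"]) auto
qed

lemma basis_scaled_smooth:
  "\<exists>M\<ge>0. \<forall>n k l \<delta> x. (k, l) \<in> hier_index p n \<and> \<delta> \<in> hier_mesh n \<and> x \<in> \<delta> \<and> hier_basis p n k l x \<noteq> 0 \<longrightarrow>
    scaled_smooth \<delta> (1 / 2 ^ n) q M (hier_basis p n k l)"
proof -
  obtain M1 where M1: "0 \<le> M1" "\<And>n k l. (k, l) \<in> hier_index p n \<Longrightarrow> k \<le> p + 1 \<Longrightarrow>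
    scaled_smooth (trapezoid 0 (1 / 2 ^ n) 0 1) (1 / 2 ^ n) q M1 (hier_basis p n k l)"
    using basis_scaled_smooth_corner[of p q] by blast
  obtain M2 where M2: "0 \<le> M2" and cell: "\<forall>n k l m a c. (k, l) \<in> hier_index p n \<and> 1 \<le> m \<and> m \<le> n \<and> 2 ^ (m - 1) < a \<and> a \<le> 2 ^ m \<and>
      1 \<le> c \<and> c \<le> 2 ^ m \<and> (p + 2 \<le> k \<longrightarrow> row_level p k \<le> m) \<longrightarrow>
    scaled_smooth (cell n m a c) (1 / 2 ^ n) q M2 (hier_basis p n k l)"
    using basis_scaled_smooth_cell[of p q] by (elim exE conjE) (rule that)
  have "scaled_smooth \<delta> (1 / 2 ^ n) q (M1 + M2) (hier_basis p n k l)"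
    if kl: "(k, l) \<in> hier_index p n" and \<delta>: "\<delta> \<in> hier_mesh n" and x: "x \<in> \<delta>" "hier_basis p n k l x \<noteq> 0" for n k l \<delta> x
    using \<delta>
  proof (cases rule: hier_mesh_cases)
    case 1
    have "k \<le> p + 1"
    proof (rule ccontr)
      assume "\<not> k \<le> p + 1"
      then have k: "p + 2 \<le> k" "k \<le> 2 ^ n + p" using hier_indexD[OF kl] by auto
      have "x \<in> basis_region p n k l" using active_contains_cell[OF kl \<delta> x] x(1) by blast
      then have "open_knot p n k < fst x" using k by (simp add: basis_region_def trapezoid_def)
      moreover have "1 / 2 ^ n \<le> (2::real) ^ (row_level p k - 1) / 2 ^ n" by (intro divide_right_mono) auto
      moreover have "fst x < 1 / 2 ^ n" using x(1) 1 by (simp add: trapezoid_def)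
      ultimately show False using open_knot_row(1)[OF k] by linarith
    qed
    from M1(2)[OF kl this] show ?thesis unfolding 1 by (rule scaled_smooth_mono) (use M2 in simp)
  next
    case (2 m a c)
    have "row_level p k \<le> m" if "p + 2 \<le> k"
    proof (rule active_row_level[OF that])
      show "bspline p n k (fst x) \<noteq> 0" using x(2) by (auto simp: hier_basis_eq split: if_splits)
      show "fst x < real a / 2 ^ n" "(real a - 1) / 2 ^ n < fst x"
        using x(1) unfolding 2(7) by (auto simp: cell_def trapezoid_def)
    qed (use hier_indexD[OF kl] 2 in auto)
    then have "scaled_smooth (cell n m a c) (1 / 2 ^ n) q M2 (hier_basis p n k l)"
      by (intro cell[rule_format] conjI impI kl 2)
    then show ?thesis unfolding 2(7) by (rule scaled_smooth_mono) (use M1 in simp)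
  qed
  then show ?thesis using M1(1) M2 by (intro exI[of _ "M1 + M2"]) (auto simp del: split_paired_Ex split_paired_All)
qed

section \<open>The dual functionals on the triangle\<close>

lemma base_level_ge:
  assumes "1 \<le> p" "base_level p \<le> n" shows "8 * p \<le> 2 ^ n"
proof -
  have "log 2 (8 * real p) \<le> real (base_level p)"
    unfolding base_level_def by linarith
  also have "\<dots> \<le> real n" using assms(2) by simp
  finally have "8 * real p \<le> 2 powr real n" using assms(1) by (simp add: log_le_iff)
  then have "real (8 * p) \<le> real (2 ^ n)" by (simp add: powr_realpow)
  then show ?thesis unfolding of_nat_le_iff .
qed

lemma nn_integral_lborel_scale:
  fixes f :: "real \<times> real \<Rightarrow> ennreal"
  assumes f: "f \<in> borel_measurable borel" and c: "c \<noteq> 0"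
  shows "(\<integral>\<^sup>+x. f x \<partial>lborel) = ennreal (c\<^sup>2) * (\<integral>\<^sup>+x. f (c *\<^sub>R x) \<partial>lborel)"
  by (subst lborel_affine[OF c, of 0])
    (use f in \<open>simp add: nn_integral_density nn_integral_distr nn_integral_cmult power2_eq_square\<close>)

lemma AE_lborel_scaleR:
  fixes P :: "real \<times> real \<Rightarrow> bool"
  assumes P: "AE x in lborel. P x" and c: "c \<noteq> 0"
  shows "AE x in lborel. P (c *\<^sub>R x)"
proof -
  obtain N where N: "{v. \<not> P v} \<subseteq> N" "N \<in> null_sets lborel"
    using P by (auto simp: eventually_ae_filter)
  have Nb: "N \<in> sets borel" using N(2) by auto
  have m: "(\<lambda>x. indicator N (c *\<^sub>R x) :: ennreal) \<in> borel_measurable borel"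
    by (rule measurable_compose[of "\<lambda>x. c *\<^sub>R x" borel borel]) (use Nb in simp_all)
  have "(\<integral>\<^sup>+v. indicator N v \<partial>lborel) = ennreal (c\<^sup>2) * (\<integral>\<^sup>+x. indicator N (c *\<^sub>R x) \<partial>lborel)"
    using Nb by (intro nn_integral_lborel_scale c) simp
  moreover have "(\<integral>\<^sup>+v. indicator N v \<partial>lborel) = 0" using N(2) Nb by auto
  ultimately have "(\<integral>\<^sup>+x. indicator N (c *\<^sub>R x) \<partial>lborel) = 0" using c by simp
  then have "AE x in lborel. indicator N (c *\<^sub>R x) = (0 :: ennreal)"
    using m by (subst (asm) nn_integral_0_iff_AE) auto
  then show ?thesis by eventually_elim (use N(1) in \<open>auto simp: indicator_def split: if_splits\<close>)
qed

lemma L2_on_triangle_scale: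
  assumes s: "0 < s" and \<phi>: "L2_on (trapezoid 0 (s * \<gamma>) 0 1) \<phi>"
  shows "L2_on (trapezoid 0 \<gamma> 0 1) (\<lambda>x. \<phi> (s *\<^sub>R x))"
    "L2_norm (trapezoid 0 \<gamma> 0 1) (\<lambda>x. \<phi> (s *\<^sub>R x)) = L2_norm (trapezoid 0 (s * \<gamma>) 0 1) \<phi> / s"
proof -
  let ?T = "trapezoid 0 (s * \<gamma>) 0 1" and ?T' = "trapezoid 0 \<gamma> 0 1"
  have Tb: "?T \<in> sets borel" "?T' \<in> sets borel" using open_trapezoid by auto
  then have Tl: "?T \<in> sets lebesgue" "?T' \<in> sets lebesgue" by auto
  have mem: "s *\<^sub>R x \<in> ?T \<longleftrightarrow> x \<in> ?T'" for x using s by (auto simp: trapezoid_def zero_less_mult_iff)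
  have "(\<lambda>x. indicator ?T x *\<^sub>R \<phi> x) \<in> borel_measurable lebesgue"
    using \<phi> by (simp add: L2_on_def set_borel_measurable_def)
  then obtain f where f: "f \<in> borel_measurable borel" "AE x in lborel. indicator ?T x *\<^sub>R \<phi> x = f x"
    by (rule lebesgue_borel_representative)
  have ae: "AE x in lborel. x \<in> ?T \<longrightarrow> \<phi> x = f x" using f(2) by eventually_elim auto
  note fL = L2_on_cong_AE[OF Tl(1) \<phi> AE_completion[OF ae]]
  have gm: "(\<lambda>x. f (s *\<^sub>R x)) \<in> borel_measurable borel"
    by (rule measurable_compose[OF _ f(1)]) simp
  have m: "(\<lambda>x. indicator ?T x * ennreal ((f x)\<^sup>2)) \<in> borel_measurable borel" using f(1) Tb by simp
  have eq: "ennreal ((L2_norm ?T f)\<^sup>2) = ennreal (s\<^sup>2) * (\<integral>\<^sup>+x. indicator ?T' x * ennreal ((f (s *\<^sub>R x))\<^sup>2) \<partial>lborel)"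
    using nn_integral_lborel_scale[OF m, of s] s L2_on_borel_iff(2)[OF Tb(1) f(1) fL(1)]
    by (simp add: indicator_def mem)
  have gL: "L2_on ?T' (\<lambda>x. f (s *\<^sub>R x))"
  proof (subst L2_on_borel_iff(1)[OF Tb(2) gm], rule ccontr)
    assume "\<not> (\<integral>\<^sup>+x. indicator ?T' x * ennreal ((f (s *\<^sub>R x))\<^sup>2) \<partial>lborel) < \<infinity>"
    then have "(\<integral>\<^sup>+x. indicator ?T' x * ennreal ((f (s *\<^sub>R x))\<^sup>2) \<partial>lborel) = \<infinity>" by (simp add: less_top[symmetric])
    with eq s show False by (simp add: ennreal_mult_top)
  qed
  have "ennreal ((L2_norm ?T f)\<^sup>2) = ennreal (s\<^sup>2 * (L2_norm ?T' (\<lambda>x. f (s *\<^sub>R x)))\<^sup>2)"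
    unfolding eq L2_on_borel_iff(2)[OF Tb(2) gm gL] by (simp add: ennreal_mult)
  then have "(L2_norm ?T f)\<^sup>2 = (s * L2_norm ?T' (\<lambda>x. f (s *\<^sub>R x)))\<^sup>2"
    by (simp add: power_mult_distrib)
  then have n: "L2_norm ?T f = s * L2_norm ?T' (\<lambda>x. f (s *\<^sub>R x))"
    by (rule power2_eq_imp_eq) (use s in \<open>auto simp: L2_norm_nonneg\<close>)
  have "AE x in lborel. s *\<^sub>R x \<in> ?T \<longrightarrow> \<phi> (s *\<^sub>R x) = f (s *\<^sub>R x)"
    by (rule AE_lborel_scaleR[OF ae]) (use s in simp)
  then have ae': "AE x in lborel. x \<in> ?T' \<longrightarrow> f (s *\<^sub>R x) = \<phi> (s *\<^sub>R x)"
    unfolding mem by eventually_elim auto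
  note r = L2_on_cong_AE[OF Tl(2) gL AE_completion[OF ae']]
  show "L2_on ?T' (\<lambda>x. \<phi> (s *\<^sub>R x))" by (rule r(1))
  show "L2_norm ?T' (\<lambda>x. \<phi> (s *\<^sub>R x)) = L2_norm ?T \<phi> / s" using r(2) n fL(2) s by simp
qed

text \<open>The recursion contains only ratios of differences, so scaling argument and knots
  together changes nothing. It is enough that the knots from i to i + d + 1 scale; the remaining
  ones do not, since all levels end at the knot 1.\<close>

lemma cox_de_boor_scale:
  assumes c: "c \<noteq> 0" and \<xi>: "\<And>j. i \<le> j \<Longrightarrow> j \<le> i + d + 1 \<Longrightarrow> \<xi> j = c * \<xi>' j" and pos: "0 < c"
  shows "cox_de_boor \<xi> d i (c * x) = cox_de_boor \<xi>' d i x"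
  using \<xi>
proof (induction d arbitrary: i)
  case 0
  have "\<xi> i = c * \<xi>' i" "\<xi> (Suc i) = c * \<xi>' (Suc i)" using 0[of i] 0[of "Suc i"] by auto
  then show ?case using pos by simp
next
  case (Suc d)
  have k: "\<xi> i = c * \<xi>' i" "\<xi> (i + 1) = c * \<xi>' (i + 1)" "\<xi> (i + d + 1) = c * \<xi>' (i + d + 1)" "\<xi> (i + d + 2) = c * \<xi>' (i + d + 2)"
    using Suc.prems by auto
  have IH: "cox_de_boor \<xi> d i (c * x) = cox_de_boor \<xi>' d i x" "cox_de_boor \<xi> d (i + 1) (c * x) = cox_de_boor \<xi>' d (i + 1) x"
    using Suc.prems by (auto intro!: Suc.IH)
  show ?case unfolding cox_de_boor.simps(2) IH k right_diff_distrib[symmetric] using c by simp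
qed

section \<open>Basis functions as square integrable functions\<close>

lemma hier_basis_measurable: "hier_basis p n k l \<in> borel_measurable borel"
proof -
  have [measurable]: "fst \<in> borel_measurable (borel :: (real \<times> real) measure)" "snd \<in> borel_measurable (borel :: (real \<times> real) measure)"
    by (auto intro!: borel_measurable_continuous_onI continuous_intros)
  have [measurable]: "bspline p n k \<in> borel_measurable borel" for n k by (rule bspline_measurable)
  have [measurable]: "Bernstein i j \<in> borel_measurable borel" for i j
    unfolding Bernstein_def by (intro borel_measurable_continuous_onI continuous_intros)
  show ?thesis unfolding hier_basis_eq[abs_def] by measurable
qed

lemma Bernstein_abs_le: "0 \<le> t \<Longrightarrow> t \<le> 1 \<Longrightarrow> \<bar>Bernstein i j t\<bar> \<le> real (i choose j)"
  unfolding Bernstein_def by (auto simp: abs_mult mult.assoc intro!: mult_left_le mult_le_one power_le_one)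

lemma hier_basis_bounded: "\<exists>M. \<forall>x\<in>open_triangle 1. \<bar>hier_basis p n k l x\<bar> \<le> M"
proof -
  define M where "M = 2 ^ p * (real ((k - 1) choose (l - 1)) + 2 ^ p)"
  have "\<bar>hier_basis p n k l x\<bar> \<le> M" if x: "x \<in> open_triangle 1" for x
  proof -
    have "0 \<le> snd x / fst x" "snd x / fst x \<le> 1" using x by (auto simp: open_triangle_def)
    then have B: "\<bar>Bernstein (k - 1) (l - 1) (snd x / fst x)\<bar> \<le> real ((k - 1) choose (l - 1)) + 2 ^ p"
      by (intro order_trans[OF Bernstein_abs_le]) auto
    have S: "\<bar>bspline p (row_level p k) l (snd x / fst x)\<bar> \<le> real ((k - 1) choose (l - 1)) + 2 ^ p"
      by (rule order_trans[OF bspline_abs_le]) simp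
    show ?thesis unfolding hier_basis_eq M_def
      using bspline_abs_le B S by (cases "k \<le> p + 1") (simp_all only: if_True if_False abs_mult, (intro mult_mono; simp)+)
  qed
  then show ?thesis by blast
qed

lemma triangle_measure:
  "open_triangle \<gamma> \<in> sets lebesgue" "open_triangle \<gamma> \<in> sets borel" "emeasure lebesgue (open_triangle \<gamma>) < \<infinity>"
proof -
  show b: "open_triangle \<gamma> \<in> sets borel" unfolding open_triangle_trapezoid using open_trapezoid by auto
  then show "open_triangle \<gamma> \<in> sets lebesgue" by auto
  have "open_triangle \<gamma> \<subseteq> cbox (0, 0) (\<gamma>, \<gamma>)" by (auto simp: open_triangle_def)
  then have "emeasure lebesgue (open_triangle \<gamma>) \<le> emeasure lebesgue (cbox (0, 0) (\<gamma>, \<gamma>))"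
    by (intro emeasure_mono) auto
  also have "\<dots> < \<infinity>" by (simp add: emeasure_lborel_cbox_eq)
  finally show "emeasure lebesgue (open_triangle \<gamma>) < \<infinity>" .
qed

lemma hier_basis_L2: "L2_on (open_triangle 1) (hier_basis p n k l)"
  using hier_basis_bounded[of p n k l]
    L2_on_bounded(1)[OF triangle_measure(1,3) borel_measurable_lebesgue_on[OF hier_basis_measurable]] by blast

lemma L2_norm_eq_0: "(\<And>x. x \<in> D \<Longrightarrow> f x = 0) \<Longrightarrow> L2_norm D f = 0"
proof -
  assume "\<And>x. x \<in> D \<Longrightarrow> f x = 0"
  then have "(\<lambda>x. indicator D x *\<^sub>R (f x)\<^sup>2) = (\<lambda>x. 0)" by (auto simp: indicator_def fun_eq_iff)
  then show ?thesis unfolding L2_norm_def set_lebesgue_integral_def by simp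
qed

section \<open>Bounds and biorthogonality of the dual functionals\<close>

context
  fixes p :: nat and Cp :: real and lam :: "nat \<Rightarrow> nat \<Rightarrow> (real \<Rightarrow> real) \<Rightarrow> real"
    and mu :: "nat \<Rightarrow> nat \<Rightarrow> (real \<times> real \<Rightarrow> real) \<Rightarrow> real"
  assumes p: "1 \<le> p" and dual: "bspline_dual p Cp lam" and corner: "corner_dual p mu"
begin

text \<open>There are finitely many corner functionals, fixed at the base level; the sum of the
  moduli of their constants serves for all.\<close>

lemma mu_bound:
  "\<exists>M\<ge>0. \<forall>k\<in>{1..p + 1}. \<forall>l\<in>{1..k}. \<forall>f. L2_on (open_triangle (1 / 2 ^ base_level p)) f \<longrightarrow>
    \<bar>mu k l f\<bar> \<le> M * L2_norm (open_triangle (1 / 2 ^ base_level p)) f"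
proof -
  let ?D = "open_triangle (1 / 2 ^ base_level p)"
  have "\<forall>k l. \<exists>m. k \<in> {1..p + 1} \<longrightarrow> l \<in> {1..k} \<longrightarrow> (\<forall>f. L2_on ?D f \<longrightarrow> \<bar>mu k l f\<bar> \<le> m * L2_norm ?D f)"
    using corner unfolding corner_dual_def L2_bounded_linear_def by blast
  then obtain m where m: "\<And>k l f. k \<in> {1..p + 1} \<Longrightarrow> l \<in> {1..k} \<Longrightarrow> L2_on ?D f \<Longrightarrow> \<bar>mu k l f\<bar> \<le> m k l * L2_norm ?D f"
    by metis
  define M where "M = (\<Sum>k\<in>{1..p + 1}. \<Sum>l\<in>{1..k}. \<bar>m k l\<bar>)"
  have "m k l \<le> M" if k: "k \<in> {1..p + 1}" and l: "l \<in> {1..k}" for k l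
  proof -
    have "m k l \<le> \<bar>m k l\<bar>" by simp
    also have "\<dots> \<le> (\<Sum>l\<in>{1..k}. \<bar>m k l\<bar>)" by (rule member_le_sum[OF l]) auto
    also have "\<dots> \<le> M" unfolding M_def by (rule member_le_sum[OF k]) (auto intro: sum_nonneg)
    finally show ?thesis .
  qed
  then have "\<bar>mu k l f\<bar> \<le> M * L2_norm ?D f" if "k \<in> {1..p + 1}" "l \<in> {1..k}" "L2_on ?D f" for k l f
    using order_trans[OF m[OF that] mult_right_mono[OF _ L2_norm_nonneg]] that by blast
  moreover have "0 \<le> M" unfolding M_def by (intro sum_nonneg) auto
  ultimately show ?thesis by blast
qed

lemma mu_linear:
  assumes "k \<in> {1..p + 1}" "l \<in> {1..k}" "L2_on (open_triangle (1 / 2 ^ base_level p)) f"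
    "L2_on (open_triangle (1 / 2 ^ base_level p)) g"
  shows "mu k l (\<lambda>x. a * f x + b * g x) = a * mu k l f + b * mu k l g"
  using corner assms unfolding corner_dual_def L2_bounded_linear_def L2_linear_def by blast

lemma mu_cong:
  assumes kl: "k \<in> {1..p + 1}" "l \<in> {1..k}" and f: "L2_on (open_triangle (1 / 2 ^ base_level p)) f"
    and eq: "\<And>x. x \<in> open_triangle (1 / 2 ^ base_level p) \<Longrightarrow> f x = g x"
  shows "mu k l g = mu k l f"
proof -
  let ?D = "open_triangle (1 / 2 ^ base_level p)"
  have g: "L2_on ?D g" by (rule L2_on_cong_AE(1)[OF triangle_measure(1) f]) (auto simp: eq)
  obtain M where "\<bar>mu k l (\<lambda>x. 1 * f x + (- 1) * g x)\<bar> \<le> M * L2_norm ?D (\<lambda>x. 1 * f x + (- 1) * g x)"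
    using mu_bound L2_on_linear[OF triangle_measure(1) f g, of 1 "- 1"] kl by blast
  moreover have "L2_norm ?D (\<lambda>x. 1 * f x + (- 1) * g x) = 0" by (rule L2_norm_eq_0) (simp add: eq)
  ultimately show ?thesis using mu_linear[OF kl f g, of 1 "- 1"] by simp
qed

definition corner_scale :: "nat \<Rightarrow> real" where
  "corner_scale n = 2 ^ base_level p / 2 ^ n"

lemma corner_scale: "0 < corner_scale n" "2 powi (int (base_level p) - int n) = corner_scale n"
  "corner_scale n * (1 / 2 ^ base_level p) = 1 / 2 ^ n"
  by (simp_all add: corner_scale_def power_int_diff)

lemma corner_restrict:
  assumes "L2_on (open_triangle 1) \<phi>"
  shows "L2_on (open_triangle (1 / 2 ^ base_level p)) (\<lambda>x. \<phi> (corner_scale n *\<^sub>R x))"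
    "L2_norm (open_triangle (1 / 2 ^ base_level p)) (\<lambda>x. \<phi> (corner_scale n *\<^sub>R x)) =
      L2_norm (trapezoid 0 (1 / 2 ^ n) 0 1) \<phi> / corner_scale n"
proof -
  have "trapezoid 0 (1 / 2 ^ n) 0 1 \<subseteq> open_triangle 1" by (rule trapezoid_subset_triangle) auto
  then have "L2_on (trapezoid 0 (corner_scale n * (1 / 2 ^ base_level p)) 0 1) \<phi>"
    unfolding corner_scale(3) using open_trapezoid
    by (intro L2_on_subset[OF assms _ _ triangle_measure(1)]) auto
  from L2_on_triangle_scale[OF corner_scale(1) this]
  show "L2_on (open_triangle (1 / 2 ^ base_level p)) (\<lambda>x. \<phi> (corner_scale n *\<^sub>R x))"
    "L2_norm (open_triangle (1 / 2 ^ base_level p)) (\<lambda>x. \<phi> (corner_scale n *\<^sub>R x)) =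
      L2_norm (trapezoid 0 (1 / 2 ^ n) 0 1) \<phi> / corner_scale n"
    unfolding open_triangle_trapezoid corner_scale(3) by auto
qed

lemma hier_dual_corner: "k \<le> p + 1 \<Longrightarrow> hier_dual p lam mu n k l \<phi> = mu k l (\<lambda>x. \<phi> (corner_scale n *\<^sub>R x))"
  by (simp add: hier_dual_def corner_scale(2))

lemma hier_dual_tensor:
  "p + 2 \<le> k \<Longrightarrow> hier_dual p lam mu n k l \<phi> = tensor_functional p lam n k (row_level p k) l (\<phi> \<circ> duffy)"
  by (simp add: hier_dual_def)

lemma tensor_index:
  assumes kl: "(k, l) \<in> hier_index p n" and k: "p + 2 \<le> k"
  shows "k \<in> {1..2 ^ n + p}" "l \<in> {1..2 ^ row_level p k + p}" "0 < open_knot p n k"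
proof -
  note hi = hier_indexD[OF kl]
  show "k \<in> {1..2 ^ n + p}" "l \<in> {1..2 ^ row_level p k + p}" using hi k by auto
  have "0 < (2::real) ^ (row_level p k - 1) / 2 ^ n" by simp
  then show "0 < open_knot p n k" using open_knot_row(1)[OF k hi(2)] by linarith
qed

lemma tensor_region_L2:
  assumes "L2_on (open_triangle 1) \<phi>" "p + 2 \<le> k"
  shows "L2_on (tensor_trapezoid p n k (row_level p k) l) \<phi>"
  using L2_on_subset[OF assms(1) basis_region_triangle[of p n k l]] triangle_measure(1) open_basis_region[of p n k l] assms(2)
  by (simp add: basis_region_def)

lemma hier_dual_linear:
  assumes kl: "(k, l) \<in> hier_index p n" and \<phi>: "L2_on (open_triangle 1) \<phi>" and \<eta>: "L2_on (open_triangle 1) \<eta>"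
  shows "hier_dual p lam mu n k l (\<lambda>x. a * \<phi> x + b * \<eta> x) = a * hier_dual p lam mu n k l \<phi> + b * hier_dual p lam mu n k l \<eta>"
proof (cases "k \<le> p + 1")
  case True
  have "k \<in> {1..p + 1}" "l \<in> {1..k}" using True hier_indexD[OF kl] by auto
  from mu_linear[OF this corner_restrict(1)[OF \<phi>] corner_restrict(1)[OF \<eta>]]
  show ?thesis using True by (simp add: hier_dual_corner)
next
  case False
  then have k: "p + 2 \<le> k" by simp
  show ?thesis unfolding hier_dual_tensor[OF k]
    by (rule tensor_functional_linear[OF dual tensor_index[OF kl k] tensor_region_L2[OF \<phi> k] tensor_region_L2[OF \<eta> k]])
qed

lemma dual_const_le:
  assumes k: "k \<in> {1..2 ^ n + p}" shows "dual_const p Cp n k \<le> \<bar>Cp\<bar> * sqrt (2 ^ n)"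
proof -
  have k': "1 \<le> k" "k \<le> 2 ^ n + p" using k by auto
  have gap: "1 / 2 ^ n \<le> open_knot p n (k + p + 1) - open_knot p n k"
    by (rule open_knot_gap[OF open_knot_less[OF k']])
  have "measure lebesgue (bspline_supp p n k) = open_knot p n (k + p + 1) - open_knot p n k"
    unfolding bspline_supp_eq[OF k'] using open_knot_less[OF k'] by simp
  then have "measure lebesgue (bspline_supp p n k) powr (- 1 / 2) \<le> (1 / 2 ^ n) powr (- 1 / 2)"
    using gap by (intro powr_mono2') auto
  also have "\<dots> = sqrt (2 ^ n)"
    by (simp add: powr_minus_divide powr_half_sqrt real_sqrt_divide)
  finally show ?thesis unfolding dual_const_def by (intro mult_left_mono) auto
qed

text \<open>In a tensor row the univariate bounds give 2^(n/2) and 2^(m/2), and the Jacobian at u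
  \<ge> 2^(m - 1) h gives (2^n / 2^(m - 1))^(1/2). The powers of 2^m cancel and sqrt 2 * 2^n
  remains. In the corner rows the factor is the inverse of the dilation, because L2 norms in the
  plane scale linearly.\<close>

lemma hier_dual_bound:
  "\<exists>C\<ge>0. \<forall>n k l \<phi>. (k, l) \<in> hier_index p n \<and> L2_on (open_triangle 1) \<phi> \<longrightarrow>
    \<bar>hier_dual p lam mu n k l \<phi>\<bar> \<le> C * 2 ^ n * L2_norm (basis_region p n k l) \<phi>"
proof -
  obtain M where M: "0 \<le> M" "\<And>k l f. k \<in> {1..p + 1} \<Longrightarrow> l \<in> {1..k} \<Longrightarrow> L2_on (open_triangle (1 / 2 ^ base_level p)) f \<Longrightarrow>
    \<bar>mu k l f\<bar> \<le> M * L2_norm (open_triangle (1 / 2 ^ base_level p)) f"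
    using mu_bound by blast
  define C where "C = M + \<bar>Cp\<bar> * \<bar>Cp\<bar> * sqrt 2"
  have C: "0 \<le> C" "M \<le> C" "\<bar>Cp\<bar> * \<bar>Cp\<bar> * sqrt 2 \<le> C" using M(1) by (auto simp: C_def)
  have "\<bar>hier_dual p lam mu n k l \<phi>\<bar> \<le> C * 2 ^ n * L2_norm (basis_region p n k l) \<phi>"
    if kl: "(k, l) \<in> hier_index p n" and \<phi>: "L2_on (open_triangle 1) \<phi>" for n k l \<phi>
  proof (cases "k \<le> p + 1")
    case True
    let ?R = "basis_region p n k l"
    have k: "k \<in> {1..p + 1}" "l \<in> {1..k}" using True hier_indexD[OF kl] by auto
    have "open_knot p n (p + 2) = 1 / 2 ^ n" by (subst open_knot_mid) auto
    moreover have "open_knot p n (p + 2) \<le> open_knot p n (k + p + 1)" using k by (intro open_knot_mono) simp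
    ultimately have "trapezoid 0 (1 / 2 ^ n) 0 1 \<subseteq> ?R"
      using True unfolding basis_region_def by (simp only: if_True) (intro trapezoid_mono; simp)
    then have le: "L2_norm (trapezoid 0 (1 / 2 ^ n) 0 1) \<phi> \<le> L2_norm ?R \<phi>"
      using open_trapezoid open_basis_region
      by (intro L2_norm_mono L2_on_subset[OF \<phi> basis_region_triangle _ triangle_measure(1)]) auto
    have "1 / corner_scale n \<le> 2 ^ n" by (simp add: corner_scale_def divide_simps)
    have "\<bar>hier_dual p lam mu n k l \<phi>\<bar> \<le> M * (L2_norm (trapezoid 0 (1 / 2 ^ n) 0 1) \<phi> / corner_scale n)"
      unfolding hier_dual_corner[OF True] corner_restrict(2)[OF \<phi>, symmetric] by (rule M(2)[OF k corner_restrict(1)[OF \<phi>]])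
    also have "\<dots> = M * (1 / corner_scale n) * L2_norm (trapezoid 0 (1 / 2 ^ n) 0 1) \<phi>" by simp
    also have "\<dots> \<le> C * 2 ^ n * L2_norm ?R \<phi>"
      using M(1) C \<open>1 / corner_scale n \<le> 2 ^ n\<close> le corner_scale(1)[of n] by (intro mult_mono) (auto simp: L2_norm_nonneg)
    finally show ?thesis .
  next
    case False
    then have k: "p + 2 \<le> k" by simp
    let ?R = "basis_region p n k l"
    define m where "m = row_level p k"
    note ti = tensor_index[OF kl k, folded m_def]
    note hi = hier_indexD[OF kl]
    have m1: "1 \<le> m" unfolding m_def by (rule row_level_bounds(1)[OF k])
    have mm: "(2::real) ^ m = 2 * 2 ^ (m - 1)" using m1 by (metis One_nat_def Suc_pred less_eq_Suc_le power_Suc)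
    have R: "?R = tensor_trapezoid p n k m l" using False by (simp add: basis_region_def m_def)
    have "1 / sqrt (open_knot p n k) \<le> 1 / sqrt (2 ^ (m - 1) / 2 ^ n)"
    proof (intro divide_left_mono mult_pos_pos)
      show "sqrt (2 ^ (m - 1) / 2 ^ n) \<le> sqrt (open_knot p n k)"
        using open_knot_row(1)[OF k hi(2)] unfolding m_def by (rule real_sqrt_le_mono)
    qed (use ti(3) in auto)
    also have "\<dots> = sqrt (2 ^ n / 2 ^ (m - 1))" by (simp add: real_sqrt_divide)
    finally have q: "1 / sqrt (open_knot p n k) \<le> sqrt (2 ^ n / 2 ^ (m - 1))" .
    have "\<bar>hier_dual p lam mu n k l \<phi>\<bar> \<le> dual_const p Cp n k * dual_const p Cp m l * (L2_norm ?R \<phi> / sqrt (open_knot p n k))"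
      unfolding hier_dual_tensor[OF k] R m_def[symmetric]
      by (rule tensor_functional_bound[OF dual ti tensor_region_L2[OF \<phi> k, folded m_def]])
    also have "\<dots> = dual_const p Cp n k * dual_const p Cp m l * (1 / sqrt (open_knot p n k)) * L2_norm ?R \<phi>" by simp
    also have "\<dots> \<le> (\<bar>Cp\<bar> * sqrt (2 ^ n)) * (\<bar>Cp\<bar> * sqrt (2 ^ m)) * sqrt (2 ^ n / 2 ^ (m - 1)) * L2_norm ?R \<phi>"
      using dual_const_le[OF ti(1)] dual_const_le[OF ti(2)] q ti(3)
        dual_functional(4)[OF dual ti(1)] dual_functional(4)[OF dual ti(2)]
      by (intro mult_right_mono mult_mono L2_norm_nonneg mult_nonneg_nonneg) auto
    also have "(\<bar>Cp\<bar> * sqrt (2 ^ n)) * (\<bar>Cp\<bar> * sqrt (2 ^ m)) * sqrt (2 ^ n / 2 ^ (m - 1)) =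
        \<bar>Cp\<bar> * \<bar>Cp\<bar> * sqrt (2 ^ n * 2 ^ m * (2 ^ n / 2 ^ (m - 1)))"
      by (simp only: real_sqrt_mult mult_ac)
    also have "(2::real) ^ n * 2 ^ m * (2 ^ n / 2 ^ (m - 1)) = 2 * (2 ^ n)\<^sup>2"
      by (simp add: mm power2_eq_square)
    also have "sqrt (2 * (2 ^ n)\<^sup>2) = sqrt 2 * 2 ^ n" by (simp add: real_sqrt_mult)
    also have "\<bar>Cp\<bar> * \<bar>Cp\<bar> * (sqrt 2 * 2 ^ n) * L2_norm ?R \<phi> = \<bar>Cp\<bar> * \<bar>Cp\<bar> * sqrt 2 * (2 ^ n * L2_norm ?R \<phi>)"
      by simp
    also have "\<dots> \<le> C * (2 ^ n * L2_norm ?R \<phi>)"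
      by (intro mult_right_mono C mult_nonneg_nonneg L2_norm_nonneg) auto
    finally show ?thesis by (simp add: mult.assoc)
  qed
  then show ?thesis using C(1) by blast
qed

text \<open>The bound in \<open>bspline_dual\<close> involves the norm over the support only, so
  cutting off to the support changes nothing.\<close>

lemma functional_restrict:
  assumes k: "k \<in> {1..2 ^ n + p}" and f: "f \<in> borel_measurable borel" "\<And>x. x \<in> {0..1} \<Longrightarrow> \<bar>f x\<bar> \<le> c"
  shows "L2_on unit_interval f" "L2_on unit_interval (\<lambda>s. indicator (bspline_supp p n k) s * f s)"
    "lam n k (\<lambda>s. indicator (bspline_supp p n k) s * f s) = lam n k f"
proof -
  let ?I = "bspline_supp p n k"
  note df = dual_functional[OF dual k]
  have c: "0 \<le> c" using f(2)[of 0] by simp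
  show L: "L2_on unit_interval f"
    by (rule L2_on_bounded(1)[OF unit_interval_measure borel_measurable_lebesgue_on[OF f(1)], where M = c]) (use f(2) in auto)
  have "(\<lambda>s. indicator ?I s * f s) \<in> borel_measurable borel" using df(2) f(1) by simp
  then show Li: "L2_on unit_interval (\<lambda>s. indicator ?I s * f s)"
    by (intro L2_on_bounded(1)[OF unit_interval_measure borel_measurable_lebesgue_on, where M = c])
      (use f(2) c in \<open>auto simp: indicator_def\<close>)
  have "\<bar>lam n k (\<lambda>s. 1 * (indicator ?I s * f s) + (- 1) * f s)\<bar> \<le>
      dual_const p Cp n k * L2_norm ?I (\<lambda>s. 1 * (indicator ?I s * f s) + (- 1) * f s)"
    by (rule df(5)[OF L2_on_linear[OF unit_interval_measure(1) Li L]])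
  also have "L2_norm ?I (\<lambda>s. 1 * (indicator ?I s * f s) + (- 1) * f s) = 0" by (rule L2_norm_eq_0) simp
  finally have "lam n k (\<lambda>s. 1 * (indicator ?I s * f s) + (- 1) * f s) = 0" by simp
  moreover have "lam n k (\<lambda>s. 1 * (indicator ?I s * f s) + (- 1) * f s) =
      1 * lam n k (\<lambda>s. indicator ?I s * f s) + (- 1) * lam n k f"
    using df(1) L Li unfolding L2_linear_def by blast
  ultimately show "lam n k (\<lambda>s. indicator ?I s * f s) = lam n k f" by simp
qed

lemma functional_scale:
  assumes k: "k \<in> {1..2 ^ n + p}" and f: "L2_on unit_interval f"
  shows "lam n k (\<lambda>s. c * f s) = c * lam n k f"
proof -
  have "lam n k (\<lambda>s. c * f s + 0 * f s) = c * lam n k f + 0 * lam n k f"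
    using dual_functional(1)[OF dual k] f unfolding L2_linear_def by blast
  then show ?thesis by simp
qed

lemma lam_bspline:
  "k \<in> {1..2 ^ n + p} \<Longrightarrow> i \<in> {1..2 ^ n + p} \<Longrightarrow> lam n k (bspline p n i) = (if i = k then 1 else 0)"
  using dual unfolding bspline_dual_def by blast

text \<open>The pull-back of a basis function is a product in s and t, so the functionals factor. If
  i \<noteq> k the outer functional gives 0 whatever the inner one gives; if i = k the row levels
  agree and the inner one is dual to the factor in t.\<close>

lemma tensor_functional_basis:
  assumes kl: "(k, l) \<in> hier_index p n" and k: "p + 2 \<le> k" and ij: "(i, j) \<in> hier_index p n"
  shows "tensor_functional p lam n k (row_level p k) l (hier_basis p n i j \<circ> duffy) = (if (i, j) = (k, l) then 1 else 0)"
proof -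
  define m where "m = row_level p k"
  note ti = tensor_index[OF kl k, folded m_def]
  let ?I = "bspline_supp p n k" and ?J = "bspline_supp p m l"
  define g where "g = (if i \<le> p + 1 then Bernstein (i - 1) (j - 1) else bspline p (row_level p i) j)"
  have gm: "g \<in> borel_measurable borel"
    unfolding g_def Bernstein_def by (auto intro!: bspline_measurable borel_measurable_continuous_onI continuous_intros)
  have gb: "\<bar>g t\<bar> \<le> real ((i - 1) choose (j - 1)) + 2 ^ p" if "t \<in> {0..1}" for t
  proof (cases "i \<le> p + 1")
    case True
    have "\<bar>Bernstein (i - 1) (j - 1) t\<bar> \<le> real ((i - 1) choose (j - 1))" using that by (intro Bernstein_abs_le) auto
    moreover have "0 \<le> (2::real) ^ p" by simp
    ultimately show ?thesis using True unfolding g_def by (auto intro: add_increasing2)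
  next
    case False
    then show ?thesis unfolding g_def using order_trans[OF bspline_abs_le] by simp
  qed
  note J = functional_restrict[OF ti(2) gm gb]
  have bb: "\<bar>bspline p n i s\<bar> \<le> 2 ^ p" for s by (rule bspline_abs_le)
  note I = functional_restrict[OF ti(1) bspline_measurable[of p n i] bb]
  have k': "1 \<le> k" "k \<le> 2 ^ n + p" using ti(1) by auto
  have eq: "indicator (?I \<times> ?J) (s, t) * (hier_basis p n i j \<circ> duffy) (s, t) =
      (indicator ?I s * bspline p n i s) * (indicator ?J t * g t)" for s t
  proof (cases "s \<in> ?I")
    case True
    \<comment> \<open>Needed to recover t from (s t) / s; at s = 0 this quotient would be 0. The
      support starts at a positive knot.\<close>
    then have "s \<noteq> 0" using ti(3) unfolding bspline_supp_eq[OF k'] by auto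
    then show ?thesis using True by (auto simp: hier_basis_eq duffy_def g_def indicator_def)
  qed simp
  have "tensor_functional p lam n k m l (hier_basis p n i j \<circ> duffy) =
      lam n k (\<lambda>s. lam m l (\<lambda>t. (indicator ?I s * bspline p n i s) * (indicator ?J t * g t)))"
    unfolding tensor_functional_def eq ..
  also have "\<dots> = lam n k (\<lambda>s. (indicator ?I s * bspline p n i s) * lam m l g)"
    by (simp only: functional_scale[OF ti(2) J(2)] J(3))
  also have "\<dots> = lam n k (\<lambda>s. lam m l g * (indicator ?I s * bspline p n i s))" by (simp only: mult.commute)
  also have "\<dots> = lam m l g * lam n k (bspline p n i)"
    by (simp only: functional_scale[OF ti(1) I(2)] I(3))
  also have "\<dots> = (if (i, j) = (k, l) then 1 else 0)"
  proof -
    have i: "i \<in> {1..2 ^ n + p}" using hier_indexD[OF ij] by auto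
    show ?thesis
    proof (cases "i = k")
      case True
      then have "g = bspline p m j" "j \<in> {1..2 ^ m + p}" using k hier_indexD[OF ij] by (auto simp: g_def m_def)
      then show ?thesis using True lam_bspline[OF ti(1) i] lam_bspline[OF ti(2), of j] by simp
    qed (simp add: lam_bspline[OF ti(1) i])
  qed
  finally show ?thesis by (simp add: m_def)
qed

text \<open>For the corner functionals: dilation maps the first p + 1 rows of level n to those of
  the base level, where the duality is assumed; all other rows vanish on the triangle of size
  h.\<close>

lemma hier_dual_basis:
  assumes n: "base_level p \<le> n" and kl: "(k, l) \<in> hier_index p n" and ij: "(i, j) \<in> hier_index p n"
  shows "hier_dual p lam mu n k l (hier_basis p n i j) = (if (i, j) = (k, l) then 1 else 0)"
proof (cases "k \<le> p + 1")
  case False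
  then have "p + 2 \<le> k" by simp
  with tensor_functional_basis[OF kl this ij] show ?thesis by (simp add: hier_dual_tensor)
next
  case True
  let ?D = "open_triangle (1 / 2 ^ base_level p)"
  have k: "k \<in> {1..p + 1}" "l \<in> {1..k}" using True hier_indexD[OF kl] by auto
  have sx: "corner_scale n * fst x < 1 / 2 ^ n" if "x \<in> ?D" for x
  proof -
    have "corner_scale n * fst x < corner_scale n * (1 / 2 ^ base_level p)"
      using that corner_scale(1)[of n] by (intro mult_strict_left_mono) (auto simp: open_triangle_def)
    then show ?thesis unfolding corner_scale(3) .
  qed
  show ?thesis
  proof (cases "i \<le> p + 1")
    case i: True
    \<comment> \<open>The knots of rows i \<le> p + 1 have indices up to 2 p + 2. With p + 1 \<le>
      2^n at both levels none of them is cut off at 1, so they scale exactly.\<close>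
    have pn: "p + 1 \<le> 2 ^ base_level p" "p + 1 \<le> 2 ^ n"
      using base_level_ge[OF p order_refl] base_level_ge[OF p n] p by linarith+
    have kn: "open_knot p n r = corner_scale n * open_knot p (base_level p) r" if "r \<le> i + p + 1" for r
    proof -
      have "min (r - (p + 1)) (2 ^ n) = r - (p + 1)" "min (r - (p + 1)) (2 ^ base_level p) = r - (p + 1)"
        using that i pn by auto
      then show ?thesis unfolding open_knot_eq by (simp only:) (simp add: corner_scale_def)
    qed
    have eq: "hier_basis p (base_level p) i j x = hier_basis p n i j (corner_scale n *\<^sub>R x)" for x
    proof -
      have "bspline p n i (corner_scale n * fst x) = bspline p (base_level p) i (fst x)"
        unfolding bspline_def using corner_scale(1)[of n] by (intro cox_de_boor_scale kn) auto
      then show ?thesis using i corner_scale(1)[of n] by (simp add: hier_basis_eq)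
    qed
    have ij0: "(i, j) \<in> hier_index p (base_level p)"
      using ij i by (auto simp: hier_index_def row_dim_def intro: le_trans[of _ "p + 1"])
    have "?D \<subseteq> open_triangle 1" unfolding open_triangle_trapezoid by (intro trapezoid_mono) auto
    then have L: "L2_on ?D (hier_basis p (base_level p) i j)"
      by (rule L2_on_subset[OF hier_basis_L2 _ triangle_measure(1) triangle_measure(1)])
    have "hier_dual p lam mu n k l (hier_basis p n i j) = mu k l (hier_basis p (base_level p) i j)"
      unfolding hier_dual_corner[OF True] by (rule mu_cong[OF k L eq])
    also have "\<dots> = (if (i, j) = (k, l) then 1 else 0)"
      using corner k ij0 unfolding corner_dual_def by fastforce
    finally show ?thesis .
  next
    case False
    \<comment> \<open>Row i starts at a knot not below h, and the dilated triangle only reaches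
      points with u < h.\<close>
    have "hier_dual p lam mu n k l (hier_basis p n i j) = mu k l (\<lambda>x. 0)"
      unfolding hier_dual_corner[OF True]
    proof (rule mu_cong[OF k L2_on_zero[OF triangle_measure(1)]])
      fix x assume x: "x \<in> ?D"
      have "1 / 2 ^ n = open_knot p n (p + 2)" by (subst open_knot_mid) auto
      also have "\<dots> \<le> open_knot p n i" using False by (intro open_knot_mono) simp
      finally have "bspline p n i (corner_scale n * fst x) = 0"
        using sx[OF x] by (intro bspline_outside) linarith
      then show "0 = hier_basis p n i j (corner_scale n *\<^sub>R x)" by (simp add: hier_basis_eq)
    qed
    also have "\<dots> = 0"
      using mu_linear[OF k L2_on_zero[OF triangle_measure(1)] L2_on_zero[OF triangle_measure(1)], of 0 0] by simp
    finally show ?thesis using False True by auto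
  qed
qed

lemma hier_dual_cong:
  assumes kl: "(k, l) \<in> hier_index p n" and \<phi>: "L2_on (open_triangle 1) \<phi>"
    and eq: "\<And>x. x \<in> open_triangle 1 \<Longrightarrow> \<phi> x = \<eta> x"
  shows "hier_dual p lam mu n k l \<phi> = hier_dual p lam mu n k l \<eta>"
proof -
  have \<eta>: "L2_on (open_triangle 1) \<eta>" by (rule L2_on_cong_AE(1)[OF triangle_measure(1) \<phi>]) (auto simp: eq)
  obtain C where "\<bar>hier_dual p lam mu n k l (\<lambda>x. 1 * \<phi> x + (- 1) * \<eta> x)\<bar> \<le>
      C * 2 ^ n * L2_norm (basis_region p n k l) (\<lambda>x. 1 * \<phi> x + (- 1) * \<eta> x)"
    using hier_dual_bound kl L2_on_linear[OF triangle_measure(1) \<phi> \<eta>, of 1 "- 1"] by blast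
  moreover have "L2_norm (basis_region p n k l) (\<lambda>x. 1 * \<phi> x + (- 1) * \<eta> x) = 0"
    by (rule L2_norm_eq_0) (use eq basis_region_triangle[of p n k l] in auto)
  ultimately show ?thesis using hier_dual_linear[OF kl \<phi> \<eta>, of 1 "- 1"] by simp
qed

text \<open>Biorthogonality recovers the coefficients. Equality on the triangle is enough for this,
  since the functionals see only the values there (\<open>hier_dual_cong\<close>).\<close>

lemma hier_projection_reproduces:
  assumes n: "base_level p \<le> n" and eq: "\<And>x. x \<in> open_triangle 1 \<Longrightarrow>
      \<phi> x = (\<Sum>(i, j)\<in>hier_index p n. d i j * hier_basis p n i j x)"
    and x: "x \<in> open_triangle 1"
  shows "hier_projection p lam mu n \<phi> x = \<phi> x"
proof -
  define S where "S I x = (\<Sum>ij\<in>I. d (fst ij) (snd ij) * hier_basis p n (fst ij) (snd ij) x)" for I x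
  have SL: "L2_on (open_triangle 1) (S I)" for I
    unfolding S_def by (intro L2_on_sum L2_on_cmult hier_basis_L2 triangle_measure(1))
  have lin: "hier_dual p lam mu n k l (S I) = (\<Sum>ij\<in>I. d (fst ij) (snd ij) * (if ij = (k, l) then 1 else 0))"
    if kl: "(k, l) \<in> hier_index p n" and I: "I \<subseteq> hier_index p n" for k l I
  proof -
    have "finite I" using I finite_hier_index by (rule finite_subset)
    then show ?thesis using I
    proof (induction I rule: finite_induct)
      case empty
      have "hier_dual p lam mu n k l (\<lambda>x. 0 * S {} x + 0 * S {} x) = 0"
        using hier_dual_linear[OF kl SL SL, of 0 "{}" 0 "{}"] by simp
      then show ?case by (simp add: S_def)
    next
      case (insert ij I)
      obtain i j where ij: "ij = (i, j)" by (cases ij)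
      have "S (insert ij I) = (\<lambda>x. d i j * hier_basis p n i j x + 1 * S I x)"
        using insert(1,2) by (auto simp: S_def ij)
      then have "hier_dual p lam mu n k l (S (insert ij I)) =
          d i j * hier_dual p lam mu n k l (hier_basis p n i j) + 1 * hier_dual p lam mu n k l (S I)"
        using hier_dual_linear[OF kl hier_basis_L2 SL, of "d i j" p n i j 1 I] by (simp only:)
      also have "hier_dual p lam mu n k l (hier_basis p n i j) = (if (i, j) = (k, l) then 1 else 0)"
        using insert.prems ij by (intro hier_dual_basis[OF n kl]) auto
      finally show ?case using insert by (simp add: ij)
    qed
  qed
  have dual_d: "hier_dual p lam mu n k l \<phi> = d k l" if kl: "(k, l) \<in> hier_index p n" for k l
  proof -
    have "hier_dual p lam mu n k l \<phi> = hier_dual p lam mu n k l (S (hier_index p n))"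
      by (rule hier_dual_cong[OF kl SL, symmetric]) (simp add: eq S_def case_prod_unfold)
    also have "\<dots> = d k l"
      unfolding lin[OF kl order_refl] using kl finite_hier_index[of p n]
      by (simp add: if_distrib sum.delta cong: if_cong)
    finally show ?thesis .
  qed
  have "hier_projection p lam mu n \<phi> x = (\<Sum>(k, l)\<in>hier_index p n. d k l * hier_basis p n k l x)"
    unfolding hier_projection_def by (intro sum.cong refl) (auto simp: dual_d)
  then show ?thesis using eq[OF x] by simp
qed

end

section \<open>The quasi-interpolation error\<close>

text \<open>Degree elevation: multiply t^b by (t + (1 - t))^(d - b) = 1 and expand.\<close>

lemma power_bernstein_expansion:
  assumes b: "b \<le> d"
  shows "\<exists>e. \<forall>t. t ^ b = (\<Sum>j\<in>{1..d + 1}. e j * Bernstein d (j - 1) t)"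
proof -
  define e where "e k = (if b \<le> k then real ((d - b) choose (k - b)) / real (d choose k) else 0)" for k
  have "t ^ b = (\<Sum>j\<in>{1..d + 1}. e (j - 1) * Bernstein d (j - 1) t)" for t
  proof -
    have "t ^ b = t ^ b * (t + (1 - t)) ^ (d - b)" by simp
    also have "\<dots> = (\<Sum>r\<le>d - b. t ^ b * (real ((d - b) choose r) * t ^ r * (1 - t) ^ (d - b - r)))"
      unfolding binomial_ring by (simp add: sum_distrib_left)
    also have "\<dots> = (\<Sum>r\<le>d - b. e (b + r) * Bernstein d (b + r) t)"
    proof (intro sum.cong refl)
      fix r assume "r \<in> {..d - b}"
      then have "d choose (b + r) \<noteq> 0" "d - (b + r) = d - b - r" using b by (auto simp: binomial_eq_0_iff)
      then show "t ^ b * (real ((d - b) choose r) * t ^ r * (1 - t) ^ (d - b - r)) = e (b + r) * Bernstein d (b + r) t"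
        by (simp add: e_def Bernstein_def power_add)
    qed
    also have "\<dots> = (\<Sum>k\<in>{b..d}. e k * Bernstein d k t)"
      by (rule sum.reindex_bij_witness[of _ "\<lambda>k. k - b" "\<lambda>r. b + r"]) (use b in auto)
    also have "\<dots> = (\<Sum>k\<in>{0..d}. e k * Bernstein d k t)"
      by (rule sum.mono_neutral_left) (auto simp: e_def)
    also have "\<dots> = (\<Sum>j\<in>{1..d + 1}. e (j - 1) * Bernstein d (j - 1) t)"
      by (rule sum.reindex_bij_witness[of _ "\<lambda>j. j - 1" "\<lambda>k. k + 1"]) auto
    finally show ?thesis .
  qed
  then show ?thesis by (intro exI[of _ "\<lambda>j. e (j - 1)"]) simp
qed

text \<open>
  In the coordinates \<open>s = u\<close>, \<open>t = v / u\<close> the monomial \<open>u\<^sup>a v\<^sup>b\<close> is \<open>s\<^sup>a\<^sup>+\<^sup>b t\<^sup>b\<close>. The B-spline coefficients of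
  \<open>s\<^sup>a\<^sup>+\<^sup>b\<close> vanish for the first \<open>a + b\<close> rows, and the degree of every other row is at least \<open>b\<close>.
\<close>

lemma monomial_in_hier_space:
  assumes ab: "a + b \<le> p"
  shows "\<exists>d. \<forall>x\<in>open_triangle 1. fst x ^ a * snd x ^ b = (\<Sum>(i, j)\<in>hier_index p n. d i j * hier_basis p n i j x)"
proof -
  obtain c where c0: "\<And>i. 1 \<le> i \<Longrightarrow> i \<le> a + b \<Longrightarrow> c i = 0"
    and c: "\<And>s. 0 \<le> s \<Longrightarrow> s < 1 \<Longrightarrow> s ^ (a + b) = (\<Sum>i\<in>{1..2 ^ n + p}. c i * bspline p n i s)"
    using power_bspline_expansion[OF ab, of n] by (elim exE conjE) (rule that, auto)
  define g where "g i j t = (if i \<le> p + 1 then Bernstein (i - 1) (j - 1) t else bspline p (row_level p i) j t)" for i j t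
  have "\<exists>e. 1 \<le> i \<longrightarrow> (\<forall>t. 0 \<le> t \<longrightarrow> t < 1 \<longrightarrow> c i * t ^ b = (\<Sum>j\<in>{1..row_dim p i}. e j * g i j t))" for i
  proof (cases "1 \<le> i \<and> a + b < i")
    case False
    then show ?thesis using c0[of i] by (intro exI[of _ "\<lambda>_. 0"]) auto
  next
    case True
    have "\<exists>e. \<forall>t. 0 \<le> t \<longrightarrow> t < 1 \<longrightarrow> t ^ b = (\<Sum>j\<in>{1..row_dim p i}. e j * g i j t)"
    proof (cases "i \<le> p + 1")
      case i: True
      have "b \<le> i - 1" using True by auto
      from power_bernstein_expansion[OF this] obtain e where
        "\<forall>t. t ^ b = (\<Sum>j\<in>{1..i - 1 + 1}. e j * Bernstein (i - 1) (j - 1) t)" ..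
      then show ?thesis using i True by (intro exI[of _ e]) (auto simp: row_dim_def g_def)
    next
      case False
      have "b \<le> p" using ab by simp
      from power_bspline_expansion[OF this, of "row_level p i"] obtain e where
        "\<forall>t. 0 \<le> t \<longrightarrow> t < 1 \<longrightarrow> t ^ b = (\<Sum>j\<in>{1..2 ^ row_level p i + p}. e j * bspline p (row_level p i) j t)"
        by (elim exE conjE)
      then show ?thesis using False by (intro exI[of _ e]) (auto simp: row_dim_def g_def)
    qed
    then obtain e where e: "\<And>t. 0 \<le> t \<Longrightarrow> t < 1 \<Longrightarrow> t ^ b = (\<Sum>j\<in>{1..row_dim p i}. e j * g i j t)" by blast
    show ?thesis by (intro exI[of _ "\<lambda>j. c i * e j"]) (auto simp: e sum_distrib_left mult.assoc)
  qed
  then obtain e where e: "\<And>i t. 1 \<le> i \<Longrightarrow> 0 \<le> t \<Longrightarrow> t < 1 \<Longrightarrow> c i * t ^ b = (\<Sum>j\<in>{1..row_dim p i}. e i j * g i j t)"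
    by metis
  have "fst x ^ a * snd x ^ b = (\<Sum>(i, j)\<in>hier_index p n. e i j * hier_basis p n i j x)" if x: "x \<in> open_triangle 1" for x
  proof -
    define s t where "s = fst x" and "t = snd x / fst x"
    have st: "0 < s" "s < 1" "0 \<le> t" "t < 1" and v: "snd x = s * t" using x by (auto simp: open_triangle_def s_def t_def)
    have "fst x ^ a * snd x ^ b = s ^ (a + b) * t ^ b"
      unfolding v s_def[symmetric] by (simp add: power_add power_mult_distrib)
    also have "\<dots> = (\<Sum>i\<in>{1..2 ^ n + p}. bspline p n i s * (c i * t ^ b))"
      unfolding c[OF less_imp_le[OF st(1)] st(2)] sum_distrib_right by (intro sum.cong refl) simp
    also have "\<dots> = (\<Sum>i\<in>{1..2 ^ n + p}. \<Sum>j\<in>{1..row_dim p i}. e i j * hier_basis p n i j x)"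
    proof (intro sum.cong refl)
      fix i assume i: "i \<in> {1..2 ^ n + p}"
      have b: "hier_basis p n i j x = bspline p n i s * g i j t" for j by (simp add: hier_basis_eq g_def s_def t_def)
      have "c i * t ^ b = (\<Sum>j\<in>{1..row_dim p i}. e i j * g i j t)" using i st by (intro e) auto
      then show "bspline p n i s * (c i * t ^ b) = (\<Sum>j\<in>{1..row_dim p i}. e i j * hier_basis p n i j x)"
        unfolding b by (simp add: sum_distrib_left mult_ac)
    qed
    also have "\<dots> = (\<Sum>(i, j)\<in>hier_index p n. e i j * hier_basis p n i j x)"
      unfolding hier_index_def by (rule sum.Sigma) auto
    finally show ?thesis .
  qed
  then show ?thesis by (intro exI[of _ e] ballI)
qed

lemma polynomial_in_hier_space:
  "\<exists>d. \<forall>x\<in>open_triangle 1. poly_deriv p c 0 0 x = (\<Sum>(i, j)\<in>hier_index p n. d i j * hier_basis p n i j x)"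
proof -
  let ?A = "{(a, b). a + b \<le> p}"
  have "\<forall>ab. \<exists>d. ab \<in> ?A \<longrightarrow> (\<forall>x\<in>open_triangle 1.
      fst x ^ fst ab * snd x ^ snd ab = (\<Sum>(i, j)\<in>hier_index p n. d i j * hier_basis p n i j x))"
    using monomial_in_hier_space by (simp add: split_beta)
  from choice[OF this] obtain d where d: "\<And>ab x. ab \<in> ?A \<Longrightarrow> x \<in> open_triangle 1 \<Longrightarrow>
      fst x ^ fst ab * snd x ^ snd ab = (\<Sum>(i, j)\<in>hier_index p n. d ab i j * hier_basis p n i j x)" by blast
  have "poly_deriv p c 0 0 x = (\<Sum>(i, j)\<in>hier_index p n. (\<Sum>ab\<in>?A. c ab * d ab i j) * hier_basis p n i j x)"
    if x: "x \<in> open_triangle 1" for x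
  proof -
    have "poly_deriv p c 0 0 x = (\<Sum>ab\<in>?A. c ab * (fst x ^ fst ab * snd x ^ snd ab))"
      unfolding poly_deriv_def by (intro sum.cong refl) (auto simp: mono_deriv_0)
    also have "\<dots> = (\<Sum>ab\<in>?A. c ab * (\<Sum>ij\<in>hier_index p n. d ab (fst ij) (snd ij) * hier_basis p n (fst ij) (snd ij) x))"
      by (intro sum.cong refl arg_cong2[where f = "(*)"]) (simp only: d[OF _ x] case_prod_unfold)
    also have "\<dots> = (\<Sum>ij\<in>hier_index p n. (\<Sum>ab\<in>?A. c ab * d ab (fst ij) (snd ij)) * hier_basis p n (fst ij) (snd ij) x)"
      unfolding sum_distrib_left sum_distrib_right mult.assoc[symmetric] by (rule sum.swap)
    finally show ?thesis by (simp add: case_prod_unfold)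
  qed
  then show ?thesis by (intro exI[of _ "\<lambda>i j. \<Sum>ab\<in>?A. c ab * d ab i j"] ballI)
qed

section \<open>Counting the active functions of a cell\<close>

lemma hier_cell_triangle:
  assumes "\<delta> \<in> hier_mesh n" shows "\<delta> \<subseteq> open_triangle 1"
  using assms
proof (cases rule: hier_mesh_cases)
  case 1
  then show ?thesis by (simp add: trapezoid_subset_triangle)
next
  case (2 m a c)
  have "2 ^ m \<le> (2::nat) ^ n" using 2(2) by simp
  with 2(4) have "a \<le> 2 ^ n" by (rule le_trans)
  then show ?thesis unfolding 2(7) cell_def
    using 2(3,5,6) by (intro trapezoid_subset_triangle) (auto simp: divide_simps)
qed

text \<open>The constant 1 belongs to the space, so the basis functions cannot all vanish at a
  point; a cell has points because its area is positive.\<close>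

lemma active_exists:
  assumes \<delta>: "\<delta> \<in> hier_mesh n"
  obtains k l x where "(k, l) \<in> hier_index p n" "x \<in> \<delta>" "hier_basis p n k l x \<noteq> 0"
proof -
  have "0 < (1 / (2::real) ^ n)\<^sup>2 / 2" by simp
  then have "0 < measure lebesgue \<delta>" using measure_hier_cell(1)[OF \<delta>] by (rule less_le_trans)
  then obtain x where x: "x \<in> \<delta>" by (cases "\<delta> = {}") auto
  obtain d where d: "\<And>x. x \<in> open_triangle 1 \<Longrightarrow>
      fst x ^ 0 * snd x ^ 0 = (\<Sum>(i, j)\<in>hier_index p n. d i j * hier_basis p n i j x)"
    using monomial_in_hier_space[of 0 0 p n] by auto
  have "(\<Sum>(i, j)\<in>hier_index p n. d i j * hier_basis p n i j x) \<noteq> 0"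
    using d[of x] x hier_cell_triangle[OF \<delta>] by auto
  then have "\<exists>ij\<in>hier_index p n. (case ij of (i, j) \<Rightarrow> d i j * hier_basis p n i j x) \<noteq> 0"
    by (metis (no_types, lifting) sum.neutral)
  then obtain ij where ij: "ij \<in> hier_index p n" "hier_basis p n (fst ij) (snd ij) x \<noteq> 0" by (auto simp: split_beta)
  show ?thesis by (rule that[OF _ x ij(2)]) (use ij(1) in simp)
qed

text \<open>With r the integer part of u * 2^n, the two conditions say k - (p + 1) \<le> r < k up to
  truncation: at most p + 1 splines of one level are active at a point.\<close>

lemma knot_window:
  assumes u: "0 < u" "u < 1"
  shows "\<exists>r. \<forall>k. open_knot p n k < u \<longrightarrow> u < open_knot p n (k + p + 1) \<longrightarrow> k \<in> {r + 1..r + p + 1}"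
proof (intro exI allI impI)
  fix k assume k: "open_knot p n k < u" "u < open_knot p n (k + p + 1)"
  define r where "r = nat \<lfloor>u * 2 ^ n\<rfloor>"
  have r: "real r \<le> u * 2 ^ n" "u * 2 ^ n < real r + 1" using u by (auto simp: r_def)
  have "real (min (k - (p + 1)) (2 ^ n)) < u * 2 ^ n" "u * 2 ^ n < real (min k (2 ^ n))" "u * 2 ^ n < 2 ^ n"
    using k u unfolding open_knot_eq by (simp_all add: pos_divide_less_eq pos_less_divide_eq)
  then have "real (min (k - (p + 1)) (2 ^ n)) < real r + 1" "real r < real (min k (2 ^ n))" "real (2 ^ n) > u * 2 ^ n"
    using r by auto
  then have "min (k - (p + 1)) (2 ^ n) < r + 1" "r < min k (2 ^ n)" by linarith+
  then show "k \<in> {nat \<lfloor>u * 2 ^ n\<rfloor> + 1..nat \<lfloor>u * 2 ^ n\<rfloor> + p + 1}" unfolding r_def[symmetric] by auto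
qed

definition active :: "nat \<Rightarrow> nat \<Rightarrow> (real \<times> real) set \<Rightarrow> (nat \<times> nat) set" where
  "active p n \<delta> = {(k, l) \<in> hier_index p n. \<exists>x\<in>\<delta>. hier_basis p n k l x \<noteq> 0}"

text \<open>By \<open>active_contains_cell\<close> all active regions contain one common point of
  the cell. This leaves p + 1 rows, and in each row p + 1 functions: a window of knots in t, or
  simply l \<le> k \<le> p + 1 in the Bernstein rows.\<close>

lemma card_active_le:
  assumes \<delta>: "\<delta> \<in> hier_mesh n"
  shows "finite (active p n \<delta>)" "card (active p n \<delta>) \<le> (p + 1)\<^sup>2"
proof -
  have "active p n \<delta> \<subseteq> hier_index p n" by (auto simp: active_def)
  then show "finite (active p n \<delta>)" by (rule finite_subset[OF _ finite_hier_index])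
  obtain k0 l0 x where x: "x \<in> \<delta>" by (rule active_exists[OF \<delta>])
  then have xt: "0 < fst x" "fst x < 1" "0 < snd x / fst x" "snd x / fst x < 1"
    using hier_cell_triangle[OF \<delta>] by (auto simp: open_triangle_def)
  obtain r where r: "\<And>k. open_knot p n k < fst x \<Longrightarrow> fst x < open_knot p n (k + p + 1) \<Longrightarrow> k \<in> {r + 1..r + p + 1}"
    using knot_window[OF xt(1,2), of p n] by blast
  have "\<forall>m. \<exists>r. \<forall>l. open_knot p m l < snd x / fst x \<longrightarrow> snd x / fst x < open_knot p m (l + p + 1) \<longrightarrow> l \<in> {r + 1..r + p + 1}"
    using knot_window[OF xt(3,4), of p] by blast
  from choice[OF this] obtain r' where r': "\<And>m l. open_knot p m l < snd x / fst x \<Longrightarrow>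
      snd x / fst x < open_knot p m (l + p + 1) \<Longrightarrow> l \<in> {r' m + 1..r' m + p + 1}" by blast
  define s where "s k = (if k \<le> p + 1 then 0 else r' (row_level p k))" for k
  have sub: "active p n \<delta> \<subseteq> (SIGMA k:{r + 1..r + p + 1}. {s k + 1..s k + p + 1})"
  proof (clarsimp simp only: mem_Sigma_iff split_paired_all)
    fix k l assume "(k, l) \<in> active p n \<delta>"
    then obtain y where kl: "(k, l) \<in> hier_index p n" and y: "y \<in> \<delta>" "hier_basis p n k l y \<noteq> 0" by (auto simp: active_def)
    have xr: "x \<in> basis_region p n k l" using active_contains_cell[OF kl \<delta> y] x by blast
    show "k \<in> {r + 1..r + p + 1} \<and> l \<in> {s k + 1..s k + p + 1}"
    proof (cases "k \<le> p + 1")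
      case True
      then have "open_knot p n k = 0" by (simp add: open_knot_def)
      then have "k \<in> {r + 1..r + p + 1}" using xr xt True by (intro r) (auto simp: basis_region_def trapezoid_def)
      moreover have "l \<in> {s k + 1..s k + p + 1}" using True hier_indexD[OF kl] by (auto simp: s_def)
      ultimately show ?thesis ..
    next
      case False
      then have "open_knot p n k < fst x" "fst x < open_knot p n (k + p + 1)"
        "open_knot p (row_level p k) l < snd x / fst x" "snd x / fst x < open_knot p (row_level p k) (l + p + 1)"
        using xr xt by (auto simp: basis_region_def trapezoid_def pos_less_divide_eq pos_divide_less_eq)
      then show ?thesis using r r' False by (simp add: s_def)
    qed
  qed
  have "card (active p n \<delta>) \<le> card (SIGMA k:{r + 1..r + p + 1}. {s k + 1..s k + p + 1})"
    by (rule card_mono[OF _ sub]) auto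
  also have "\<dots> = (p + 1)\<^sup>2" by (simp add: power2_eq_square)
  finally show "card (active p n \<delta>) \<le> (p + 1)\<^sup>2" .
qed

lemma weak_partial_minus_sum:
  assumes D: "D \<in> sets lebesgue" and A: "finite A" and f: "weak_partial D i j f g"
    and F: "\<And>a. a \<in> A \<Longrightarrow> weak_partial D i j (F a) (F' a)"
  shows "weak_partial D i j (\<lambda>x. f x - (\<Sum>a\<in>A. w a * F a x)) (\<lambda>x. g x - (\<Sum>a\<in>A. w a * F' a x))"
  using A F
proof (induction A rule: finite_induct)
  case empty
  show ?case using f by simp
next
  case (insert a A)
  from weak_partial_linear[OF D insert.IH insert.prems, of a 1 "- w a"] insert
  show ?case by (simp add: algebra_simps)
qed

lemma approximation_near_cell:
  assumes \<delta>: "\<delta> \<in> hier_mesh n" and T: "open T" "convex T" "\<delta> \<subseteq> T"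
    "T \<subseteq> cbox z (z + (2 * (real p + 1) / 2 ^ n, 2 * (real p + 1) / 2 ^ n))"
    and L: "\<And>i j. i + j \<le> p + 1 \<Longrightarrow> L2_on T (H i j)"
    and w: "\<And>i j. i + j \<le> p + 1 \<Longrightarrow> weak_partial T i j f (H i j)"
    and m: "\<And>i j. i + j \<le> p \<Longrightarrow> (LINT x:\<delta>|lebesgue. H i j x) = 0"
    and ij: "i + j \<le> p + 1"
  shows "L2_norm T (H i j) \<le> (32 * (real p + 1)\<^sup>2 / 2 ^ n) ^ (p + 1 - (i + j)) * sqrt (deriv_energy T H (p + 1))"
proof -
  \<comment> \<open>For side length l = 2 (p + 1) h one has 16 l^4 = 256 (p + 1)^4 h^4, and the cell
    has area at least h^2 / 2. The square of K times this area is 512 (p + 1)^4 h^4, which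
    suffices.\<close>
  define K where "K = 32 * (real p + 1)\<^sup>2 / 2 ^ n"
  let ?l = "2 * (real p + 1) / 2 ^ n"
  have K0: "0 \<le> K" by (simp add: K_def)
  have \<mu>: "(1 / 2 ^ n)\<^sup>2 / 2 \<le> measure lebesgue \<delta>" by (rule measure_hier_cell(1)[OF \<delta>])
  have "0 < (1 / (2::real) ^ n)\<^sup>2 / 2" by simp
  then have \<mu>0: "0 < measure lebesgue \<delta>" using \<mu> by (rule less_le_trans)
  have "16 * ?l ^ 4 = 256 * (real p + 1) ^ 4 * (1 / 2 ^ n) ^ 4"
    unfolding power_divide power_mult_distrib by simp
  also have "\<dots> \<le> 512 * (real p + 1) ^ 4 * (1 / 2 ^ n) ^ 4"
    by (intro mult_right_mono) auto
  also have "\<dots> = K\<^sup>2 * ((1 / 2 ^ n)\<^sup>2 / 2)"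
    by (simp add: K_def power_mult_distrib power_divide power_mult[symmetric] field_simps flip: power_add)
  also have "\<dots> \<le> K\<^sup>2 * measure lebesgue \<delta>" using \<mu> by (intro mult_left_mono) auto
  finally have Km: "16 * ?l ^ 4 \<le> K\<^sup>2 * measure lebesgue \<delta>" .
  have "deriv_energy T H (i + j) \<le> (K\<^sup>2) ^ (Suc p - (i + j)) * deriv_energy T H (Suc p)"
  proof (rule bramble_hilbert[OF T(1,2,4)])
    show "weak_partial T 1 0 (H i j) (H (Suc i) j)" if "i + j \<le> p" for i j
      using that by (intro weak_partial_cancel1[OF w w]) auto
    show "weak_partial T 0 1 (H i j) (H i (Suc j))" if "i + j \<le> p" for i j
      using that by (intro weak_partial_cancel2[OF w w]) auto
    show "\<delta> \<in> sets borel" using hier_cell_open_convex(1)[OF \<delta>] by simp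
  qed (use L T m \<mu>0 Km ij in auto)
  moreover have "(L2_norm T (H i j))\<^sup>2 \<le> deriv_energy T H (i + j)"
    unfolding deriv_energy_def
    using member_le_sum[of i "{..i + j}" "\<lambda>i'. (L2_norm T (H i' (i + j - i')))\<^sup>2"] by simp
  ultimately have "(L2_norm T (H i j))\<^sup>2 \<le> (K\<^sup>2) ^ (p + 1 - (i + j)) * deriv_energy T H (p + 1)" by simp
  then have "sqrt ((L2_norm T (H i j))\<^sup>2) \<le> sqrt ((K\<^sup>2) ^ (p + 1 - (i + j)) * deriv_energy T H (p + 1))"
    by (rule real_sqrt_le_mono)
  also have "\<dots> = sqrt ((K ^ (p + 1 - (i + j)))\<^sup>2) * sqrt (deriv_energy T H (p + 1))"
    by (simp only: real_sqrt_mult power_mult[symmetric] mult.commute)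
  finally show ?thesis using K0 by (simp add: L2_norm_nonneg K_def)
qed

text \<open>The derivative of order 0 is chosen as the function itself rather than one that agrees
  with it almost everywhere, because the projection is applied to this very function.\<close>

lemma sobolev_derivatives:
  assumes "sobolev k D \<phi>"
  shows "\<exists>G. G 0 0 = \<phi> \<and> (\<forall>i j. i + j \<le> k \<longrightarrow> L2_on D (G i j) \<and> weak_partial D i j \<phi> (G i j))"
proof -
  have "\<forall>ij. \<exists>g. fst ij + snd ij \<le> k \<longrightarrow> L2_on D g \<and> weak_partial D (fst ij) (snd ij) \<phi> g"
    using assms unfolding sobolev_def by blast
  from choice[OF this] obtain g where g: "\<And>i j. i + j \<le> k \<Longrightarrow> L2_on D (g (i, j)) \<and> weak_partial D i j \<phi> (g (i, j))"
    by auto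
  define G where "G i j = (if i = 0 \<and> j = 0 then \<phi> else g (i, j))" for i j
  have "L2_on D (G i j)" if "i + j \<le> k" for i j
    using g[OF that] assms by (auto simp: G_def sobolev_def)
  moreover have "weak_partial D i j \<phi> (G i j)" if "i + j \<le> k" for i j
    using g[OF that] weak_partial_0[OF weak_partialD(1), of D i j \<phi> "g (i, j)"] by (auto simp: G_def)
  moreover have "G 0 0 = \<phi>" by (simp add: G_def)
  ultimately show ?thesis by (intro exI[of _ G]) simp
qed

lemma moment_fit:
  assumes B: "B \<in> sets lebesgue" "B \<subseteq> cbox u v" "0 < measure lebesgue B"
    and G: "\<And>i j. i + j \<le> p \<Longrightarrow> L2_on B (G i j)"
  obtains c where "\<And>i j. i + j \<le> p \<Longrightarrow> (LINT x:B|lebesgue. G i j x - poly_deriv p c i j x) = 0"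
proof -
  have fin: "emeasure lebesgue B < \<infinity>"
    by (rule le_less_trans[OF emeasure_mono[OF B(2)]]) (auto simp: emeasure_lborel_cbox_eq)
  obtain c where c: "\<And>i j. i + j \<le> p \<Longrightarrow> integral\<^sup>L (lebesgue_on B) (poly_deriv p c i j) = integral\<^sup>L (lebesgue_on B) (G i j)"
    using poly_moments[OF B, of p "\<lambda>i j. integral\<^sup>L (lebesgue_on B) (G i j)"] by (elim exE) (rule that, blast)
  have "(LINT x:B|lebesgue. G i j x - poly_deriv p c i j x) = 0" if ij: "i + j \<le> p" for i j
    unfolding integral_on_eq[OF B(1)]
    using c[OF ij] L2_on_integrable[OF B(1) fin G[OF ij]]
      L2_on_integrable[OF B(1) fin continuous_L2_on[OF B(1,2) poly_deriv_continuous]]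
    by (subst Bochner_Integration.integral_diff) auto
  then show ?thesis by (rule that)
qed

lemma L2_on_polynomial: "L2_on (open_triangle 1) (poly_deriv p c i j)"
proof (rule continuous_L2_on[OF triangle_measure(1) _ poly_deriv_continuous])
  show "open_triangle 1 \<subseteq> cbox (0, 0) (1, 1)" by (auto simp: open_triangle_def)
qed

section \<open>The error of the projection on a cell\<close>

context
  fixes p :: nat and Cp :: real and lam :: "nat \<Rightarrow> nat \<Rightarrow> (real \<Rightarrow> real) \<Rightarrow> real"
    and mu :: "nat \<Rightarrow> nat \<Rightarrow> (real \<times> real \<Rightarrow> real) \<Rightarrow> real"
  assumes p: "1 \<le> p" and dual: "bspline_dual p Cp lam" and corner: "corner_dual p mu"
begin

lemma projection_error_split:
  assumes n: "base_level p \<le> n" and \<phi>: "L2_on (open_triangle 1) \<phi>" and \<delta>: "\<delta> \<in> hier_mesh n" and x: "x \<in> \<delta>"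
  shows "\<phi> x - hier_projection p lam mu n \<phi> x = (\<phi> x - poly_deriv p c 0 0 x) -
    (\<Sum>kl\<in>active p n \<delta>. hier_dual p lam mu n (fst kl) (snd kl) (\<lambda>x. \<phi> x - poly_deriv p c 0 0 x) *
      hier_basis p n (fst kl) (snd kl) x)"
proof -
  let ?P = "poly_deriv p c 0 0" and ?r = "\<lambda>x. \<phi> x - poly_deriv p c 0 0 x" and ?I = "hier_index p n"
  let ?\<Lambda> = "\<lambda>kl f. hier_dual p lam mu n (fst kl) (snd kl) f" and ?\<beta> = "\<lambda>kl. hier_basis p n (fst kl) (snd kl) x"
  have xt: "x \<in> open_triangle 1" using hier_cell_triangle[OF \<delta>] x by auto
  have r: "L2_on (open_triangle 1) ?r" by (rule L2_on_diff[OF triangle_measure(1) \<phi> L2_on_polynomial])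
  have \<Lambda>: "?\<Lambda> kl \<phi> = ?\<Lambda> kl ?r + ?\<Lambda> kl ?P" if "kl \<in> ?I" for kl
  proof -
    have "(fst kl, snd kl) \<in> ?I" using that by simp
    from hier_dual_linear[OF p dual corner this r L2_on_polynomial, of 1 1 p c 0 0] show ?thesis by simp
  qed
  obtain d where d: "\<forall>x\<in>open_triangle 1. ?P x = (\<Sum>(i, j)\<in>?I. d i j * hier_basis p n i j x)"
    using polynomial_in_hier_space[of p c n] by (elim exE)
  have "hier_projection p lam mu n \<phi> x = (\<Sum>kl\<in>?I. ?\<Lambda> kl ?r * ?\<beta> kl + ?\<Lambda> kl ?P * ?\<beta> kl)"
    unfolding hier_projection_def case_prod_unfold by (intro sum.cong refl) (simp only: \<Lambda> distrib_right)
  also have "\<dots> = (\<Sum>kl\<in>?I. ?\<Lambda> kl ?r * ?\<beta> kl) + hier_projection p lam mu n ?P x"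
    unfolding hier_projection_def case_prod_unfold sum.distrib ..
  also have "hier_projection p lam mu n ?P x = ?P x"
    by (rule hier_projection_reproduces[OF p dual corner n d[rule_format] xt])
  also have "(\<Sum>kl\<in>?I. ?\<Lambda> kl ?r * ?\<beta> kl) = (\<Sum>kl\<in>active p n \<delta>. ?\<Lambda> kl ?r * ?\<beta> kl)"
    by (rule sum.mono_neutral_right[OF finite_hier_index]) (use x in \<open>auto simp: active_def\<close>)
  finally show ?thesis by simp
qed

lemma projection_error_derivatives:
  "\<exists>C>0. \<forall>n \<phi> \<delta>. base_level p \<le> n \<longrightarrow> sobolev (p + 1) (open_triangle 1) \<phi> \<longrightarrow> \<delta> \<in> hier_mesh n \<longrightarrow>
    (\<exists>R. \<forall>i j. i + j \<le> p + 1 \<longrightarrow> L2_on \<delta> (R i j) \<and>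
      weak_partial \<delta> i j (\<lambda>x. \<phi> x - hier_projection p lam mu n \<phi> x) (R i j) \<and>
      L2_norm \<delta> (R i j) \<le> C * (1 / 2 ^ n) ^ (p + 1 - (i + j)) * sobolev_seminorm (p + 1) (support_extension p n \<delta>) \<phi>)"
proof -
  obtain M where M0: "0 \<le> M" and M: "\<And>n k l \<delta> x. (k, l) \<in> hier_index p n \<Longrightarrow> \<delta> \<in> hier_mesh n \<Longrightarrow> x \<in> \<delta> \<Longrightarrow>
      hier_basis p n k l x \<noteq> 0 \<Longrightarrow> scaled_smooth \<delta> (1 / 2 ^ n) (p + 1) M (hier_basis p n k l)"
    using basis_scaled_smooth[of p "p + 1"] by (elim exE conjE) (rule that, assumption, blast)
  obtain C\<Lambda> where C0: "0 \<le> C\<Lambda>" and C\<Lambda>: "\<And>n k l \<phi>. (k, l) \<in> hier_index p n \<Longrightarrow> L2_on (open_triangle 1) \<phi> \<Longrightarrow>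
      \<bar>hier_dual p lam mu n k l \<phi>\<bar> \<le> C\<Lambda> * 2 ^ n * L2_norm (basis_region p n k l) \<phi>"
    using hier_dual_bound[OF p dual corner] by (elim exE conjE) (rule that, assumption, blast)
  define c0 where "c0 = 32 * (real p + 1)\<^sup>2"
  have "1 \<le> (real p + 1)\<^sup>2" by (rule one_le_power) simp
  then have c1: "1 \<le> c0" unfolding c0_def by linarith
  define N where "N = real ((p + 1)\<^sup>2)"
  \<comment> \<open>The summand 1 accounts for the remainder itself, each of the at most N active
    functions contributes the product of a functional bound and a derivative bound.\<close>
  define C where "C = c0 ^ (p + 1) * (1 + N * (C\<Lambda> * M))"
  have "0 \<le> N * (C\<Lambda> * M)" using M0 C0 by (simp add: N_def)
  then have Cpos: "0 < C" using c1 by (simp add: C_def)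
  have "\<exists>R. \<forall>i j. i + j \<le> p + 1 \<longrightarrow> L2_on \<delta> (R i j) \<and>
      weak_partial \<delta> i j (\<lambda>x. \<phi> x - hier_projection p lam mu n \<phi> x) (R i j) \<and>
      L2_norm \<delta> (R i j) \<le> C * (1 / 2 ^ n) ^ (p + 1 - (i + j)) * sobolev_seminorm (p + 1) (support_extension p n \<delta>) \<phi>"
    if n: "base_level p \<le> n" and s: "sobolev (p + 1) (open_triangle 1) \<phi>" and \<delta>: "\<delta> \<in> hier_mesh n" for n \<phi> \<delta>
  proof -
    define h where "h = 1 / (2::real) ^ n"
    have h: "0 < h" by (simp add: h_def)
    define S where "S = support_extension p n \<delta>"
    define E where "E = sobolev_seminorm (p + 1) S \<phi>"
    let ?D = "open_triangle 1" and ?A = "active p n \<delta>"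
    obtain G where G: "G 0 0 = \<phi> \<and> (\<forall>i j. i + j \<le> p + 1 \<longrightarrow> L2_on ?D (G i j) \<and> weak_partial ?D i j \<phi> (G i j))"
      using sobolev_derivatives[OF s] by (elim exE)
    note G0 = conjunct1[OF G]
    have GL: "L2_on ?D (G i j)" and Gw: "weak_partial ?D i j \<phi> (G i j)" if "i + j \<le> p + 1" for i j
      using G that by blast+
    have oS: "open S" "S \<subseteq> ?D" unfolding S_def by (rule open_support_extension support_extension_triangle)+
    have o\<delta>: "open \<delta>" "convex \<delta>" "\<delta> \<subseteq> ?D" using hier_cell_open_convex[OF \<delta>] hier_cell_triangle[OF \<delta>] by auto
    have leb: "T \<in> sets lebesgue" if "open T" for T :: "(real \<times> real) set" using that by auto
    have E: "E = sqrt (deriv_energy S G (p + 1))" unfolding E_def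
      by (intro sobolev_seminorm_energy oS weak_partial_restrict[OF Gw oS(2)] L2_on_subset[OF GL oS(2) leb[OF oS(1)] triangle_measure(1)]) auto
    have E0: "0 \<le> E" unfolding E by (simp add: deriv_energy_nonneg)
    have "0 < (1 / (2::real) ^ n)\<^sup>2 / 2" by simp
    then have \<mu>0: "0 < measure lebesgue \<delta>" using measure_hier_cell(1)[OF \<delta>] by (rule less_le_trans)
    have box: "\<delta> \<subseteq> cbox (0, 0) (1, 1)" using o\<delta>(3) by (auto simp: open_triangle_def)
    obtain c where c: "\<And>i j. i + j \<le> p \<Longrightarrow> (LINT x:\<delta>|lebesgue. G i j x - poly_deriv p c i j x) = 0"
      using moment_fit[OF leb[OF o\<delta>(1)] box \<mu>0, of p G] L2_on_subset[OF GL o\<delta>(3) leb[OF o\<delta>(1)] triangle_measure(1)]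
      by (metis le_add1 le_trans)
    define H where "H i j x = G i j x - poly_deriv p c i j x" for i j x
    have H0: "H 0 0 = (\<lambda>x. \<phi> x - poly_deriv p c 0 0 x)" by (simp add: H_def[abs_def] G0)
    have HL: "L2_on ?D (H i j)" if "i + j \<le> p + 1" for i j
      unfolding H_def[abs_def] by (rule L2_on_diff[OF triangle_measure(1) GL[OF that] L2_on_polynomial])
    have oD: "open ?D" unfolding open_triangle_trapezoid by (rule open_trapezoid)
    have Hw: "weak_partial ?D i j (H 0 0) (H i j)" if "i + j \<le> p + 1" for i j
      using weak_partial_linear[OF triangle_measure(1) Gw[OF that] weak_partial_poly_deriv[OF oD], of 1 "- 1" p c]
      by (simp add: H_def[abs_def] G0)
    \<comment> \<open>Used for T = \<delta> and for T a basis region. Since the moments are taken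
      over \<delta>, the same polynomial works for all of these sets.\<close>
    have near: "L2_norm T (H i j) \<le> (c0 * h) ^ (p + 1 - (i + j)) * E"
      if T: "open T" "convex T" "\<delta> \<subseteq> T" "T \<subseteq> S" "T \<subseteq> basis_region p n k l" and kl: "(k, l) \<in> hier_index p n"
        and ij: "i + j \<le> p + 1" for T k l i j
    proof -
      obtain z where "basis_region p n k l \<subseteq> cbox z (z + (2 * (real p + 1) / 2 ^ n, 2 * (real p + 1) / 2 ^ n))"
        using basis_region_box[OF kl] by (elim exE)
      then have z: "T \<subseteq> cbox z (z + (2 * (real p + 1) / 2 ^ n, 2 * (real p + 1) / 2 ^ n))" using T(5) by (rule order_trans[rotated])
      have TD: "T \<subseteq> ?D" using T(4) oS(2) by (rule order_trans)
      have "L2_norm T (H i j) \<le> (32 * (real p + 1)\<^sup>2 / 2 ^ n) ^ (p + 1 - (i + j)) * sqrt (deriv_energy T H (p + 1))"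
        by (rule approximation_near_cell[OF \<delta> T(1-3) z L2_on_subset[OF HL TD leb[OF T(1)] triangle_measure(1)]
              weak_partial_restrict[OF Hw TD] _ ij]) (auto simp: H_def c)
      also have "sqrt (deriv_energy T H (p + 1)) \<le> E"
        unfolding E deriv_energy_def
      proof (intro real_sqrt_le_mono sum_mono power_mono L2_norm_nonneg)
        fix i assume i: "i \<in> {..p + 1}"
        \<comment> \<open>Derivatives of order p + 1 do not see the polynomial of degree p, so only
          \<open>\<phi>\<close> remains on the right side.\<close>
        have "H i (p + 1 - i) = G i (p + 1 - i)" using i by (auto simp: H_def[abs_def] poly_deriv_top)
        then show "L2_norm T (H i (p + 1 - i)) \<le> L2_norm S (G i (p + 1 - i))"
          using i by (simp only:) (intro L2_norm_mono T(4) leb T(1) oS(1) L2_on_subset[OF GL oS(2) leb[OF oS(1)] triangle_measure(1)], simp)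
      qed
      finally show ?thesis unfolding c0_def h_def by (simp add: mult_left_mono)
    qed
    have region: "(fst a, snd a) \<in> hier_index p n" "\<delta> \<subseteq> basis_region p n (fst a) (snd a)" "basis_region p n (fst a) (snd a) \<subseteq> S"
      "scaled_smooth \<delta> h (p + 1) M (hier_basis p n (fst a) (snd a))" if "a \<in> ?A" for a
    proof -
      from that obtain x where x: "x \<in> \<delta>" "hier_basis p n (fst a) (snd a) x \<noteq> 0" and a: "(fst a, snd a) \<in> hier_index p n"
        by (auto simp: active_def)
      show "(fst a, snd a) \<in> hier_index p n" by (rule a)
      show "\<delta> \<subseteq> basis_region p n (fst a) (snd a)" by (rule active_contains_cell[OF a \<delta> x])
      show "basis_region p n (fst a) (snd a) \<subseteq> S" unfolding S_def by (rule basis_region_support_extension[OF a x])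
      show "scaled_smooth \<delta> h (p + 1) M (hier_basis p n (fst a) (snd a))" unfolding h_def by (rule M[OF a \<delta> x])
    qed
    define w where "w a = hier_dual p lam mu n (fst a) (snd a) (H 0 0)" for a
    \<comment> \<open>The factor 2^n = 1/h of the functional takes one power from the rate h^(p + 1)
      of the remainder in the region.\<close>
    have wb: "\<bar>w a\<bar> \<le> C\<Lambda> * c0 ^ (p + 1) * h ^ p * E" if a: "a \<in> ?A" for a
    proof -
      have "\<bar>w a\<bar> \<le> C\<Lambda> * 2 ^ n * L2_norm (basis_region p n (fst a) (snd a)) (H 0 0)"
        unfolding w_def by (rule C\<Lambda>[OF region(1)[OF a] HL]) simp
      also have "\<dots> \<le> C\<Lambda> * 2 ^ n * ((c0 * h) ^ (p + 1 - (0 + 0)) * E)"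
        by (intro mult_left_mono near[OF open_basis_region convex_basis_region region(2,3)[OF a] order_refl region(1)[OF a]]) (use C0 in auto)
      also have "\<dots> = C\<Lambda> * c0 ^ (p + 1) * h ^ p * E" unfolding power_mult_distrib by (simp add: h_def)
      finally show ?thesis .
    qed
    have "\<forall>a. \<exists>F. a \<in> ?A \<longrightarrow> (\<forall>i j. i + j \<le> p + 1 \<longrightarrow> weak_partial \<delta> i j (hier_basis p n (fst a) (snd a)) (F i j) \<and>
        continuous_on \<delta> (F i j) \<and> (\<forall>z\<in>\<delta>. \<bar>F i j z\<bar> \<le> M / \<bar>h\<bar> ^ (i + j)))"
      using scaled_smooth_weak_partials[OF o\<delta>(1) region(4)] by blast
    from choice[OF this] obtain F where F: "\<And>a i j. a \<in> ?A \<Longrightarrow> i + j \<le> p + 1 \<Longrightarrow>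
        weak_partial \<delta> i j (hier_basis p n (fst a) (snd a)) (F a i j) \<and>
        continuous_on \<delta> (F a i j) \<and> (\<forall>z\<in>\<delta>. \<bar>F a i j z\<bar> \<le> M / \<bar>h\<bar> ^ (i + j))" by blast
    have FL: "L2_on \<delta> (F a i j)" "L2_norm \<delta> (F a i j) \<le> M / h ^ (i + j) * h" if a: "a \<in> ?A" and ij: "i + j \<le> p + 1" for a i j
    proof -
      have fin: "emeasure lebesgue \<delta> < \<infinity>"
        by (rule le_less_trans[OF emeasure_mono[OF o\<delta>(3) triangle_measure(1)] triangle_measure(3)])
      have m: "F a i j \<in> borel_measurable (lebesgue_on \<delta>)"
        using F[OF a ij] leb[OF o\<delta>(1)] by (intro continuous_imp_measurable_on_sets_lebesgue) auto
      have b: "\<bar>F a i j z\<bar> \<le> M / h ^ (i + j)" if "z \<in> \<delta>" for z using F[OF a ij] that h by simp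
      note L = L2_on_bounded[OF leb[OF o\<delta>(1)] fin m b]
      show "L2_on \<delta> (F a i j)" by (rule L(1))
      have "sqrt (measure lebesgue \<delta>) \<le> sqrt (h\<^sup>2)"
        using measure_hier_cell(2)[OF \<delta>] unfolding h_def by (rule real_sqrt_le_mono)
      also have "\<dots> = h" using h by simp
      finally have "M / h ^ (i + j) * sqrt (measure lebesgue \<delta>) \<le> M / h ^ (i + j) * h"
        using M0 h by (intro mult_left_mono) auto
      then show "L2_norm \<delta> (F a i j) \<le> M / h ^ (i + j) * h" using L(2) by linarith
    qed
    define R where "R i j x = H i j x - (\<Sum>a\<in>?A. w a * F a i j x)" for i j x
    have fA: "finite ?A" by (rule card_active_le[OF \<delta>])
    have H\<delta>: "L2_on \<delta> (H i j)" if "i + j \<le> p + 1" for i j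
      by (rule L2_on_subset[OF HL[OF that] o\<delta>(3) leb[OF o\<delta>(1)] triangle_measure(1)])
    have sumL: "L2_on \<delta> (\<lambda>x. \<Sum>a\<in>?A. w a * F a i j x)" if "i + j \<le> p + 1" for i j
      by (intro L2_on_sum L2_on_cmult FL leb o\<delta>(1) that)
    have R1: "L2_on \<delta> (R i j)" if "i + j \<le> p + 1" for i j
      unfolding R_def[abs_def] by (rule L2_on_diff[OF leb[OF o\<delta>(1)] H\<delta>[OF that] sumL[OF that]])
    have R2: "weak_partial \<delta> i j (\<lambda>x. \<phi> x - hier_projection p lam mu n \<phi> x) (R i j)" if ij: "i + j \<le> p + 1" for i j
    proof -
      have "weak_partial \<delta> i j (\<lambda>x. H 0 0 x - (\<Sum>a\<in>?A. w a * hier_basis p n (fst a) (snd a) x)) (R i j)"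
        unfolding R_def[abs_def] using F[OF _ ij]
        by (intro weak_partial_minus_sum leb o\<delta>(1) fA weak_partial_restrict[OF Hw[OF ij] o\<delta>(3)]) auto
      moreover have "AE x in lebesgue. x \<in> \<delta> \<longrightarrow>
          H 0 0 x - (\<Sum>a\<in>?A. w a * hier_basis p n (fst a) (snd a) x) = \<phi> x - hier_projection p lam mu n \<phi> x"
        using projection_error_split[OF n _ \<delta>, of \<phi> _ c] GL[of 0 0] G0 by (intro AE_I2) (simp add: w_def H0)
      ultimately show ?thesis by (rule weak_partial_cong_AE)
    qed
    have R3: "L2_norm \<delta> (R i j) \<le> C * h ^ (p + 1 - (i + j)) * E" if ij: "i + j \<le> p + 1" for i j
    proof -
      define q where "q = i + j"
      \<comment> \<open>The powers of h in a term: h^p from the coefficient, h^-q from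
        differentiating the basis function, and h from the square root of the area of the
        cell.\<close>
      have hq: "h ^ p * (1 / h ^ q * h) = h ^ (p + 1 - q)"
        using h ij by (simp add: q_def power_diff)
      \<comment> \<open>Any active function serves; its region places \<delta> in a box of size of
        order h and in the support extension, which \<open>near\<close> needs for T =
        \<delta>.\<close>
      obtain k l x where kl: "(k, l) \<in> hier_index p n" "x \<in> \<delta>" "hier_basis p n k l x \<noteq> 0"
        by (rule active_exists[OF \<delta>])
      then have "(k, l) \<in> ?A" by (auto simp: active_def)
      note r = region[OF this, simplified]
      have "L2_norm \<delta> (R i j) \<le> L2_norm \<delta> (H i j) + L2_norm \<delta> (\<lambda>x. \<Sum>a\<in>?A. w a * F a i j x)"
        unfolding R_def[abs_def] by (rule L2_norm_diff_le[OF leb[OF o\<delta>(1)] H\<delta>[OF ij] sumL[OF ij]])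
      also have "\<dots> \<le> (c0 * h) ^ (p + 1 - q) * E + (\<Sum>a\<in>?A. L2_norm \<delta> (\<lambda>x. w a * F a i j x))"
        unfolding q_def
        by (intro add_mono near[OF o\<delta>(1,2) order_refl order_trans[OF r(2,3)] r(2,1) ij] L2_norm_sum_le L2_on_cmult FL leb o\<delta>(1) ij)
      also have "(\<Sum>a\<in>?A. L2_norm \<delta> (\<lambda>x. w a * F a i j x)) \<le> (\<Sum>a\<in>?A. C\<Lambda> * c0 ^ (p + 1) * h ^ p * E * (M / h ^ q * h))"
      proof (intro sum_mono)
        fix a assume a: "a \<in> ?A"
        have "L2_norm \<delta> (\<lambda>x. w a * F a i j x) = \<bar>w a\<bar> * L2_norm \<delta> (F a i j)" by (rule L2_norm_cmult[OF leb[OF o\<delta>(1)]])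
        also have "\<dots> \<le> C\<Lambda> * c0 ^ (p + 1) * h ^ p * E * (M / h ^ q * h)"
          unfolding q_def using C0 c1 h E0 by (intro mult_mono wb[OF a] FL(2)[OF a ij] L2_norm_nonneg mult_nonneg_nonneg) auto
        finally show "L2_norm \<delta> (\<lambda>x. w a * F a i j x) \<le> C\<Lambda> * c0 ^ (p + 1) * h ^ p * E * (M / h ^ q * h)" .
      qed
      also have "\<dots> = real (card ?A) * (C\<Lambda> * M * c0 ^ (p + 1) * (h ^ p * (1 / h ^ q * h)) * E)" by simp
      also have "\<dots> = real (card ?A) * (C\<Lambda> * M * c0 ^ (p + 1) * h ^ (p + 1 - q) * E)" unfolding hq ..
      also have "\<dots> \<le> N * (C\<Lambda> * M * c0 ^ (p + 1) * h ^ (p + 1 - q) * E)"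
        using card_active_le(2)[OF \<delta>] C0 M0 c1 h E0 unfolding N_def of_nat_le_iff[where 'a = real, symmetric]
        by (intro mult_right_mono mult_nonneg_nonneg) auto
      also have "(c0 * h) ^ (p + 1 - q) * E \<le> c0 ^ (p + 1) * h ^ (p + 1 - q) * E"
        unfolding power_mult_distrib using c1 h E0 by (intro mult_right_mono power_increasing) auto
      finally show ?thesis unfolding C_def q_def by (simp add: algebra_simps)
    qed
    show ?thesis
      by (intro exI[of _ R] allI impI conjI R1 R2 R3[unfolded h_def E_def S_def])
  qed
  with Cpos show ?thesis by (intro exI[of _ C]) simp
qed

end

theorem theorem8:
  fixes p :: nat and C\<^sub>p :: real
    and lam :: "nat \<Rightarrow> nat \<Rightarrow> (real \<Rightarrow> real) \<Rightarrow> real"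
    and mu :: "nat \<Rightarrow> nat \<Rightarrow> (real \<times> real \<Rightarrow> real) \<Rightarrow> real"
  assumes "p \<ge> 1"
    and "bspline_dual p C\<^sub>p lam"
    and "corner_dual p mu"
  shows "\<exists>C>0. \<forall>n\<ge>base_level p. \<forall>\<phi>. sobolev (p + 1) (open_triangle 1) \<phi> \<longrightarrow>
           (\<forall>q\<le>p + 1. \<forall>\<delta>\<in>hier_mesh n.
              sobolev q \<delta> (\<lambda>x. \<phi> x - hier_projection p lam mu n \<phi> x) \<and>
              sobolev_seminorm q \<delta> (\<lambda>x. \<phi> x - hier_projection p lam mu n \<phi> x)
                \<le> C * (1 / 2 ^ n) ^ (p + 1 - q) *
                  sobolev_seminorm (p + 1) (support_extension p n \<delta>) \<phi>)"
proof -
  obtain C where C: "0 < C" and err: "\<And>n \<phi> \<delta>. base_level p \<le> n \<Longrightarrow> sobolev (p + 1) (open_triangle 1) \<phi> \<Longrightarrow> \<delta> \<in> hier_mesh n \<Longrightarrow>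
    \<exists>R. \<forall>i j. i + j \<le> p + 1 \<longrightarrow> L2_on \<delta> (R i j) \<and>
      weak_partial \<delta> i j (\<lambda>x. \<phi> x - hier_projection p lam mu n \<phi> x) (R i j) \<and>
      L2_norm \<delta> (R i j) \<le> C * (1 / 2 ^ n) ^ (p + 1 - (i + j)) * sobolev_seminorm (p + 1) (support_extension p n \<delta>) \<phi>"
    using projection_error_derivatives[OF assms] by (elim exE conjE) (rule that, assumption, blast)
  have "sobolev q \<delta> (\<lambda>x. \<phi> x - hier_projection p lam mu n \<phi> x) \<and>
      sobolev_seminorm q \<delta> (\<lambda>x. \<phi> x - hier_projection p lam mu n \<phi> x)
        \<le> sqrt (real p + 2) * C * (1 / 2 ^ n) ^ (p + 1 - q) * sobolev_seminorm (p + 1) (support_extension p n \<delta>) \<phi>"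
    if n: "base_level p \<le> n" and s: "sobolev (p + 1) (open_triangle 1) \<phi>" and q: "q \<le> p + 1" and \<delta>: "\<delta> \<in> hier_mesh n" for n \<phi> q \<delta>
  proof
    let ?e = "\<lambda>x. \<phi> x - hier_projection p lam mu n \<phi> x"
    define B where "B = C * (1 / 2 ^ n) ^ (p + 1 - q) * sobolev_seminorm (p + 1) (support_extension p n \<delta>) \<phi>"
    from err[OF n s \<delta>] obtain R where R0: "\<forall>i j. i + j \<le> p + 1 \<longrightarrow> L2_on \<delta> (R i j) \<and> weak_partial \<delta> i j ?e (R i j) \<and>
      L2_norm \<delta> (R i j) \<le> C * (1 / 2 ^ n) ^ (p + 1 - (i + j)) * sobolev_seminorm (p + 1) (support_extension p n \<delta>) \<phi>" ..
    have R: "\<And>i j. i + j \<le> p + 1 \<Longrightarrow> L2_on \<delta> (R i j)" "\<And>i j. i + j \<le> p + 1 \<Longrightarrow> weak_partial \<delta> i j ?e (R i j)"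
      "\<And>i j. i + j = q \<Longrightarrow> L2_norm \<delta> (R i j) \<le> B"
      using R0 q unfolding B_def by blast+
    have o: "open \<delta>" by (rule hier_cell_open_convex[OF \<delta>])
    \<comment> \<open>The error is a weak derivative of order 0 of itself; uniqueness identifies it
      with \<open>R 0 0\<close>, so it is square integrable on the cell.\<close>
    have "AE x in lebesgue. x \<in> \<delta> \<longrightarrow> R 0 0 x = ?e x"
      by (rule weak_partial_unique[OF o R(2) weak_partial_0[OF weak_partialD(1)[OF R(2), of 0 0]]]) auto
    then have "L2_on \<delta> ?e" using o by (intro L2_on_cong_AE(1)[OF _ R(1)[of 0 0]]) auto
    then show "sobolev q \<delta> ?e" unfolding sobolev_def using R(1,2) q by (meson le_trans)
    have "0 \<le> B" using R(3)[of 0 q] L2_norm_nonneg[of \<delta> "R 0 q"] by simp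
    have "deriv_energy \<delta> R q \<le> (\<Sum>i\<le>q. B\<^sup>2)"
      unfolding deriv_energy_def by (intro sum_mono power_mono R(3) L2_norm_nonneg) simp
    \<comment> \<open>There are q + 1 \<le> p + 2 derivatives of order q; this is the source of the
      factor sqrt (p + 2), uniform in q.\<close>
    also have "\<dots> \<le> (real p + 2) * B\<^sup>2" using q by (simp add: mult_right_mono)
    finally have "sqrt (deriv_energy \<delta> R q) \<le> sqrt ((real p + 2) * B\<^sup>2)" by (rule real_sqrt_le_mono)
    moreover have "sobolev_seminorm q \<delta> ?e = sqrt (deriv_energy \<delta> R q)"
      using q by (intro sobolev_seminorm_energy[OF o] R) auto
    ultimately show "sobolev_seminorm q \<delta> ?e \<le> sqrt (real p + 2) * C * (1 / 2 ^ n) ^ (p + 1 - q) *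
        sobolev_seminorm (p + 1) (support_extension p n \<delta>) \<phi>"
      using \<open>0 \<le> B\<close> by (simp add: real_sqrt_mult B_def mult.assoc)
  qed
  moreover have "0 < sqrt (real p + 2) * C" using C by simp
  ultimately show ?thesis by (intro exI[of _ "sqrt (real p + 2) * C"]) simp
qed

end
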